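(* Let $X$ be a standard Borel space. In $\mathbf{Stoch}(\mathbf{SBS})$, the draw-and-delete chain $\mathbf 1\xleftarrow{\mathrm{DD}_0}M_1X\xleftarrow{\mathrm{DD}_1}M_2X\cdots$ over the copointed object $(X,!:X\to\mathbf 1)$ has $\mathcal G X$ as limit, with limit morphisms $\mathcal G X\to M_nX$ sending $\alpha$ to the push-forward of $\alpha^{\otimes n}$ along $(x_1,\dots,x_n)\mapsto[x_1,\dots,x_n]$; this limit commutes with the tensor product (for every standard Borel $Y$, $\mathcal GX\otimes Y$ with the tensored limit morphisms is a limit of the chain $(\mathrm{DD}_n\otimes Y)_n$). Moreover, $\mathcal G X$ is the free commutative comonoid generated by $X$.
   Context: $\mathbf{Stoch}(\mathbf{SBS})$: objects are standard Borel spaces, morphisms are stochastic kernels (Kleisli category of the Giry monad $\mathcal G$), symmetric monoidal with $\otimes$ the product space and unit the one-point space $\mathbf 1$, which is terminal. $\mathcal G X$ is the space of probability measures on $X$. $M_nX$ is the set of multisets of size $n$ on $X$ with the largest $\sigma$-algebra making $(x_1,\dots,x_n)\mapsto[x_1,\dots,x_n]$ measurable; with $\mathrm{eq}_n:M_nX\to X^n$ sending $[a_1,\dots,a_n]$ to the uniform average of the Dirac measures at all orderings, $(M_nX,\mathrm{eq}_n)$ is the equaliser of the symmetries of $X^{\otimes n}$. $\mathrm{DD}_n:M_{n+1}X\to M_nX$ is the unique kernel with $\mathrm{eq}_n\circ\mathrm{DD}_n=(X^{\otimes n}\otimes !)\circ\mathrm{eq}_{n+1}$ (draw an element uniformly at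 random and delete it). A free commutative comonoid generated by an object $A$ of a symmetric monoidal category is a commutative comonoid $C$ with a morphism $d:C\to A$ such that for every commutative comonoid $D$ and morphism $f:D\to A$ there is a unique comonoid morphism $g:D\to C$ with $d\circ g=f$. *)

theory Defs
  imports "HOL-Probability.Probability"
begin

section \<open>The symmetric monoidal category of standard Borel spaces and stochastic kernels\<close>

text \<open>
  A measurable space is represented by a value of type \<^typ>\<open>'a measure\<close>, of which only the carrier and
  the \<open>\<sigma>\<close>-algebra matter. The empty space is standard Borel.
\<close>

definition standard_borel :: "'a measure \<Rightarrow> bool" where
  "standard_borel X \<longleftrightarrow>
     (\<exists>T. completely_metrizable_space T \<and> separable_space T \<and>
          topspace T = space X \<and> sigma_sets (topspace T) {U. openin T U} = sets X)"

text \<open>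
  Kernels are taken to be extensional functions (equal to \<^const>\<open>undefined\<close> off the source), so that
  equality of morphisms is equality in HOL. Hence every operation carries its source object.
\<close>

definition stoch_hom :: "'a measure \<Rightarrow> 'b measure \<Rightarrow> ('a \<Rightarrow> 'b measure) set" where
  "stoch_hom X Y = (X \<rightarrow>\<^sub>M prob_algebra Y) \<inter> extensional (space X)"

definition stoch_comp ::
  "'a measure \<Rightarrow> ('b \<Rightarrow> 'c measure) \<Rightarrow> ('a \<Rightarrow> 'b measure) \<Rightarrow> 'a \<Rightarrow> 'c measure" where
  "stoch_comp X g f = (\<lambda>x\<in>space X. f x \<bind> g)"

definition stoch_det :: "'a measure \<Rightarrow> 'b measure \<Rightarrow> ('a \<Rightarrow> 'b) \<Rightarrow> 'a \<Rightarrow> 'b measure" where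
  "stoch_det X Y f = (\<lambda>x\<in>space X. return Y (f x))"

definition stoch_id :: "'a measure \<Rightarrow> 'a \<Rightarrow> 'a measure" where
  "stoch_id X = stoch_det X X (\<lambda>x. x)"

text \<open>On objects the tensor product is \<^const>\<open>pair_measure\<close>.\<close>

definition stoch_tensor ::
  "'a measure \<Rightarrow> 'b measure \<Rightarrow> ('a \<Rightarrow> 'c measure) \<Rightarrow> ('b \<Rightarrow> 'd measure) \<Rightarrow> 'a \<times> 'b \<Rightarrow> ('c \<times> 'd) measure"
  where
  "stoch_tensor X Y k l = (\<lambda>p\<in>space (X \<Otimes>\<^sub>M Y). k (fst p) \<Otimes>\<^sub>M l (snd p))"

definition stoch_unit :: "unit measure" where
  "stoch_unit = count_space UNIV"

definition stoch_assoc ::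
  "'a measure \<Rightarrow> 'b measure \<Rightarrow> 'c measure \<Rightarrow> ('a \<times> 'b) \<times> 'c \<Rightarrow> ('a \<times> 'b \<times> 'c) measure" where
  "stoch_assoc X Y Z =
     stoch_det ((X \<Otimes>\<^sub>M Y) \<Otimes>\<^sub>M Z) (X \<Otimes>\<^sub>M (Y \<Otimes>\<^sub>M Z)) (\<lambda>((x, y), z). (x, y, z))"

definition stoch_lunit :: "'a measure \<Rightarrow> unit \<times> 'a \<Rightarrow> 'a measure" where
  "stoch_lunit X = stoch_det (stoch_unit \<Otimes>\<^sub>M X) X snd"

definition stoch_runit :: "'a measure \<Rightarrow> 'a \<times> unit \<Rightarrow> 'a measure" where
  "stoch_runit X = stoch_det (X \<Otimes>\<^sub>M stoch_unit) X fst"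

definition stoch_swap :: "'a measure \<Rightarrow> 'b measure \<Rightarrow> 'a \<times> 'b \<Rightarrow> ('b \<times> 'a) measure" where
  "stoch_swap X Y = stoch_det (X \<Otimes>\<^sub>M Y) (Y \<Otimes>\<^sub>M X) (\<lambda>(x, y). (y, x))"


section \<open>Limits of chains\<close>

text \<open>
  \<open>C 0 \<longleftarrow> C 1 \<longleftarrow> C 2 \<longleftarrow> \<dots>\<close> with \<open>c n : C (n + 1) \<rightarrow> C n\<close>.
\<close>

definition stoch_chain :: "(nat \<Rightarrow> 'a measure) \<Rightarrow> (nat \<Rightarrow> 'a \<Rightarrow> 'a measure) \<Rightarrow> bool" where
  "stoch_chain C c \<longleftrightarrow> (\<forall>n. standard_borel (C n) \<and> c n \<in> stoch_hom (C (Suc n)) (C n))"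

definition stoch_cone ::
  "(nat \<Rightarrow> 'a measure) \<Rightarrow> (nat \<Rightarrow> 'a \<Rightarrow> 'a measure) \<Rightarrow> 'z measure \<Rightarrow> (nat \<Rightarrow> 'z \<Rightarrow> 'a measure) \<Rightarrow> bool"
  where
  "stoch_cone C c Z q \<longleftrightarrow>
     standard_borel Z \<and>
     (\<forall>n. q n \<in> stoch_hom Z (C n) \<and> stoch_comp Z (c n) (q (Suc n)) = q n)"

text \<open>
  The objects of the category are spread over all HOL types, and a definition cannot quantify over
  types. The argument \<open>TYPE('z)\<close> is the carrier type of the competing cones; a theorem in which
  \<open>'z\<close> is a free type variable covers all of them. The same applies to \<open>free_comm_comonoid\<close>
  below.
\<close>

definition stoch_chain_limit ::
  "'z itself \<Rightarrow> (nat \<Rightarrow> 'a measure) \<Rightarrow> (nat \<Rightarrow> 'a \<Rightarrow> 'a measure) \<Rightarrow>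
   'l measure \<Rightarrow> (nat \<Rightarrow> 'l \<Rightarrow> 'a measure) \<Rightarrow> bool" where
  "stoch_chain_limit (_ :: 'z itself) C c L p \<longleftrightarrow>
     stoch_chain C c \<and> stoch_cone C c L p \<and>
     (\<forall>(Z :: 'z measure) q. stoch_cone C c Z q \<longrightarrow>
        (\<exists>!h. h \<in> stoch_hom Z L \<and> (\<forall>n. stoch_comp Z (p n) h = q n)))"


section \<open>Commutative comonoids\<close>

definition comm_comonoid ::
  "'a measure \<Rightarrow> ('a \<Rightarrow> ('a \<times> 'a) measure) \<Rightarrow> ('a \<Rightarrow> unit measure) \<Rightarrow> bool" where
  "comm_comonoid C \<delta> \<epsilon> \<longleftrightarrow>
     standard_borel C \<and> \<delta> \<in> stoch_hom C (C \<Otimes>\<^sub>M C) \<and> \<epsilon> \<in> stoch_hom C stoch_unit \<and>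
     stoch_comp C (stoch_assoc C C C) (stoch_comp C (stoch_tensor C C \<delta> (stoch_id C)) \<delta>) =
       stoch_comp C (stoch_tensor C C (stoch_id C) \<delta>) \<delta> \<and>
     stoch_comp C (stoch_lunit C) (stoch_comp C (stoch_tensor C C \<epsilon> (stoch_id C)) \<delta>) = stoch_id C \<and>
     stoch_comp C (stoch_runit C) (stoch_comp C (stoch_tensor C C (stoch_id C) \<epsilon>) \<delta>) = stoch_id C \<and>
     stoch_comp C (stoch_swap C C) \<delta> = \<delta>"

definition comonoid_hom ::
  "'a measure \<Rightarrow> ('a \<Rightarrow> ('a \<times> 'a) measure) \<Rightarrow> ('a \<Rightarrow> unit measure) \<Rightarrow>
   'b measure \<Rightarrow> ('b \<Rightarrow> ('b \<times> 'b) measure) \<Rightarrow> ('b \<Rightarrow> unit measure) \<Rightarrow>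
   ('a \<Rightarrow> 'b measure) set" where
  "comonoid_hom D \<delta>\<^sub>D \<epsilon>\<^sub>D C \<delta>\<^sub>C \<epsilon>\<^sub>C =
     {g \<in> stoch_hom D C.
        stoch_comp D \<delta>\<^sub>C g = stoch_comp D (stoch_tensor D D g g) \<delta>\<^sub>D \<and>
        stoch_comp D \<epsilon>\<^sub>C g = \<epsilon>\<^sub>D}"

definition free_comm_comonoid ::
  "'d itself \<Rightarrow> 'a measure \<Rightarrow> 'c measure \<Rightarrow> ('c \<Rightarrow> ('c \<times> 'c) measure) \<Rightarrow> ('c \<Rightarrow> unit measure) \<Rightarrow>
   ('c \<Rightarrow> 'a measure) \<Rightarrow> bool" where
  "free_comm_comonoid (_ :: 'd itself) A C \<delta> \<epsilon> d \<longleftrightarrow>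
     comm_comonoid C \<delta> \<epsilon> \<and> d \<in> stoch_hom C A \<and>
     (\<forall>(D :: 'd measure) \<delta>\<^sub>D \<epsilon>\<^sub>D f. comm_comonoid D \<delta>\<^sub>D \<epsilon>\<^sub>D \<and> f \<in> stoch_hom D A \<longrightarrow>
        (\<exists>!g. g \<in> comonoid_hom D \<delta>\<^sub>D \<epsilon>\<^sub>D C \<delta> \<epsilon> \<and> stoch_comp D d g = f))"


section \<open>Multisets and the draw-and-delete chain\<close>

text \<open>
  Points of \<open>X\<^sup>n\<close> are functions on \<open>{..<n}\<close>; in particular \<open>X\<^sup>0\<close> and \<open>M\<^sub>0 X\<close> are
  one-point spaces, and \<open>M\<^sub>0 X = {{#}}\<close> plays the role of the unit as the base of the chain.
\<close>

definition power_space :: "nat \<Rightarrow> 'a measure \<Rightarrow> (nat \<Rightarrow> 'a) measure" where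
  "power_space n X = (\<Pi>\<^sub>M i\<in>{..<n}. X)"

definition mset_of_tuple :: "nat \<Rightarrow> (nat \<Rightarrow> 'a) \<Rightarrow> 'a multiset" where
  "mset_of_tuple n x = image_mset x (mset_set {..<n})"

text \<open>The generating family is already a \<open>\<sigma>\<close>-algebra, namely the largest one required.\<close>

definition mset_space :: "nat \<Rightarrow> 'a measure \<Rightarrow> 'a multiset measure" where
  "mset_space n X =
     (let \<Omega> = {m. size m = n \<and> set_mset m \<subseteq> space X}
      in sigma \<Omega> {A. A \<subseteq> \<Omega> \<and>
           mset_of_tuple n -` A \<inter> space (power_space n X) \<in> sets (power_space n X)})"

text \<open>
  All distinct orderings of \<open>m\<close> are weighted equally. As every ordering arises from the same number of
  permutations of \<open>n\<close> letters, this is also the average over all \<open>n!\<close> permutations.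
\<close>

definition mset_eq :: "nat \<Rightarrow> 'a measure \<Rightarrow> 'a multiset \<Rightarrow> (nat \<Rightarrow> 'a) measure" where
  "mset_eq n X = (\<lambda>m\<in>space (mset_space n X).
     distr (uniform_count_measure {x \<in> space (power_space n X). mset_of_tuple n x = m})
           (power_space n X) (\<lambda>x. x))"

text \<open>
  The kernel \<open>X\<^sup>n \<otimes> ! : X\<^sup>n\<^sup>+\<^sup>1 \<rightarrow> X\<^sup>n\<close>, under the identifications
  \<open>X\<^sup>n\<^sup>+\<^sup>1 \<cong> X\<^sup>n \<otimes> X\<close> and \<open>X\<^sup>n \<otimes> \<one> \<cong> X\<^sup>n\<close>.
\<close>

definition power_discard_last :: "nat \<Rightarrow> 'a measure \<Rightarrow> (nat \<Rightarrow> 'a) \<Rightarrow> (nat \<Rightarrow> 'a) measure" where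
  "power_discard_last n X =
     stoch_det (power_space (Suc n) X) (power_space n X) (\<lambda>x. restrict x {..<n})"

definition draw_delete :: "'a measure \<Rightarrow> nat \<Rightarrow> 'a multiset \<Rightarrow> 'a multiset measure" where
  "draw_delete X n =
     (THE k. k \<in> stoch_hom (mset_space (Suc n) X) (mset_space n X) \<and>
        stoch_comp (mset_space (Suc n) X) (mset_eq n X) k =
        stoch_comp (mset_space (Suc n) X) (power_discard_last n X) (mset_eq (Suc n) X))"

definition iid_mset :: "'a measure \<Rightarrow> nat \<Rightarrow> 'a measure \<Rightarrow> 'a multiset measure" where
  "iid_mset X n = (\<lambda>\<alpha>\<in>space (prob_algebra X).
     distr (power_space n \<alpha>) (mset_space n X) (mset_of_tuple n))"


section \<open>The comonoid structure on the space of probability measures\<close>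

definition giry_copy :: "'a measure \<Rightarrow> 'a measure \<Rightarrow> ('a measure \<times> 'a measure) measure" where
  "giry_copy X =
     stoch_det (prob_algebra X) (prob_algebra X \<Otimes>\<^sub>M prob_algebra X) (\<lambda>\<alpha>. (\<alpha>, \<alpha>))"

definition giry_discard :: "'a measure \<Rightarrow> 'a measure \<Rightarrow> unit measure" where
  "giry_discard X = stoch_det (prob_algebra X) stoch_unit (\<lambda>_. ())"

text \<open>A probability measure, regarded as a point of \<open>\<G> X\<close>, is sent to itself, regarded as a law on \<open>X\<close>.\<close>

definition giry_sample :: "'a measure \<Rightarrow> 'a measure \<Rightarrow> 'a measure" where
  "giry_sample X = (\<lambda>\<alpha>\<in>space (prob_algebra X). \<alpha>)"

end

theory Submission
  imports Defs "HOL-Combinatorics.Permutations"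
begin

text \<open>
  A cone over the draw-and-delete chain is the same as a measurable family of exchangeable laws on sequences:
  unfold the multisets into uniformly random orderings and extend by Kolmogorov. De Finetti's theorem then
  supplies the mediating kernel. The directing measure is a limit of empirical distribution functions at the
  rationals along blocks of length \<open>4 ^ k\<close>, decoded by quantile functions after \<open>X\<close> has been embedded in
  \<open>[0, 1]\<close> as a measurable retract; this works for all points of the vertex at once, so measurability is
  automatic. A law on \<open>\<G> X\<close> is determined by the moments \<open>\<integral> \<alpha> A\<^sub>1 \<dots> \<alpha> A\<^sub>n\<close>, whence uniqueness. For the tensored chain
  the \<open>Y\<close>-component is recorded next to every \<open>X\<close>-component. For a commutative comonoid \<open>D\<close> over \<open>X\<close>, the iterated
  comultiplications followed by copies of \<open>D \<rightarrow> X\<close> are exchangeable, and coassociativity makes the mediating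
  kernel \<open>D \<rightarrow> \<G> X\<close> multiplicative on moments, that is, a comonoid morphism.
\<close>

subsection \<open>Standard Borel spaces as measurable retracts\<close>

text \<open>\<open>standard_borel\<close> asks for a Polish topology, whereas spaces of multisets
  and of probability measures come only with sigma-algebras. A nonempty standard Borel space is the
  same as a measurable retract of the space of real sequences, and retracts pass to products, to
  multisets by sorting, and to probability measures by distribution functions. The price is the way
  back: a retract is isomorphic to a Borel set of sequences, which need not be Polish in the
  subspace topology. It becomes Polish once it is replaced by a G-delta graph over it. Empty spaces
  are not retracts and are treated apart; over an empty X the multisets of size 0 still form a
  point. The directing measure has to be one map on sequences that refers to no law, since it is
  applied to the laws at all points of the vertex. Hence plain limits of frequencies are taken, with
  arbitrary values where they diverge, and quantile functions are defined for arbitrary families of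
  values.\<close>

definition borel_retract :: "'a measure \<Rightarrow> 'b measure \<Rightarrow> bool" where
  "borel_retract X Y \<longleftrightarrow>
     (\<exists>e r. e \<in> X \<rightarrow>\<^sub>M Y \<and> r \<in> Y \<rightarrow>\<^sub>M X \<and> (\<forall>x\<in>space X. r (e x) = x))"

lemma borel_retractI:
  "e \<in> X \<rightarrow>\<^sub>M Y \<Longrightarrow> r \<in> Y \<rightarrow>\<^sub>M X \<Longrightarrow> (\<And>x. x \<in> space X \<Longrightarrow> r (e x) = x) \<Longrightarrow> borel_retract X Y"
  by (auto simp: borel_retract_def)

lemma borel_retract_trans:
  assumes "borel_retract X Y" "borel_retract Y Z"
  shows "borel_retract X Z"
proof -
  obtain e r where "e \<in> X \<rightarrow>\<^sub>M Y" "r \<in> Y \<rightarrow>\<^sub>M X" and 1: "\<And>x. x \<in> space X \<Longrightarrow> r (e x) = x"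
    using assms(1) unfolding borel_retract_def by blast
  obtain e' r' where "e' \<in> Y \<rightarrow>\<^sub>M Z" "r' \<in> Z \<rightarrow>\<^sub>M Y" and 2: "\<And>x. x \<in> space Y \<Longrightarrow> r' (e' x) = x"
    using assms(2) unfolding borel_retract_def by blast
  have "(\<lambda>x. e' (e x)) \<in> X \<rightarrow>\<^sub>M Z" "(\<lambda>x. r (r' x)) \<in> Z \<rightarrow>\<^sub>M X"
    by (rule measurable_compose[where N = Y]; fact)+
  moreover have "r (r' (e' (e x))) = x" if "x \<in> space X" for x
    using that 1 2 measurable_space[OF \<open>e \<in> X \<rightarrow>\<^sub>M Y\<close>] by auto
  ultimately show ?thesis by (rule borel_retractI)
qed

section \<open>Borel sets of real sequences as injective projections of G-delta sets\<close>

definition is_Gdelta :: "'a::topological_space set \<Rightarrow> bool" where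
  "is_Gdelta S \<longleftrightarrow> (\<exists>F :: nat \<Rightarrow> 'a set. (\<forall>n. open (F n)) \<and> S = (\<Inter>n. F n))"

lemma is_GdeltaI: "S = (\<Inter>n. F n) \<Longrightarrow> (\<And>n::nat. open (F n)) \<Longrightarrow> is_Gdelta S"
  by (auto simp: is_Gdelta_def)

lemma is_Gdelta_open: "open S \<Longrightarrow> is_Gdelta S"
  unfolding is_Gdelta_def by (intro exI[of _ "\<lambda>_. S"]) auto

text \<open>In a metric space a closed set is the intersection of its open neighbourhoods of radius
  1 / (n + 1). Distance 0 characterises membership only for nonempty sets, hence the case
  split.\<close>

lemma is_Gdelta_closed:
  fixes S :: "'a::metric_space set"
  assumes "closed S" shows "is_Gdelta S"
proof (cases "S = {}")
  case True then show ?thesis by (simp add: is_Gdelta_open)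
next
  case False
  have "S = (\<Inter>n. {x. infdist x S < 1 / Suc n})"
  proof safe
    fix x assume "x \<in> (\<Inter>n. {x. infdist x S < 1 / real (Suc n)})"
    then have *: "infdist x S < 1 / real (Suc n)" for n by blast
    have "infdist x S \<le> 0"
    proof (rule ccontr)
      assume "\<not> ?thesis"
      then obtain n where "inverse (real (Suc n)) < infdist x S" using reals_Archimedean[of "infdist x S"] infdist_nonneg[of x S] by auto
      then show False using *[of n] by (simp add: inverse_eq_divide)
    qed
    then have "infdist x S = 0" using infdist_nonneg[of x S] by simp
    then show "x \<in> S" using in_closed_iff_infdist_zero[OF assms False] by simp
  qed auto
  moreover have "open {x. infdist x S < 1 / Suc n}" for n
    by (intro open_Collect_less continuous_intros)
  ultimately show ?thesis by (rule is_GdeltaI)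
qed

lemma is_Gdelta_INT:
  assumes "\<And>i::nat. is_Gdelta (S i)" shows "is_Gdelta (\<Inter>i. S i)"
proof -
  obtain F where F: "\<And>i n::nat. open (F i n)" "\<And>i. S i = (\<Inter>n. F i n)"
    using assms unfolding is_Gdelta_def by metis
  have "(\<Inter>i. S i) = (\<Inter>m. F (fst (prod_decode m)) (snd (prod_decode m)))"
  proof (safe)
    fix x i assume "x \<in> (\<Inter>m. F (fst (prod_decode m)) (snd (prod_decode m)))"
    then have "x \<in> F i n" for n by (metis INT_D UNIV_I fst_conv prod_encode_inverse snd_conv)
    then show "x \<in> S i" using F by auto
  qed (use F in auto)
  then show ?thesis by (rule is_GdeltaI) (rule F(1))
qed

lemma is_Gdelta_vimage:
  assumes "is_Gdelta S" "continuous_on UNIV f" shows "is_Gdelta (f -` S)"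
proof -
  obtain F :: "nat \<Rightarrow> _" where F: "\<And>n. open (F n)" "S = (\<Inter>n. F n)"
    using assms(1) unfolding is_Gdelta_def by auto
  have "f -` S = (\<Inter>n. f -` F n)" by (auto simp: F(2))
  then show ?thesis by (rule is_GdeltaI) (intro open_vimage F assms(2))
qed

lemma INT_case_nat: "(\<Inter>i. case i of 0 \<Rightarrow> C | Suc n \<Rightarrow> A n) = C \<inter> (\<Inter>n. A n)"
proof -
  have "(\<Inter>i. F i) = F 0 \<inter> (\<Inter>n. F (Suc n))" for F :: "nat \<Rightarrow> 'a set"
    by (auto simp: INT_iff) (metis not0_implies_Suc)
  from this[of "\<lambda>i. case i of 0 \<Rightarrow> C | Suc n \<Rightarrow> A n"] show ?thesis by simp
qed

text \<open>The sets \<open>{p. c p = real k}\<close> are separated by the open sets \<open>{p. \<bar>c p - real k\<bar> < 1/2}\<close>.\<close>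

lemma is_Gdelta_separated_UN:
  fixes c :: "'a::topological_space \<Rightarrow> real" and E :: "nat \<Rightarrow> 'a set"
  assumes "\<And>k. is_Gdelta (E k)" and c: "continuous_on UNIV c" and E: "\<And>k p. p \<in> E k \<Longrightarrow> c p = real k"
  shows "is_Gdelta (\<Union>k. E k)"
proof -
  obtain F where F: "\<And>i n::nat. open (F i n)" "\<And>i. E i = (\<Inter>n. F i n)"
    using assms(1) unfolding is_Gdelta_def by metis
  have "(\<Union>k. E k) = (\<Inter>m. \<Union>k. F k m \<inter> {p. \<bar>c p - real k\<bar> < 1/2})"
  proof (intro set_eqI iffI)
    fix p assume "p \<in> (\<Union>k. E k)"
    then obtain k where k: "p \<in> E k" by auto
    have "p \<in> F k m \<inter> {p. \<bar>c p - real k\<bar> < 1/2}" for m using k F(2)[of k] E[OF k] by auto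
    then show "p \<in> (\<Inter>m. \<Union>k. F k m \<inter> {p. \<bar>c p - real k\<bar> < 1/2})" by blast
  next
    fix p assume p: "p \<in> (\<Inter>m. \<Union>k. F k m \<inter> {p. \<bar>c p - real k\<bar> < 1/2})"
    then have "\<exists>k. p \<in> F k m \<and> \<bar>c p - real k\<bar> < 1/2" for m by auto
    then obtain k where k: "\<And>m. p \<in> F (k m) m" "\<And>m. \<bar>c p - real (k m)\<bar> < 1/2" by metis
    \<comment> \<open>Two naturals within less than 1/2 of \<open>c p\<close> coincide, so a single
      index serves all \<open>m\<close>.\<close>
    have "k m = k 0" for m using k(2)[of m] k(2)[of 0] by linarith
    then have "p \<in> E (k 0)" using k(1) F(2) by (metis INT_I)
    then show "p \<in> (\<Union>k. E k)" by auto
  qed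
  moreover have "open (\<Union>k. F k m \<inter> {p. \<bar>c p - real k\<bar> < 1/2})" for m
    by (intro open_UN ballI open_Int F open_Collect_less continuous_intros c)
  ultimately show ?thesis by (rule is_GdeltaI)
qed

text \<open>A Borel set is the injective projection of a \<open>G\<^sub>\<delta>\<close> set, namely of a measurable graph over it. The
  complement is carried along so that the induction passes through complements.\<close>

lemma borel_graph_Gdelta:
  fixes B :: "(nat \<Rightarrow> real) set"
  assumes "B \<in> sets borel"
  shows "\<exists>(g :: (nat \<Rightarrow> real) \<Rightarrow> nat \<Rightarrow> real) (g' :: (nat \<Rightarrow> real) \<Rightarrow> nat \<Rightarrow> real).
    g \<in> borel_measurable borel \<and> g' \<in> borel_measurable borel \<and>
    is_Gdelta ((\<lambda>x. (x, g x)) ` B) \<and> is_Gdelta ((\<lambda>x. (x, g' x)) ` (- B))"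
proof -
  have "B \<in> sigma_sets UNIV {S. open S}" using assms by (simp add: borel_def)
  then show ?thesis
  proof induction
    case (Basic S)
    then have S: "open S" by simp
    have *: "(\<lambda>x. (x, (\<lambda>_. 0) :: nat \<Rightarrow> real)) ` T = T \<times> {\<lambda>_. 0}" for T :: "(nat \<Rightarrow> real) set" by auto
    have z: "is_Gdelta (UNIV \<times> {\<lambda>_. 0} :: ((nat \<Rightarrow> real) \<times> (nat \<Rightarrow> real)) set)"
      by (intro is_Gdelta_closed closed_Times) auto
    have "is_Gdelta ((- S) \<times> {(\<lambda>_. 0) :: nat \<Rightarrow> real})"
      using S by (intro is_Gdelta_closed closed_Times) auto
    moreover have "is_Gdelta (S \<times> {(\<lambda>_. 0) :: nat \<Rightarrow> real})"
    proof -
      have "is_Gdelta (\<Inter>i::nat. if i = 0 then S \<times> UNIV else UNIV \<times> {(\<lambda>_. 0) :: nat \<Rightarrow> real})"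
        using is_Gdelta_open[OF open_Times[OF S open_UNIV]] z by (intro is_Gdelta_INT) auto
      also have "(\<Inter>i::nat. if i = 0 then S \<times> UNIV else UNIV \<times> {(\<lambda>_. 0) :: nat \<Rightarrow> real}) = S \<times> {\<lambda>_. 0}"
        by (auto split: if_splits) 
      finally show ?thesis .
    qed
    ultimately have "is_Gdelta ((\<lambda>x. (x, (\<lambda>_. 0) :: nat \<Rightarrow> real)) ` S)"
      "is_Gdelta ((\<lambda>x. (x, (\<lambda>_. 0) :: nat \<Rightarrow> real)) ` (- S))"
      by (simp_all only: *)
    note ** = this borel_measurable_const
    show ?case
      by (rule exI[where x = "\<lambda>_ _. 0"], rule exI[where x = "\<lambda>_ _. 0"], intro conjI; rule **)
  next
    case Empty
    have *: "(\<lambda>x. (x, (\<lambda>_. 0) :: nat \<Rightarrow> real)) ` T = T \<times> {\<lambda>_. 0}" for T :: "(nat \<Rightarrow> real) set" by auto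
    have "is_Gdelta (UNIV \<times> {\<lambda>_. 0} :: ((nat \<Rightarrow> real) \<times> (nat \<Rightarrow> real)) set)"
      by (intro is_Gdelta_closed closed_Times) auto
    then show ?case 
      by (intro exI[of _ "(\<lambda>_ _. 0) :: (nat \<Rightarrow> real) \<Rightarrow> nat \<Rightarrow> real"]) (auto simp: * is_Gdelta_open)
  next
    case (Compl a)
    have "UNIV - a = - a" by auto
    then show ?case using Compl by auto
  next
    case (Union B)
    define Q where "Q n g g' \<longleftrightarrow> g \<in> borel_measurable borel \<and> g' \<in> borel_measurable borel \<and>
      is_Gdelta ((\<lambda>x. (x, g x)) ` B n) \<and> is_Gdelta ((\<lambda>x. (x, g' x)) ` (- B n))"
      for n and g g' :: "(nat \<Rightarrow> real) \<Rightarrow> nat \<Rightarrow> real"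
    have "\<forall>n. \<exists>g. \<exists>g'. Q n g g'" using Union(2) by (simp add: Q_def)
    from choice[OF this] obtain g where "\<forall>n. \<exists>g'. Q n (g n) g'" by blast
    from choice[OF this] obtain g' where Q: "\<And>n. Q n (g n) (g' n)" by blast
    have [measurable]: "\<And>n. g n \<in> borel_measurable borel" "\<And>n. g' n \<in> borel_measurable borel"
      and G: "\<And>n. is_Gdelta ((\<lambda>x. (x, g n x)) ` B n)" "\<And>n. is_Gdelta ((\<lambda>x. (x, g' n x)) ` (- B n))"
      using Q by (auto simp: Q_def)
    have [measurable]: "B n \<in> sets borel" for n using Union(1)[of n] by (simp add: borel_def)
    have coord: "(\<lambda>x. f x j) \<in> borel_measurable borel" if "f \<in> borel_measurable borel"
      for f :: "(nat \<Rightarrow> real) \<Rightarrow> nat \<Rightarrow> real" and j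
      using that measurable_product_coordinates[of j] by (rule measurable_compose)
    note [measurable] = coord[OF \<open>\<And>n. g n \<in> _\<close>] coord[OF \<open>\<And>n. g' n \<in> _\<close>]
    \<comment> \<open>A sequence \<open>y\<close> is read as countably many sequences
      \<open>sl n y\<close>, so that one witness can carry the witnesses of all \<open>B n\<close>;
      \<open>sh\<close> drops coordinate 0, which is reserved for an index.\<close>
    define sl :: "nat \<Rightarrow> (nat \<Rightarrow> real) \<Rightarrow> nat \<Rightarrow> real" where "sl n y = (\<lambda>i. y (prod_encode (n, i)))" for n y
    define sh :: "(nat \<Rightarrow> real) \<Rightarrow> nat \<Rightarrow> real" where "sh y = (\<lambda>i. y (Suc i))" for y
    have cont_sl: "continuous_on UNIV (sl n)" for n unfolding sl_def
      by (intro continuous_on_coordinatewise_then_product continuous_on_product_coordinates)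
    have cont_sh: "continuous_on UNIV sh" unfolding sh_def
      by (intro continuous_on_coordinatewise_then_product continuous_on_product_coordinates)
    have sl_eqI: "y = y'" if "\<And>n. sl n y = sl n y'" for y y'
    proof
      fix j show "y j = y' j"
        using fun_cong[OF that[of "fst (prod_decode j)"], of "snd (prod_decode j)"] by (simp add: sl_def)
    qed
    have cont_slx: "continuous_on UNIV (\<lambda>(x::nat \<Rightarrow> real, y). (x, sl n y))" for n
      unfolding split_def by (intro continuous_intros continuous_on_compose2[OF cont_sl]) auto
    have cont_slsh: "continuous_on UNIV (\<lambda>(x::nat \<Rightarrow> real, y). (x, sl n (sh y)))" for n
      unfolding split_def
      by (intro continuous_intros continuous_on_compose2[OF cont_sl] continuous_on_compose2[OF cont_sh]) auto
    \<comment> \<open>A point outside the union has to certify that it lies outside every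
      \<open>B n\<close>: the slices of \<open>h' x\<close> are all the certificates
      \<open>g' n x\<close>.\<close>
    define h' where "h' x j = (case prod_decode j of (n, i) \<Rightarrow> g' n x i)" for x j
    have sl_h': "sl n (h' x) = g' n x" for n x by (auto simp: sl_def h'_def)
    have [measurable]: "h' \<in> borel_measurable borel"
      by (intro measurable_coordinatewise_then_product) (simp add: h'_def split_def)
    have "(\<lambda>x. (x, h' x)) ` (- \<Union> (range B)) = (\<Inter>n. (\<lambda>(x, y). (x, sl n y)) -` ((\<lambda>x. (x, g' n x)) ` (- B n)))"
      (is "?L = ?R")
    proof (intro set_eqI iffI; clarify?)
      fix x y assume p: "(x, y) \<in> ?R"
      have *: "x \<in> - B n \<and> sl n y = g' n x" for n
      proof -
        have "(x, sl n y) \<in> (\<lambda>x. (x, g' n x)) ` (- B n)" using p by simp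
        then obtain x' where "(x, sl n y) = (x', g' n x')" "x' \<in> - B n" by (rule imageE)
        then show ?thesis by simp
      qed
      have "y = h' x" by (rule sl_eqI) (simp only: sl_h' *)
      moreover have "x \<in> - \<Union> (range B)" using * by simp
      ultimately show "(x, y) \<in> ?L" by blast
    qed (auto simp: sl_h')
    then have 1: "is_Gdelta ((\<lambda>x. (x, h' x)) ` (- \<Union> (range B)))"
      by (simp add: is_Gdelta_INT is_Gdelta_vimage[OF G(2) cont_slx])
    \<comment> \<open>A point of the union is certified through the first \<open>B n\<close> that
      contains it. Coordinate 0 of \<open>h x\<close> names this index, the slices before it show
      that the earlier sets are missed, its own slice shows membership, and the later slices are 0
      so that the witness stays unique.\<close>
    define k where "k x = (LEAST n. x \<in> B n)" for x
    have [measurable]: "k \<in> measurable borel (count_space UNIV)" unfolding k_def by measurable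
    define h where "h x j = (case j of 0 \<Rightarrow> real (k x) | Suc j \<Rightarrow>
       (case prod_decode j of (n, i) \<Rightarrow> if n < k x then g' n x i else if n = k x then g n x i else 0))" for x j
    have sl_h: "sl n (sh (h x)) = (if n < k x then g' n x else if n = k x then g n x else (\<lambda>_. 0))" for n x
      by (auto simp: sl_def sh_def h_def)
    have h0: "h x 0 = real (k x)" for x by (simp add: h_def)
    have [measurable]: "h \<in> borel_measurable borel"
    proof (intro measurable_coordinatewise_then_product)
      fix j show "(\<lambda>x. h x j) \<in> borel_measurable borel"
        by (cases j) (simp_all add: h_def split_def)
    qed
    \<comment> \<open>\<open>E m\<close> is the part of the graph of \<open>h\<close> over the
      points with first index \<open>m\<close>, written with closed and G-delta conditions only;
      coordinate 0 separates the parts.\<close>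
    define E where "E m = {(x :: nat \<Rightarrow> real, y :: nat \<Rightarrow> real). y 0 = real m} \<inter> 
       (\<Inter>n. (\<lambda>(x, y). (x, sl n (sh y))) -`
        (if n < m then (\<lambda>x. (x, g' n x)) ` (- B n) else if n = m then (\<lambda>x. (x, g n x)) ` B n else UNIV \<times> {\<lambda>_. 0}))"
      for m
    have E_G: "is_Gdelta (E m)" for m
    proof -
      let ?A = "\<lambda>n. (\<lambda>(x, y). (x, sl n (sh y))) -`
        (if n < m then (\<lambda>x. (x, g' n x)) ` (- B n) else if n = m then (\<lambda>x. (x, g n x)) ` B n else UNIV \<times> {\<lambda>_. 0})"
      let ?C = "{(x :: nat \<Rightarrow> real, y :: nat \<Rightarrow> real). y 0 = real m}"
      have "is_Gdelta ?C" unfolding split_def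
        by (intro is_Gdelta_closed closed_Collect_eq continuous_intros
            continuous_on_compose2[OF continuous_on_product_coordinates]) auto
      moreover have "is_Gdelta (UNIV \<times> {(\<lambda>_. 0) :: nat \<Rightarrow> real} :: ((nat \<Rightarrow> real) \<times> _) set)"
        by (intro is_Gdelta_closed closed_Times) auto
      ultimately have "is_Gdelta (\<Inter>i::nat. case i of 0 \<Rightarrow> ?C | Suc n \<Rightarrow> ?A n)"
        using G by (intro is_Gdelta_INT) (simp split: nat.split add: is_Gdelta_vimage[OF _ cont_slsh])
      also have "(\<Inter>i::nat. case i of 0 \<Rightarrow> ?C | Suc n \<Rightarrow> ?A n) = E m"
        unfolding E_def INT_case_nat ..
      finally show ?thesis .
    qed
    have "(\<lambda>x. (x, h x)) ` (\<Union> (range B)) = (\<Union>m. E m)"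
    proof (intro set_eqI iffI)
      fix p assume "p \<in> (\<lambda>x. (x, h x)) ` (\<Union> (range B))"
      then obtain x n where p: "p = (x, h x)" and "x \<in> B n" by auto
      then have 1: "x \<in> B (k x)" unfolding k_def by (metis LeastI)
      have 2: "x \<notin> B n" if "n < k x" for n using that not_less_Least unfolding k_def by auto
      have "p \<in> E (k x)" unfolding E_def p using 1 2 by (auto simp: h0 sl_h)
      then show "p \<in> (\<Union>m. E m)" by auto
    next
      fix p assume "p \<in> (\<Union>m. E m)"
      then obtain m x y where p: "p = (x, y)" "(x, y) \<in> E m" by (cases p) auto
      have y0: "y 0 = real m" and *: "(x, sl n (sh y)) \<in> (if n < m then (\<lambda>x. (x, g' n x)) ` (- B n) 
        else if n = m then (\<lambda>x. (x, g n x)) ` B n else UNIV \<times> {\<lambda>_. 0})" for n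
        using p(2) unfolding E_def by auto
      have 1: "x \<in> B m" using *[of m] by auto
      have 2: "x \<notin> B n" if "n < m" for n using *[of n] that by auto
      have km: "k x = m" unfolding k_def using 1 2 by (intro Least_equality) (auto simp: not_less[symmetric])
      have "sl n (sh y) = sl n (sh (h x))" for n using *[of n] unfolding sl_h km by (auto split: if_splits)
      then have "sh y = sh (h x)" by (rule sl_eqI)
      then have "y j = h x j" for j using y0 h0[of x] km by (cases j) (auto simp: sh_def fun_eq_iff)
      then have "y = h x" by auto
      then show "p \<in> (\<lambda>x. (x, h x)) ` (\<Union> (range B))" using p 1 by auto
    qed
    moreover have "is_Gdelta (\<Union>m. E m)"
    proof (rule is_Gdelta_separated_UN[OF E_G])
      show "continuous_on UNIV (\<lambda>p::(nat \<Rightarrow> real) \<times> (nat \<Rightarrow> real). snd p 0)"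
        by (intro continuous_intros continuous_on_compose2[OF continuous_on_product_coordinates]) auto
    qed (auto simp: E_def)
    ultimately have 2: "is_Gdelta ((\<lambda>x. (x, h x)) ` \<Union> (range B))" by simp
    show ?case
      by (rule exI[where x = h], rule exI[where x = h'], intro conjI; fact)
  qed
qed


lemma is_Gdelta_gdelta_in: "is_Gdelta S \<Longrightarrow> gdelta_in euclidean S"
  unfolding is_Gdelta_def by (force intro: gdelta_in_Inter open_imp_gdelta_in)

lemma second_countable_euclidean: "second_countable (euclidean :: 'a::second_countable_topology topology)"
proof -
  obtain B :: "'a set set" where B: "countable B" "topological_basis B"
    using ex_countable_basis by blast
  have "\<exists>V\<in>B. x \<in> V \<and> V \<subseteq> U" if "open U" "x \<in> U" for U x
    by (rule topological_basisE[OF B(2) that]) blast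
  then show ?thesis
    unfolding second_countable_def using B(1) topological_basis_open[OF B(2)]
    by (intro exI[of _ B]) simp
qed

text \<open>\<open>e\<close> identifies X with the set S of fixed points of the Borel map that sends
  \<open>y\<close> to \<open>e (r y)\<close>. S is Borel but in general not Polish as a subspace, so
  it is replaced by the graph of \<open>g\<close> over S, a G-delta set in a Polish space, and the
  topology of X is pulled back from this graph.\<close>

lemma standard_borel_if_borel_retract:
  assumes "borel_retract X (borel :: (nat \<Rightarrow> real) measure)"
  shows "standard_borel X"
proof -
  obtain e r where e[measurable]: "e \<in> X \<rightarrow>\<^sub>M (borel :: (nat \<Rightarrow> real) measure)"
    and r: "r \<in> borel \<rightarrow>\<^sub>M X" and re: "\<And>x. x \<in> space X \<Longrightarrow> r (e x) = x"
    using assms unfolding borel_retract_def by blast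
  have rX: "r y \<in> space X" for y using measurable_space[OF r] by simp
  define S where "S = {y. e (r y) = y}"
  have S: "S = e ` space X"
  proof safe
    fix y assume "y \<in> S"
    then show "y \<in> e ` space X" using rX[of y] by (intro image_eqI[of _ _ "r y"]) (auto simp: S_def)
  qed (auto simp: S_def re)
  have er: "(\<lambda>y. e (r y)) \<in> borel_measurable borel" using r e by (rule measurable_compose)
  define F where "F i y = e (r y) i" for i y
  have [measurable]: "F i \<in> borel_measurable borel" for i
    unfolding F_def using measurable_compose[OF er measurable_product_coordinates] .
  have [measurable]: "(\<lambda>y :: nat \<Rightarrow> real. y i) \<in> borel_measurable borel" for i
    by (rule measurable_product_coordinates)
  have "S = (\<Inter>i. (\<lambda>y. F i y - y i) -` {0} \<inter> space borel)"
    by (auto simp: S_def F_def fun_eq_iff)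
  also have "\<dots> \<in> sets borel"
    by (intro sets.countable_INT'' measurable_sets[of _ _ borel] borel_measurable_diff) auto
  finally have "S \<in> sets borel" .
  from borel_graph_Gdelta[OF this] obtain g :: "(nat \<Rightarrow> real) \<Rightarrow> nat \<Rightarrow> real"
    where g[measurable]: "g \<in> borel_measurable borel" and G: "is_Gdelta ((\<lambda>x. (x, g x)) ` S)"
    by blast
  define E where "E x = (e x, g (e x))" for x
  define \<Gamma> where "\<Gamma> = E ` space X"
  have \<Gamma>: "gdelta_in euclidean \<Gamma>" 
    using is_Gdelta_gdelta_in[OF G] by (simp add: \<Gamma>_def E_def S image_image)
  have E[measurable]: "E \<in> borel_measurable X" unfolding E_def by measurable
  have inj: "inj_on E (space X)" by (rule inj_on_inverseI[where g = "\<lambda>p. r (fst p)"]) (simp add: E_def re)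
  define T where "T = pullback_topology (space X) E euclidean"
  have open_T: "openin T U \<longleftrightarrow> (\<exists>V. open V \<and> U = E -` V \<inter> space X)" for U
    by (simp add: T_def openin_pullback_topology)
  have space_T: "topspace T = space X" by (simp add: T_def topspace_pullback_topology)
  have "homeomorphic_map T (top_of_set \<Gamma>) E"
  proof (rule bijective_open_imp_homeomorphic_map)
    show "continuous_map T (top_of_set \<Gamma>) E"
      unfolding continuous_map_in_subtopology
      by (auto simp: continuous_map_def space_T \<Gamma>_def open_T)
    show "open_map T (top_of_set \<Gamma>) E"
      unfolding open_map_def open_T openin_open
    proof safe
      fix V :: "((nat \<Rightarrow> real) \<times> (nat \<Rightarrow> real)) set" assume "open V"
      then show "\<exists>W. open W \<and> E ` (E -` V \<inter> space X) = \<Gamma> \<inter> W"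
        by (intro exI[of _ V]) (auto simp: \<Gamma>_def)
    qed
  qed (auto simp: space_T \<Gamma>_def inj)
  then have hom: "T homeomorphic_space (top_of_set \<Gamma>)" by (rule homeomorphic_map_imp_homeomorphic_space)
  have "completely_metrizable_space (top_of_set \<Gamma>)"
    using completely_metrizable_space_gdelta_in[OF completely_metrizable_space_euclidean \<Gamma>] .
  then have 1: "completely_metrizable_space T"
    using homeomorphic_completely_metrizable_space[OF hom] by simp
  have "separable_space (top_of_set \<Gamma>)"
    by (intro second_countable_imp_separable_space second_countable_subtopology second_countable_euclidean)
  then have 2: "separable_space T" using homeomorphic_separable_space[OF hom] by simp
  have "sigma_sets (topspace T) {U. openin T U} = {E -` A \<inter> space X | A. A \<in> sets borel}"
  proof -
    have "{E -` A \<inter> space X | A. A \<in> sigma_sets UNIV {S. open S}}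
        = sigma_sets (space X) {E -` A \<inter> space X | A. A \<in> {S. open S}}"
      by (rule sigma_sets_vimage_commute) auto
    moreover have "{U. openin T U} = {E -` A \<inter> space X | A. A \<in> {S. open S}}"
      by (auto simp: open_T)
    ultimately show ?thesis by (simp add: space_T borel_def)
  qed
  also have "\<dots> = sets X"
  proof safe
    fix A assume "A \<in> sets (borel :: ((nat \<Rightarrow> real) \<times> (nat \<Rightarrow> real)) measure)"
    then show "E -` A \<inter> space X \<in> sets X" by measurable
  next
    \<comment> \<open>The first coordinate of \<open>E x\<close> is \<open>e x\<close>, so a
      measurable A is cut out of X by the Borel set of pairs whose first coordinate is sent into A
      by \<open>r\<close>.\<close>
    fix A assume A: "A \<in> sets X"
    then have "r -` A \<in> sets borel" using measurable_sets[OF r A] by simp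
    then have "fst -` (r -` A) \<inter> space borel \<in> sets (borel :: ((nat \<Rightarrow> real) \<times> (nat \<Rightarrow> real)) measure)"
      by (intro measurable_sets[of _ _ borel] borel_measurable_continuous_onI continuous_intros)
    moreover have "A = E -` (fst -` (r -` A) \<inter> space borel) \<inter> space X"
      using sets.sets_into_space[OF A] by (auto simp: E_def re)
    ultimately show "\<exists>B. A = E -` B \<inter> space X \<and> B \<in> sets borel" by blast
  qed
  finally have 3: "sigma_sets (topspace T) {U. openin T U} = sets X" .
  show ?thesis unfolding standard_borel_def using 1 2 3 space_T by blast
qed

text \<open>A retract of the space of real sequences contains the values of \<open>r\<close>, so the
  empty space is out of reach of \<open>standard_borel_if_borel_retract\<close>.\<close>

lemma standard_borel_empty: 
  assumes "space X = {}" shows "standard_borel X"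
proof -
  have "second_countable (trivial_topology :: 'a topology)"
    by (simp add: second_countable_discrete_topology)
  then have "separable_space (trivial_topology :: 'a topology)"
    by (rule second_countable_imp_separable_space)
  moreover have "sets X = {{}}" using assms by (simp add: space_empty_iff)
  moreover have "{U. openin (trivial_topology :: 'a topology) U} = {{}}"
    using openin_subset[of "trivial_topology :: 'a topology"] by auto
  then have "sigma_sets {} {U. openin (trivial_topology :: 'a topology) U} = {{}}"
    using sigma_sets_single[of "{} :: 'a set"] by simp
  moreover have "topspace (trivial_topology :: 'a topology) = {}" by simp
  ultimately show ?thesis
    unfolding standard_borel_def using assms
    by (intro exI[of _ "trivial_topology :: 'a topology"] conjI empty_completely_metrizable_space)
       (simp_all only: )
qed

text \<open>The Kuratowski embedding sends a point to its distances from a dense sequence.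
  Completeness makes its image describable by countably many inequalities, hence Borel, and
  \<open>r\<close> inverts the embedding there.\<close>

lemma borel_retract_if_standard_borel:
  assumes X: "standard_borel X" and ne: "space X \<noteq> {}"
  shows "borel_retract X (borel :: (nat \<Rightarrow> real) measure)"
proof -
  obtain T where T: "completely_metrizable_space T" "separable_space T" "topspace T = space X"
    "sigma_sets (topspace T) {U. openin T U} = sets X"
    using X unfolding standard_borel_def by blast
  obtain M d where "Metric_space M d" and compl: "Metric_space.mcomplete M d"
    and T_eq: "T = Metric_space.mtopology M d"
    using T(1) unfolding completely_metrizable_space_def by blast
  interpret Metric_space M d by fact
  have M: "M = space X" using T(3) by (simp add: T_eq)
  have open_sets: "U \<in> sets X" if "openin mtopology U" for U
    using that T(4) by (auto simp: T_eq[symmetric])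
  obtain C where C: "countable C" "C \<subseteq> M" "mtopology closure_of C = M"
    using T(2) unfolding separable_space_def by (auto simp: T_eq)
  have "C \<noteq> {}" using C ne M by auto
  then obtain a :: "nat \<Rightarrow> 'a" where a: "range a = C"
    using C(1) by (metis range_from_nat_into)
  have aM[simp]: "a n \<in> M" for n using a C(2) by auto
  have dense: "\<exists>n. d x (a n) < \<epsilon>" if "x \<in> M" "0 < \<epsilon>" for x \<epsilon>
  proof -
    have "x \<in> mtopology closure_of C" using C that by simp
    then have "\<exists>y\<in>C. y \<in> mball x \<epsilon>" using that(2) unfolding metric_closure_of by blast
    then obtain y where "y \<in> C" "d x y < \<epsilon>" by (auto simp: in_mball)
    then show ?thesis using a by (metis imageE)
  qed
  define e where "e x n = d x (a n)" for x n
  have [measurable]: "e \<in> X \<rightarrow>\<^sub>M borel"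
  proof (rule measurable_coordinatewise_then_product)
    fix n
    have "{x \<in> space X. e x n < c} = mball (a n) c" for c
      by (auto simp: e_def M[symmetric] in_mball commute)
    then show "(\<lambda>x. e x n) \<in> borel_measurable X"
      unfolding borel_measurable_iff_less by (auto intro: open_sets)
  qed
  \<comment> \<open>The sequences that behave like the distances from one point to the
    \<open>a n\<close>: triangle inequalities in both forms, and values arbitrarily close to 0, so
    that the point can be found as a limit of some of the \<open>a n\<close>.\<close>
  define S :: "(nat \<Rightarrow> real) set" where "S = {y \<in> space borel. (\<forall>k. \<exists>n. y n < inverse (real (Suc k))) \<and> 
      (\<forall>n m. \<bar>y n - y m\<bar> \<le> d (a n) (a m) \<and> d (a n) (a m) \<le> y n + y m)}"
  note measurable_product_coordinates[measurable]
  have S[measurable]: "S \<in> sets borel" unfolding S_def by measurable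
  have eS: "e x \<in> S" if x: "x \<in> M" for x
  proof -
    have "\<bar>d x (a n) - d x (a m)\<bar> \<le> d (a n) (a m)" "d (a n) (a m) \<le> d x (a n) + d x (a m)" for n m
      using triangle[OF x aM[of n] aM[of m]] triangle[OF x aM[of m] aM[of n]] triangle[OF aM[of n] x aM[of m]]
      by (auto simp: commute)
    then show ?thesis using dense[OF x] unfolding S_def e_def by auto
  qed
  have surj: "\<exists>x\<in>M. e x = y" if y: "y \<in> S" for y
  proof -
    have 1: "\<exists>n. y n < inverse (real (Suc k))" for k using y by (auto simp: S_def)
    have 2: "\<bar>y n - y m\<bar> \<le> d (a n) (a m)" "d (a n) (a m) \<le> y n + y m" for n m using y by (auto simp: S_def)
    \<comment> \<open>The centres at prescribed distance below 1 / (k + 1) form a Cauchy sequence,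
      and its limit has all the prescribed distances.\<close>
    from 1 obtain \<nu> where \<nu>: "\<And>k. y (\<nu> k) < inverse (real (Suc k))" by metis
    have y0: "0 \<le> y n" for n using 2(2)[of n n] by simp
    have "MCauchy (\<lambda>k. a (\<nu> k))"
      unfolding MCauchy_def
    proof safe
      fix \<epsilon> :: real assume "0 < \<epsilon>"
      then obtain N where N: "inverse (real (Suc N)) < \<epsilon> / 2" using reals_Archimedean[of "\<epsilon>/2"] by auto
      have "d (a (\<nu> n)) (a (\<nu> m)) < \<epsilon>" if "N \<le> n" "N \<le> m" for n m
      proof -
        have "inverse (real (Suc n)) \<le> inverse (real (Suc N))" "inverse (real (Suc m)) \<le> inverse (real (Suc N))"
          using that by (auto simp: field_simps)
        then show ?thesis using 2(2)[of "\<nu> n" "\<nu> m"] \<nu>[of n] \<nu>[of m] N by linarith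
      qed
      then show "\<exists>N. \<forall>n n'. N \<le> n \<longrightarrow> N \<le> n' \<longrightarrow> d (a (\<nu> n)) (a (\<nu> n')) < \<epsilon>" by blast
    qed auto
    then obtain x where x: "limitin mtopology (\<lambda>k. a (\<nu> k)) x sequentially"
      using compl unfolding mcomplete_def by blast
    then have xM: "x \<in> M" and lim: "(\<lambda>k. d (a (\<nu> k)) x) \<longlonglongrightarrow> 0"
      using limitin_mspace[OF x] x by (simp_all add: limitin_metric_dist_null)
    have inv0: "(\<lambda>k. inverse (real (Suc k))) \<longlonglongrightarrow> 0" by (rule LIMSEQ_inverse_real_of_nat)
    have "d x (a m) = y m" for m
    proof -
      have "\<bar>y m - d x (a m)\<bar> \<le> inverse (real (Suc k)) + d (a (\<nu> k)) x" for k
        using triangle[OF xM aM[of "\<nu> k"] aM[of m]] triangle[OF aM[of "\<nu> k"] xM aM[of m]]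
          2[of m "\<nu> k"] 2[of "\<nu> k" m] \<nu>[of k] y0[of "\<nu> k"] by (auto simp: commute)
      then have "\<bar>y m - d x (a m)\<bar> \<le> 0 + 0"
        by (intro LIMSEQ_le_const[OF tendsto_add[OF inv0 lim]]) auto
      then show ?thesis by simp
    qed
    then show ?thesis using xM by (intro bexI[of _ x]) (auto simp: e_def)
  qed
  have inj: "x = x'" if "x \<in> M" "x' \<in> M" "e x = e x'" for x x'
  proof (rule ccontr)
    assume "x \<noteq> x'"
    then have "0 < d x x' / 2" using that by simp
    then obtain n where "d x (a n) < d x x' / 2" using dense[OF \<open>x \<in> M\<close>] by blast
    moreover have "d x' (a n) = d x (a n)" using fun_cong[OF that(3), of n] by (simp add: e_def)
    ultimately show False using triangle[OF \<open>x \<in> M\<close> aM[of n] \<open>x' \<in> M\<close>] by (simp add: commute)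
  qed
  \<comment> \<open>Off S a fixed point of X is used as value; as S is Borel, \<open>r\<close> stays
    measurable.\<close>
  define r where "r y = (if y \<in> S then (SOME x. x \<in> M \<and> e x = y) else a 0)" for y
  have rS: "r y \<in> M \<and> e (r y) = y" if "y \<in> S" for y
    using someI_ex[of "\<lambda>x. x \<in> M \<and> e x = y"] surj[OF that] that unfolding r_def by auto
  have re: "r (e x) = x" if "x \<in> M" for x
    using rS[OF eS[OF that]] inj[OF _ that] by blast
  have "r \<in> borel \<rightarrow>\<^sub>M X"
  proof (rule measurable_sigma_sets)
    show "sets X = sigma_sets (space X) {U. openin mtopology U}"
      using T(4) unfolding T(3) by (simp add: T_eq)
    show "{U. openin mtopology U} \<subseteq> Pow (space X)" using openin_subset[of mtopology] unfolding topspace_mtopology M[symmetric] by blast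
    show "r \<in> space borel \<rightarrow> space X" using rS M aM by (auto simp: r_def)
    fix U assume "U \<in> {U. openin mtopology U}"
    then have U: "openin mtopology U" by simp
    \<comment> \<open>The balls of radius 1 / (m + 1) about dense points that fit into U cover U.
      For \<open>y\<close> in S, membership of \<open>r y\<close> in such a ball is an inequality
      for the coordinate \<open>y n\<close>, so the preimage of U becomes a countable union.\<close>
    define I where "I = {(n, m). mball (a n) (inverse (real (Suc m))) \<subseteq> U}"
    have *: "r y \<in> U \<longleftrightarrow> (\<exists>p\<in>I. y (fst p) < inverse (real (Suc (snd p))))" if "y \<in> S" for y
    proof
      assume "r y \<in> U"
      then obtain \<epsilon> where \<epsilon>: "0 < \<epsilon>" "mball (r y) \<epsilon> \<subseteq> U" using U unfolding openin_mtopology by blast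
      then obtain m where m: "inverse (real (Suc m)) < \<epsilon> / 2" using reals_Archimedean[of "\<epsilon>/2"] by auto
      obtain n where n: "d (r y) (a n) < inverse (real (Suc m))" using dense[of "r y" "inverse (real (Suc m))"] rS[OF \<open>y \<in> S\<close>] by auto
      have "mball (a n) (inverse (real (Suc m))) \<subseteq> mball (r y) \<epsilon>"
      proof
        fix z assume "z \<in> mball (a n) (inverse (real (Suc m)))"
        then have "z \<in> M" "d (a n) z < inverse (real (Suc m))" by (auto simp: in_mball)
        then show "z \<in> mball (r y) \<epsilon>"
          using m n triangle[of "r y" "a n" z] rS[OF that] by (auto simp: in_mball)
      qed
      then have "(n, m) \<in> I" using \<epsilon> by (auto simp: I_def)
      moreover have "y n = d (r y) (a n)" using fun_cong[OF conjunct2[OF rS[OF \<open>y \<in> S\<close>]], of n] by (simp add: e_def)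
      ultimately show "\<exists>p\<in>I. y (fst p) < inverse (real (Suc (snd p)))" using n by force
    next
      assume "\<exists>p\<in>I. y (fst p) < inverse (real (Suc (snd p)))"
      then obtain n m where nm: "mball (a n) (inverse (real (Suc m))) \<subseteq> U" "y n < inverse (real (Suc m))"
        by (auto simp: I_def)
      moreover have "y n = d (r y) (a n)" using fun_cong[OF conjunct2[OF rS[OF \<open>y \<in> S\<close>]], of n] by (simp add: e_def)
      ultimately have "r y \<in> mball (a n) (inverse (real (Suc m)))" using rS[OF that] by (auto simp: in_mball commute)
      then show "r y \<in> U" using nm by auto
    qed
    have meas_I: "{y. \<exists>p\<in>I. y (fst p) < inverse (real (Suc (snd p)))} \<in> sets borel"
    proof -
      have "{y. \<exists>p\<in>I. y (fst p) < inverse (real (Suc (snd p)))} =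
          (\<Union>p\<in>I. {y \<in> space borel. y (fst p) < inverse (real (Suc (snd p)))})" by auto
      also have "\<dots> \<in> sets borel" by (intro sets.countable_UN'') auto
      finally show ?thesis .
    qed
    have "r -` U \<inter> space borel = (S \<inter> {y. \<exists>p\<in>I. y (fst p) < inverse (real (Suc (snd p)))}) \<union>
        (if a 0 \<in> U then - S else {})"
    proof (rule set_eqI)
      have rn: "r y = a 0" if "y \<notin> S" for y using that by (simp add: r_def)
      show "y \<in> r -` U \<inter> space borel \<longleftrightarrow> y \<in> (S \<inter> {y. \<exists>p\<in>I. y (fst p) < inverse (real (Suc (snd p)))}) \<union>
        (if a 0 \<in> U then - S else {})" for y
        by (cases "y \<in> S"; cases "a 0 \<in> U") (simp_all only: * rn vimage_eq Int_iff Un_iff mem_Collect_eq space_borel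
            UNIV_I Compl_iff empty_iff simp_thms if_True if_False)
    qed
    also have "\<dots> \<in> sets borel"
      using S sets.compl_sets[OF S] by (intro sets.Un sets.Int S meas_I) (simp add: Compl_eq_Diff_UNIV)
    finally show "r -` U \<inter> space borel \<in> sets borel" .
  qed
  with \<open>e \<in> X \<rightarrow>\<^sub>M borel\<close> show ?thesis
    by (rule borel_retractI) (rule re, unfold M)
qed

subsection \<open>Coding by real numbers\<close>

lemma borel_retract_pair:
  assumes "borel_retract X A" "borel_retract Y B"
  shows "borel_retract (X \<Otimes>\<^sub>M Y) (A \<Otimes>\<^sub>M B)"
proof -
  obtain e r where [measurable]: "e \<in> X \<rightarrow>\<^sub>M A" and r[measurable]: "r \<in> A \<rightarrow>\<^sub>M X" and re: "\<And>x. x \<in> space X \<Longrightarrow> r (e x) = x"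
    using assms(1) unfolding borel_retract_def by blast
  obtain e' r' where [measurable]: "e' \<in> Y \<rightarrow>\<^sub>M B" and r'[measurable]: "r' \<in> B \<rightarrow>\<^sub>M Y" and re': "\<And>x. x \<in> space Y \<Longrightarrow> r' (e' x) = x"
    using assms(2) unfolding borel_retract_def by blast
  show ?thesis
  proof (rule borel_retractI)
    show "(\<lambda>p. (e (fst p), e' (snd p))) \<in> X \<Otimes>\<^sub>M Y \<rightarrow>\<^sub>M A \<Otimes>\<^sub>M B" by measurable
    show "(\<lambda>p. (r (fst p), r' (snd p))) \<in> A \<Otimes>\<^sub>M B \<rightarrow>\<^sub>M X \<Otimes>\<^sub>M Y" by measurable
  qed (auto simp: space_pair_measure re re')
qed

lemma borel_measurable_coord: "f \<in> borel_measurable M \<Longrightarrow> (\<lambda>x. f x i) \<in> borel_measurable M"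
  for f :: "'a \<Rightarrow> nat \<Rightarrow> real"
  by (rule measurable_compose[OF _ measurable_product_coordinates])

lemma borel_retract_seq_PiM:
  assumes "borel_retract X (borel :: (nat \<Rightarrow> real) measure)"
  shows "borel_retract (\<Pi>\<^sub>M i\<in>{..<n::nat}. X) (borel :: (nat \<Rightarrow> real) measure)"
proof -
  obtain e r where e: "e \<in> X \<rightarrow>\<^sub>M (borel :: (nat \<Rightarrow> real) measure)" and r: "r \<in> borel \<rightarrow>\<^sub>M X"
    and re: "\<And>x. x \<in> space X \<Longrightarrow> r (e x) = x"
    using assms unfolding borel_retract_def by blast
  define E :: "(nat \<Rightarrow> 'a) \<Rightarrow> nat \<Rightarrow> real"
    where "E x j = (if fst (prod_decode j) < n then e (x (fst (prod_decode j))) (snd (prod_decode j)) else 0)" for x j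
  define R where "R y = (\<lambda>i\<in>{..<n}. r (\<lambda>k. y (prod_encode (i, k))))" for y :: "nat \<Rightarrow> real"
  show ?thesis
  proof (rule borel_retractI)
    show "E \<in> (\<Pi>\<^sub>M i\<in>{..<n}. X) \<rightarrow>\<^sub>M borel"
    proof (rule measurable_coordinatewise_then_product)
      fix j show "(\<lambda>x. E x j) \<in> borel_measurable (\<Pi>\<^sub>M i\<in>{..<n}. X)"
      proof (cases "fst (prod_decode j) < n")
        case True
        then have "(\<lambda>x. x (fst (prod_decode j))) \<in> (\<Pi>\<^sub>M i\<in>{..<n}. X) \<rightarrow>\<^sub>M X" 
          by (intro measurable_component_singleton) simp
        from measurable_compose[OF this borel_measurable_coord[OF e]] True show ?thesis by (simp add: E_def)
      qed (simp add: E_def)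
    qed
    show "R \<in> borel \<rightarrow>\<^sub>M (\<Pi>\<^sub>M i\<in>{..<n}. X)"
      unfolding R_def
      by (intro measurable_restrict measurable_compose[OF _ r] measurable_coordinatewise_then_product
          measurable_product_coordinates)
  next
    fix x assume x: "x \<in> space (\<Pi>\<^sub>M i\<in>{..<n}. X)"
    have "(\<lambda>k. E x (prod_encode (i, k))) = e (x i)" if "i < n" for i
      using that by (auto simp: E_def)
    then show "R (E x) = x"
      using x by (auto simp: R_def space_PiM PiE_iff re fun_eq_iff extensional_def)
  qed
qed

lemma borel_retract_seq_pair:
  "borel_retract ((borel :: (nat \<Rightarrow> real) measure) \<Otimes>\<^sub>M (borel :: (nat \<Rightarrow> real) measure)) (borel :: (nat \<Rightarrow> real) measure)"
proof (rule borel_retractI)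
  let ?E = "\<lambda>p j. if even j then fst p (j div 2) else snd p (j div 2)"
  show "?E \<in> borel \<Otimes>\<^sub>M borel \<rightarrow>\<^sub>M (borel :: (nat \<Rightarrow> real) measure)"
  proof (rule measurable_coordinatewise_then_product)
    fix j :: nat
    show "(\<lambda>p. ?E p j) \<in> borel_measurable ((borel :: (nat \<Rightarrow> real) measure) \<Otimes>\<^sub>M (borel :: (nat \<Rightarrow> real) measure))"
      by (cases "even j") (simp_all add: borel_measurable_coord)
  qed
  show "(\<lambda>y. (\<lambda>j. y (2 * j), \<lambda>j. y (2 * j + 1))) \<in> (borel :: (nat \<Rightarrow> real) measure) \<rightarrow>\<^sub>M borel \<Otimes>\<^sub>M borel"
    by (intro measurable_Pair measurable_coordinatewise_then_product measurable_product_coordinates)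
qed auto

lemma standard_borel_pair:
  assumes "standard_borel X" "standard_borel Y"
  shows "standard_borel (X \<Otimes>\<^sub>M Y)"
proof (cases "space X = {} \<or> space Y = {}")
  case True then show ?thesis by (intro standard_borel_empty) (auto simp: space_pair_measure)
next
  case False
  then have "borel_retract X (borel :: (nat \<Rightarrow> real) measure)" "borel_retract Y (borel :: (nat \<Rightarrow> real) measure)"
    using borel_retract_if_standard_borel assms by blast+
  from borel_retract_trans[OF borel_retract_pair[OF this] borel_retract_seq_pair]
  show ?thesis by (rule standard_borel_if_borel_retract)
qed

text \<open>Bits are read in base 4: with digits 0 and 1 only, every tail is at most 1/3 and cannot
  carry, so expansions are unique and the digits can be recovered by rounding down.\<close>

definition base4 :: "(nat \<Rightarrow> bool) \<Rightarrow> real" where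
  "base4 b = (\<Sum>j. (if b j then 1 else 0) / 4 ^ Suc j)"

lemma base4_summable: "summable (\<lambda>j. (if b j then 1 else 0) / (4::real) ^ Suc j)"
proof (rule summable_comparison_test')
  show "summable (\<lambda>j. (1/4::real) ^ Suc j)" by (simp add: summable_geometric)
qed (simp add: power_divide)

lemma base4_bounds: "0 \<le> base4 b" "base4 b \<le> 1/3"
proof -
  show "0 \<le> base4 b" unfolding base4_def by (intro suminf_nonneg base4_summable) auto
  have "(\<lambda>j. (1/4::real) ^ Suc j) sums (1/3)"
    using sums_mult[OF geometric_sums[of "1/4::real"], of "1/4"] by simp
  then show "base4 b \<le> 1/3" unfolding base4_def
    by (intro sums_le[OF _ summable_sums[OF base4_summable]]) (auto simp: power_divide)
qed

lemma base4_rec: "4 * base4 b = (if b 0 then 1 else 0) + base4 (\<lambda>j. b (Suc j))"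
proof -
  have "base4 b = (\<Sum>j. (if b (Suc j) then 1 else 0) / 4 ^ Suc (Suc j)) + (if b 0 then 1 else 0) / 4"
    unfolding base4_def using suminf_split_head[OF base4_summable, of b] by simp
  also have "(\<Sum>j. (if b (Suc j) then 1 else 0) / (4::real) ^ Suc (Suc j)) = base4 (\<lambda>j. b (Suc j)) / 4"
    unfolding base4_def by (subst suminf_divide[OF base4_summable, symmetric]) (simp add: field_simps)
  finally show ?thesis by simp
qed

text \<open>Multiplication by \<open>4 ^ Suc n\<close> yields a multiple of 4, plus the digit
  \<open>b n\<close>, plus a tail of at most 1/3; the parity of the integer part is therefore the
  digit.\<close>

lemma base4_digit: "odd \<lfloor>4 ^ Suc n * base4 b\<rfloor> \<longleftrightarrow> b n"
proof -
  have "\<exists>k::int. 4 ^ n * base4 b = of_int k + base4 (\<lambda>j. b (j + n))"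
  proof (induction n)
    case 0 show ?case by (intro exI[of _ 0]) simp
  next
    case (Suc n)
    then obtain k :: int where "4 ^ n * base4 b = of_int k + base4 (\<lambda>j. b (j + n))" by auto
    then have "4 ^ Suc n * base4 b = of_int (4 * k) + 4 * base4 (\<lambda>j. b (j + n))" by simp
    then show ?case by (intro exI[of _ "4 * k + (if b n then 1 else 0)"]) (simp add: base4_rec[of "\<lambda>j. b (j + n)"])
  qed
  then obtain k :: int where k: "4 ^ n * base4 b = of_int k + base4 (\<lambda>j. b (j + n))" by auto
  then have "4 ^ Suc n * base4 b = of_int (4 * k + (if b n then 1 else 0)) + base4 (\<lambda>j. b (Suc j + n))"
    using base4_rec[of "\<lambda>j. b (j + n)"]
    by (simp only: power_Suc mult.assoc distrib_left of_int_add of_int_mult of_int_numeral add_0 if_distrib[of real_of_int]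
        of_int_1 of_int_0 add.assoc)
  then have "\<lfloor>4 ^ Suc n * base4 b\<rfloor> = 4 * k + (if b n then 1 else 0)"
    using base4_bounds[of "\<lambda>j. b (Suc j + n)"] by (intro floor_unique) auto
  then show ?thesis by auto
qed

definition ratq :: "nat \<Rightarrow> real" where "ratq = from_nat_into \<rat>"

lemma ratq_dense:
  assumes "x < y" obtains j where "x < ratq j" "ratq j < y"
proof -
  have "range ratq = \<rat>" unfolding ratq_def by (rule range_from_nat_into[OF _ countable_rat]) (use Rats_0 in blast)
  moreover obtain q where "q \<in> \<rat>" "x < q" "q < y" using Rats_dense_in_real[OF assms] by auto
  ultimately show thesis using that by (metis rangeE)
qed

text \<open>Distribution functions are continuous from the right, so their value at t is reached
  through rationals strictly above t; monotonicity makes the corresponding half-lines a decreasing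
  sequence.\<close>

lemma ratq_seq_above:
  "\<exists>s. (\<forall>m. t < ratq (s m)) \<and> (\<forall>m. ratq (s (Suc m)) \<le> ratq (s m)) \<and> (\<lambda>m. ratq (s m)) \<longlonglongrightarrow> t"
proof -
  \<comment> \<open>Successive terms are taken from adjacent disjoint windows, which forces the
    sequence to decrease.\<close>
  have "\<exists>j. t + inverse (real (Suc (Suc m))) < ratq j \<and> ratq j < t + inverse (real (Suc m))" for m
  proof -
    have "t + inverse (real (Suc (Suc m))) < t + inverse (real (Suc m))" by (simp add: field_simps)
    then show ?thesis by (rule ratq_dense) blast
  qed
  then have "\<forall>m. \<exists>j. t + inverse (real (Suc (Suc m))) < ratq j \<and> ratq j < t + inverse (real (Suc m))" by simp
  from choice[OF this] obtain s where
    s: "\<And>m. t + inverse (real (Suc (Suc m))) < ratq (s m)" "\<And>m. ratq (s m) < t + inverse (real (Suc m))" by auto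
  have 1: "t < ratq (s m)" for m
  proof -
    have "0 < inverse (real (Suc (Suc m)))" by simp
    then show ?thesis using s(1)[of m] by linarith
  qed
  have "(\<lambda>m. t + inverse (real (Suc m))) \<longlonglongrightarrow> t + 0"
    by (intro tendsto_add tendsto_const LIMSEQ_inverse_real_of_nat)
  then have "(\<lambda>m. t + inverse (real (Suc m))) \<longlonglongrightarrow> t" by simp
  then have "(\<lambda>m. ratq (s m)) \<longlonglongrightarrow> t"
    by (rule tendsto_sandwich[OF always_eventually always_eventually tendsto_const, rotated 2])
       (intro allI less_imp_le 1 s(2))+
  moreover have "ratq (s (Suc m)) \<le> ratq (s m)" for m
    using s(1)[of m] s(2)[of "Suc m"] by linarith
  ultimately show ?thesis using 1 by (intro exI[of _ s] conjI allI)
qed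

text \<open>A real sequence is determined by the bits \<open>x i < ratq k\<close>, which
  \<open>base4\<close> packs into one number; the decoder recovers \<open>x i\<close> as the infimum
  of the rationals above it.\<close>

lemma borel_retract_seq_real:
  "\<exists>e r. e \<in> (borel :: (nat \<Rightarrow> real) measure) \<rightarrow>\<^sub>M (borel :: real measure) \<and> r \<in> borel \<rightarrow>\<^sub>M borel \<and>
    (\<forall>x. r (e x) = x \<and> 0 \<le> e x \<and> e x \<le> 1)"
proof -
  define b where "b x j = (x (fst (prod_decode j)) < ratq (snd (prod_decode j)))" for x :: "nat \<Rightarrow> real" and j
  define e where "e x = base4 (b x)" for x
  \<comment> \<open>The infimum is taken in the extended reals, where an unset bit contributes
    infinity. For \<open>t\<close> outside the range of \<open>e\<close> it may be infinite, and
    \<open>real_of_ereal\<close> then supplies a default.\<close>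
  define r where "r t i = real_of_ereal (INF k. if odd \<lfloor>4 ^ Suc (prod_encode (i, k)) * t\<rfloor> then ereal (ratq k) else \<infinity>)"
    for t :: real and i :: nat
  show ?thesis
  proof (rule exI[where x = e], rule exI[where x = r], intro conjI allI)
    have "Measurable.pred borel (\<lambda>x. b x j)" for j
      unfolding b_def pred_def by (intro borel_measurable_less measurable_product_coordinates) simp_all
    then have "(\<lambda>x. (if b x j then 1 else 0) / (4::real) ^ Suc j) \<in> borel_measurable borel" for j
      by (intro borel_measurable_divide measurable_If) simp_all
    then show "e \<in> borel_measurable borel" unfolding e_def base4_def by (rule borel_measurable_suminf)
    show "r \<in> borel_measurable borel"
    proof (rule measurable_coordinatewise_then_product)
      fix i show "(\<lambda>t. r t i) \<in> borel_measurable borel" unfolding r_def by measurable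
    qed
    show "r (e x) = x" for x
    proof
      fix i
      have "r (e x) i = real_of_ereal (INF k. if x i < ratq k then ereal (ratq k) else \<infinity>)"
        unfolding r_def e_def base4_digit by (simp add: b_def)
      also have "(INF k. if x i < ratq k then ereal (ratq k) else \<infinity>) = ereal (x i)"
      proof (rule antisym)
        show "ereal (x i) \<le> (INF k. if x i < ratq k then ereal (ratq k) else \<infinity>)"
          by (intro INF_greatest) simp
        show "(INF k. if x i < ratq k then ereal (ratq k) else \<infinity>) \<le> ereal (x i)"
        proof (rule ereal_le_epsilon2)
          fix \<epsilon> :: real assume "0 < \<epsilon>"
          then have "x i < x i + \<epsilon>" by simp
          then obtain k where k: "x i < ratq k" "ratq k < x i + \<epsilon>" by (rule ratq_dense)
          have "(INF k. if x i < ratq k then ereal (ratq k) else \<infinity>) \<le> (if x i < ratq k then ereal (ratq k) else \<infinity>)"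
            by (rule INF_lower) simp
          also have "\<dots> \<le> ereal (x i) + ereal \<epsilon>" using k by simp
          finally show "(INF k. if x i < ratq k then ereal (ratq k) else \<infinity>) \<le> ereal (x i) + ereal \<epsilon>" .
        qed
      qed
      finally show "r (e x) i = x i" by simp
    qed
    show "0 \<le> e x" "e x \<le> 1" for x using base4_bounds[of "b x"] by (auto simp: e_def)
  qed
qed

subsection \<open>Quantile functions\<close>

text \<open>The lower quantile: the infimum of the rationals at which the values \<open>v\<close>
  reach \<open>u\<close>. Replacing negative rationals and rationals with too small a value by 1
  keeps the infimum bounded below for arbitrary \<open>v\<close>, which makes it total and jointly
  measurable.\<close>

definition quant :: "(nat \<Rightarrow> real) \<Rightarrow> real \<Rightarrow> real" where
  "quant v u = (INF j. if 0 \<le> ratq j \<and> u \<le> v j then ratq j else 1)"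

definition quantile_law :: "(nat \<Rightarrow> real) \<Rightarrow> real measure" where
  "quantile_law v = distr (uniform_measure lborel {0<..1}) borel (quant v)"

text \<open>The properties of the values at the rationals of the distribution function of a law on \<open>[0, 1]\<close> that
  survive pointwise limits. Right continuity does not, and is not needed for \<open>quant_le_iff\<close>.\<close>

definition cdf_values :: "(nat \<Rightarrow> real) \<Rightarrow> bool" where
  "cdf_values v \<longleftrightarrow> (\<forall>i j. ratq i \<le> ratq j \<longrightarrow> v i \<le> v j) \<and> (\<forall>j. 0 \<le> v j \<and> v j \<le> 1) \<and>
     (\<forall>j. ratq j < 0 \<longrightarrow> v j = 0) \<and> (\<forall>j. 1 \<le> ratq j \<longrightarrow> v j = 1)"

lemma quant_bdd: "bdd_below (range (\<lambda>j. if 0 \<le> ratq j \<and> u \<le> v j then ratq j else 1))"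
  by (rule bdd_belowI2[of _ 0]) simp

text \<open>The Galois connection between quantiles and distribution functions, in right-limit form.
  The range of \<open>u\<close> matters: \<open>u > 0\<close> rules out negative t, where
  \<open>v\<close> vanishes, and \<open>u \<le> 1\<close> copes with the substitute value 1, beyond
  which \<open>v\<close> is 1.\<close>

lemma quant_le_iff:
  assumes v: "cdf_values v" and u: "0 < u" "u \<le> 1"
  shows "quant v u \<le> t \<longleftrightarrow> (\<forall>j. t < ratq j \<longrightarrow> u \<le> v j)"
proof
  assume q: "quant v u \<le> t"
  show "\<forall>j. t < ratq j \<longrightarrow> u \<le> v j"
  proof safe
    fix j assume "t < ratq j"
    then have "quant v u < ratq j" using q by simp
    then obtain i where i: "(if 0 \<le> ratq i \<and> u \<le> v i then ratq i else 1) < ratq j"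
      unfolding quant_def cINF_less_iff[OF UNIV_not_empty quant_bdd] by auto
    show "u \<le> v j"
    proof (cases "0 \<le> ratq i \<and> u \<le> v i")
      case True
      then have "v i \<le> v j" using v i by (simp add: cdf_values_def)
      then show ?thesis using True by simp
    next
      case False
      then have "1 < ratq j" using i by (simp only: if_False)
      then have "v j = 1" using v by (simp add: cdf_values_def)
      then show ?thesis using u by simp
    qed
  qed
next
  assume *: "\<forall>j. t < ratq j \<longrightarrow> u \<le> v j"
  have "0 \<le> t"
  proof (rule ccontr)
    assume "\<not> ?thesis"
    then have "t < 0" by simp
    then obtain j where "t < ratq j" "ratq j < 0" by (rule ratq_dense)
    then show False using * v u by (auto simp: cdf_values_def)
  qed
  show "quant v u \<le> t"
  proof (rule field_le_epsilon)
    fix \<epsilon> :: real assume "0 < \<epsilon>"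
    then have "t < t + \<epsilon>" by simp
    then obtain j where j: "t < ratq j" "ratq j < t + \<epsilon>" by (rule ratq_dense)
    have "quant v u \<le> (if 0 \<le> ratq j \<and> u \<le> v j then ratq j else 1)"
      unfolding quant_def by (rule cINF_lower[OF quant_bdd]) simp
    also have "\<dots> \<le> t + \<epsilon>" using j * \<open>0 \<le> t\<close> by simp
    finally show "quant v u \<le> t + \<epsilon>" .
  qed
qed

lemma prob_space_unit_uniform: "prob_space (uniform_measure lborel {0<..1::real})"
  by (rule prob_space_uniform_measure) auto

text \<open>Joint measurability in the values and the level is what makes
  \<open>quantile_law\<close> a kernel.\<close>

lemma quant_measurable: "(\<lambda>p. quant (fst p) (snd p)) \<in> borel_measurable ((borel :: (nat \<Rightarrow> real) measure) \<Otimes>\<^sub>M borel)"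
  unfolding quant_def
proof (rule borel_measurable_cINF)
  fix j :: nat
  have [measurable]: "(\<lambda>p. fst p j) \<in> borel_measurable ((borel :: (nat \<Rightarrow> real) measure) \<Otimes>\<^sub>M (borel :: real measure))"
    by (rule borel_measurable_coord) simp
  have [measurable]: "Measurable.pred ((borel :: (nat \<Rightarrow> real) measure) \<Otimes>\<^sub>M (borel :: real measure)) (\<lambda>p. snd p \<le> fst p j)"
    unfolding pred_def by (rule borel_measurable_le) simp_all
  show "(\<lambda>p. if 0 \<le> ratq j \<and> snd p \<le> fst p j then ratq j else 1) \<in> borel_measurable ((borel :: (nat \<Rightarrow> real) measure) \<Otimes>\<^sub>M borel)"
    by measurable
qed (simp, rule quant_bdd)

lemma quant_measurable1[measurable]: "quant v \<in> borel_measurable borel"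
  using measurable_compose[OF measurable_Pair1'[of v borel borel] quant_measurable] by simp

lemma quantile_law_measurable: "quantile_law \<in> borel \<rightarrow>\<^sub>M prob_algebra borel"
  unfolding quantile_law_def
proof (rule measurable_distr_prob_space2)
  have "uniform_measure lborel {0<..1::real} \<in> space (prob_algebra borel)"
    using prob_space_unit_uniform by (simp add: space_prob_algebra)
  then show "(\<lambda>v. uniform_measure lborel {0<..1::real}) \<in> borel \<rightarrow>\<^sub>M prob_algebra borel" by (rule measurable_const)
qed (use quant_measurable in \<open>simp add: split_def\<close>)

text \<open>By \<open>quant_le_iff\<close>, \<open>quant v u\<close> is at most t exactly when
  \<open>u\<close> is at most every \<open>v (s m)\<close>, for almost every \<open>u\<close>. These
  events decrease in m, and under the uniform law the event for m has probability
  \<open>v (s m)\<close>.\<close>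

lemma cdf_values_limit:
  assumes v: "cdf_values v" and s: "\<And>m. t < ratq (s m)" "\<And>m. ratq (s (Suc m)) \<le> ratq (s m)" "(\<lambda>m. ratq (s m)) \<longlonglongrightarrow> t"
  shows "(\<lambda>m. v (s m)) \<longlonglongrightarrow> measure (quantile_law v) {..t}"
proof -
  let ?U = "uniform_measure lborel {0<..1::real}"
  interpret U: prob_space ?U by (rule prob_space_unit_uniform)
  have v01: "0 \<le> v j" "v j \<le> 1" for j using v by (auto simp: cdf_values_def)
  have vmono: "ratq i \<le> ratq j \<Longrightarrow> v i \<le> v j" for i j using v by (auto simp: cdf_values_def)
  have mU: "measure ?U {u. u \<le> c} = c" if "0 \<le> c" "c \<le> 1" for c
  proof -
    have "{0<..1} \<inter> {u. u \<le> c} = {0<..c}" using that by auto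
    moreover have "emeasure ?U {u. u \<le> c} = emeasure lborel ({0<..1} \<inter> {u. u \<le> c}) / emeasure lborel {0<..1::real}"
      by (rule emeasure_uniform_measure) (auto simp: atMost_def[symmetric])
    ultimately have "emeasure ?U {u. u \<le> c} = ennreal c" using that by (simp add: divide_ennreal_def)
    then show ?thesis using that by (simp add: measure_def)
  qed
  define A where "A m = {u. u \<le> v (s m)}" for m
  have "(\<lambda>m. measure ?U (A m)) \<longlonglongrightarrow> measure ?U (\<Inter>m. A m)"
  proof (rule U.finite_Lim_measure_decseq)
    show "range A \<subseteq> U.events" by (auto simp: A_def atMost_def[symmetric])
    show "decseq A" unfolding decseq_Suc_iff A_def by (auto intro: order_trans[OF _ vmono[OF s(2)]])
  qed
  moreover have "measure ?U (A m) = v (s m)" for m unfolding A_def by (rule mU[OF v01])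
  moreover have "measure ?U (\<Inter>m. A m) = measure (quantile_law v) {..t}"
  proof -
    have "measure (quantile_law v) {..t} = measure ?U (quant v -` {..t})"
      unfolding quantile_law_def by (subst measure_distr) auto
    also have "\<dots> = measure ?U (\<Inter>m. A m)"
    proof (rule measure_eq_AE)
      have "quant v u \<le> t \<longleftrightarrow> (\<forall>m. u \<le> v (s m))" if u: "0 < u" "u \<le> 1" for u
        unfolding quant_le_iff[OF v u]
      proof safe
        fix j assume *: "\<forall>m. u \<le> v (s m)" "t < ratq j"
        then have "\<forall>\<^sub>F m in sequentially. ratq (s m) < ratq j" using s(3) by (simp add: order_tendstoD)
        then obtain m where "ratq (s m) < ratq j" by (auto simp: eventually_sequentially)
        then show "u \<le> v j" using vmono[of "s m" j] *(1) by (meson less_imp_le order_trans)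
      qed (use s(1) in auto)
      then have "\<forall>u\<in>{0<..1}. u \<in> quant v -` {..t} \<longleftrightarrow> u \<in> (\<Inter>m. A m)" by (simp add: A_def)
      moreover have "AE u in ?U. u \<in> {0<..1}" 
        by (rule AE_uniform_measureI) auto
      ultimately show "AE u in ?U. (u \<in> quant v -` {..t}) = (u \<in> (\<Inter>m. A m))" 
        by (elim AE_mp) (intro AE_I2, blast)
    next
      show "quant v -` {..t} \<in> sets ?U" using measurable_sets[OF quant_measurable1, of "{..t}" v] by simp
      show "(\<Inter>m. A m) \<in> sets ?U" by (intro sets.countable_INT'') (auto simp: A_def atMost_def[symmetric])
    qed
    finally show ?thesis ..
  qed
  ultimately show ?thesis by simp
qed

text \<open>\<open>r\<close> is measurable on all reals, which forces X to be nonempty. The bounds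
  on \<open>e\<close> provide the values 0 and 1 that \<open>cdf_values\<close> demands to the left
  of 0 and from 1 on.\<close>

locale unit_coded =
  fixes X :: "'a measure" and e :: "'a \<Rightarrow> real" and r :: "real \<Rightarrow> 'a"
  assumes e[measurable]: "e \<in> borel_measurable X" and r[measurable]: "r \<in> borel \<rightarrow>\<^sub>M X"
    and re: "\<And>x. x \<in> space X \<Longrightarrow> r (e x) = x" and e01: "\<And>x. x \<in> space X \<Longrightarrow> 0 \<le> e x \<and> e x \<le> 1"
begin

definition decode :: "(nat \<Rightarrow> real) \<Rightarrow> 'a measure" where "decode v = distr (quantile_law v) X r"

definition code :: "'a measure \<Rightarrow> nat \<Rightarrow> real" where
  "code \<mu> j = measure \<mu> {x \<in> space X. e x \<le> ratq j}"

lemma decode_measurable: "decode \<in> borel \<rightarrow>\<^sub>M prob_algebra X"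
  unfolding decode_def using quantile_law_measurable measurable_distr_prob_space[OF r]
  by (rule measurable_compose)

lemma code_measurable: "code \<in> prob_algebra X \<rightarrow>\<^sub>M borel"
proof (rule measurable_coordinatewise_then_product)
  fix j
  have "{x \<in> space X. e x \<le> ratq j} \<in> sets X" by measurable
  then show "(\<lambda>\<mu>. code \<mu> j) \<in> borel_measurable (prob_algebra X)"
    unfolding code_def by (rule measurable_measure_prob_algebra)
qed

text \<open>\<open>code \<mu>\<close> samples the distribution function of \<open>e\<close> under
  \<mu> at the rationals. Continuity from above recovers the law of \<open>e\<close> as the quantile
  law, and \<open>r\<close> undoes \<open>e\<close>. This exhibits the space of probability measures
  as a retract of the space of real sequences.\<close>

lemma decode_code:
  assumes \<mu>: "\<mu> \<in> space (prob_algebra X)"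
  shows "decode (code \<mu>) = \<mu>"
proof -
  have sets_\<mu>[measurable_cong]: "sets \<mu> = sets X" and "prob_space \<mu>" using \<mu> by (auto simp: space_prob_algebra)
  interpret prob_space \<mu> by fact
  have sp: "space \<mu> = space X" using sets_\<mu> by (rule sets_eq_imp_space_eq)
  have ev: "{x \<in> space X. e x \<le> t} \<in> events" for t unfolding sets_\<mu> by measurable
  have v: "cdf_values (code \<mu>)" unfolding cdf_values_def code_def
  proof (intro conjI allI impI)
    show "measure \<mu> {x \<in> space X. e x \<le> ratq i} \<le> measure \<mu> {x \<in> space X. e x \<le> ratq j}"
      if "ratq i \<le> ratq j" for i j
      using that by (intro finite_measure_mono ev) auto
    show "measure \<mu> {x \<in> space X. e x \<le> ratq j} = 0" if "ratq j < 0" for j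
    proof -
      have "{x \<in> space X. e x \<le> ratq j} = {}" using that e01 by force
      then show ?thesis by (simp only: measure_empty)
    qed
    show "measure \<mu> {x \<in> space X. e x \<le> ratq j} = 1" if "1 \<le> ratq j" for j
    proof -
      have "{x \<in> space X. e x \<le> ratq j} = space \<mu>" using that e01 sp by force
      then show ?thesis by (simp only: prob_space)
    qed
  qed auto
  have "quantile_law (code \<mu>) = distr \<mu> borel e"
  proof (rule cdf_unique)
    show "real_distribution (quantile_law (code \<mu>))"
      unfolding quantile_law_def
      by (intro prob_space.real_distribution_distr prob_space_unit_uniform) simp
    show "real_distribution (distr \<mu> borel e)" by (rule real_distribution_distr) measurable
    show "cdf (quantile_law (code \<mu>)) = cdf (distr \<mu> borel e)"
    proof
      fix t
      obtain s where s: "\<And>m. t < ratq (s m)" "\<And>m. ratq (s (Suc m)) \<le> ratq (s m)" "(\<lambda>m. ratq (s m)) \<longlonglongrightarrow> t"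
        using ratq_seq_above by blast
      have "(\<lambda>m. measure \<mu> {x \<in> space X. e x \<le> ratq (s m)}) \<longlonglongrightarrow> measure \<mu> (\<Inter>m. {x \<in> space X. e x \<le> ratq (s m)})"
      proof (rule finite_Lim_measure_decseq)
        show "range (\<lambda>m. {x \<in> space X. e x \<le> ratq (s m)}) \<subseteq> events" using ev by auto
        show "decseq (\<lambda>m. {x \<in> space X. e x \<le> ratq (s m)})" unfolding decseq_Suc_iff using s(2) order_trans by blast
      qed
      also have "(\<Inter>m. {x \<in> space X. e x \<le> ratq (s m)}) = {x \<in> space X. e x \<le> t}"
      proof (intro set_eqI iffI)
        fix x assume x: "x \<in> (\<Inter>m. {x \<in> space X. e x \<le> ratq (s m)})"
        then have "\<forall>m. e x \<le> ratq (s m)" "x \<in> space X" by auto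
        then show "x \<in> {x \<in> space X. e x \<le> t}" using LIMSEQ_le_const[OF s(3), of "e x"] by auto
      next
        fix x assume "x \<in> {x \<in> space X. e x \<le> t}"
        then show "x \<in> (\<Inter>m. {x \<in> space X. e x \<le> ratq (s m)})" using s(1) by (auto intro: less_imp_le order_trans)
      qed
      finally have "(\<lambda>m. code \<mu> (s m)) \<longlonglongrightarrow> measure \<mu> {x \<in> space X. e x \<le> t}" by (simp only: code_def)
      with cdf_values_limit[OF v s] have "measure (quantile_law (code \<mu>)) {..t} = measure \<mu> {x \<in> space X. e x \<le> t}"
        by (rule LIMSEQ_unique)
      also have "{x \<in> space X. e x \<le> t} = e -` {..t} \<inter> space \<mu>" by (auto simp: sp)
      also have "measure \<mu> (e -` {..t} \<inter> space \<mu>) = measure (distr \<mu> borel e) {..t}"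
        by (rule measure_distr[symmetric]) auto
      finally show "cdf (quantile_law (code \<mu>)) t = cdf (distr \<mu> borel e) t" by (simp add: cdf_def)
    qed
  qed
  then have "decode (code \<mu>) = distr (distr \<mu> borel e) X r" by (simp add: decode_def)
  also have "\<dots> = distr \<mu> X (r \<circ> e)" by (rule distr_distr) auto
  also have "\<dots> = distr \<mu> \<mu> (\<lambda>x. x)" using sets_\<mu> sp re by (intro distr_cong) auto
  finally show ?thesis by simp
qed

end

lemma unit_coded_if_standard_borel:
  assumes "standard_borel X" "space X \<noteq> {}"
  obtains e r where "unit_coded X e r"
proof -
  obtain e r where e: "e \<in> X \<rightarrow>\<^sub>M (borel :: (nat \<Rightarrow> real) measure)" and r: "r \<in> borel \<rightarrow>\<^sub>M X"
    and re: "\<And>x. x \<in> space X \<Longrightarrow> r (e x) = x"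
    using borel_retract_if_standard_borel[OF assms] unfolding borel_retract_def by blast
  obtain e' r' where e': "e' \<in> (borel :: (nat \<Rightarrow> real) measure) \<rightarrow>\<^sub>M (borel :: real measure)" and r': "r' \<in> borel \<rightarrow>\<^sub>M borel"
    and re': "\<And>x. r' (e' x) = x" and b: "\<And>x. 0 \<le> e' x" "\<And>x. e' x \<le> 1"
    using borel_retract_seq_real by blast
  show thesis
  proof (rule that)
    show "unit_coded X (\<lambda>x. e' (e x)) (\<lambda>t. r (r' t))"
      by standard (simp_all add: measurable_compose[OF e e'] measurable_compose[OF r' r] re re' b)
  qed
qed

lemma space_prob_algebra_empty:
  assumes "space X = {}" shows "space (prob_algebra X) = {}"
proof -
  have False if "sets M = sets X" "prob_space M" for M :: "'a measure"
    using prob_space.not_empty[OF that(2)] sets_eq_imp_space_eq[OF that(1)] assms by simp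
  then show ?thesis unfolding space_prob_algebra by auto
qed

lemma standard_borel_prob_algebra:
  assumes "standard_borel X"
  shows "standard_borel (prob_algebra X)"
proof (cases "space X = {}")
  case True then show ?thesis by (intro standard_borel_empty space_prob_algebra_empty)
next
  case False
  obtain e r where "unit_coded X e r" using unit_coded_if_standard_borel[OF assms False] .
  then interpret unit_coded X e r .
  show ?thesis
    by (rule standard_borel_if_borel_retract, rule borel_retractI[OF code_measurable decode_measurable], rule decode_code)
qed

subsection \<open>Laws of random measures are determined by their moments\<close>

text \<open>A list rather than a set of events, so that a repeated event counts with its
  multiplicity and the powers of \<open>emeasure \<alpha> A\<close> are moments too.\<close>

definition moment :: "'a set list \<Rightarrow> 'a measure \<Rightarrow> ennreal" where
  "moment As \<alpha> = prod_list (map (emeasure \<alpha>) As)"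

lemma moment_simps[simp]:
  "moment [] \<alpha> = 1" "moment (A # As) \<alpha> = emeasure \<alpha> A * moment As \<alpha>"
  "moment (As @ Bs) \<alpha> = moment As \<alpha> * moment Bs \<alpha>"
  by (simp_all add: moment_def)

lemma emeasure_measurable_prob_algebra:
  "A \<in> sets X \<Longrightarrow> (\<lambda>\<alpha>. emeasure \<alpha> A) \<in> borel_measurable (prob_algebra X)"
  unfolding prob_algebra_def
  by (intro measurable_restrict_space1 measurable_emeasure_subprob_algebra)

lemma moment_measurable[measurable]:
  "set As \<subseteq> sets X \<Longrightarrow> moment As \<in> borel_measurable (prob_algebra X)"
proof (induction As)
  case (Cons A As)
  have "moment (A # As) = (\<lambda>\<alpha>. emeasure \<alpha> A * moment As \<alpha>)" by (simp add: fun_eq_iff)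
  also have "\<dots> \<in> borel_measurable (prob_algebra X)"
    using Cons by (intro borel_measurable_times_ennreal emeasure_measurable_prob_algebra) auto
  finally show ?case .
qed (simp add: moment_def[abs_def])

lemma moment_le_1:
  assumes "\<alpha> \<in> space (prob_algebra X)" shows "moment As \<alpha> \<le> 1"
proof (induction As)
  case (Cons A As)
  have "prob_space \<alpha>" using assms by (simp add: space_prob_algebra)
  then have "emeasure \<alpha> A \<le> 1" by (rule prob_space.measure_le_1)
  from mult_mono[OF this Cons] show ?case by simp
qed simp

lemma moment_ennreal:
  assumes "\<alpha> \<in> space (prob_algebra X)"
  shows "moment As \<alpha> = ennreal (prod_list (map (measure \<alpha>) As))"
proof (induction As)
  case (Cons A As)
  have "prob_space \<alpha>" using assms by (simp add: space_prob_algebra)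
  then have "emeasure \<alpha> A = ennreal (measure \<alpha> A)"
    by (simp add: finite_measure.emeasure_eq_measure prob_space_def)
  then show ?case using Cons by (simp add: ennreal_mult')
qed simp

lemma prod_list_01:
  fixes f :: "'b \<Rightarrow> real"
  assumes "\<And>x. x \<in> set xs \<Longrightarrow> 0 \<le> f x \<and> f x \<le> 1"
  shows "0 \<le> prod_list (map f xs) \<and> prod_list (map f xs) \<le> 1"
  using assms by (induction xs) (auto intro!: mult_nonneg_nonneg mult_le_one)

lemma prod_list_map_tendsto:
  fixes f :: "'b \<Rightarrow> 'c \<Rightarrow> real"
  assumes "\<And>x. x \<in> set xs \<Longrightarrow> ((\<lambda>n. f n x) \<longlongrightarrow> g x) F"
  shows "((\<lambda>n. prod_list (map (f n) xs)) \<longlongrightarrow> prod_list (map g xs)) F"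
  using assms by (induction xs) (auto intro!: tendsto_mult)

lemma prod_list_map_measurable:
  fixes f :: "'b \<Rightarrow> 'c \<Rightarrow> real"
  assumes "\<And>x. x \<in> set xs \<Longrightarrow> (\<lambda>a. f a x) \<in> borel_measurable M"
  shows "(\<lambda>a. prod_list (map (f a) xs)) \<in> borel_measurable M"
  using assms by (induction xs) (auto intro!: borel_measurable_times)

text \<open>Finite conjunctions of conditions are taken because they are closed under intersection,
  as uniqueness of measures on a generator requires.\<close>

lemma sets_prob_algebra_generator:
  fixes X :: "'a measure"
  defines "\<Omega> \<equiv> space (prob_algebra X)"
  defines "E \<equiv> {{\<alpha> \<in> \<Omega>. \<forall>p\<in>set L. snd p < measure \<alpha> (fst p)} | L. fst ` set L \<subseteq> sets X}"
  shows "sets (prob_algebra X) = sigma_sets \<Omega> E"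
proof
  have E_sub: "E \<subseteq> Pow \<Omega>" by (auto simp: E_def)
  show "sigma_sets \<Omega> E \<subseteq> sets (prob_algebra X)"
    unfolding \<Omega>_def
  proof (rule sets.sigma_sets_subset, safe)
    fix A assume "A \<in> E"
    then obtain L where L: "A = {\<alpha> \<in> \<Omega>. \<forall>p\<in>set L. snd p < measure \<alpha> (fst p)}" "fst ` set L \<subseteq> sets X"
      by (auto simp: E_def)
    have "{\<alpha> \<in> \<Omega>. snd p < measure \<alpha> (fst p)} \<in> sets (prob_algebra X)" if "p \<in> set L" for p
    proof -
      have "fst p \<in> sets X" using L(2) that by auto
      from measurable_measure_prob_algebra[OF this] show ?thesis
        unfolding borel_measurable_iff_greater \<Omega>_def by auto
    qed
    then show "A \<in> sets (prob_algebra X)" unfolding L(1) \<Omega>_def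
      by (intro sets.sets_Collect_finite_All) auto
  qed
  let ?S = "sigma \<Omega> E"
  have sp: "space ?S = \<Omega>" and st: "sets ?S = sigma_sets \<Omega> E" using E_sub by (auto simp: space_measure_of)
  have "(\<lambda>\<alpha>. \<alpha>) \<in> ?S \<rightarrow>\<^sub>M prob_algebra X"
  proof (rule measurable_prob_algebraI)
    show "prob_space \<alpha>" if "\<alpha> \<in> space ?S" for \<alpha> using that unfolding sp by (simp add: \<Omega>_def space_prob_algebra)
    show "(\<lambda>\<alpha>. \<alpha>) \<in> ?S \<rightarrow>\<^sub>M subprob_algebra X"
    proof (rule measurable_subprob_algebra)
      fix \<alpha> assume "\<alpha> \<in> space ?S"
      then have *: "sets \<alpha> = sets X" "prob_space \<alpha>" unfolding sp by (auto simp: \<Omega>_def space_prob_algebra)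
      show "sets \<alpha> = sets X" by fact
      show "subprob_space \<alpha>" using *(2) by (rule prob_space_imp_subprob_space)
    next
      fix A assume A: "A \<in> sets X"
      have "(\<lambda>\<alpha>. measure \<alpha> A) \<in> borel_measurable ?S"
        unfolding borel_measurable_iff_greater sp st
      proof
        fix c
        have "{\<alpha> \<in> \<Omega>. c < measure \<alpha> A} \<in> E" unfolding E_def
          using A by (intro CollectI exI[of _ "[(A, c)]"]) auto
        then show "{\<alpha> \<in> \<Omega>. c < measure \<alpha> A} \<in> sigma_sets \<Omega> E" by (rule sigma_sets.Basic)
      qed
      then have "(\<lambda>\<alpha>. ennreal (measure \<alpha> A)) \<in> borel_measurable ?S" by (rule measurable_compose) simp
      also have "?this \<longleftrightarrow> (\<lambda>\<alpha>. emeasure \<alpha> A) \<in> borel_measurable ?S"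
        by (rule measurable_cong, unfold sp)
           (simp add: \<Omega>_def space_prob_algebra finite_measure.emeasure_eq_measure prob_space_def)
      finally show "(\<lambda>\<alpha>. emeasure \<alpha> A) \<in> borel_measurable ?S" .
    qed
  qed
  then show "sets (prob_algebra X) \<subseteq> sigma_sets \<Omega> E"
    using measurable_sets[of "\<lambda>\<alpha>. \<alpha>" ?S "prob_algebra X"] sets.sets_into_space[of _ "prob_algebra X"]
    by (auto simp: sp st \<Omega>_def[symmetric] Int_absorb2)
qed

text \<open>In terms of \<open>\<alpha> A\<close> and \<open>\<alpha> (space X - A) = 1 - \<alpha> A\<close>, the Bernstein polynomials of \<open>\<alpha> A\<close> are linear
  combinations of moments, so factors \<open>\<alpha> A\<close> can be replaced by continuous functions of \<open>\<alpha> A\<close> one by one.\<close>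

lemma random_measure_eqI:
  fixes M M' :: "'a measure measure"
  assumes M: "finite_measure M" "sets M = sets (prob_algebra X)"
    and M': "finite_measure M'" "sets M' = sets (prob_algebra X)"
    and eq: "\<And>As. set As \<subseteq> sets X \<Longrightarrow> (\<integral>\<^sup>+\<alpha>. moment As \<alpha> \<partial>M) = (\<integral>\<^sup>+\<alpha>. moment As \<alpha> \<partial>M')"
  shows "M = M'"
proof -
  interpret M: finite_measure M by fact
  interpret M': finite_measure M' by fact
  have sp: "space M = space (prob_algebra X)" "space M' = space (prob_algebra X)"
    using M M' sets_eq_imp_space_eq by blast+
  define w where "w As \<alpha> = prod_list (map (measure \<alpha>) As)" for As and \<alpha> :: "'a measure"
  have measX: "(\<lambda>\<alpha>. measure \<alpha> A) \<in> borel_measurable (prob_algebra X)" if "A \<in> sets X" for A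
    using that by (rule measurable_measure_prob_algebra)
  have m01: "0 \<le> measure \<alpha> A \<and> measure \<alpha> A \<le> 1" if "\<alpha> \<in> space (prob_algebra X)" for \<alpha> A
    using that by (simp add: space_prob_algebra prob_space.prob_le_1)
  \<comment> \<open>\<open>fs\<close> lists the factors already replaced by a continuous function of
    the mass, \<open>As\<close> those still plain. The induction on \<open>fs\<close> trades one
    function for a combination of products with a longer \<open>As\<close>, until only moments are
    left.\<close>
  define G where "G fs As \<alpha> = prod_list (map (\<lambda>p. fst p (measure \<alpha> (snd p))) fs) * w As \<alpha>"
    for fs :: "((real \<Rightarrow> real) \<times> 'a set) list" and As \<alpha>
  define ok where "ok \<phi> \<longleftrightarrow> continuous_on UNIV \<phi> \<and> (\<forall>t. 0 \<le> \<phi> t \<and> \<phi> t \<le> 1)" for \<phi> :: "real \<Rightarrow> real"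
  define good where "good fs \<longleftrightarrow> (\<forall>p\<in>set fs. ok (fst p) \<and> snd p \<in> sets X)"
    for fs :: "((real \<Rightarrow> real) \<times> 'a set) list"
  have G_meas: "G fs As \<in> borel_measurable (prob_algebra X)" if "good fs" "set As \<subseteq> sets X" for fs As
    unfolding G_def w_def
  proof (intro borel_measurable_times prod_list_map_measurable measX)
    fix p assume "p \<in> set fs"
    then have "ok (fst p)" "snd p \<in> sets X" using that by (auto simp: good_def)
    then show "(\<lambda>\<alpha>. fst p (measure \<alpha> (snd p))) \<in> borel_measurable (prob_algebra X)"
      unfolding ok_def using measurable_compose[OF measX borel_measurable_continuous_onI] by blast
  qed (use that in auto)
  have G01: "0 \<le> G fs As \<alpha> \<and> G fs As \<alpha> \<le> 1" if "good fs" "\<alpha> \<in> space (prob_algebra X)" for fs As \<alpha>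
  proof -
    have "0 \<le> prod_list (map (\<lambda>p. fst p (measure \<alpha> (snd p))) fs) \<and> prod_list (map (\<lambda>p. fst p (measure \<alpha> (snd p))) fs) \<le> 1"
      using that(1) by (intro prod_list_01) (auto simp: good_def ok_def)
    moreover have "0 \<le> w As \<alpha> \<and> w As \<alpha> \<le> 1" unfolding w_def using m01[OF that(2)] by (intro prod_list_01) auto
    ultimately show ?thesis unfolding G_def by (auto intro!: mult_le_one)
  qed
  have bint: "integrable M f \<and> integrable M' f"
    if "f \<in> borel_measurable (prob_algebra X)" "\<And>\<alpha>. \<alpha> \<in> space (prob_algebra X) \<Longrightarrow> \<bar>f \<alpha>\<bar> \<le> B"
    for f :: "'a measure \<Rightarrow> real" and B
  proof
    show "integrable M f"
      by (rule M.integrable_const_bound[where B = B]) (use that sp in \<open>auto simp: measurable_cong_sets[OF M(2) refl]\<close>)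
    show "integrable M' f"
      by (rule M'.integrable_const_bound[where B = B]) (use that sp in \<open>auto simp: measurable_cong_sets[OF M'(2) refl]\<close>)
  qed
  have G_int: "integrable M (G fs As)" "integrable M' (G fs As)" if "good fs" "set As \<subseteq> sets X" for fs As
    using bint[OF G_meas[OF that], of 1] G01[OF that(1)] by auto
  have base: "(\<integral>\<alpha>. w As \<alpha> \<partial>M) = (\<integral>\<alpha>. w As \<alpha> \<partial>M')" if As: "set As \<subseteq> sets X" for As
  proof -
    have g: "good []" by (simp add: good_def)
    have w: "w As = G [] As" by (simp add: G_def fun_eq_iff)
    have "(\<integral>\<^sup>+\<alpha>. ennreal (w As \<alpha>) \<partial>M) = (\<integral>\<^sup>+\<alpha>. ennreal (w As \<alpha>) \<partial>M')"
      using eq[OF As] nn_integral_cong[of M "\<lambda>\<alpha>. ennreal (w As \<alpha>)" "moment As"]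
        nn_integral_cong[of M' "\<lambda>\<alpha>. ennreal (w As \<alpha>)" "moment As"]
      by (simp add: sp moment_ennreal w_def)
    moreover have "AE \<alpha> in M. 0 \<le> w As \<alpha>" "AE \<alpha> in M'. 0 \<le> w As \<alpha>"
      using G01[OF g] by (auto intro!: AE_I2 simp: w sp)
    moreover have "w As \<in> borel_measurable M" "w As \<in> borel_measurable M'"
      using G_int[OF g As] by (auto simp: w)
    ultimately show ?thesis by (simp add: integral_eq_nn_integral)
  qed
  have main: "(\<integral>\<alpha>. G fs As \<alpha> \<partial>M) = (\<integral>\<alpha>. G fs As \<alpha> \<partial>M')" if "good fs" "set As \<subseteq> sets X" for fs As
    using that
  proof (induction fs arbitrary: As)
    case Nil
    then show ?case using base by (simp add: G_def)
  next
    case (Cons p fs)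
    obtain \<phi> A where p: "p = (\<phi>, A)" by (cases p)
    have gfs: "good fs" and \<phi>: "ok \<phi>" and A: "A \<in> sets X" using Cons.prems by (auto simp: good_def p)
    have G_Cons: "G (p # fs) As \<alpha> = \<phi> (measure \<alpha> A) * G fs As \<alpha>" for \<alpha> by (simp add: G_def p)
    define K where "K = measure M (space M) + measure M' (space M')"
    have K: "0 \<le> K" by (simp add: K_def)
    have est: "\<bar>(\<integral>\<alpha>. G (p # fs) As \<alpha> \<partial>M) - (\<integral>\<alpha>. G (p # fs) As \<alpha> \<partial>M')\<bar> \<le> \<epsilon> * K" if "0 < \<epsilon>" for \<epsilon>
    proof -
      have "continuous_on {0..1} \<phi>" using \<phi> unfolding ok_def by (auto intro: continuous_on_subset)
      from Bernstein_Weierstrass[OF this \<open>0 < \<epsilon>\<close>] obtain n where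
        n: "\<And>x. x \<in> {0..1} \<Longrightarrow> \<bar>\<phi> x - (\<Sum>k\<le>n. \<phi> (k/n) * Bernstein n k x)\<bar> < \<epsilon>" by blast
      \<comment> \<open>Up to a binomial coefficient, the Bernstein polynomial of index k is the
        k-th power of the mass of A times the (n - k)-th power of the mass of its complement; these
        powers join \<open>As\<close> as repeated events.\<close>
      define L where "L k = replicate k A @ replicate (n - k) (space X - A) @ As" for k
      have L: "set (L k) \<subseteq> sets X" for k using A Cons.prems by (auto simp: L_def)
      define P where "P \<alpha> = (\<Sum>k\<le>n. \<phi> (k/n) * Bernstein n k (measure \<alpha> A)) * G fs As \<alpha>" for \<alpha>
      have P_eq: "P \<alpha> = (\<Sum>k\<le>n. (\<phi> (k/n) * (n choose k)) * G fs (L k) \<alpha>)" if "\<alpha> \<in> space (prob_algebra X)" for \<alpha>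
      proof -
        have pr: "prob_space \<alpha>" and st: "sets \<alpha> = sets X" using that by (auto simp: space_prob_algebra)
        have "measure \<alpha> (space X - A) = 1 - measure \<alpha> A"
          using prob_space.prob_compl[OF pr, of A] A st sets_eq_imp_space_eq[OF st] by simp
        then show ?thesis
          by (simp add: P_def G_def w_def L_def Bernstein_def sum_distrib_right sum_distrib_left mult_ac
              map_replicate prod_list_replicate)
      qed
      have iP: "integrable N P" and IP: "(\<integral>\<alpha>. P \<alpha> \<partial>N) = (\<Sum>k\<le>n. (\<phi> (k/n) * (n choose k)) * (\<integral>\<alpha>. G fs (L k) \<alpha> \<partial>N))"
        if N: "N = M \<or> N = M'" for N
      proof -
        have spN: "space N = space (prob_algebra X)" using N sp by auto
        have i: "integrable N (G fs (L k))" for k using G_int[OF gfs L] N by auto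
        have "integrable N P \<longleftrightarrow> integrable N (\<lambda>\<alpha>. \<Sum>k\<le>n. (\<phi> (k/n) * (n choose k)) * G fs (L k) \<alpha>)"
          by (rule Bochner_Integration.integrable_cong[OF refl]) (simp add: P_eq spN)
        then show "integrable N P" using i by simp
        have "(\<integral>\<alpha>. P \<alpha> \<partial>N) = (\<integral>\<alpha>. (\<Sum>k\<le>n. (\<phi> (k/n) * (n choose k)) * G fs (L k) \<alpha>) \<partial>N)"
          by (rule Bochner_Integration.integral_cong[OF refl]) (simp add: P_eq spN)
        then show "(\<integral>\<alpha>. P \<alpha> \<partial>N) = (\<Sum>k\<le>n. (\<phi> (k/n) * (n choose k)) * (\<integral>\<alpha>. G fs (L k) \<alpha> \<partial>N))"
          using i by simp
      qed
      have PP: "(\<integral>\<alpha>. P \<alpha> \<partial>M) = (\<integral>\<alpha>. P \<alpha> \<partial>M')"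
        by (simp add: IP Cons.IH[OF gfs L])
      have close: "\<bar>(\<integral>\<alpha>. G (p # fs) As \<alpha> \<partial>N) - (\<integral>\<alpha>. P \<alpha> \<partial>N)\<bar> \<le> \<epsilon> * measure N (space N)"
        if N: "N = M \<or> N = M'" for N
      proof -
        interpret N: finite_measure N using N M(1) M'(1) by auto
        have spN: "space N = space (prob_algebra X)" using N sp by auto
        have iG: "integrable N (G (p # fs) As)" using G_int[OF Cons.prems] N by auto
        have "\<bar>(\<integral>\<alpha>. G (p # fs) As \<alpha> \<partial>N) - (\<integral>\<alpha>. P \<alpha> \<partial>N)\<bar> = \<bar>\<integral>\<alpha>. G (p # fs) As \<alpha> - P \<alpha> \<partial>N\<bar>"
          using iG iP[OF N] by simp
        also have "\<dots> \<le> (\<integral>\<alpha>. \<bar>G (p # fs) As \<alpha> - P \<alpha>\<bar> \<partial>N)" by (rule integral_abs_bound)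
        also have "\<dots> \<le> (\<integral>\<alpha>. \<epsilon> \<partial>N)"
        proof (rule integral_mono)
          show "integrable N (\<lambda>\<alpha>. \<bar>G (p # fs) As \<alpha> - P \<alpha>\<bar>)" using iG iP[OF N] by simp
          fix \<alpha> assume "\<alpha> \<in> space N"
          then have \<alpha>: "\<alpha> \<in> space (prob_algebra X)" by (simp add: spN)
          have "\<bar>G (p # fs) As \<alpha> - P \<alpha>\<bar> =
              \<bar>\<phi> (measure \<alpha> A) - (\<Sum>k\<le>n. \<phi> (k/n) * Bernstein n k (measure \<alpha> A))\<bar> * G fs As \<alpha>"
            using G01[OF gfs \<alpha>, of As] by (simp add: G_Cons P_def left_diff_distrib[symmetric] abs_mult)
          also have "\<dots> \<le> \<epsilon> * 1"
            using n[of "measure \<alpha> A"] m01[OF \<alpha>, of A] G01[OF gfs \<alpha>, of As] \<open>0 < \<epsilon>\<close>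
            by (intro mult_mono) auto
          finally show "\<bar>G (p # fs) As \<alpha> - P \<alpha>\<bar> \<le> \<epsilon>" by simp
        qed simp
        also have "\<dots> = \<epsilon> * measure N (space N)" by simp
        finally show ?thesis .
      qed
      show ?thesis using close[of M] close[of M'] PP unfolding K_def distrib_left by simp
    qed
    have "\<bar>(\<integral>\<alpha>. G (p # fs) As \<alpha> \<partial>M) - (\<integral>\<alpha>. G (p # fs) As \<alpha> \<partial>M')\<bar> \<le> 0"
    proof (rule field_le_epsilon)
      fix \<epsilon> :: real assume "0 < \<epsilon>"
      \<comment> \<open>The total mass K may be 0, hence the denominator
        \<open>K + 1\<close>.\<close>
      then have "0 < \<epsilon> / (K + 1)" using K by simp
      from est[OF this] have "\<bar>(\<integral>\<alpha>. G (p # fs) As \<alpha> \<partial>M) - (\<integral>\<alpha>. G (p # fs) As \<alpha> \<partial>M')\<bar> \<le> \<epsilon> / (K + 1) * K" .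
      also have "\<dots> \<le> \<epsilon>" using K \<open>0 < \<epsilon>\<close> by (simp add: field_simps)
      finally show "\<bar>(\<integral>\<alpha>. G (p # fs) As \<alpha> \<partial>M) - (\<integral>\<alpha>. G (p # fs) As \<alpha> \<partial>M')\<bar> \<le> 0 + \<epsilon>" by simp
    qed
    then show ?case by simp
  qed
  define \<Omega> where "\<Omega> = space (prob_algebra X)"
  define S where "S L = {\<alpha> \<in> \<Omega>. \<forall>p\<in>set L. snd p < measure \<alpha> (fst p)}" for L :: "('a set \<times> real) list"
  define E where "E = {S L | L. fst ` set L \<subseteq> sets X}"
  have gen: "sets (prob_algebra X) = sigma_sets \<Omega> E"
    unfolding E_def S_def \<Omega>_def by (rule sets_prob_algebra_generator)
  \<comment> \<open>For k > 0 a continuous ramp that is 0 up to c and 1 from c + 1 / k on. It tends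
    to the indicator of \<open>c < t\<close>, with value 0 at c itself.\<close>
  define \<psi> where "\<psi> c k t = min 1 (real k * max 0 (t - c))" for c t :: real and k :: nat
  have \<psi>_ok: "ok (\<psi> c k)" for c k unfolding ok_def \<psi>_def
    by (intro conjI allI continuous_intros) auto
  have \<psi>_lim: "(\<lambda>k. \<psi> c k t) \<longlonglongrightarrow> (if c < t then 1 else 0)" for c t
  proof (cases "c < t")
    case True
    obtain n where n: "1 / (t - c) < real n" using reals_Archimedean2 by blast
    have "\<psi> c k t = 1" if "n \<le> k" for k
    proof -
      have "1 / (t - c) < real k" using n that by (meson less_le_trans of_nat_le_iff)
      then have "1 < real k * (t - c)" using True by (simp add: field_simps)
      then show ?thesis using True by (simp add: \<psi>_def)
    qed
    then have "\<forall>\<^sub>F k in sequentially. \<psi> c k t = 1" by (auto simp: eventually_sequentially)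
    then show ?thesis using True by (simp add: tendsto_eventually)
  qed (simp add: \<psi>_def)
  \<comment> \<open>Dominated convergence writes the mass of a generating set as a limit of
    integrals on which the two measures agree.\<close>
  have ind: "measure N (S L) = lim (\<lambda>k. \<integral>\<alpha>. G (map (\<lambda>p. (\<psi> (snd p) k, fst p)) L) [] \<alpha> \<partial>N)"
    if N: "N = M \<or> N = M'" and L: "fst ` set L \<subseteq> sets X" for N L
  proof -
    interpret N: finite_measure N using N M(1) M'(1) by auto
    have spN: "space N = \<Omega>" and stN: "sets N = sets (prob_algebra X)" using N sp M M' by (auto simp: \<Omega>_def)
    let ?G = "\<lambda>k. G (map (\<lambda>p. (\<psi> (snd p) k, fst p)) L) []"
    have gk: "good (map (\<lambda>p. (\<psi> (snd p) k, fst p)) L)" for k using L \<psi>_ok by (auto simp: good_def)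
    have SL: "S L \<in> sets N" unfolding stN gen using L by (intro sigma_sets.Basic) (auto simp: E_def)
    have "(\<lambda>k. \<integral>\<alpha>. ?G k \<alpha> \<partial>N) \<longlonglongrightarrow> (\<integral>\<alpha>. indicator (S L) \<alpha> \<partial>N)"
    proof (rule integral_dominated_convergence[where w = "\<lambda>_. 1"])
      show "AE \<alpha> in N. (\<lambda>k. ?G k \<alpha>) \<longlonglongrightarrow> indicator (S L) \<alpha>"
      proof (rule AE_I2)
        fix \<alpha> assume "\<alpha> \<in> space N"
        then have \<alpha>: "\<alpha> \<in> \<Omega>" by (simp add: spN)
        have "(\<lambda>k. prod_list (map (\<lambda>p. \<psi> (snd p) k (measure \<alpha> (fst p))) L)) \<longlonglongrightarrow>
          prod_list (map (\<lambda>p. if snd p < measure \<alpha> (fst p) then 1 else 0) L)"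
          by (intro prod_list_map_tendsto \<psi>_lim)
        moreover have "prod_list (map (\<lambda>p. if snd p < measure \<alpha> (fst p) then 1 else 0) L) = (indicator (S L) \<alpha> :: real)"
          using \<alpha> unfolding S_def by (induction L) (auto simp: indicator_def)
        ultimately show "(\<lambda>k. ?G k \<alpha>) \<longlonglongrightarrow> indicator (S L) \<alpha>"
          by (simp add: G_def w_def o_def)
      qed
      show "?G k \<in> borel_measurable N" for k
        using G_int[OF gk, of "[]" k] N by auto
      show "AE \<alpha> in N. norm (?G k \<alpha>) \<le> 1" for k
        using G01[OF gk] by (intro AE_I2) (simp add: spN \<Omega>_def)
    qed (use SL in auto)
    then show ?thesis using SL by (simp add: limI)
  qed
  show ?thesis
  proof (rule measure_eqI_generator_eq[where \<Omega> = \<Omega> and E = E and A = "\<lambda>_. \<Omega>"])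
    show "Int_stable E"
    proof (rule Int_stableI)
      fix a b assume "a \<in> E" "b \<in> E"
      then obtain L L' where "a = S L" "fst ` set L \<subseteq> sets X" "b = S L'" "fst ` set L' \<subseteq> sets X" by (auto simp: E_def)
      moreover from this have "a \<inter> b = S (L @ L')" by (auto simp: S_def)
      ultimately show "a \<inter> b \<in> E" unfolding E_def by (intro CollectI exI[of _ "L @ L'"]) auto
    qed
    show "E \<subseteq> Pow \<Omega>" by (auto simp: E_def S_def)
    fix a assume "a \<in> E"
    then obtain L where L: "a = S L" "fst ` set L \<subseteq> sets X" by (auto simp: E_def)
    have g: "good (map (\<lambda>p. (\<psi> (snd p) k, fst p)) L)" for k using L \<psi>_ok by (auto simp: good_def)
    have "measure M a = measure M' a" unfolding L(1) using ind[of M L] ind[of M' L] L(2) main[OF g, of "[]"] by simp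
    then show "emeasure M a = emeasure M' a" by (simp add: M.emeasure_eq_measure M'.emeasure_eq_measure)
  next
    have "S [] = \<Omega>" by (simp add: S_def)
    then show "range (\<lambda>_. \<Omega>) \<subseteq> E" unfolding E_def by (auto intro!: exI[of _ "[]"])
  qed (use gen M(2) M'(2) in auto)
qed

lemma measure_eqI_rect:
  assumes M: "finite_measure M" "sets M = sets (A \<Otimes>\<^sub>M B)" and N: "sets N = sets (A \<Otimes>\<^sub>M B)"
    and eq: "\<And>a b. a \<in> sets A \<Longrightarrow> b \<in> sets B \<Longrightarrow> emeasure M (a \<times> b) = emeasure N (a \<times> b)"
  shows "M = N"
proof (rule measure_eqI_generator_eq[where \<Omega> = "space A \<times> space B" and E = "{a \<times> b | a b. a \<in> sets A \<and> b \<in> sets B}"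
      and A = "\<lambda>_. space A \<times> space B"])
  show "Int_stable {a \<times> b | a b. a \<in> sets A \<and> b \<in> sets B}" by (rule Int_stable_pair_measure_generator)
  show "{a \<times> b | a b. a \<in> sets A \<and> b \<in> sets B} \<subseteq> Pow (space A \<times> space B)" by (rule pair_measure_closed)
  show "sets M = sigma_sets (space A \<times> space B) {a \<times> b | a b. a \<in> sets A \<and> b \<in> sets B}"
    "sets N = sigma_sets (space A \<times> space B) {a \<times> b | a b. a \<in> sets A \<and> b \<in> sets B}"
    unfolding M N by (rule sets_pair_measure)+
  show "emeasure M (space A \<times> space B) \<noteq> \<infinity>"
    using finite_measure.emeasure_finite[OF M(1)] by simp
qed (use eq in auto)

lemma nn_integral_distr_density:
  assumes [measurable]: "f \<in> M \<rightarrow>\<^sub>M N" "h \<in> borel_measurable M" "g \<in> borel_measurable N"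
  shows "(\<integral>\<^sup>+y. g y \<partial>distr (density M h) N f) = (\<integral>\<^sup>+x. h x * g (f x) \<partial>M)"
  by (subst nn_integral_distr) (simp_all add: nn_integral_density)

lemma finite_measure_distr_density:
  assumes M: "finite_measure M" and f: "f \<in> M \<rightarrow>\<^sub>M N" and h: "h \<in> borel_measurable M" "\<And>x. x \<in> space M \<Longrightarrow> h x \<le> 1"
  shows "finite_measure (distr (density M h) N f)"
proof (rule finite_measure.finite_measure_distr)
  interpret finite_measure M by fact
  have "emeasure (density M h) (space M) = (\<integral>\<^sup>+x. h x \<partial>M)"
    using h by (subst emeasure_density) (auto intro!: nn_integral_cong)
  also have "\<dots> \<le> (\<integral>\<^sup>+x. 1 \<partial>M)" using h by (intro nn_integral_mono) auto
  also have "\<dots> < \<infinity>" using emeasure_finite[of "space M"] by (simp add: less_top[symmetric])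
  finally show "finite_measure (density M h)" by (intro finite_measureI) auto
qed (use f in simp)

text \<open>Restricting to second components in B and projecting to the first component gives a
  finite measure that is determined by its moments. This is why \<open>random_measure_eqI\<close>
  admits total masses other than 1.\<close>

lemma random_measure_pair_eqI:
  assumes P: "finite_measure P" "sets P = sets (prob_algebra X \<Otimes>\<^sub>M W)"
    and P': "finite_measure P'" "sets P' = sets (prob_algebra X \<Otimes>\<^sub>M W)"
    and eq: "\<And>As B. set As \<subseteq> sets X \<Longrightarrow> B \<in> sets W \<Longrightarrow>
      (\<integral>\<^sup>+p. indicator B (snd p) * moment As (fst p) \<partial>P) = (\<integral>\<^sup>+p. indicator B (snd p) * moment As (fst p) \<partial>P')"
  shows "P = P'"
proof (rule measure_eqI_rect[OF P P'(2)])
  fix \<A> B assume \<A>: "\<A> \<in> sets (prob_algebra X)" and B: "B \<in> sets W"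
  define M where "M Q = distr (density Q (\<lambda>p. indicator B (snd p))) (prob_algebra X) fst"
    for Q :: "('a measure \<times> 'b) measure"
  have Q: "finite_measure (M Q)" "sets (M Q) = sets (prob_algebra X)"
      "g \<in> borel_measurable (prob_algebra X) \<Longrightarrow> (\<integral>\<^sup>+\<alpha>. g \<alpha> \<partial>M Q) = (\<integral>\<^sup>+p. indicator B (snd p) * g (fst p) \<partial>Q)"
    if "finite_measure Q" and st[measurable_cong]: "sets Q = sets (prob_algebra X \<Otimes>\<^sub>M W)" for Q g
  proof -
    have 1: "fst \<in> Q \<rightarrow>\<^sub>M prob_algebra X" by measurable
    have 2: "(\<lambda>p. indicator B (snd p) :: ennreal) \<in> borel_measurable Q" using B by measurable
    show "finite_measure (M Q)" unfolding M_def
      by (rule finite_measure_distr_density[OF that(1) 1 2]) (simp add: indicator_def)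
    show "sets (M Q) = sets (prob_algebra X)" by (simp add: M_def)
    show "(\<integral>\<^sup>+\<alpha>. g \<alpha> \<partial>M Q) = (\<integral>\<^sup>+p. indicator B (snd p) * g (fst p) \<partial>Q)" if "g \<in> borel_measurable (prob_algebra X)"
      unfolding M_def by (rule nn_integral_distr_density[OF 1 2 that])
  qed
  have "M P = M P'"
    by (rule random_measure_eqI[where X = X]) (simp_all add: Q P P' eq B)
  with Q(3)[OF P borel_measurable_indicator[OF \<A>]] Q(3)[OF P' borel_measurable_indicator[OF \<A>]]
  have "(\<integral>\<^sup>+p. indicator B (snd p) * indicator \<A> (fst p) \<partial>P) = (\<integral>\<^sup>+p. indicator B (snd p) * indicator \<A> (fst p) \<partial>P')"
    by (simp only:)
  moreover have "(\<integral>\<^sup>+p. indicator B (snd p) * indicator \<A> (fst p) \<partial>Q) = emeasure Q (\<A> \<times> B)"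
    if "sets Q = sets (prob_algebra X \<Otimes>\<^sub>M W)" for Q
  proof -
    have "(\<integral>\<^sup>+p. indicator B (snd p) * indicator \<A> (fst p) \<partial>Q) = (\<integral>\<^sup>+p. indicator (\<A> \<times> B) p \<partial>Q)"
      by (intro nn_integral_cong) (auto simp: indicator_def)
    then show ?thesis using that \<A> B by simp
  qed
  ultimately show "emeasure P (\<A> \<times> B) = emeasure P' (\<A> \<times> B)" using P P' by simp
qed

text \<open>Weighting by \<open>moment As\<close> of the first component, which is at most 1, and
  projecting to the second reduces the hypothesis of \<open>random_measure_pair_eqI\<close> to
  \<open>random_measure_eqI\<close> on the second factor. It is made for comparing laws of pairs of
  random measures, as in the comultiplication law.\<close>

lemma random_measure_pair2_eqI:
  assumes P: "finite_measure P" "sets P = sets (prob_algebra X \<Otimes>\<^sub>M prob_algebra Y)"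
    and P': "finite_measure P'" "sets P' = sets (prob_algebra X \<Otimes>\<^sub>M prob_algebra Y)"
    and eq: "\<And>As Bs. set As \<subseteq> sets X \<Longrightarrow> set Bs \<subseteq> sets Y \<Longrightarrow>
      (\<integral>\<^sup>+p. moment As (fst p) * moment Bs (snd p) \<partial>P) = (\<integral>\<^sup>+p. moment As (fst p) * moment Bs (snd p) \<partial>P')"
  shows "P = P'"
proof (rule random_measure_pair_eqI[OF P P'])
  fix As B assume As: "set As \<subseteq> sets X" and B: "B \<in> sets (prob_algebra Y)"
  define M where "M Q = distr (density Q (\<lambda>p. moment As (fst p))) (prob_algebra Y) snd"
    for Q :: "('a measure \<times> 'b measure) measure"
  have Q: "finite_measure (M Q)" "sets (M Q) = sets (prob_algebra Y)"
      "g \<in> borel_measurable (prob_algebra Y) \<Longrightarrow> (\<integral>\<^sup>+\<alpha>. g \<alpha> \<partial>M Q) = (\<integral>\<^sup>+p. moment As (fst p) * g (snd p) \<partial>Q)"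
    if "finite_measure Q" and st[measurable_cong]: "sets Q = sets (prob_algebra X \<Otimes>\<^sub>M prob_algebra Y)" for Q g
  proof -
    have 1: "snd \<in> Q \<rightarrow>\<^sub>M prob_algebra Y" by measurable
    have "fst \<in> Q \<rightarrow>\<^sub>M prob_algebra X" by measurable
    from measurable_compose[OF this moment_measurable[OF As]]
    have 2: "(\<lambda>p. moment As (fst p)) \<in> borel_measurable Q" .
    show "finite_measure (M Q)" unfolding M_def
    proof (rule finite_measure_distr_density[OF that(1) 1 2])
      fix p assume "p \<in> space Q"
      then have "fst p \<in> space (prob_algebra X)" using sets_eq_imp_space_eq[OF st] by (auto simp: space_pair_measure)
      then show "moment As (fst p) \<le> 1" by (rule moment_le_1)
    qed
    show "sets (M Q) = sets (prob_algebra Y)" by (simp add: M_def)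
    show "(\<integral>\<^sup>+\<alpha>. g \<alpha> \<partial>M Q) = (\<integral>\<^sup>+p. moment As (fst p) * g (snd p) \<partial>Q)" if "g \<in> borel_measurable (prob_algebra Y)"
      unfolding M_def by (rule nn_integral_distr_density[OF 1 2 that])
  qed
  have "M P = M P'"
    by (rule random_measure_eqI[where X = Y]) (simp_all add: Q P P' eq As)
  with Q(3)[OF P borel_measurable_indicator[OF B]] Q(3)[OF P' borel_measurable_indicator[OF B]]
  show "(\<integral>\<^sup>+p. indicator B (snd p) * moment As (fst p) \<partial>P) = (\<integral>\<^sup>+p. indicator B (snd p) * moment As (fst p) \<partial>P')"
    by (simp only: mult.commute[of "indicator B _"])
qed

subsection \<open>Kernels\<close>

lemma stoch_homI:
  "f \<in> X \<rightarrow>\<^sub>M prob_algebra Y \<Longrightarrow> f \<in> extensional (space X) \<Longrightarrow> f \<in> stoch_hom X Y"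
  by (simp add: stoch_hom_def)

lemma stoch_hom_restrictI: "f \<in> X \<rightarrow>\<^sub>M prob_algebra Y \<Longrightarrow> restrict f (space X) \<in> stoch_hom X Y"
  by (intro stoch_homI) (simp_all cong: measurable_cong)

lemma stoch_homD: "f \<in> stoch_hom X Y \<Longrightarrow> f \<in> X \<rightarrow>\<^sub>M prob_algebra Y"
  by (simp add: stoch_hom_def)

lemma stoch_hom_eqI:
  assumes "f \<in> stoch_hom X Y" "g \<in> stoch_hom X Y'" "\<And>x. x \<in> space X \<Longrightarrow> f x = g x"
  shows "f = g"
  using assms by (intro extensionalityI[of f "space X"]) (auto simp: stoch_hom_def)

lemma prob_algebraD:
  assumes "\<mu> \<in> space (prob_algebra X)"
  shows "prob_space \<mu>" "sets \<mu> = sets X" "space \<mu> = space X"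
  using assms sets_eq_imp_space_eq[of \<mu> X] by (auto simp: space_prob_algebra)

lemma prob_algebraI: "prob_space \<mu> \<Longrightarrow> sets \<mu> = sets X \<Longrightarrow> \<mu> \<in> space (prob_algebra X)"
  by (simp add: space_prob_algebra)

lemma kernel_space: "f \<in> X \<rightarrow>\<^sub>M prob_algebra Y \<Longrightarrow> x \<in> space X \<Longrightarrow> f x \<in> space (prob_algebra Y)"
  by (rule measurable_space)

lemma distr_prob_algebra:
  "\<mu> \<in> space (prob_algebra X) \<Longrightarrow> f \<in> X \<rightarrow>\<^sub>M Y \<Longrightarrow> distr \<mu> Y f \<in> space (prob_algebra Y)"
  by (rule measurable_space[OF measurable_distr_prob_space])

lemma bind_prob_algebra:
  "\<mu> \<in> space (prob_algebra X) \<Longrightarrow> f \<in> X \<rightarrow>\<^sub>M prob_algebra Y \<Longrightarrow> \<mu> \<bind> f \<in> space (prob_algebra Y)"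
  using prob_space_bind'[of \<mu> X f Y] sets_bind'[of \<mu> X f Y] by (simp add: space_prob_algebra)

lemma return_prob_algebra: "x \<in> space X \<Longrightarrow> return X x \<in> space (prob_algebra X)"
  by (rule measurable_space[OF measurable_return_prob_space])

lemma bind_cong_space:
  assumes "\<mu> \<in> space (prob_algebra X)" "\<And>x. x \<in> space X \<Longrightarrow> f x = g x"
  shows "\<mu> \<bind> f = \<mu> \<bind> g"
  using assms prob_algebraD(3)[OF assms(1)] by (intro bind_cong) auto

lemma nn_integral_bind_prob_algebra:
  assumes "\<mu> \<in> space (prob_algebra X)" "k \<in> X \<rightarrow>\<^sub>M prob_algebra Y" "g \<in> borel_measurable Y"
  shows "(\<integral>\<^sup>+y. g y \<partial>(\<mu> \<bind> k)) = (\<integral>\<^sup>+x. (\<integral>\<^sup>+y. g y \<partial>k x) \<partial>\<mu>)"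
proof (rule nn_integral_bind[OF assms(3)])
  show "k \<in> \<mu> \<rightarrow>\<^sub>M subprob_algebra Y"
    using measurable_prob_algebraD[OF assms(2)] by (simp add: measurable_cong_sets[OF prob_algebraD(2)[OF assms(1)] refl])
qed

lemma bind_return_kernel:
  assumes "\<mu> \<in> space (prob_algebra X)" "f \<in> X \<rightarrow>\<^sub>M Y"
  shows "\<mu> \<bind> (\<lambda>x. return Y (f x)) = distr \<mu> Y f"
  using bind_return_distr'[of \<mu> f Y] prob_space.not_empty[OF prob_algebraD(1)[OF assms(1)]] assms
  by (simp add: measurable_cong_sets[OF prob_algebraD(2)[OF assms(1)] refl])

lemma bind_stoch_det:
  assumes "\<mu> \<in> space (prob_algebra X)" "f \<in> X \<rightarrow>\<^sub>M Y"
  shows "\<mu> \<bind> stoch_det X Y f = distr \<mu> Y f"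
  unfolding bind_return_kernel[OF assms, symmetric] by (rule bind_cong_space[OF assms(1)]) (simp add: stoch_det_def)

lemma stoch_det_hom: "f \<in> X \<rightarrow>\<^sub>M Y \<Longrightarrow> stoch_det X Y f \<in> stoch_hom X Y"
  unfolding stoch_det_def
  by (intro stoch_hom_restrictI measurable_compose[OF _ measurable_return_prob_space])

lemma stoch_comp_hom:
  assumes "f \<in> stoch_hom X Y" "g \<in> stoch_hom Y Z" shows "stoch_comp X g f \<in> stoch_hom X Z"
  unfolding stoch_comp_def using assms
  by (intro stoch_hom_restrictI measurable_bind_prob_space) (auto dest: stoch_homD)

lemma distr_bind_kernel:
  assumes "\<mu> \<in> space (prob_algebra X)" "k \<in> X \<rightarrow>\<^sub>M prob_algebra Y" "f \<in> Y \<rightarrow>\<^sub>M Z"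
  shows "distr (\<mu> \<bind> k) Z f = \<mu> \<bind> (\<lambda>x. distr (k x) Z f)"
proof (rule distr_bind)
  show "k \<in> \<mu> \<rightarrow>\<^sub>M subprob_algebra Y"
    using measurable_prob_algebraD[OF assms(2)] by (simp add: measurable_cong_sets[OF prob_algebraD(2)[OF assms(1)] refl])
  show "space \<mu> \<noteq> {}" using prob_space.not_empty[OF prob_algebraD(1)[OF assms(1)]] .
qed fact

lemma bind_distr_kernel:
  assumes "\<mu> \<in> space (prob_algebra X)" "f \<in> X \<rightarrow>\<^sub>M Y" "k \<in> Y \<rightarrow>\<^sub>M prob_algebra Z"
  shows "distr \<mu> Y f \<bind> k = \<mu> \<bind> (\<lambda>x. k (f x))"
proof (rule bind_distr)
  show "f \<in> \<mu> \<rightarrow>\<^sub>M Y" using assms(2) by (simp add: measurable_cong_sets[OF prob_algebraD(2)[OF assms(1)] refl])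
  show "k \<in> Y \<rightarrow>\<^sub>M subprob_algebra Z" using assms(3) by (rule measurable_prob_algebraD)
  show "space \<mu> \<noteq> {}" using prob_space.not_empty[OF prob_algebraD(1)[OF assms(1)]] .
qed

lemma bind_assoc_kernel:
  assumes "\<mu> \<in> space (prob_algebra X)" "k \<in> X \<rightarrow>\<^sub>M prob_algebra Y" "l \<in> Y \<rightarrow>\<^sub>M prob_algebra Z"
  shows "(\<mu> \<bind> k) \<bind> l = \<mu> \<bind> (\<lambda>x. k x \<bind> l)"
proof (rule bind_assoc)
  show "k \<in> \<mu> \<rightarrow>\<^sub>M subprob_algebra Y"
    using measurable_prob_algebraD[OF assms(2)] by (simp add: measurable_cong_sets[OF prob_algebraD(2)[OF assms(1)] refl])
  show "l \<in> Y \<rightarrow>\<^sub>M subprob_algebra Z" using assms(3) by (rule measurable_prob_algebraD)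
qed

subsection \<open>Finite powers\<close>

lemma PiM_prob_eqI:
  assumes "finite I" "prob_space P" "sets P = sets (PiM I M)" "sets Q = sets (PiM I M)"
    and "\<And>A. (\<And>i. i \<in> I \<Longrightarrow> A i \<in> sets (M i)) \<Longrightarrow> emeasure P (PiE I A) = emeasure Q (PiE I A)"
  shows "P = Q"
proof (rule measure_eqI_PiM_finite[where A = "\<lambda>_. PiE I (\<lambda>i. space (M i))"])
  show "range (\<lambda>_. PiE I (\<lambda>i. space (M i))) \<subseteq> prod_algebra I M"
    using assms(1) by (auto simp: prod_algebra_eq_finite)
  interpret prob_space P by fact
  show "emeasure P (PiE I (\<lambda>i. space (M i))) \<noteq> \<infinity>" by simp
qed (use assms in \<open>auto simp: space_PiM\<close>)

lemma measurable_PiM_prob_algebra: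
  assumes "finite I" "\<And>a. a \<in> space N \<Longrightarrow> prob_space (K a)" "\<And>a. a \<in> space N \<Longrightarrow> sets (K a) = sets (PiM I M)"
    and "\<And>A. (\<And>i. i \<in> I \<Longrightarrow> A i \<in> sets (M i)) \<Longrightarrow> (\<lambda>a. emeasure (K a) (PiE I A)) \<in> borel_measurable N"
  shows "K \<in> N \<rightarrow>\<^sub>M prob_algebra (PiM I M)"
proof (rule measurable_prob_algebra_generated[OF sets_PiM Int_stable_prod_algebra prod_algebra_sets_into_space])
  fix A assume "A \<in> prod_algebra I M"
  then obtain X where "A = PiE I X" "X \<in> (\<Pi> j\<in>I. sets (M j))"
    unfolding prod_algebra_eq_finite[OF assms(1)] by auto
  then show "(\<lambda>a. emeasure (K a) A) \<in> borel_measurable N" using assms(4)[of X] by auto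
qed (use assms in auto)

lemma emeasure_power_space:
  assumes \<alpha>: "\<alpha> \<in> space (prob_algebra X)" and A: "\<And>i. i < n \<Longrightarrow> A i \<in> sets X"
  shows "emeasure (power_space n \<alpha>) (PiE {..<n} A) = (\<Prod>i<n. emeasure \<alpha> (A i))"
proof -
  interpret prob_space \<alpha> by (rule prob_algebraD[OF \<alpha>])
  interpret product_prob_space "\<lambda>_. \<alpha>" "{..<n}" ..
  show ?thesis unfolding power_space_def using A prob_algebraD(2)[OF \<alpha>] by (subst emeasure_PiM) auto
qed

lemma power_space_prob_algebra:
  assumes \<alpha>: "\<alpha> \<in> space (prob_algebra X)"
  shows "power_space n \<alpha> \<in> space (prob_algebra (power_space n X))"
proof (rule prob_algebraI)
  interpret prob_space \<alpha> by (rule prob_algebraD[OF \<alpha>])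
  show "prob_space (power_space n \<alpha>)" unfolding power_space_def by (intro prob_space_PiM) unfold_locales
  show "sets (power_space n \<alpha>) = sets (power_space n X)"
    unfolding power_space_def by (intro sets_PiM_cong prob_algebraD(2)[OF \<alpha>] refl)
qed

lemma power_space_kernel: "power_space n \<in> prob_algebra X \<rightarrow>\<^sub>M prob_algebra (power_space n X)"
  unfolding power_space_def[of n X]
proof (rule measurable_PiM_prob_algebra)
  fix A :: "nat \<Rightarrow> 'a set" assume A: "\<And>i. i \<in> {..<n} \<Longrightarrow> A i \<in> sets X"
  have "(\<lambda>\<alpha>. \<Prod>i<n. emeasure \<alpha> (A i)) \<in> borel_measurable (prob_algebra X)"
    using A unfolding prob_algebra_def
    by (intro borel_measurable_prod_ennreal measurable_restrict_space1 measurable_emeasure_subprob_algebra) auto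
  also have "?this \<longleftrightarrow> (\<lambda>\<alpha>. emeasure (power_space n \<alpha>) (PiE {..<n} A)) \<in> borel_measurable (prob_algebra X)"
    using A by (intro measurable_cong) (simp add: emeasure_power_space)
  finally show "(\<lambda>\<alpha>. emeasure (power_space n \<alpha>) (PiE {..<n} A)) \<in> borel_measurable (prob_algebra X)" .
qed (use power_space_prob_algebra[of _ X n] in \<open>auto simp: space_prob_algebra power_space_def\<close>)

lemma power_space_compose_measurable:
  assumes "\<And>i. i < m \<Longrightarrow> f i < n"
  shows "(\<lambda>x. \<lambda>i\<in>{..<m}. x (f i)) \<in> power_space n X \<rightarrow>\<^sub>M power_space m X"
  unfolding power_space_def using assms by (intro measurable_restrict measurable_component_singleton) auto

lemma permute_measurable:
  assumes p: "p permutes {..<n}"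
  shows "(\<lambda>x. x \<circ> p) \<in> power_space n X \<rightarrow>\<^sub>M power_space n X"
proof -
  have "(\<lambda>x. \<lambda>i\<in>{..<n}. x (p i)) \<in> power_space n X \<rightarrow>\<^sub>M power_space n X"
    using permutes_in_image[OF p] by (intro power_space_compose_measurable) simp
  also have "?this \<longleftrightarrow> ?thesis"
  proof (rule measurable_cong)
    fix x assume x: "x \<in> space (power_space n X)"
    \<comment> \<open>From n on both sides are \<open>undefined\<close>, since \<open>p\<close>
      fixes these indices.\<close>
    show "(\<lambda>i\<in>{..<n}. x (p i)) = x \<circ> p"
    proof
      fix i show "(\<lambda>i\<in>{..<n}. x (p i)) i = (x \<circ> p) i"
        using x permutes_not_in[OF p, of i]
        by (cases "i < n") (auto simp: power_space_def space_PiM PiE_iff extensional_def)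
    qed
  qed
  finally show ?thesis .
qed

subsection \<open>Multisets\<close>

lemma mset_space_sigma_algebra:
  "sigma_algebra {m. size m = n \<and> set_mset m \<subseteq> space X}
     {A. A \<subseteq> {m. size m = n \<and> set_mset m \<subseteq> space X} \<and>
         mset_of_tuple n -` A \<inter> space (power_space n X) \<in> sets (power_space n X)}"
  (is "sigma_algebra ?\<Omega> ?S")
proof -
  have sub: "mset_of_tuple n -` ?\<Omega> \<inter> space (power_space n X) = space (power_space n X)"
    by (auto simp: mset_of_tuple_def power_space_def space_PiM PiE_iff)
  show ?thesis
  proof (rule sigma_algebra_iff2[THEN iffD2], intro conjI ballI allI impI)
    show "?S \<subseteq> Pow ?\<Omega>" by auto
    show "{} \<in> ?S" by simp
    fix A assume A: "A \<in> ?S"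
    have "mset_of_tuple n -` (?\<Omega> - A) \<inter> space (power_space n X) =
        space (power_space n X) - (mset_of_tuple n -` A \<inter> space (power_space n X))"
      using sub by blast
    then show "?\<Omega> - A \<in> ?S" using A by auto
  next
    fix A :: "nat \<Rightarrow> 'a multiset set" assume A: "range A \<subseteq> ?S"
    have "mset_of_tuple n -` (\<Union>i. A i) \<inter> space (power_space n X) =
        (\<Union>i. mset_of_tuple n -` A i \<inter> space (power_space n X))" by auto
    also have "\<dots> \<in> sets (power_space n X)" using A by (intro sets.countable_UN) auto
    finally have "mset_of_tuple n -` (\<Union>i. A i) \<inter> space (power_space n X) \<in> sets (power_space n X)" .
    moreover have "A i \<subseteq> ?\<Omega>" for i using A by blast
    ultimately show "(\<Union>i. A i) \<in> ?S" by blast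
  qed
qed

lemma space_mset_space: "space (mset_space n X) = {m. size m = n \<and> set_mset m \<subseteq> space X}"
  unfolding mset_space_def Let_def by (rule space_measure_of) auto

lemma sets_mset_space: "sets (mset_space n X) = {A. A \<subseteq> {m. size m = n \<and> set_mset m \<subseteq> space X} \<and>
         mset_of_tuple n -` A \<inter> space (power_space n X) \<in> sets (power_space n X)}"
  unfolding mset_space_def Let_def by (rule sigma_algebra.sets_measure_of_eq[OF mset_space_sigma_algebra])

lemma mset_of_tuple_space: "x \<in> space (power_space n X) \<Longrightarrow> mset_of_tuple n x \<in> space (mset_space n X)"
  by (auto simp: space_mset_space mset_of_tuple_def power_space_def space_PiM PiE_iff)

lemma mset_of_tuple_measurable: "mset_of_tuple n \<in> power_space n X \<rightarrow>\<^sub>M mset_space n X"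
  by (rule measurableI) (auto simp: sets_mset_space intro: mset_of_tuple_space)

lemma mset_of_tuple_eq: "mset_of_tuple n x = mset (map x [0..<n])"
  unfolding mset_map mset_upt atLeast0LessThan mset_of_tuple_def ..

lemma mset_of_tuple_surj:
  assumes "m \<in> space (mset_space n X)"
  shows "\<exists>x\<in>space (power_space n X). mset_of_tuple n x = m"
proof -
  obtain xs where xs: "mset xs = m" using ex_mset by blast
  have len: "length xs = n" and sub: "set xs \<subseteq> space X"
    using assms xs by (auto simp: space_mset_space)
  have "map (\<lambda>i\<in>{..<n}. xs ! i) [0..<n] = xs" using len by (intro nth_equalityI) auto
  then have "mset_of_tuple n (\<lambda>i\<in>{..<n}. xs ! i) = m" using xs by (simp add: mset_of_tuple_eq)
  moreover have "(\<lambda>i\<in>{..<n}. xs ! i) \<in> space (power_space n X)"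
    using len sub nth_mem[of _ xs] by (auto simp: power_space_def space_PiM PiE_iff)
  ultimately show ?thesis by blast
qed

text \<open>The universal property of the quotient: with the largest sigma-algebra on multisets,
  measurability may be tested on tuples.\<close>

lemma measurable_from_mset_space:
  assumes f: "(\<lambda>x. f (mset_of_tuple n x)) \<in> power_space n X \<rightarrow>\<^sub>M W"
  shows "f \<in> mset_space n X \<rightarrow>\<^sub>M W"
proof (rule measurableI)
  fix m assume "m \<in> space (mset_space n X)"
  then obtain x where "x \<in> space (power_space n X)" "mset_of_tuple n x = m" using mset_of_tuple_surj by blast
  then show "f m \<in> space W" using measurable_space[OF f] by blast
next
  fix A assume "A \<in> sets W"
  then have "(\<lambda>x. f (mset_of_tuple n x)) -` A \<inter> space (power_space n X) \<in> sets (power_space n X)"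
    using f by (rule measurable_sets[rotated])
  moreover have "mset_of_tuple n -` (f -` A \<inter> space (mset_space n X)) \<inter> space (power_space n X) =
      (\<lambda>x. f (mset_of_tuple n x)) -` A \<inter> space (power_space n X)"
    using mset_of_tuple_space by auto
  ultimately show "f -` A \<inter> space (mset_space n X) \<in> sets (mset_space n X)"
    by (simp add: sets_mset_space space_mset_space[symmetric])
qed

lemma mset_of_tuple_permute:
  assumes "p permutes {..<n}" shows "mset_of_tuple n (x \<circ> p) = mset_of_tuple n x"
proof -
  have "image_mset (x \<circ> p) (mset_set {..<n}) = image_mset x (image_mset p (mset_set {..<n}))"
    by (rule multiset.map_comp[symmetric])
  also have "image_mset p (mset_set {..<n}) = mset_set {..<n}"
    using image_mset_mset_set[OF permutes_inj_on[OF assms]] permutes_image[OF assms] by simp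
  finally show ?thesis unfolding mset_of_tuple_def .
qed

text \<open>Fibres of \<open>mset_of_tuple\<close> are orbits of the symmetric group. Outside the
  index range both tuples are \<open>undefined\<close> and the permutation is the identity, so the
  equality holds between functions.\<close>

lemma mset_of_tuple_eqD:
  assumes "mset_of_tuple n x = mset_of_tuple n y" "x \<in> space (power_space n X)" "y \<in> space (power_space n X)"
  shows "\<exists>p. p permutes {..<n} \<and> y = x \<circ> p"
proof -
  have "image_mset y (mset_set {..<n}) = image_mset x (mset_set {..<n})"
    using assms(1) by (simp add: mset_of_tuple_def)
  from image_mset_eq_implies_permutes[OF _ this] obtain p where p: "p permutes {..<n}" "\<forall>i\<in>{..<n}. y i = x (p i)"
    by auto
  have "y = x \<circ> p"
  proof
    fix i show "y i = (x \<circ> p) i"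
    proof (cases "i < n")
      case False
      then show ?thesis using assms(2,3) permutes_not_in[OF p(1), of i]
        by (auto simp: power_space_def space_PiM PiE_iff extensional_def)
    qed (use p(2) in simp)
  qed
  then show ?thesis using p(1) by blast
qed

abbreviation perms :: "nat \<Rightarrow> (nat \<Rightarrow> nat) set" where "perms n \<equiv> {p. p permutes {..<n}}"

lemma fact_divide_fact_ennreal: "fact n / fact n = (1 :: ennreal)"
proof -
  have "(fact n :: ennreal) = of_nat (fact n)" by simp
  then show ?thesis 
    using ennreal_divide_self[of "of_nat (fact n) :: ennreal"] of_nat_less_top[of "fact n"] by (simp del: of_nat_fact)
qed

lemma finite_perms: "finite (perms n)" and card_perms: "card (perms n) = fact n"
  by (simp_all add: finite_permutations card_permutations)

text \<open>Both sides count, up to the factor \<open>n! * card F\<close>, the pairs of an ordering \<open>y\<close> in the set \<open>F\<close> of all orderings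
  and a permutation \<open>p\<close> with \<open>y \<circ> p \<in> A\<close>.\<close>

lemma emeasure_mset_eq:
  assumes x: "x \<in> space (power_space n X)" and A: "A \<in> sets (power_space n X)"
  shows "emeasure (mset_eq n X (mset_of_tuple n x)) A = (\<Sum>p\<in>perms n. indicator A (x \<circ> p)) / fact n"
proof -
  define F where "F = {y \<in> space (power_space n X). mset_of_tuple n y = mset_of_tuple n x}"
  have F_eq: "F = (\<lambda>p. x \<circ> p) ` perms n"
  proof (intro set_eqI iffI)
    fix y assume "y \<in> F"
    then show "y \<in> (\<lambda>p. x \<circ> p) ` perms n" using mset_of_tuple_eqD[of n x y X] x by (auto simp: F_def)
  next
    fix y assume "y \<in> (\<lambda>p. x \<circ> p) ` perms n"
    then show "y \<in> F" using measurable_space[OF permute_measurable x] by (auto simp: F_def mset_of_tuple_permute)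
  qed
  have finF: "finite F" unfolding F_eq by (intro finite_imageI finite_perms)
  have "x \<in> F" using x by (simp add: F_def)
  then have cF: "0 < card F" using finF by (auto simp: card_gt_0_iff)
  \<comment> \<open>For a fixed permutation, rearranging is a bijection of the orderings, so the
    number of hits is the same for every \<open>p\<close>.\<close>
  have inv: "card {y \<in> F. y \<circ> p \<in> A} = card (A \<inter> F)" if p: "p \<in> perms n" for p
  proof (rule bij_betw_same_card)
    have p': "inv p \<in> perms n" using p by (simp add: permutes_inv)
    have Fp: "y \<circ> q \<in> F" if "y \<in> F" "q \<in> perms n" for y q
      using that measurable_space[OF permute_measurable] by (auto simp: F_def mset_of_tuple_permute)
    have 1: "y \<circ> p \<circ> inv p = y" "y \<circ> inv p \<circ> p = y" for y :: "nat \<Rightarrow> 'a"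
      using p by (simp_all add: o_assoc[symmetric] permutes_inv_o)
    show "bij_betw (\<lambda>y. y \<circ> p) {y \<in> F. y \<circ> p \<in> A} (A \<inter> F)"
      by (rule bij_betw_byWitness[where f' = "\<lambda>y. y \<circ> inv p"]) (auto simp: 1 Fp[OF _ p] Fp[OF _ p'])
  qed
  \<comment> \<open>For a fixed ordering \<open>y\<close>, composing with \<open>q\<close> reindexes
    the permutations of \<open>x\<close> as those of \<open>y\<close>, so the number of hits is the
    same for every \<open>y\<close>.\<close>
  have sum_F: "(\<Sum>p\<in>perms n. indicator A (y \<circ> p)) = (\<Sum>p\<in>perms n. indicator A (x \<circ> p) :: nat)" if "y \<in> F" for y
  proof -
    have "y \<in> (\<lambda>p. x \<circ> p) ` perms n" using that unfolding F_eq .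
    then obtain q where q: "q permutes {..<n}" "y = x \<circ> q" by auto
    have "(\<Sum>p\<in>perms n. indicator A (x \<circ> p)) = (\<Sum>p\<in>perms n. indicator A (x \<circ> (q \<circ> p)) :: nat)"
      by (rule setum_permutations_compose_left[OF q(1)])
    then show ?thesis by (simp add: q(2) o_assoc)
  qed
  have "fact n * card (A \<inter> F) = (\<Sum>p\<in>perms n. card {y \<in> F. y \<circ> p \<in> A})"
    by (simp add: inv card_perms)
  also have "\<dots> = (\<Sum>p\<in>perms n. \<Sum>y\<in>F. indicator A (y \<circ> p))"
  proof (rule sum.cong[OF refl])
    fix p
    have "card {y \<in> F. y \<circ> p \<in> A} = (\<Sum>y\<in>F. if y \<circ> p \<in> A then 1 else 0)"
      by (subst sum.inter_filter[OF finF, symmetric]) simp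
    then show "card {y \<in> F. y \<circ> p \<in> A} = (\<Sum>y\<in>F. indicator A (y \<circ> p))" by (simp only: indicator_def of_bool_def)
  qed
  also have "\<dots> = (\<Sum>y\<in>F. \<Sum>p\<in>perms n. indicator A (y \<circ> p))" by (rule sum.swap)
  also have "\<dots> = card F * (\<Sum>p\<in>perms n. indicator A (x \<circ> p))" by (simp add: sum_F)
  finally have count: "fact n * card (A \<inter> F) = card F * (\<Sum>p\<in>perms n. indicator A (x \<circ> p))" .
  have "emeasure (mset_eq n X (mset_of_tuple n x)) A = emeasure (uniform_count_measure F) (A \<inter> F)"
  proof -
    have "(\<lambda>y. y) \<in> uniform_count_measure F \<rightarrow>\<^sub>M power_space n X"
      by (rule measurableI) (auto simp: F_def space_uniform_count_measure sets_uniform_count_measure)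
    from emeasure_distr[OF this A] show ?thesis
      using mset_of_tuple_space[OF x] by (simp add: mset_eq_def F_def[symmetric] space_uniform_count_measure)
  qed
  also have "\<dots> = ennreal (real (card (A \<inter> F)) / real (card F))"
    using finF by (subst emeasure_uniform_count_measure) auto
  also have "real (card (A \<inter> F)) / real (card F) = real (\<Sum>p\<in>perms n. indicator A (x \<circ> p)) / fact n"
  proof -
    have "fact n * real (card (A \<inter> F)) = real (card F) * real (\<Sum>p\<in>perms n. indicator A (x \<circ> p))"
      using arg_cong[OF count, of real] by simp
    then show ?thesis using cF by (simp add: field_simps)
  qed
  also have "ennreal \<dots> = ennreal (real (\<Sum>p\<in>perms n. indicator A (x \<circ> p))) / ennreal (fact n)"
    by (rule divide_ennreal[symmetric]) (rule of_nat_0_le_iff, rule fact_gt_zero)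
  also have "ennreal (real (\<Sum>p\<in>perms n. indicator A (x \<circ> p))) = (\<Sum>p\<in>perms n. indicator A (x \<circ> p))"
    by (subst ennreal_of_nat_eq_real_of_nat[symmetric], subst of_nat_sum, intro sum.cong refl)
       (simp add: indicator_def)
  also have "ennreal (fact n) = fact n"
    using ennreal_of_nat_eq_real_of_nat[of "fact n"] by simp
  finally show ?thesis .
qed


lemma mset_eq_prob:
  assumes m: "m \<in> space (mset_space n X)"
  shows "mset_eq n X m \<in> space (prob_algebra (power_space n X))"
proof (rule prob_algebraI)
  show st: "sets (mset_eq n X m) = sets (power_space n X)" using m by (simp add: mset_eq_def)
  obtain x where x: "x \<in> space (power_space n X)" "mset_of_tuple n x = m" using mset_of_tuple_surj[OF m] by blast
  have sp: "space (mset_eq n X m) = space (power_space n X)" using st by (rule sets_eq_imp_space_eq)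
  have xp: "x \<circ> p \<in> space (power_space n X)" if "p \<in> perms n" for p
    using that measurable_space[OF permute_measurable x(1)] by auto
  have "emeasure (mset_eq n X m) (space (power_space n X)) = (\<Sum>p\<in>perms n. 1) / fact n"
    unfolding x(2)[symmetric] emeasure_mset_eq[OF x(1) sets.top]
    by (intro arg_cong2[where f = "(/)"] sum.cong refl) (simp add: xp)
  also have "\<dots> = 1" by (simp add: card_perms fact_divide_fact_ennreal)
  finally show "prob_space (mset_eq n X m)" by (intro prob_spaceI) (simp add: sp)
qed

lemma emeasure_mset_eq_measurable:
  assumes A: "A \<in> sets (power_space n X)"
  shows "(\<lambda>x. (\<Sum>p\<in>perms n. indicator A (x \<circ> p)) / (fact n :: ennreal)) \<in> borel_measurable (power_space n X)"
proof -
  have "(\<lambda>x. indicator A (x \<circ> p) :: ennreal) \<in> borel_measurable (power_space n X)" if "p \<in> perms n" for p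
    using that by (intro measurable_compose[OF permute_measurable borel_measurable_indicator[OF A]]) auto
  then show ?thesis by (intro borel_measurable_divide_ennreal borel_measurable_sum) auto
qed

lemma mset_eq_kernel: "mset_eq n X \<in> mset_space n X \<rightarrow>\<^sub>M prob_algebra (power_space n X)"
proof (rule measurable_from_mset_space, rule measurable_prob_algebraI)
  fix x assume "x \<in> space (power_space n X)"
  from mset_eq_prob[OF mset_of_tuple_space[OF this]] show "prob_space (mset_eq n X (mset_of_tuple n x))"
    by (rule prob_algebraD)
next
  show "(\<lambda>x. mset_eq n X (mset_of_tuple n x)) \<in> power_space n X \<rightarrow>\<^sub>M subprob_algebra (power_space n X)"
  proof (rule measurable_subprob_algebra)
    fix x assume x: "x \<in> space (power_space n X)"
    note * = mset_eq_prob[OF mset_of_tuple_space[OF x]]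
    show "subprob_space (mset_eq n X (mset_of_tuple n x))"
      using prob_algebraD(1)[OF *] by (rule prob_space_imp_subprob_space)
    show "sets (mset_eq n X (mset_of_tuple n x)) = sets (power_space n X)" by (rule prob_algebraD(2)[OF *])
  next
    fix A assume A: "A \<in> sets (power_space n X)"
    from emeasure_mset_eq_measurable[OF A]
    show "(\<lambda>x. emeasure (mset_eq n X (mset_of_tuple n x)) A) \<in> borel_measurable (power_space n X)"
      by (rule measurable_cong[THEN iffD1, rotated]) (simp add: emeasure_mset_eq A)
  qed
qed

text \<open>Every ordering of \<open>m\<close> has multiset \<open>m\<close>, so
  \<open>mset_of_tuple\<close> is a left inverse of \<open>mset_eq\<close>. Cancelling
  \<open>mset_eq\<close> from an equation of kernels rests on this.\<close>

lemma distr_mset_eq: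
  assumes m: "m \<in> space (mset_space n X)"
  shows "distr (mset_eq n X m) (mset_space n X) (mset_of_tuple n) = return (mset_space n X) m"
proof (rule measure_eqI)
  fix A assume "A \<in> sets (distr (mset_eq n X m) (mset_space n X) (mset_of_tuple n))"
  then have A: "A \<in> sets (mset_space n X)" by simp
  obtain x where x: "x \<in> space (power_space n X)" "mset_of_tuple n x = m" using mset_of_tuple_surj[OF m] by blast
  note P = mset_eq_prob[OF m]
  have meas: "mset_of_tuple n \<in> mset_eq n X m \<rightarrow>\<^sub>M mset_space n X"
    using mset_of_tuple_measurable by (simp add: measurable_cong_sets[OF prob_algebraD(2)[OF P] refl])
  have xp: "x \<circ> p \<in> space (power_space n X)" if "p \<in> perms n" for p
    using that measurable_space[OF permute_measurable x(1)] by auto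
  let ?B = "mset_of_tuple n -` A \<inter> space (power_space n X)"
  have B: "?B \<in> sets (power_space n X)" using A by (simp add: sets_mset_space)
  have "emeasure (distr (mset_eq n X m) (mset_space n X) (mset_of_tuple n)) A = emeasure (mset_eq n X m) ?B"
    by (subst emeasure_distr[OF meas A]) (simp add: prob_algebraD(3)[OF P])
  also have "\<dots> = (\<Sum>p\<in>perms n. indicator ?B (x \<circ> p)) / fact n"
    unfolding x(2)[symmetric] by (rule emeasure_mset_eq[OF x(1) B])
  also have "\<dots> = (\<Sum>p\<in>perms n. indicator A m) / fact n"
    by (intro arg_cong2[where f = "(/)"] sum.cong refl) (simp add: indicator_def xp mset_of_tuple_permute x(2))
  also have "\<dots> = indicator A m" by (simp add: card_perms fact_divide_fact_ennreal indicator_def)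
  finally show "emeasure (distr (mset_eq n X m) (mset_space n X) (mset_of_tuple n)) A = emeasure (return (mset_space n X) m) A"
    using A by simp
qed simp

text \<open>Integrating \<open>mset_eq\<close> averages the laws of the permuted tuples, and each of
  these is \<rho> again. This is the factorisation through the equaliser of the symmetries.\<close>

lemma symmetric_law_mset_eq:
  assumes \<rho>: "\<rho> \<in> space (prob_algebra (power_space n X))"
    and sym: "\<And>p. p permutes {..<n} \<Longrightarrow> distr \<rho> (power_space n X) (\<lambda>x. x \<circ> p) = \<rho>"
  shows "distr \<rho> (mset_space n X) (mset_of_tuple n) \<bind> mset_eq n X = \<rho>"
proof (rule measure_eqI)
  have *: "distr \<rho> (mset_space n X) (mset_of_tuple n) \<bind> mset_eq n X = \<rho> \<bind> (\<lambda>x. mset_eq n X (mset_of_tuple n x))"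
    by (rule bind_distr_kernel[OF \<rho> mset_of_tuple_measurable mset_eq_kernel])
  have k: "(\<lambda>x. mset_eq n X (mset_of_tuple n x)) \<in> power_space n X \<rightarrow>\<^sub>M prob_algebra (power_space n X)"
    using mset_of_tuple_measurable mset_eq_kernel by (rule measurable_compose)
  have st: "sets (\<rho> \<bind> (\<lambda>x. mset_eq n X (mset_of_tuple n x))) = sets (power_space n X)"
    by (rule prob_algebraD(2)[OF bind_prob_algebra[OF \<rho> k]])
  show "sets (distr \<rho> (mset_space n X) (mset_of_tuple n) \<bind> mset_eq n X) = sets \<rho>"
    unfolding * st using prob_algebraD(2)[OF \<rho>] by simp
  fix A assume "A \<in> sets (distr \<rho> (mset_space n X) (mset_of_tuple n) \<bind> mset_eq n X)"
  then have A: "A \<in> sets (power_space n X)" unfolding * st .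
  have ind: "(\<lambda>x. indicator A (x \<circ> p) :: ennreal) \<in> borel_measurable \<rho>" if "p \<in> perms n" for p
    using that measurable_compose[OF permute_measurable borel_measurable_indicator[OF A]]
    by (auto simp: measurable_cong_sets[OF prob_algebraD(2)[OF \<rho>] refl])
  have int: "(\<integral>\<^sup>+x. indicator A (x \<circ> p) \<partial>\<rho>) = emeasure \<rho> A" if p: "p \<in> perms n" for p
  proof -
    have "(\<integral>\<^sup>+x. indicator A (x \<circ> p) \<partial>\<rho>) = (\<integral>\<^sup>+x. indicator A x \<partial>distr \<rho> (power_space n X) (\<lambda>x. x \<circ> p))"
      using p permute_measurable A
      by (subst nn_integral_distr) (auto simp: measurable_cong_sets[OF prob_algebraD(2)[OF \<rho>] refl])
    also have "\<dots> = emeasure \<rho> A" using sym p A prob_algebraD(2)[OF \<rho>] by simp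
    finally show ?thesis .
  qed
  have "emeasure (\<rho> \<bind> (\<lambda>x. mset_eq n X (mset_of_tuple n x))) A = (\<integral>\<^sup>+x. emeasure (mset_eq n X (mset_of_tuple n x)) A \<partial>\<rho>)"
    by (rule emeasure_bind_prob_algebra[OF \<rho> k A])
  also have "\<dots> = (\<integral>\<^sup>+x. (\<Sum>p\<in>perms n. indicator A (x \<circ> p)) / fact n \<partial>\<rho>)"
    by (intro nn_integral_cong emeasure_mset_eq A) (simp add: prob_algebraD(3)[OF \<rho>])
  also have "\<dots> = (\<Sum>p\<in>perms n. (\<integral>\<^sup>+x. indicator A (x \<circ> p) \<partial>\<rho>)) / fact n"
    by (subst nn_integral_divide, rule borel_measurable_sum[OF ind], assumption, subst nn_integral_sum[OF ind]) simp_all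
  also have "\<dots> = of_nat (fact n) * emeasure \<rho> A / fact n" by (simp add: int card_perms)
  also have "\<dots> = emeasure \<rho> A"
    by (simp add: mult.commute[of _ "emeasure \<rho> A"] ennreal_times_divide[symmetric] fact_divide_fact_ennreal)
  finally show "emeasure (distr \<rho> (mset_space n X) (mset_of_tuple n) \<bind> mset_eq n X) A = emeasure \<rho> A"
    unfolding * .
qed

text \<open>Composing with \<open>q\<close> on the right only reindexes the average over all
  permutations.\<close>

lemma mset_eq_symmetric:
  assumes m: "m \<in> space (mset_space n X)" and q: "q permutes {..<n}"
  shows "distr (mset_eq n X m) (power_space n X) (\<lambda>x. x \<circ> q) = mset_eq n X m"
proof (rule measure_eqI)
  note P = mset_eq_prob[OF m]
  show "sets (distr (mset_eq n X m) (power_space n X) (\<lambda>x. x \<circ> q)) = sets (mset_eq n X m)"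
    using prob_algebraD(2)[OF P] by simp
  fix A assume "A \<in> sets (distr (mset_eq n X m) (power_space n X) (\<lambda>x. x \<circ> q))"
  then have A: "A \<in> sets (power_space n X)" by simp
  obtain x where x: "x \<in> space (power_space n X)" "mset_of_tuple n x = m" using mset_of_tuple_surj[OF m] by blast
  let ?B = "(\<lambda>x. x \<circ> q) -` A \<inter> space (power_space n X)"
  have B: "?B \<in> sets (power_space n X)" using A by (rule measurable_sets[OF permute_measurable[OF q]])
  have xp: "x \<circ> p \<in> space (power_space n X)" if "p \<in> perms n" for p
    using that measurable_space[OF permute_measurable x(1)] by auto
  have "emeasure (distr (mset_eq n X m) (power_space n X) (\<lambda>x. x \<circ> q)) A = emeasure (mset_eq n X m) ?B"
    using permute_measurable[OF q, of X] A
    by (subst emeasure_distr) (auto simp: prob_algebraD(3)[OF P] measurable_cong_sets[OF prob_algebraD(2)[OF P] refl])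
  also have "\<dots> = (\<Sum>p\<in>perms n. indicator ?B (x \<circ> p)) / fact n"
    unfolding x(2)[symmetric] by (rule emeasure_mset_eq[OF x(1) B])
  also have "(\<Sum>p\<in>perms n. indicator ?B (x \<circ> p)) = (\<Sum>p\<in>perms n. indicator A (x \<circ> (p \<circ> q)) :: ennreal)"
    by (intro sum.cong refl) (simp add: indicator_def xp o_assoc)
  also have "\<dots> = (\<Sum>p\<in>perms n. indicator A (x \<circ> p))"
    by (rule sum_permutations_compose_right[OF q, symmetric])
  also have "\<dots> / fact n = emeasure (mset_eq n X m) A"
    unfolding x(2)[symmetric] by (rule emeasure_mset_eq[OF x(1) A, symmetric])
  finally show "emeasure (distr (mset_eq n X m) (power_space n X) (\<lambda>x. x \<circ> q)) A = emeasure (mset_eq n X m) A" .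
qed

subsection \<open>The draw-and-delete kernel\<close>

lemma restrict_power_measurable: "(\<lambda>x. restrict x {..<n}) \<in> power_space (Suc n) X \<rightarrow>\<^sub>M power_space n X"
  by (rule power_space_compose_measurable) simp

text \<open>The explicit witness for the definite description in \<open>draw_delete\<close>: the
  last entry of a random ordering is a uniformly drawn element.\<close>

definition draw_delete_kernel :: "'a measure \<Rightarrow> nat \<Rightarrow> 'a multiset \<Rightarrow> 'a multiset measure" where
  "draw_delete_kernel X n = (\<lambda>m\<in>space (mset_space (Suc n) X).
     distr (distr (mset_eq (Suc n) X m) (power_space n X) (\<lambda>x. restrict x {..<n})) (mset_space n X) (mset_of_tuple n))"

lemma discard_last_kernel:
  "(\<lambda>m. distr (mset_eq (Suc n) X m) (power_space n X) (\<lambda>x. restrict x {..<n})) \<in>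
    mset_space (Suc n) X \<rightarrow>\<^sub>M prob_algebra (power_space n X)"
  using mset_eq_kernel measurable_distr_prob_space[OF restrict_power_measurable] by (rule measurable_compose)

lemma draw_delete_kernel_hom: "draw_delete_kernel X n \<in> stoch_hom (mset_space (Suc n) X) (mset_space n X)"
  unfolding draw_delete_kernel_def
  using discard_last_kernel measurable_distr_prob_space[OF mset_of_tuple_measurable]
  by (intro stoch_hom_restrictI) (rule measurable_compose)

text \<open>A permutation of n letters extends to n + 1 letters by fixing the last, so dropping the
  last entry of a random ordering leaves a symmetric law, and a symmetric law is the random ordering
  of its own multiset.\<close>

lemma draw_delete_kernel_eq:
  assumes m: "m \<in> space (mset_space (Suc n) X)"
  shows "draw_delete_kernel X n m \<bind> mset_eq n X =
    distr (mset_eq (Suc n) X m) (power_space n X) (\<lambda>x. restrict x {..<n})"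
proof -
  let ?\<rho> = "distr (mset_eq (Suc n) X m) (power_space n X) (\<lambda>x. restrict x {..<n})"
  note P = mset_eq_prob[OF m]
  have meas: "f \<in> mset_eq (Suc n) X m \<rightarrow>\<^sub>M N \<longleftrightarrow> f \<in> power_space (Suc n) X \<rightarrow>\<^sub>M N" for f and N :: "'c measure"
    by (rule arg_cong[OF measurable_cong_sets[OF prob_algebraD(2)[OF P] refl]])
  have "distr ?\<rho> (mset_space n X) (mset_of_tuple n) \<bind> mset_eq n X = ?\<rho>"
  proof (rule symmetric_law_mset_eq)
    show "?\<rho> \<in> space (prob_algebra (power_space n X))"
      by (rule distr_prob_algebra[OF P restrict_power_measurable])
    fix p assume p: "p permutes {..<n}"
    then have p': "p permutes {..<Suc n}" by (rule permutes_subset) auto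
    have "distr ?\<rho> (power_space n X) (\<lambda>x. x \<circ> p) =
        distr (mset_eq (Suc n) X m) (power_space n X) ((\<lambda>x. x \<circ> p) \<circ> (\<lambda>x. restrict x {..<n}))"
      by (rule distr_distr) (simp_all add: permute_measurable p meas restrict_power_measurable)
    also have "(\<lambda>x. x \<circ> p) \<circ> (\<lambda>x. restrict x {..<n}) = (\<lambda>x. restrict x {..<n}) \<circ> (\<lambda>x :: nat \<Rightarrow> 'a. x \<circ> p)"
      using permutes_in_image[OF p] by (auto simp: fun_eq_iff restrict_def)
    also have "distr (mset_eq (Suc n) X m) (power_space n X) \<dots> =
        distr (distr (mset_eq (Suc n) X m) (power_space (Suc n) X) (\<lambda>x. x \<circ> p)) (power_space n X) (\<lambda>x. restrict x {..<n})"
      by (rule distr_distr[symmetric]) (simp_all add: permute_measurable p' meas restrict_power_measurable)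
    also have "\<dots> = ?\<rho>" by (simp add: mset_eq_symmetric[OF m p'])
    finally show "distr ?\<rho> (power_space n X) (\<lambda>x. x \<circ> p) = ?\<rho>" .
  qed
  then show ?thesis using m by (simp add: draw_delete_kernel_def)
qed

lemma draw_delete_eq: "draw_delete X n = draw_delete_kernel X n"
  unfolding draw_delete_def
proof (rule the_equality)
  have disc: "mset_eq (Suc n) X m \<bind> power_discard_last n X =
      distr (mset_eq (Suc n) X m) (power_space n X) (\<lambda>x. restrict x {..<n})"
    if "m \<in> space (mset_space (Suc n) X)" for m
    unfolding power_discard_last_def by (rule bind_stoch_det[OF mset_eq_prob[OF that] restrict_power_measurable])
  show "draw_delete_kernel X n \<in> stoch_hom (mset_space (Suc n) X) (mset_space n X) \<and>
    stoch_comp (mset_space (Suc n) X) (mset_eq n X) (draw_delete_kernel X n) =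
    stoch_comp (mset_space (Suc n) X) (power_discard_last n X) (mset_eq (Suc n) X)"
    unfolding stoch_comp_def
    by (intro conjI draw_delete_kernel_hom restrict_ext) (simp add: draw_delete_kernel_eq disc)
  fix k assume k: "k \<in> stoch_hom (mset_space (Suc n) X) (mset_space n X) \<and>
    stoch_comp (mset_space (Suc n) X) (mset_eq n X) k =
    stoch_comp (mset_space (Suc n) X) (power_discard_last n X) (mset_eq (Suc n) X)"
  show "k = draw_delete_kernel X n"
  proof (rule stoch_hom_eqI[OF _ draw_delete_kernel_hom])
    show "k \<in> stoch_hom (mset_space (Suc n) X) (mset_space n X)" using k by simp
    fix m assume m: "m \<in> space (mset_space (Suc n) X)"
    have km: "k m \<in> space (prob_algebra (mset_space n X))"
      using k m by (intro kernel_space[OF stoch_homD]) auto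
    have "k m \<bind> mset_eq n X = distr (mset_eq (Suc n) X m) (power_space n X) (\<lambda>x. restrict x {..<n})"
      using fun_cong[OF conjunct2[OF k], of m] m disc[OF m] by (simp add: stoch_comp_def)
    \<comment> \<open>Uniqueness: forgetting the order cancels \<open>mset_eq\<close>, so
      \<open>k\<close> can be read off from the prescribed composite.\<close>
    then have "draw_delete_kernel X n m = distr (k m \<bind> mset_eq n X) (mset_space n X) (mset_of_tuple n)"
      using m by (simp add: draw_delete_kernel_def)
    also have "\<dots> = k m \<bind> (\<lambda>m. distr (mset_eq n X m) (mset_space n X) (mset_of_tuple n))"
      by (rule distr_bind_kernel[OF km mset_eq_kernel mset_of_tuple_measurable])
    also have "\<dots> = k m \<bind> (\<lambda>m. return (mset_space n X) m)"
      by (rule bind_cong_space[OF km]) (rule distr_mset_eq)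
    also have "\<dots> = k m" using prob_algebraD(2)[OF km] by (intro bind_return'')
    finally show "k m = draw_delete_kernel X n m" ..
  qed
qed

subsection \<open>Spaces of multisets are standard Borel\<close>

text \<open>In a sorted list the entries up to t form an initial segment. A bound on an order
  statistic thereby becomes a condition on a count, which is a measurable function of the unsorted
  entries.\<close>

lemma sorted_nth_le_iff:
  fixes t :: "'b::linorder"
  assumes "sorted xs" "i < length xs"
  shows "xs ! i \<le> t \<longleftrightarrow> i < length (filter (\<lambda>a. a \<le> t) xs)"
  using assms
proof (induction xs arbitrary: i)
  case (Cons a xs)
  show ?case
  proof (cases i)
    case 0
    then show ?thesis using Cons.prems by (cases "a \<le> t") (auto simp: filter_empty_conv dest: order_trans)
  next
    case (Suc j)
    show ?thesis
    proof (cases "a \<le> t")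
      case True
      then show ?thesis using Cons Suc by simp
    next
      case False
      have "a \<le> b" if "b \<in> set xs" for b using Cons.prems that by simp
      then have *: "\<not> b \<le> t" if "b \<in> set xs" for b using that False order_trans by blast
      then have "filter (\<lambda>a. a \<le> t) xs = []" by (simp add: filter_empty_conv)
      moreover have "\<not> xs ! j \<le> t" using * Cons.prems Suc by simp
      ultimately show ?thesis using False Suc by simp
    qed
  qed
qed simp

text \<open>Sorting the coded entries selects one ordering measurably, which gives a section of
  \<open>mset_of_tuple\<close>.\<close>

lemma (in unit_coded) borel_retract_mset_space: "borel_retract (mset_space n X) (power_space n X)"
proof -
  define srt where "srt m i = sorted_list_of_multiset (image_mset e m) ! i" for m i
  define s where "s m = (\<lambda>i\<in>{..<n}. r (srt m i))" for m
  have len: "length (sorted_list_of_multiset (image_mset e (mset_of_tuple n x))) = n" for x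
    by (metis mset_of_tuple_def mset_sorted_list_of_multiset size_image_mset size_mset size_mset_set card_lessThan finite_lessThan)
  have srt: "(\<lambda>x. srt (mset_of_tuple n x) i) \<in> borel_measurable (power_space n X)" if i: "i < n" for i
    unfolding borel_measurable_iff_le
  proof
    fix t
    have "srt (mset_of_tuple n x) i \<le> t \<longleftrightarrow> real i < (\<Sum>j<n. indicator {u. e u \<le> t} (x j))" for x
    proof -
      have "srt (mset_of_tuple n x) i \<le> t \<longleftrightarrow>
          i < length (filter (\<lambda>a. a \<le> t) (sorted_list_of_multiset (image_mset e (mset_of_tuple n x))))"
        unfolding srt_def by (rule sorted_nth_le_iff) (simp_all add: len i)
      also have "length (filter (\<lambda>a. a \<le> t) (sorted_list_of_multiset (image_mset e (mset_of_tuple n x)))) =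
          size (filter_mset (\<lambda>a. a \<le> t) (image_mset e (mset_of_tuple n x)))"
        by (metis mset_filter mset_sorted_list_of_multiset size_mset)
      also have "\<dots> = card {j \<in> {..<n}. e (x j) \<le> t}"
        by (simp add: mset_of_tuple_def filter_mset_image_mset multiset.map_comp comp_def)
      finally have "srt (mset_of_tuple n x) i \<le> t \<longleftrightarrow> i < card {j \<in> {..<n}. e (x j) \<le> t}" .
      moreover have "real (card {j \<in> {..<n}. e (x j) \<le> t}) = (\<Sum>j<n. indicator {u. e u \<le> t} (x j))"
        by (simp add: indicator_def sum.If_cases Int_def)
      ultimately show ?thesis by linarith
    qed
    then have "{x \<in> space (power_space n X). srt (mset_of_tuple n x) i \<le> t} =
        {x \<in> space (power_space n X). real i < (\<Sum>j<n. indicator {u. e u \<le> t} (x j))}" by simp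
    also have "\<dots> = {x \<in> space (power_space n X). real i < (\<Sum>j<n. indicator {u \<in> space X. e u \<le> t} (x j))}"
      by (intro Collect_cong conj_cong refl arg_cong2[where f = "(<)"] sum.cong)
         (auto simp: power_space_def space_PiM indicator_def)
    also have "\<dots> \<in> sets (power_space n X)"
    proof -
      have "{u \<in> space X. e u \<le> t} \<in> sets X" by measurable
      then have "(\<lambda>x. \<Sum>j<n. indicator {u \<in> space X. e u \<le> t} (x j) :: real) \<in> borel_measurable (power_space n X)"
        unfolding power_space_def
        by (intro borel_measurable_sum measurable_compose[OF measurable_component_singleton borel_measurable_indicator]) auto
      then show ?thesis unfolding borel_measurable_iff_greater by blast
    qed
    finally show "{x \<in> space (power_space n X). srt (mset_of_tuple n x) i \<le> t} \<in> sets (power_space n X)" .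
  qed
  show ?thesis
  proof (rule borel_retractI[OF _ mset_of_tuple_measurable])
    show "s \<in> mset_space n X \<rightarrow>\<^sub>M power_space n X"
    proof (rule measurable_from_mset_space)
      show "(\<lambda>x. s (mset_of_tuple n x)) \<in> power_space n X \<rightarrow>\<^sub>M power_space n X"
        unfolding s_def power_space_def[of n X, THEN arg_cong[where f = "measurable (power_space n X)"]]
        by (intro measurable_restrict measurable_compose[OF srt r]) simp
    qed
    fix m assume m: "m \<in> space (mset_space n X)"
    define xs where "xs = sorted_list_of_multiset (image_mset e m)"
    have mset_xs: "mset xs = image_mset e m" by (simp add: xs_def)
    have len: "length xs = n" using m arg_cong[OF mset_xs, of size] by (simp add: space_mset_space)
    have "map (s m) [0..<n] = map r xs"
      using len by (intro nth_equalityI) (auto simp: s_def srt_def xs_def)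
    then have "mset_of_tuple n (s m) = image_mset r (image_mset e m)"
      unfolding mset_of_tuple_eq by (simp only: mset_map mset_xs)
    also have "\<dots> = image_mset (\<lambda>x. x) m"
      unfolding multiset.map_comp using m by (intro image_mset_cong) (auto simp: space_mset_space re)
    finally show "mset_of_tuple n (s m) = m" by simp
  qed
qed

lemma standard_borel_mset_space:
  assumes X: "standard_borel X"
  shows "standard_borel (mset_space n X)"
proof (cases "space X = {}")
  case True
  show ?thesis
  proof (cases "n = 0")
    case False
    then show ?thesis using True by (intro standard_borel_empty) (auto simp: space_mset_space)
  next
    \<comment> \<open>Even for empty X there is one multiset of size 0.\<close>
    case n: True
    have sp: "space (mset_space n X) = {{#}}" using n by (auto simp: space_mset_space)
    show ?thesis
      by (rule standard_borel_if_borel_retract, rule borel_retractI[of "\<lambda>_ _. 0" _ _ "\<lambda>_. {#}"]) (simp_all add: sp)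
  qed
next
  case False
  obtain e r where "unit_coded X e r" using unit_coded_if_standard_borel[OF X False] .
  then interpret unit_coded X e r .
  have "borel_retract (power_space n X) (borel :: (nat \<Rightarrow> real) measure)"
    unfolding power_space_def by (rule borel_retract_seq_PiM[OF borel_retract_if_standard_borel[OF X False]])
  from borel_retract_trans[OF borel_retract_mset_space this] show ?thesis
    by (rule standard_borel_if_borel_retract)
qed

subsection \<open>Exchangeable sequences\<close>

abbreviation seq_space :: "'a measure \<Rightarrow> (nat \<Rightarrow> 'a) measure" where
  "seq_space X \<equiv> (\<Pi>\<^sub>M i\<in>UNIV. X)"

lemma measurable_coord: "i \<in> I \<Longrightarrow> (\<lambda>x. x i) \<in> (\<Pi>\<^sub>M i\<in>I. X) \<rightarrow>\<^sub>M X"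
  by (rule measurable_component_singleton)

lemma restrict_seq_measurable: "finite J \<Longrightarrow> (\<lambda>x. restrict x J) \<in> seq_space X \<rightarrow>\<^sub>M (\<Pi>\<^sub>M i\<in>J. X)"
  by (rule measurable_restrict_subset) simp

text \<open>Kolmogorov extension is applied over the reals: the laws are transported along
  \<open>e\<close>, extended there, and brought back along \<open>r\<close>.\<close>

lemma (in unit_coded) kolmogorov_sequence:
  fixes Q :: "nat \<Rightarrow> (nat \<Rightarrow> 'a) measure"
  assumes Q: "\<And>n. Q n \<in> space (prob_algebra (power_space n X))"
    and cons: "\<And>n. distr (Q (Suc n)) (power_space n X) (\<lambda>x. restrict x {..<n}) = Q n"
  shows "\<exists>L\<in>space (prob_algebra (seq_space X)). \<forall>n. distr L (power_space n X) (\<lambda>x. restrict x {..<n}) = Q n"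
proof -
  define B where "B J = (\<Pi>\<^sub>M i\<in>J. (borel :: real measure))" for J :: "nat set"
  have mQ: "f \<in> Q n \<rightarrow>\<^sub>M N \<longleftrightarrow> f \<in> power_space n X \<rightarrow>\<^sub>M N" for f n and N :: "'c measure"
    by (rule arg_cong[OF measurable_cong_sets[OF prob_algebraD(2)[OF Q] refl]])
  have E: "(\<lambda>x. \<lambda>i\<in>{..<n}. e (x i)) \<in> power_space n X \<rightarrow>\<^sub>M B {..<n}" for n
    unfolding power_space_def B_def
    by (intro measurable_restrict measurable_compose[OF measurable_coord e]) simp
  have restr: "(\<lambda>x. restrict x J) \<in> B I \<rightarrow>\<^sub>M B J" if "J \<subseteq> I" for I J
    unfolding B_def using that by (rule measurable_restrict_subset)
  define R where "R n = distr (Q n) (B {..<n}) (\<lambda>x. \<lambda>i\<in>{..<n}. e (x i))" for n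
  have R: "R n \<in> space (prob_algebra (B {..<n}))" for n
    unfolding R_def by (rule distr_prob_algebra[OF Q E])
  have mR: "f \<in> R n \<rightarrow>\<^sub>M N \<longleftrightarrow> f \<in> B {..<n} \<rightarrow>\<^sub>M N" for f n and N :: "'c measure"
    by (simp add: R_def)
  have R_Suc: "distr (R (Suc n)) (B {..<n}) (\<lambda>x. restrict x {..<n}) = R n" for n
  proof -
    have "distr (R (Suc n)) (B {..<n}) (\<lambda>x. restrict x {..<n}) =
        distr (Q (Suc n)) (B {..<n}) ((\<lambda>x. restrict x {..<n}) \<circ> (\<lambda>x. \<lambda>i\<in>{..<Suc n}. e (x i)))"
      unfolding R_def by (rule distr_distr) (simp_all add: mQ E restr)
    also have "(\<lambda>x. restrict x {..<n}) \<circ> (\<lambda>x. \<lambda>i\<in>{..<Suc n}. e (x i)) =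
        (\<lambda>x. \<lambda>i\<in>{..<n}. e (x i)) \<circ> (\<lambda>x. restrict x {..<n})"
      by (auto simp: fun_eq_iff restrict_def)
    also have "distr (Q (Suc n)) (B {..<n}) \<dots> =
        distr (distr (Q (Suc n)) (power_space n X) (\<lambda>x. restrict x {..<n})) (B {..<n}) (\<lambda>x. \<lambda>i\<in>{..<n}. e (x i))"
      by (rule distr_distr[symmetric]) (simp_all add: mQ E restrict_power_measurable)
    finally show ?thesis unfolding cons R_def[of n, symmetric] .
  qed
  \<comment> \<open>By consistency, the marginal on J can be computed at any level that contains
    J.\<close>
  have R_restr: "distr (R n) (B J) (\<lambda>x. restrict x J) = distr (R m) (B J) (\<lambda>x. restrict x J)"
    if "J \<subseteq> {..<m}" "m \<le> n" for J m n
    using that(2)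
  proof (induction n rule: dec_induct)
    case (step n)
    have J: "J \<subseteq> {..<n}" using that(1) step(1) by (meson lessThan_subset_iff order_trans)
    have "distr (R (Suc n)) (B J) (\<lambda>x. restrict x J) =
       distr (R (Suc n)) (B J) ((\<lambda>x. restrict x J) \<circ> (\<lambda>x. restrict x {..<n}))"
      using J by (simp add: comp_def restrict_restrict Int_absorb1)
    also have "\<dots> = distr (distr (R (Suc n)) (B {..<n}) (\<lambda>x. restrict x {..<n})) (B J) (\<lambda>x. restrict x J)"
      by (rule distr_distr[symmetric]) (simp_all add: mR restr J)
    finally show ?case by (simp only: R_Suc step.IH)
  qed simp
  \<comment> \<open>A level whose indices include the finite set J; inserting 0 covers the empty
    set.\<close>
  define N where "N J = Suc (Max (insert 0 J))" for J :: "nat set"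
  have N: "J \<subseteq> {..<N J}" if "finite J" for J
    using that by (auto simp: N_def less_Suc_eq_le)
  have N_mono: "N J \<le> N H" if "J \<subseteq> H" "finite H" for J H
    unfolding N_def Suc_le_mono using that by (intro Max_mono) auto
  define P where "P J = distr (R (N J)) (B J) (\<lambda>x. restrict x J)" for J
  have P_prob: "P J \<in> space (prob_algebra (B J))" if "finite J" for J
    unfolding P_def by (rule distr_prob_algebra[OF R restr[OF N[OF that]]])
  interpret polish_projective UNIV P
  proof (intro polish_projective.intro projective_family.intro)
    fix J H :: "nat set" assume JH: "J \<subseteq> H" "finite H"
    then have finJ: "finite J" by (rule finite_subset)
    have "distr (P H) (B J) (\<lambda>x. restrict x J) = distr (R (N H)) (B J) ((\<lambda>x. restrict x J) \<circ> (\<lambda>x. restrict x H))"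
      unfolding P_def by (rule distr_distr) (simp_all add: mR restr N JH)
    also have "(\<lambda>x. restrict x J) \<circ> (\<lambda>x. restrict x H) = (\<lambda>x :: nat \<Rightarrow> real. restrict x J)"
      using JH by (simp add: comp_def restrict_restrict Int_absorb1)
    also have "distr (R (N H)) (B J) (\<lambda>x. restrict x J) = P J"
      unfolding P_def by (rule R_restr[OF N[OF finJ] N_mono[OF JH]])
    finally have "distr (P H) (B J) (\<lambda>x. restrict x J) = P J" .
    then show "P J = distr (P H) (\<Pi>\<^sub>M i\<in>J. borel) (\<lambda>f. restrict f J)" unfolding B_def by (rule sym)
  next
    fix J :: "nat set" assume "finite J"
    then show "prob_space (P J)" using P_prob prob_algebraD(1) by blast
  qed
  have lim_prob: "lim \<in> space (prob_algebra (seq_space (borel :: real measure)))"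
    by (rule prob_algebraI[OF P.prob_space_axioms sets_lim])
  have mlim: "f \<in> lim \<rightarrow>\<^sub>M N \<longleftrightarrow> f \<in> seq_space borel \<rightarrow>\<^sub>M N" for f and N :: "'c measure"
    by (rule arg_cong[OF measurable_cong_sets[OF sets_lim refl]])
  have lim_restr: "distr lim (B J) (\<lambda>x. restrict x J) = P J" if J: "finite J" for J
  proof (rule measure_eqI)
    show "sets (distr lim (B J) (\<lambda>x. restrict x J)) = sets (P J)" by (simp add: P_def)
    fix A assume "A \<in> sets (distr lim (B J) (\<lambda>x. restrict x J))"
    then have A: "A \<in> sets (\<Pi>\<^sub>M i\<in>J. borel)" by (simp add: B_def)
    have "emeasure (distr lim (B J) (\<lambda>x. restrict x J)) A = emeasure lim ((\<lambda>x. restrict x J) -` A \<inter> space lim)"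
      using A by (intro emeasure_distr) (simp_all add: mlim B_def restrict_seq_measurable J)
    also have "(\<lambda>x. restrict x J) -` A \<inter> space lim = prod_emb UNIV (\<lambda>_. borel) J A"
      by (simp add: prod_emb_def space_PiM)
    also have "emeasure lim \<dots> = emeasure (P J) A" using J A by (intro emeasure_lim_emb) auto
    finally show "emeasure (distr lim (B J) (\<lambda>x. restrict x J)) A = emeasure (P J) A" .
  qed
  have r_seq: "(\<lambda>x i. r (x i)) \<in> seq_space borel \<rightarrow>\<^sub>M seq_space X"
    by (rule measurable_PiM_single')
       (auto intro!: measurable_compose[OF measurable_coord r] measurable_space[OF r] simp: space_PiM)
  have r_n: "(\<lambda>x. \<lambda>i\<in>{..<n}. r (x i)) \<in> B {..<n} \<rightarrow>\<^sub>M power_space n X" for n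
    unfolding power_space_def B_def
    by (intro measurable_restrict measurable_compose[OF measurable_coord r]) simp
  define L where "L = distr lim (seq_space X) (\<lambda>x i. r (x i))"
  have L: "L \<in> space (prob_algebra (seq_space X))"
    unfolding L_def by (rule distr_prob_algebra[OF lim_prob r_seq])
  have "distr L (power_space n X) (\<lambda>x. restrict x {..<n}) = Q n" for n
  proof -
    have "distr L (power_space n X) (\<lambda>x. restrict x {..<n}) =
        distr lim (power_space n X) ((\<lambda>x. restrict x {..<n}) \<circ> (\<lambda>x i. r (x i)))"
      unfolding L_def by (rule distr_distr) (simp_all add: mlim r_seq power_space_def restrict_seq_measurable)
    also have "(\<lambda>x. restrict x {..<n}) \<circ> (\<lambda>x i. r (x i)) = (\<lambda>x. \<lambda>i\<in>{..<n}. r (x i)) \<circ> (\<lambda>x. restrict x {..<n})"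
      by (auto simp: fun_eq_iff restrict_def)
    also have "distr lim (power_space n X) \<dots> =
        distr (distr lim (B {..<n}) (\<lambda>x. restrict x {..<n})) (power_space n X) (\<lambda>x. \<lambda>i\<in>{..<n}. r (x i))"
    proof (rule distr_distr[OF r_n, symmetric])
      show "(\<lambda>x. restrict x {..<n}) \<in> lim \<rightarrow>\<^sub>M B {..<n}"
        unfolding mlim B_def by (rule restrict_seq_measurable) simp
    qed
    also have "distr lim (B {..<n}) (\<lambda>x. restrict x {..<n}) = R n"
    proof -
      have "distr (R (N {..<n})) (B {..<n}) (\<lambda>x. restrict x {..<n}) = distr (R n) (B {..<n}) (\<lambda>x. restrict x {..<n})"
        by (rule R_restr) (use N[of "{..<n}"] in auto)
      also have "\<dots> = distr (R n) (R n) (\<lambda>x. x)"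
      proof (rule distr_cong)
        fix x assume "x \<in> space (R n)"
        then show "restrict x {..<n} = x" by (simp add: R_def B_def space_PiM)
      qed (simp_all add: R_def)
      finally show ?thesis by (simp add: lim_restr P_def)
    qed
    also have "distr (R n) (power_space n X) (\<lambda>x. \<lambda>i\<in>{..<n}. r (x i)) =
        distr (Q n) (power_space n X) ((\<lambda>x. \<lambda>i\<in>{..<n}. r (x i)) \<circ> (\<lambda>x. \<lambda>i\<in>{..<n}. e (x i)))"
      unfolding R_def by (rule distr_distr) (simp_all add: mQ E r_n)
    also have "\<dots> = distr (Q n) (Q n) (\<lambda>x. x)"
    proof (rule distr_cong)
      show "sets (power_space n X) = sets (Q n)" using prob_algebraD(2)[OF Q] by simp
      fix x assume "x \<in> space (Q n)"
      then have "x \<in> (\<Pi>\<^sub>E i\<in>{..<n}. space X)" using prob_algebraD(3)[OF Q] by (simp add: power_space_def space_PiM)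
      then show "((\<lambda>x. \<lambda>i\<in>{..<n}. r (x i)) \<circ> (\<lambda>x. \<lambda>i\<in>{..<n}. e (x i))) x = x"
        by (auto simp: fun_eq_iff PiE_iff re extensional_def)
    qed simp
    also have "distr (Q n) (Q n) (\<lambda>x. x) = Q n" by simp
    finally show ?thesis .
  qed
  then show ?thesis using L by blast
qed

text \<open>The indices from n on and the values missed by \<open>f\<close> are equally many below
  N, so any bijection between them completes \<open>f\<close>. This passes from invariance under
  permutations to invariance under injections.\<close>

lemma inj_on_extend_permutes:
  assumes f: "inj_on f {..<n}" "\<And>i. i < n \<Longrightarrow> f i < N" and n: "n \<le> N"
  shows "\<exists>p. p permutes {..<N::nat} \<and> (\<forall>i<n. p i = f i)"
proof -
  have sub: "f ` {..<n} \<subseteq> {..<N}" using f(2) by auto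
  have "card ({..<N} - {..<n}) = card ({..<N} - f ` {..<n})"
    using n sub by (subst (1 2) card_Diff_subset) (auto simp: card_image[OF f(1)])
  then obtain g where g: "bij_betw g ({..<N} - {..<n}) ({..<N} - f ` {..<n})"
    using finite_same_card_bij[of "{..<N} - {..<n}" "{..<N} - f ` {..<n}"] by auto
  define p where "p i = (if i < n then f i else if i < N then g i else i)" for i
  have 1: "bij_betw p {..<n} (f ` {..<n})"
    using f(1) by (auto simp: bij_betw_def p_def inj_on_def)
  have 2: "bij_betw p ({..<N} - {..<n}) ({..<N} - f ` {..<n})"
    using g by (rule bij_betw_cong[THEN iffD1, rotated]) (auto simp: p_def)
  have "bij_betw p ({..<n} \<union> ({..<N} - {..<n})) (f ` {..<n} \<union> ({..<N} - f ` {..<n}))"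
    by (rule bij_betw_combine[OF 1 2]) auto
  moreover have "{..<n} \<union> ({..<N} - {..<n}) = {..<N}" "f ` {..<n} \<union> ({..<N} - f ` {..<n}) = {..<N}"
    using n sub by auto
  ultimately have "bij_betw p {..<N} {..<N}" by (simp only:)
  then have "p permutes {..<N}" by (rule bij_imp_permutes) (use n in \<open>auto simp: p_def\<close>)
  then show ?thesis by (intro exI[of _ p]) (simp add: p_def)
qed

text \<open>Along \<open>4 ^ k\<close> the averages of an exchangeable sequence converge almost surely, by summability of the
  \<open>L\<^sup>1\<close> distances of consecutive terms; no strong law is needed.\<close>

definition avg :: "'a set \<Rightarrow> nat set \<Rightarrow> (nat \<Rightarrow> 'a) \<Rightarrow> real" where
  "avg A S x = (\<Sum>i\<in>S. indicator A (x i)) / card S"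

lemma avg_01: "0 \<le> avg A S x \<and> avg A S x \<le> 1"
proof
  show "0 \<le> avg A S x" unfolding avg_def by (intro divide_nonneg_nonneg sum_nonneg) auto
  show "avg A S x \<le> 1"
  proof (cases "finite S")
    case True
    have "(\<Sum>i\<in>S. indicator A (x i) :: real) \<le> (\<Sum>i\<in>S. 1)" by (intro sum_mono) (simp add: indicator_def)
    then show ?thesis unfolding avg_def by (cases "card S = 0") (auto simp: divide_le_eq)
  qed (simp add: avg_def)
qed

lemma abs_avg_le: "\<bar>avg A S x\<bar> \<le> 1"
  using avg_01[of A S x] by simp

text \<open>\<open>lim\<close> returns some real number also where the averages diverge, so
  \<open>freq A\<close> is a measurable function of the sequence that refers to no law; divergence
  is null under each exchangeable law.\<close>

definition freq :: "'a set \<Rightarrow> (nat \<Rightarrow> 'a) \<Rightarrow> real" where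
  "freq A x = lim (\<lambda>k. avg A {..<4 ^ k} x)"

lemma freq_measurable_seq:
  assumes "A \<in> sets X" shows "freq A \<in> borel_measurable (seq_space X)"
  unfolding freq_def avg_def
  by (intro borel_measurable_lim_metric borel_measurable_divide borel_measurable_sum borel_measurable_const
      measurable_compose[OF measurable_coord borel_measurable_indicator[OF assms]]) simp

text \<open>Exchangeability is stated for injections of indices and for rectangles, the form in
  which products of indicators at distinct positions are evaluated.\<close>

locale exchangeable =
  fixes X :: "'a measure" and L :: "(nat \<Rightarrow> 'a) measure"
  assumes L: "L \<in> space (prob_algebra (seq_space X))"
    and exch: "\<And>n f A. inj_on f {..<n} \<Longrightarrow> (\<And>i. i < n \<Longrightarrow> A i \<in> sets X) \<Longrightarrow>
      measure L {x \<in> space L. \<forall>i<n. x (f i) \<in> A i} = measure L {x \<in> space L. \<forall>i<n. x i \<in> A i}"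
begin

sublocale prob_space L by (rule prob_algebraD[OF L])

lemma measurable_L: "f \<in> L \<rightarrow>\<^sub>M N \<longleftrightarrow> f \<in> seq_space X \<rightarrow>\<^sub>M N"
  by (rule arg_cong[OF measurable_cong_sets[OF prob_algebraD(2)[OF L] refl]])

lemma ind_measurable:
  assumes "A \<in> sets X" shows "(\<lambda>x. indicator A (x i) :: real) \<in> borel_measurable L"
  unfolding measurable_L
  by (rule measurable_compose[OF measurable_coord borel_measurable_indicator[OF assms]]) simp

lemma bounded_integrable:
  fixes f :: "(nat \<Rightarrow> 'a) \<Rightarrow> real"
  assumes "f \<in> borel_measurable L" "\<And>x. \<bar>f x\<bar> \<le> B" shows "integrable L f"
  using assms by (intro integrable_const_bound[where B = B]) auto

lemma integral_prod_ind:
  assumes f: "inj_on f {..<n}" and A: "\<And>i. i < n \<Longrightarrow> A i \<in> sets X"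
  shows "(\<integral>x. (\<Prod>i<n. indicator (A i) (x (f i))) \<partial>L) = measure L {x \<in> space L. \<forall>i<n. x i \<in> A i}"
proof -
  have "(\<integral>x. (\<Prod>i<n. indicator (A i) (x (f i)) :: real) \<partial>L) = (\<integral>x. indicator {x \<in> space L. \<forall>i<n. x (f i) \<in> A i} x \<partial>L)"
  proof (rule Bochner_Integration.integral_cong[OF refl])
    fix x assume x: "x \<in> space L"
    show "(\<Prod>i<n. indicator (A i) (x (f i))) = (indicator {x \<in> space L. \<forall>i<n. x (f i) \<in> A i} x :: real)"
    proof (cases "\<forall>i<n. x (f i) \<in> A i")
      case False
      then obtain i where "i < n" "x (f i) \<notin> A i" by auto
      then have "(\<Prod>i<n. indicator (A i) (x (f i))) = (0 :: real)" by (intro prod_zero bexI[of _ i]) auto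
      then show ?thesis using False by (auto simp: indicator_def)
    qed (use x in simp)
  qed
  also have "\<dots> = measure L ({x \<in> space L. \<forall>i<n. x (f i) \<in> A i} \<inter> space L)"
    by (rule Bochner_Integration.integral_indicator)
  also have "{x \<in> space L. \<forall>i<n. x (f i) \<in> A i} \<inter> space L = {x \<in> space L. \<forall>i<n. x (f i) \<in> A i}" by blast
  also have "measure L \<dots> = measure L {x \<in> space L. \<forall>i<n. x i \<in> A i}" by (rule exch[OF f A])
  finally show ?thesis .
qed

lemma avg_measurable: "A \<in> sets X \<Longrightarrow> avg A S \<in> borel_measurable L"
  unfolding avg_def by (intro borel_measurable_divide borel_measurable_sum ind_measurable borel_measurable_const)

text \<open>The difference is a combination of the indicators \<open>\<xi> i\<close> with
  coefficients \<open>c i\<close> of sum 0. By exchangeability the integral of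
  \<open>\<xi> i x * \<xi> j x\<close> is \<open>b\<close> off the diagonal and \<open>a\<close> on
  it, so the part with \<open>b\<close> cancels and there remains \<open>a - b\<close> times the sum
  of the squares of the \<open>c i\<close>.\<close>

lemma avg_diff_square:
  assumes A: "A \<in> sets X" and S: "finite S" "S \<noteq> {}" and T: "finite T" "T \<noteq> {}"
  shows "(\<integral>x. (avg A S x - avg A T x)\<^sup>2 \<partial>L) \<le> 2 / card S + 2 / card T"
proof -
  define \<xi> where "\<xi> i x = (indicator A (x i) :: real)" for i and x :: "nat \<Rightarrow> 'a"
  have \<xi>01: "\<bar>\<xi> i x * \<xi> j x\<bar> \<le> 1" for i j x by (simp add: \<xi>_def indicator_def)
  have int: "integrable L (\<lambda>x. \<xi> i x * \<xi> j x)" for i j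
    by (rule bounded_integrable[OF _ \<xi>01]) (unfold \<xi>_def, intro borel_measurable_times ind_measurable A)
  define a where "a = measure L {x \<in> space L. x 0 \<in> A}"
  define b where "b = measure L {x \<in> space L. \<forall>i<2. x i \<in> A}"
  have E_a: "(\<integral>x. \<xi> i x * \<xi> i x \<partial>L) = a" for i
  proof -
    have "inj_on (\<lambda>_. i) {..<1::nat}" by (auto simp: inj_on_def)
    from integral_prod_ind[OF this, of "\<lambda>_. A"] A
    have "(\<integral>x. indicator A (x i) \<partial>L) = a" by (simp add: a_def)
    moreover have "\<xi> i x * \<xi> i x = indicator A (x i)" for x by (simp add: \<xi>_def indicator_def)
    ultimately show ?thesis by (simp only:)
  qed
  have E_b: "(\<integral>x. \<xi> i x * \<xi> j x \<partial>L) = b" if "i \<noteq> j" for i j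
  proof -
    have "inj_on (\<lambda>k. if k = 0 then i else j) {..<2::nat}" using that by (auto simp: inj_on_def numeral_2_eq_2 less_Suc_eq)
    from integral_prod_ind[OF this, of "\<lambda>_. A"] A show ?thesis
      by (simp add: \<xi>_def b_def numeral_2_eq_2)
  qed
  have E: "(\<integral>x. \<xi> i x * \<xi> j x \<partial>L) = b + (if i = j then a - b else 0)" for i j
    using E_a[of i] E_b[of i j] by auto
  have ab: "a - b \<le> 1" unfolding a_def b_def using prob_le_1[of "{x \<in> space L. x 0 \<in> A}"]
      measure_nonneg[of L "{x \<in> space L. \<forall>i<2. x i \<in> A}"] by linarith
  define I where "I = S \<union> T"
  have I: "finite I" "S \<subseteq> I" "T \<subseteq> I" using S T by (auto simp: I_def)
  define c where "c i = (if i \<in> S then 1 / real (card S) else 0) - (if i \<in> T then 1 / real (card T) else 0)" for i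
  have diff: "avg A S x - avg A T x = (\<Sum>i\<in>I. c i * \<xi> i x)" for x
  proof -
    have "avg A S x = (\<Sum>i\<in>I. (if i \<in> S then 1 / real (card S) else 0) * \<xi> i x)"
      unfolding avg_def \<xi>_def sum_divide_distrib
      by (rule sum.mono_neutral_cong_left[OF I(1,2)]) auto
    moreover have "avg A T x = (\<Sum>i\<in>I. (if i \<in> T then 1 / real (card T) else 0) * \<xi> i x)"
      unfolding avg_def \<xi>_def sum_divide_distrib
      by (rule sum.mono_neutral_cong_left[OF I(1,3)]) auto
    ultimately show ?thesis by (simp add: c_def left_diff_distrib sum_subtractf)
  qed
  have part: "(\<Sum>i\<in>I. if i \<in> U then d else 0) = real (card U) * d" if "U \<subseteq> I" for U and d :: real
    using I(1) that by (simp add: sum.If_cases Int_absorb1)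
  have cS: "0 < card S" "0 < card T" using S T by (auto simp: card_gt_0_iff)
  have c0: "(\<Sum>i\<in>I. c i) = 0" unfolding c_def sum_subtractf part[OF I(2)] part[OF I(3)] using cS by simp
  have c2: "(\<Sum>i\<in>I. (c i)\<^sup>2) \<le> 2 / card S + 2 / card T"
  proof -
    have "(\<Sum>i\<in>I. (c i)\<^sup>2) \<le> (\<Sum>i\<in>I. (if i \<in> S then 2 * (1 / real (card S))\<^sup>2 else 0) + (if i \<in> T then 2 * (1 / real (card T))\<^sup>2 else 0))"
    proof (rule sum_mono)
      fix i
      \<comment> \<open>S and T may overlap; this inequality separates their contributions to
        \<open>c i\<close>.\<close>
      have "(p - q)\<^sup>2 \<le> 2 * p\<^sup>2 + 2 * q\<^sup>2" for p q :: real
        using zero_le_power2[of "p + q"] by (simp add: power2_eq_square algebra_simps)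
      from this[of "if i \<in> S then 1 / real (card S) else 0" "if i \<in> T then 1 / real (card T) else 0"]
      show "(c i)\<^sup>2 \<le> (if i \<in> S then 2 * (1 / real (card S))\<^sup>2 else 0) + (if i \<in> T then 2 * (1 / real (card T))\<^sup>2 else 0)"
        unfolding c_def by (auto split: if_splits)
    qed
    also have "\<dots> = 2 / card S + 2 / card T"
      unfolding sum.distrib part[OF I(2)] part[OF I(3)] using cS by (simp add: power2_eq_square)
    finally show ?thesis .
  qed
  have "(\<integral>x. (avg A S x - avg A T x)\<^sup>2 \<partial>L) = (\<integral>x. (\<Sum>i\<in>I. \<Sum>j\<in>I. (c i * c j) * (\<xi> i x * \<xi> j x)) \<partial>L)"
    unfolding diff by (simp add: power2_eq_square sum_product mult_ac)
  also have "\<dots> = (\<Sum>i\<in>I. \<Sum>j\<in>I. (c i * c j) * (\<integral>x. \<xi> i x * \<xi> j x \<partial>L))"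
    by (subst Bochner_Integration.integral_sum; (intro Bochner_Integration.integrable_sum integrable_mult_right int)?)
       (subst Bochner_Integration.integral_sum; (intro integrable_mult_right int)?; simp)
  also have "\<dots> = (\<Sum>i\<in>I. \<Sum>j\<in>I. (c i * c j) * b) + (\<Sum>i\<in>I. \<Sum>j\<in>I. if i = j then c i * c j * (a - b) else 0)"
    unfolding E distrib_left sum.distrib by (simp add: if_distrib[of "(*) _"] cong: if_cong)
  also have "(\<Sum>i\<in>I. \<Sum>j\<in>I. (c i * c j) * b) = (\<Sum>i\<in>I. \<Sum>j\<in>I. c i * c j) * b"
    by (simp only: sum_distrib_right)
  also have "(\<Sum>i\<in>I. \<Sum>j\<in>I. c i * c j) = (\<Sum>i\<in>I. c i) * (\<Sum>i\<in>I. c i)" by (rule sum_product[symmetric])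
  also have "(\<Sum>i\<in>I. \<Sum>j\<in>I. if i = j then c i * c j * (a - b) else 0) = (\<Sum>i\<in>I. (c i)\<^sup>2) * (a - b)"
    using I(1) by (simp add: power2_eq_square sum_distrib_right)
  finally have "(\<integral>x. (avg A S x - avg A T x)\<^sup>2 \<partial>L) = (\<Sum>i\<in>I. (c i)\<^sup>2) * (a - b)" by (simp add: c0)
  also have "\<dots> \<le> (\<Sum>i\<in>I. (c i)\<^sup>2) * 1" using ab by (intro mult_left_mono sum_nonneg) auto
  also have "\<dots> \<le> 2 / card S + 2 / card T" using c2 by simp
  finally show ?thesis .
qed

lemma avg_diff_L1:
  assumes A: "A \<in> sets X" and S: "finite S" "S \<noteq> {}" and T: "finite T" "T \<noteq> {}"
  shows "(\<integral>x. \<bar>avg A S x - avg A T x\<bar> \<partial>L) \<le> sqrt (2 / card S + 2 / card T)"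
proof -
  let ?Y = "\<lambda>x. \<bar>avg A S x - avg A T x\<bar>"
  have b: "?Y x \<le> 1" for x using avg_01[of A S x] avg_01[of A T x] by linarith
  have meas: "?Y \<in> borel_measurable L" by (intro borel_measurable_abs borel_measurable_diff avg_measurable A)
  have 1: "integrable L ?Y" by (rule bounded_integrable[OF meas, of 1]) (use b in auto)
  have 2: "integrable L (\<lambda>x. (?Y x)\<^sup>2)"
  proof (rule bounded_integrable[of _ 1])
    show "(\<lambda>x. (?Y x)\<^sup>2) \<in> borel_measurable L" by (rule borel_measurable_power[OF meas])
    show "\<bar>(?Y x)\<^sup>2\<bar> \<le> 1" for x using b[of x] by (simp add: abs_square_le_1)
  qed
  \<comment> \<open>Nonnegativity of the variance is the Cauchy-Schwarz inequality against the
    constant 1.\<close>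
  have "0 \<le> variance ?Y" by (rule variance_positive)
  then have "(\<integral>x. ?Y x \<partial>L)\<^sup>2 \<le> (\<integral>x. (?Y x)\<^sup>2 \<partial>L)" using variance_eq[OF 1 2] by simp
  also have "\<dots> = (\<integral>x. (avg A S x - avg A T x)\<^sup>2 \<partial>L)" by simp
  also have "\<dots> \<le> 2 / card S + 2 / card T" by (rule avg_diff_square[OF assms])
  finally show ?thesis by (rule real_le_rsqrt)
qed

lemma freq_measurable: "A \<in> sets X \<Longrightarrow> freq A \<in> borel_measurable L"
  unfolding measurable_L by (rule freq_measurable_seq)

lemma AE_freq:
  assumes A: "A \<in> sets X"
  shows "AE x in L. (\<lambda>k. avg A {..<4 ^ k} x) \<longlonglongrightarrow> freq A x"
proof -
  let ?d = "\<lambda>k x. avg A {..<4 ^ Suc k} x - avg A {..<4 ^ k} x"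
  have meas: "?d k \<in> borel_measurable L" for k by (intro borel_measurable_diff avg_measurable A)
  have bnd: "\<bar>?d k x\<bar> \<le> 1" for k x using avg_01[of A "{..<4 ^ Suc k}" x] avg_01[of A "{..<4 ^ k}" x] by linarith
  have "(\<integral>\<^sup>+x. ennreal \<bar>?d k x\<bar> \<partial>L) \<le> ennreal (2 * (1/2) ^ k)" for k
  proof -
    have "(\<integral>x. \<bar>?d k x\<bar> \<partial>L) \<le> sqrt (2 / 4 ^ Suc k + 2 / 4 ^ k)"
      using avg_diff_L1[OF A, of "{..<4 ^ Suc k}" "{..<4 ^ k}"] by (auto simp: lessThan_empty_iff)
    also have "\<dots> \<le> sqrt ((2 * (1/2) ^ k)\<^sup>2)"
    proof (rule real_sqrt_le_mono)
      \<comment> \<open>The sum is 5/2 divided by \<open>4 ^ k\<close>, hence at most 4 divided by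
        \<open>4 ^ k\<close>, which is the square of a summable sequence.\<close>
      have "(4::real) ^ k = (2 ^ k)\<^sup>2" by (simp add: power2_eq_square flip: power_mult_distrib)
      then show "2 / 4 ^ Suc k + 2 / 4 ^ k \<le> (2 * (1/2) ^ k :: real)\<^sup>2"
        by (simp add: power_mult_distrib power_divide field_simps)
    qed
    also have "\<dots> = 2 * (1/2) ^ k" by (subst real_sqrt_abs) simp
    finally have "(\<integral>x. \<bar>?d k x\<bar> \<partial>L) \<le> 2 * (1/2) ^ k" .
    moreover have "(\<integral>\<^sup>+x. ennreal \<bar>?d k x\<bar> \<partial>L) = ennreal (\<integral>x. \<bar>?d k x\<bar> \<partial>L)"
      by (rule nn_integral_eq_integral, rule bounded_integrable[of _ 1]) (use meas bnd in auto)
    ultimately show ?thesis by (simp add: ennreal_leI)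
  qed
  then have "(\<Sum>k. \<integral>\<^sup>+x. ennreal \<bar>?d k x\<bar> \<partial>L) \<le> (\<Sum>k. ennreal (2 * (1/2) ^ k))"
    by (intro suminf_le summableI)
  also have "\<dots> = ennreal (\<Sum>k. 2 * (1/2) ^ k)"
    by (rule suminf_ennreal2) (auto intro!: summable_mult summable_geometric)
  also have "\<dots> < \<infinity>" by simp
  finally have fin: "(\<Sum>k. \<integral>\<^sup>+x. ennreal \<bar>?d k x\<bar> \<partial>L) < \<infinity>" .
  have meas': "(\<lambda>x. ennreal \<bar>?d k x\<bar>) \<in> borel_measurable L" for k
    by (rule measurable_compose[OF borel_measurable_abs[OF meas] measurable_ennreal])
  have "(\<integral>\<^sup>+x. (\<Sum>k. ennreal \<bar>?d k x\<bar>) \<partial>L) \<noteq> \<infinity>"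
    unfolding nn_integral_suminf[OF meas'] using fin by (rule less_imp_neq)
  then have "AE x in L. (\<Sum>k. ennreal \<bar>?d k x\<bar>) \<noteq> \<infinity>"
    by (rule nn_integral_noteq_infinite[OF borel_measurable_suminf_order[OF meas']])
  then show ?thesis
  proof eventually_elim
    fix x assume "(\<Sum>k. ennreal \<bar>?d k x\<bar>) \<noteq> \<infinity>"
    then have "summable (\<lambda>k. \<bar>?d k x\<bar>)" by (intro summable_suminf_not_top) auto
    then have "summable (\<lambda>k. ?d k x)" by (rule summable_rabs_cancel)
    then have "(\<lambda>n. \<Sum>k<n. ?d k x) \<longlonglongrightarrow> (\<Sum>k. ?d k x)" by (rule summable_LIMSEQ)
    moreover have "(\<Sum>k<n. ?d k x) = avg A {..<4 ^ n} x - avg A {..<4 ^ 0} x" for n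
      by (rule sum_lessThan_telescope)
    ultimately have "(\<lambda>n. avg A {..<4 ^ n} x - avg A {..<4 ^ 0} x) \<longlonglongrightarrow> (\<Sum>k. ?d k x)" by (simp only:)
    from tendsto_add[OF this tendsto_const[of "avg A {..<4 ^ 0} x"]]
    have "(\<lambda>n. avg A {..<4 ^ n} x) \<longlonglongrightarrow> (\<Sum>k. ?d k x) + avg A {..<4 ^ 0} x" by simp
    then have "convergent (\<lambda>n. avg A {..<4 ^ n} x)" by (auto simp: convergent_def)
    then show "(\<lambda>k. avg A {..<4 ^ k} x) \<longlonglongrightarrow> freq A x"
      unfolding freq_def by (simp add: convergent_LIMSEQ_iff)
  qed
qed

lemma AE_freq_01:
  assumes A: "A \<in> sets X" shows "AE x in L. 0 \<le> freq A x \<and> freq A x \<le> 1"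
  using AE_freq[OF A]
proof eventually_elim
  fix x assume "(\<lambda>k. avg A {..<4 ^ k} x) \<longlonglongrightarrow> freq A x"
  then show "0 \<le> freq A x \<and> freq A x \<le> 1"
    using LIMSEQ_le_const[of _ "freq A x" 0] LIMSEQ_le_const2[of _ "freq A x" 1] avg_01[of A _ x] by blast
qed

text \<open>Let T run through the initial blocks of length \<open>4 ^ k\<close> in
  \<open>avg_diff_L1\<close>. The rate depends on the size of S only, so blocks placed anywhere
  approximate the same limit.\<close>

lemma avg_freq_L1:
  assumes A: "A \<in> sets X" and S: "finite S" "S \<noteq> {}"
  shows "(\<integral>x. \<bar>avg A S x - freq A x\<bar> \<partial>L) \<le> sqrt (2 / card S)"
proof -
  have "(\<lambda>k. \<integral>x. \<bar>avg A S x - avg A {..<4 ^ k} x\<bar> \<partial>L) \<longlonglongrightarrow> (\<integral>x. \<bar>avg A S x - freq A x\<bar> \<partial>L)"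
  proof (rule integral_dominated_convergence[where w = "\<lambda>_. 1"])
    show "AE x in L. (\<lambda>k. \<bar>avg A S x - avg A {..<4 ^ k} x\<bar>) \<longlonglongrightarrow> \<bar>avg A S x - freq A x\<bar>"
      using AE_freq[OF A] by eventually_elim (intro tendsto_intros)
    show "AE x in L. norm \<bar>avg A S x - avg A {..<4 ^ k} x\<bar> \<le> 1" for k
    proof (rule AE_I2)
      fix x show "norm \<bar>avg A S x - avg A {..<4 ^ k} x\<bar> \<le> 1"
        using avg_01[of A S x] avg_01[of A "{..<4 ^ k}" x] by simp linarith
    qed
  qed (auto intro!: borel_measurable_abs borel_measurable_diff avg_measurable freq_measurable A)
  moreover have "(\<lambda>k. sqrt (2 / card S + 2 / real (4 ^ k))) \<longlonglongrightarrow> sqrt (2 / card S + 0)"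
  proof (intro tendsto_intros)
    have "(\<lambda>k. 2 * (1/4) ^ k) \<longlonglongrightarrow> 2 * (0 :: real)" by (intro tendsto_intros LIMSEQ_realpow_zero) auto
    then show "(\<lambda>k. 2 / real (4 ^ k)) \<longlonglongrightarrow> 0" by (simp add: power_divide)
  qed
  ultimately show ?thesis
    using avg_diff_L1[OF A S, of "{..<4 ^ _}"] by (intro LIMSEQ_le[of _ _ _ "sqrt (2 / card S)"]) (auto simp: lessThan_empty_iff)
qed

text \<open>Each factor is averaged over a block of its own, and the blocks are disjoint. Expanding
  the product of averages yields only terms with distinct indices, each of expectation
  \<open>t\<close> by exchangeability, so the expectation is exactly \<open>t\<close> for every
  block length, while the block averages tend to the frequencies in mean.\<close>

lemma integral_prod_freq:
  assumes A: "\<And>i. i < n \<Longrightarrow> A i \<in> sets X"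
  shows "(\<integral>x. (\<Prod>i<n. freq (A i) x) \<partial>L) = measure L {x \<in> space L. \<forall>i<n. x i \<in> A i}"
proof -
  define t where "t = measure L {x \<in> space L. \<forall>i<n. x i \<in> A i}"
  have int_f: "integrable L (\<lambda>x. \<Prod>i<n. freq (A i) x)"
  proof (rule integrable_const_bound[where B = 1])
    have "AE x in L. \<forall>i\<in>{..<n}. 0 \<le> freq (A i) x \<and> freq (A i) x \<le> 1"
      using A by (intro AE_finite_allI AE_freq_01) auto
    then show "AE x in L. norm (\<Prod>i<n. freq (A i) x) \<le> 1"
      by eventually_elim (auto simp: abs_prod intro!: prod_le_1)
  qed (intro borel_measurable_prod freq_measurable, use A in auto)
  have est: "\<bar>t - (\<integral>x. (\<Prod>i<n. freq (A i) x) \<partial>L)\<bar> \<le> n * sqrt (2 / real (Suc N))" for N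
  proof -
    define S where "S i = {i * Suc N..<Suc i * Suc N}" for i
    have S: "finite (S i)" "card (S i) = Suc N" "S i \<noteq> {}" for i by (auto simp: S_def)
    have cardPi: "card (PiE {..<n} S) = Suc N ^ n" by (simp add: card_PiE S)
    have "(\<Prod>i<n. avg (A i) (S i) x) = (\<Sum>f\<in>PiE {..<n} S. \<Prod>i<n. indicator (A i) (x (f i))) / real (Suc N) ^ n" for x
      unfolding avg_def prod_dividef S(2) using prod_sum_PiE[of "{..<n}" S "\<lambda>i j. indicator (A i) (x j) :: real"] S(1) by simp
    then have "(\<integral>x. (\<Prod>i<n. avg (A i) (S i) x) \<partial>L) =
        (\<integral>x. (\<Sum>f\<in>PiE {..<n} S. \<Prod>i<n. indicator (A i) (x (f i))) \<partial>L) / real (Suc N) ^ n" by simp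
    also have "(\<integral>x. (\<Sum>f\<in>PiE {..<n} S. \<Prod>i<n. indicator (A i) (x (f i)) :: real) \<partial>L) =
        (\<Sum>f\<in>PiE {..<n} S. (\<integral>x. (\<Prod>i<n. indicator (A i) (x (f i))) \<partial>L))"
    proof (rule Bochner_Integration.integral_sum)
      fix f
      show "integrable L (\<lambda>x. \<Prod>i<n. indicator (A i) (x (f i)) :: real)"
      proof (rule bounded_integrable[of _ 1])
        show "(\<lambda>x. \<Prod>i<n. indicator (A i) (x (f i)) :: real) \<in> borel_measurable L"
          using A by (intro borel_measurable_prod ind_measurable) auto
        show "\<bar>\<Prod>i<n. indicator (A i) (x (f i)) :: real\<bar> \<le> 1" for x
          unfolding abs_prod by (intro prod_le_1) (auto simp: indicator_def)
      qed
    qed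
    also have "\<dots> = (\<Sum>f\<in>PiE {..<n} S. t)"
    proof (rule sum.cong[OF refl])
      fix f assume f: "f \<in> PiE {..<n} S"
      \<comment> \<open>The quotient by the block length names the block, whence \<open>f\<close> is
        injective.\<close>
      have "f i div Suc N = i" if "i < n" for i
      proof -
        have "i * Suc N \<le> f i" "f i < Suc i * Suc N" using f that by (auto simp: S_def PiE_iff)
        then show ?thesis by (intro div_nat_eqI) (simp_all add: mult.commute)
      qed
      then have "inj_on f {..<n}" by (intro inj_onI) (metis lessThan_iff)
      from integral_prod_ind[OF this A] show "(\<integral>x. (\<Prod>i<n. indicator (A i) (x (f i))) \<partial>L) = t" by (simp add: t_def)
    qed
    also have "\<dots> / real (Suc N) ^ n = t" by (simp add: cardPi)
    finally have E: "(\<integral>x. (\<Prod>i<n. avg (A i) (S i) x) \<partial>L) = t" .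
    have int_a: "integrable L (\<lambda>x. \<Prod>i<n. avg (A i) (S i) x)"
    proof (rule bounded_integrable[of _ 1])
      show "\<bar>\<Prod>i<n. avg (A i) (S i) x\<bar> \<le> 1" for x unfolding abs_prod using abs_avg_le by (intro prod_le_1) auto
    qed (intro borel_measurable_prod avg_measurable, use A in auto)
    have int_d: "integrable L (\<lambda>x. \<bar>avg (A i) (S i) x - freq (A i) x\<bar>)" if "i < n" for i
    proof (rule integrable_const_bound[where B = 1])
      show "AE x in L. norm \<bar>avg (A i) (S i) x - freq (A i) x\<bar> \<le> 1"
        using AE_freq_01[OF A[OF that]]
      proof eventually_elim
        fix x assume "0 \<le> freq (A i) x \<and> freq (A i) x \<le> 1"
        then show "norm \<bar>avg (A i) (S i) x - freq (A i) x\<bar> \<le> 1" using avg_01[of "A i" "S i" x] by simp linarith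
      qed
    qed (intro borel_measurable_abs borel_measurable_diff avg_measurable freq_measurable A that)
    have "\<bar>t - (\<integral>x. (\<Prod>i<n. freq (A i) x) \<partial>L)\<bar> = \<bar>\<integral>x. (\<Prod>i<n. avg (A i) (S i) x) - (\<Prod>i<n. freq (A i) x) \<partial>L\<bar>"
      using int_a int_f by (simp add: E)
    also have "\<dots> \<le> (\<integral>x. \<bar>(\<Prod>i<n. avg (A i) (S i) x) - (\<Prod>i<n. freq (A i) x)\<bar> \<partial>L)" by (rule integral_abs_bound)
    also have "\<dots> \<le> (\<integral>x. (\<Sum>i<n. \<bar>avg (A i) (S i) x - freq (A i) x\<bar>) \<partial>L)"
    proof (rule integral_mono_AE)
      have "AE x in L. \<forall>i\<in>{..<n}. 0 \<le> freq (A i) x \<and> freq (A i) x \<le> 1"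
        using A by (intro AE_finite_allI AE_freq_01) auto
      then show "AE x in L. \<bar>(\<Prod>i<n. avg (A i) (S i) x) - (\<Prod>i<n. freq (A i) x)\<bar> \<le> (\<Sum>i<n. \<bar>avg (A i) (S i) x - freq (A i) x\<bar>)"
      proof eventually_elim
        fix x assume *: "\<forall>i\<in>{..<n}. 0 \<le> freq (A i) x \<and> freq (A i) x \<le> 1"
        show "\<bar>(\<Prod>i<n. avg (A i) (S i) x) - (\<Prod>i<n. freq (A i) x)\<bar> \<le> (\<Sum>i<n. \<bar>avg (A i) (S i) x - freq (A i) x\<bar>)"
          \<comment> \<open>For factors of modulus at most 1, two products differ by at most the sum
            of the differences of their factors.\<close>
          using norm_prod_diff[of "{..<n}" "\<lambda>i. avg (A i) (S i) x" "\<lambda>i. freq (A i) x"] * by (simp add: abs_avg_le)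
      qed
      show "integrable L (\<lambda>x. \<bar>(\<Prod>i<n. avg (A i) (S i) x) - (\<Prod>i<n. freq (A i) x)\<bar>)" using int_a int_f by simp
      show "integrable L (\<lambda>x. \<Sum>i<n. \<bar>avg (A i) (S i) x - freq (A i) x\<bar>)"
        using int_d by (intro Bochner_Integration.integrable_sum) auto
    qed
    also have "\<dots> = (\<Sum>i<n. \<integral>x. \<bar>avg (A i) (S i) x - freq (A i) x\<bar> \<partial>L)"
      using int_d by (intro Bochner_Integration.integral_sum) auto
    also have "\<dots> \<le> (\<Sum>i<n. sqrt (2 / real (Suc N)))"
    proof (rule sum_mono)
      fix i assume "i \<in> {..<n}"
      then show "(\<integral>x. \<bar>avg (A i) (S i) x - freq (A i) x\<bar> \<partial>L) \<le> sqrt (2 / real (Suc N))"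
        using avg_freq_L1[OF A S(1) S(3), of i i] S(2)[of i] by simp
    qed
    finally show ?thesis by simp
  qed
  have "(\<lambda>N. n * sqrt (2 * inverse (real (Suc N)))) \<longlonglongrightarrow> n * sqrt (2 * 0)"
    by (intro tendsto_intros LIMSEQ_inverse_real_of_nat)
  then have "\<bar>t - (\<integral>x. (\<Prod>i<n. freq (A i) x) \<partial>L)\<bar> \<le> n * sqrt (2 * 0)"
    using est by (intro LIMSEQ_le_const) (auto simp: divide_inverse)
  then show ?thesis by (simp add: t_def)
qed

end

text \<open>Joint distribution functions are all that is computed for the directing law. The boxes
  are closed under intersection, and letting the other bounds run through the naturals isolates a
  single coordinate, so they generate.\<close>

lemma power_borel_eqI:
  fixes P Q :: "(nat \<Rightarrow> real) measure"
  assumes P: "P \<in> space (prob_algebra (power_space n borel))" and Q: "Q \<in> space (prob_algebra (power_space n borel))"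
    and eq: "\<And>t. emeasure P (PiE {..<n} (\<lambda>i. {..t i})) = emeasure Q (PiE {..<n} (\<lambda>i. {..t i}))"
  shows "P = Q"
proof -
  define \<Omega> where "\<Omega> = PiE {..<n} (\<lambda>_. UNIV :: real set)"
  define E where "E = range (\<lambda>t. PiE {..<n} (\<lambda>i. {..t i :: real}))"
  have E_sub: "E \<subseteq> Pow \<Omega>" by (auto simp: E_def \<Omega>_def)
  have sp: "space (power_space n (borel :: real measure)) = \<Omega>" by (simp add: power_space_def space_PiM \<Omega>_def)
  have sS: "space (sigma \<Omega> E) = \<Omega>" "sets (sigma \<Omega> E) = sigma_sets \<Omega> E"
    using E_sub by (auto simp: space_measure_of)
  have sets_eq: "sets (power_space n (borel :: real measure)) = sigma_sets \<Omega> E"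
  proof
    show "sigma_sets \<Omega> E \<subseteq> sets (power_space n (borel :: real measure))"
      unfolding sp[symmetric]
    proof (rule sets.sigma_sets_subset, safe)
      fix A assume "A \<in> E"
      then show "A \<in> sets (power_space n borel)" by (auto simp: E_def power_space_def intro!: sets_PiM_I_finite)
    qed
    have "sets (\<Pi>\<^sub>M i\<in>{..<n}. (borel :: real measure)) \<subseteq> sets (sigma \<Omega> E)"
    proof (rule sets_PiM_in_sets)
      fix i and A :: "real set" assume i: "i \<in> {..<n}" and A: "A \<in> sets borel"
      have "(\<lambda>x. x i) \<in> borel_measurable (sigma \<Omega> E)"
        unfolding borel_measurable_iff_le sS
      proof
        fix t :: real
        have "{x \<in> \<Omega>. x i \<le> t} = (\<Union>k::nat. PiE {..<n} (\<lambda>j. {..if j = i then t else real k}))"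
        proof (intro set_eqI iffI)
          fix x assume x: "x \<in> {x \<in> \<Omega>. x i \<le> t}"
          obtain k :: nat where k: "Max (insert 0 (x ` {..<n})) \<le> real k" using real_arch_simple by blast
          have "x j \<le> real k" if "j < n" for j
            using k that by (intro order_trans[OF Max_ge k]) auto
          then have "x \<in> PiE {..<n} (\<lambda>j. {..if j = i then t else real k})" using x by (auto simp: \<Omega>_def PiE_iff)
          then show "x \<in> (\<Union>k::nat. PiE {..<n} (\<lambda>j. {..if j = i then t else real k}))" by blast
        next
          fix x assume "x \<in> (\<Union>k::nat. PiE {..<n} (\<lambda>j. {..if j = i then t else real k}))"
          then obtain k :: nat where x: "x \<in> PiE {..<n} (\<lambda>j. {..if j = i then t else real k})" by blast
          from PiE_mem[OF x i] x show "x \<in> {x \<in> \<Omega>. x i \<le> t}" by (auto simp: \<Omega>_def PiE_iff)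
        qed
        also have "\<dots> \<in> sigma_sets \<Omega> E"
        proof (rule sigma_sets.Union)
          fix k :: nat
          show "PiE {..<n} (\<lambda>j. {..if j = i then t else real k}) \<in> sigma_sets \<Omega> E"
            by (rule sigma_sets.Basic) (simp add: E_def)
        qed
        finally show "{x \<in> \<Omega>. x i \<le> t} \<in> sigma_sets \<Omega> E" .
      qed
      from measurable_sets[OF this A] show "{x \<in> space (sigma \<Omega> E). x i \<in> A} \<in> sets (sigma \<Omega> E)"
        by (simp add: vimage_def Int_def conj_commute)
    qed (unfold sS, simp add: \<Omega>_def)
    then show "sets (power_space n (borel :: real measure)) \<subseteq> sigma_sets \<Omega> E" by (simp add: power_space_def sS)
  qed
  show ?thesis
  proof (rule measure_eqI_generator_eq[where \<Omega> = \<Omega> and E = E and A = "\<lambda>k. PiE {..<n} (\<lambda>_. {..real k})"])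
    show "Int_stable E"
    proof (rule Int_stableI)
      fix a b assume "a \<in> E" "b \<in> E"
      then obtain t u where "a = PiE {..<n} (\<lambda>i. {..t i})" "b = PiE {..<n} (\<lambda>i. {..u i})" by (auto simp: E_def)
      then have "a \<inter> b = PiE {..<n} (\<lambda>i. {..t i} \<inter> {..u i})" by (simp only: PiE_Int)
      moreover have "{..t i} \<inter> {..u i} = {..min (t i) (u i)}" for i by auto
      ultimately have "a \<inter> b = PiE {..<n} (\<lambda>i. {..min (t i) (u i)})" by (simp only:)
      then show "a \<inter> b \<in> E" by (auto simp: E_def)
    qed
    show "emeasure P a = emeasure Q a" if "a \<in> E" for a using that eq by (auto simp: E_def)
    show "sets P = sigma_sets \<Omega> E" "sets Q = sigma_sets \<Omega> E"
      using prob_algebraD(2)[OF P] prob_algebraD(2)[OF Q] sets_eq by auto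
    show "range (\<lambda>k. PiE {..<n} (\<lambda>_. {..real k})) \<subseteq> E" by (auto simp: E_def)
    show "(\<Union>k. PiE {..<n} (\<lambda>_. {..real k})) = \<Omega>"
    proof (intro set_eqI iffI)
      fix x assume x: "x \<in> \<Omega>"
      obtain k :: nat where k: "Max (insert 0 (x ` {..<n})) \<le> real k" using real_arch_simple by blast
      have "x j \<le> real k" if "j < n" for j
        using k that by (intro order_trans[OF Max_ge k]) auto
      then have "x \<in> PiE {..<n} (\<lambda>_. {..real k})" using x by (auto simp: \<Omega>_def PiE_iff)
      then show "x \<in> (\<Union>k. PiE {..<n} (\<lambda>_. {..real k}))" by blast
    qed (auto simp: \<Omega>_def PiE_iff)
    show "emeasure P (PiE {..<n} (\<lambda>_. {..real k})) \<noteq> \<infinity>" for k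
      using finite_measure.emeasure_finite[OF prob_space.finite_measure[OF prob_algebraD(1)[OF P]]] by simp
  qed (rule E_sub)
qed

lemma power_space_distr:
  assumes \<alpha>: "\<alpha> \<in> space (prob_algebra X)" and f: "f \<in> X \<rightarrow>\<^sub>M Y"
  shows "power_space n (distr \<alpha> Y f) = distr (power_space n \<alpha>) (power_space n Y) (\<lambda>x. \<lambda>i\<in>{..<n}. f (x i))"
proof -
  note P = power_space_prob_algebra[OF \<alpha>, of n]
  have F: "(\<lambda>x. \<lambda>i\<in>{..<n}. f (x i)) \<in> power_space n X \<rightarrow>\<^sub>M power_space n Y"
    unfolding power_space_def by (intro measurable_restrict measurable_compose[OF measurable_coord f]) simp
  have mP: "g \<in> power_space n \<alpha> \<rightarrow>\<^sub>M N \<longleftrightarrow> g \<in> power_space n X \<rightarrow>\<^sub>M N" for g and N :: "'c measure"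
    by (rule arg_cong[OF measurable_cong_sets[OF prob_algebraD(2)[OF P] refl]])
  note \<beta> = distr_prob_algebra[OF \<alpha> f]
  note P' = power_space_prob_algebra[OF \<beta>, of n]
  show ?thesis
  proof (rule PiM_prob_eqI[of "{..<n}" _ "\<lambda>_. Y"])
    show "prob_space (power_space n (distr \<alpha> Y f))" by (rule prob_algebraD[OF P'])
    show "sets (power_space n (distr \<alpha> Y f)) = sets (\<Pi>\<^sub>M i\<in>{..<n}. Y)"
      using prob_algebraD(2)[OF P'] by (simp add: power_space_def)
    show "sets (distr (power_space n \<alpha>) (power_space n Y) (\<lambda>x. \<lambda>i\<in>{..<n}. f (x i))) = sets (\<Pi>\<^sub>M i\<in>{..<n}. Y)"
      by (simp add: power_space_def)
    fix A assume A: "\<And>i. i \<in> {..<n} \<Longrightarrow> A i \<in> sets Y"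
    have f': "f \<in> \<alpha> \<rightarrow>\<^sub>M Y" using f by (simp add: measurable_cong_sets[OF prob_algebraD(2)[OF \<alpha>] refl])
    have "emeasure (power_space n (distr \<alpha> Y f)) (PiE {..<n} A) = (\<Prod>i<n. emeasure (distr \<alpha> Y f) (A i))"
      using A by (intro emeasure_power_space[OF \<beta>]) auto
    also have "\<dots> = (\<Prod>i<n. emeasure \<alpha> (f -` A i \<inter> space X))"
      using A prob_algebraD(3)[OF \<alpha>] by (intro prod.cong refl) (simp add: emeasure_distr[OF f'])
    also have "\<dots> = emeasure (power_space n \<alpha>) (PiE {..<n} (\<lambda>i. f -` A i \<inter> space X))"
      using A f by (intro emeasure_power_space[OF \<alpha>, symmetric]) (auto intro: measurable_sets)
    also have "PiE {..<n} (\<lambda>i. f -` A i \<inter> space X) =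
        (\<lambda>x. \<lambda>i\<in>{..<n}. f (x i)) -` (PiE {..<n} A) \<inter> space (power_space n \<alpha>)"
      unfolding prob_algebraD(3)[OF P] by (auto simp: power_space_def space_PiM PiE_iff)
    also have "emeasure (power_space n \<alpha>) \<dots> =
        emeasure (distr (power_space n \<alpha>) (power_space n Y) (\<lambda>x. \<lambda>i\<in>{..<n}. f (x i))) (PiE {..<n} A)"
      using F A by (intro emeasure_distr[symmetric]) (auto simp: mP power_space_def[of n Y] intro!: sets_PiM_I_finite)
    finally show "emeasure (power_space n (distr \<alpha> Y f)) (PiE {..<n} A) =
        emeasure (distr (power_space n \<alpha>) (power_space n Y) (\<lambda>x. \<lambda>i\<in>{..<n}. f (x i))) (PiE {..<n} A)" .
  qed simp
qed

subsection \<open>De Finetti's theorem\<close>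

locale coded_exchangeable = unit_coded X e r + exchangeable X L
  for X :: "'a measure" and e r L

context unit_coded
begin

definition half_line :: "real \<Rightarrow> 'a set" where "half_line t = {u \<in> space X. e u \<le> t}"

definition directing_values :: "(nat \<Rightarrow> 'a) \<Rightarrow> nat \<Rightarrow> real" where
  "directing_values x j = freq (half_line (ratq j)) x"

definition directing :: "(nat \<Rightarrow> 'a) \<Rightarrow> 'a measure" where
  "directing x = decode (directing_values x)"

lemma half_line_sets: "half_line t \<in> sets X"
  unfolding half_line_def by measurable

lemma directing_values_measurable: "directing_values \<in> seq_space X \<rightarrow>\<^sub>M borel"
proof (rule measurable_coordinatewise_then_product)
  show "(\<lambda>x. directing_values x j) \<in> borel_measurable (seq_space X)" for j
    unfolding directing_values_def by (rule freq_measurable_seq[OF half_line_sets])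
qed

lemma directing_measurable: "directing \<in> seq_space X \<rightarrow>\<^sub>M prob_algebra X"
  unfolding directing_def using directing_values_measurable decode_measurable by (rule measurable_compose)

lemma directing_law_measurable: "(\<lambda>x. quantile_law (directing_values x)) \<in> seq_space X \<rightarrow>\<^sub>M prob_algebra borel"
  using directing_values_measurable quantile_law_measurable by (rule measurable_compose)

end

context coded_exchangeable
begin

text \<open>Each property holds for the finite averages and passes to limits; only countably many
  half-lines are involved, so one null set serves them all.\<close>

lemma AE_cdf_values: "AE x in L. cdf_values (directing_values x)"
proof -
  have "AE x in L. \<forall>j. (\<lambda>k. avg (half_line (ratq j)) {..<4 ^ k} x) \<longlonglongrightarrow> directing_values x j"
    unfolding directing_values_def AE_all_countable by (intro allI AE_freq half_line_sets)
  then show ?thesis using AE_space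
  proof eventually_elim
    fix x assume lim: "\<forall>j. (\<lambda>k. avg (half_line (ratq j)) {..<4 ^ k} x) \<longlonglongrightarrow> directing_values x j"
      and "x \<in> space L"
    then have x: "x i \<in> space X" for i using prob_algebraD(3)[OF L] by (auto simp: space_PiM)
    show "cdf_values (directing_values x)"
      unfolding cdf_values_def
    proof (intro conjI allI impI)
      fix i j assume "ratq i \<le> ratq j"
      then have "avg (half_line (ratq i)) {..<4 ^ k} x \<le> avg (half_line (ratq j)) {..<4 ^ k} x" for k
        unfolding avg_def by (intro divide_right_mono sum_mono) (auto simp: half_line_def indicator_def)
      then show "directing_values x i \<le> directing_values x j"
        using lim by (intro LIMSEQ_le[OF spec[OF lim] spec[OF lim]]) auto
    next
      fix j show "0 \<le> directing_values x j"
        by (rule LIMSEQ_le_const[OF spec[OF lim]]) (use avg_01 in auto)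
      show "directing_values x j \<le> 1"
        by (rule LIMSEQ_le_const2[OF spec[OF lim]]) (use avg_01 in auto)
    next
      fix j assume "ratq j < 0"
      then have "half_line (ratq j) = {}" using e01 by (force simp: half_line_def)
      then have "(\<lambda>k. 0) \<longlonglongrightarrow> directing_values x j" using spec[OF lim, of j] by (simp add: avg_def)
      then show "directing_values x j = 0" by (simp add: LIMSEQ_const_iff)
    next
      fix j assume "1 \<le> ratq j"
      then have "half_line (ratq j) = space X" using e01 by (force simp: half_line_def)
      then have "(\<lambda>k. 1) \<longlonglongrightarrow> directing_values x j" using spec[OF lim, of j] by (simp add: avg_def x)
      then show "directing_values x j = 1" by (simp add: LIMSEQ_const_iff)
    qed
  qed
qed

text \<open>At rational thresholds this is \<open>integral_prod_freq\<close>. When the rationals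
  decrease to the \<open>t i\<close>, dominated convergence takes care of the left side and
  continuity from above of the right side.\<close>

lemma integral_prod_directing_cdf:
  "(\<integral>x. (\<Prod>i<n. measure (quantile_law (directing_values x)) {..t i}) \<partial>L) =
    measure L {x \<in> space L. \<forall>i<n. x i \<in> half_line (t i)}"
proof -
  have "\<forall>i. \<exists>s. (\<forall>m. t i < ratq (s m)) \<and> (\<forall>m. ratq (s (Suc m)) \<le> ratq (s m)) \<and> (\<lambda>m. ratq (s m)) \<longlonglongrightarrow> t i"
    using ratq_seq_above by simp
  from choice[OF this] obtain s where s: "\<And>i m. t i < ratq (s i m)" "\<And>i m. ratq (s i (Suc m)) \<le> ratq (s i m)"
    "\<And>i. (\<lambda>m. ratq (s i m)) \<longlonglongrightarrow> t i" by auto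
  let ?f = "\<lambda>m x. \<Prod>i<n. directing_values x (s i m)"
  let ?g = "\<lambda>x. \<Prod>i<n. measure (quantile_law (directing_values x)) {..t i}"
  define A where "A m = {x \<in> space L. \<forall>i<n. x i \<in> half_line (ratq (s i m))}" for m
  have "(\<lambda>m. \<integral>x. ?f m x \<partial>L) \<longlonglongrightarrow> (\<integral>x. ?g x \<partial>L)"
  proof (rule integral_dominated_convergence[where w = "\<lambda>_. 1"])
    show "AE x in L. (\<lambda>m. ?f m x) \<longlonglongrightarrow> ?g x"
      using AE_cdf_values by eventually_elim (intro tendsto_prod cdf_values_limit s)
    show "AE x in L. norm (?f m x) \<le> 1" for m
      using AE_cdf_values by eventually_elim (auto simp: abs_prod cdf_values_def intro!: prod_le_1)
    show "?f m \<in> borel_measurable L" for m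
      unfolding directing_values_def by (intro borel_measurable_prod freq_measurable half_line_sets)
    have "(\<lambda>x. measure (quantile_law (directing_values x)) {..u}) \<in> borel_measurable L" for u
      unfolding measurable_L using directing_law_measurable measurable_measure_prob_algebra
      by (rule measurable_compose) simp
    then show "?g \<in> borel_measurable L" by (intro borel_measurable_prod)
  qed simp
  moreover have "(\<integral>x. ?f m x \<partial>L) = measure L (A m)" for m
    unfolding directing_values_def A_def by (rule integral_prod_freq[OF half_line_sets])
  moreover have "(\<lambda>m. measure L (A m)) \<longlonglongrightarrow> measure L (\<Inter>m. A m)"
  proof (rule finite_Lim_measure_decseq)
    have "{x \<in> space L. \<forall>i\<in>{..<n}. x i \<in> half_line (u i)} \<in> events" for u
    proof (intro sets.sets_Collect_finite_All)
      fix i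
      have "(\<lambda>x. x i) \<in> L \<rightarrow>\<^sub>M X" unfolding measurable_L by (rule measurable_coord) simp
      from measurable_sets[OF this half_line_sets[of "u i"]] show "{x \<in> space L. x i \<in> half_line (u i)} \<in> events"
        by (simp add: vimage_def Int_def conj_commute)
    qed simp
    from this[of "\<lambda>i. ratq (s i m)" for m] have "A m \<in> events" for m
      unfolding A_def Ball_def lessThan_iff .
    then show "range A \<subseteq> events" by blast
    show "decseq A"
      unfolding decseq_Suc_iff A_def half_line_def using order_trans[OF _ s(2)] by blast
  qed
  moreover have "(\<Inter>m. A m) = {x \<in> space L. \<forall>i<n. x i \<in> half_line (t i)}"
  proof (intro set_eqI iffI)
    fix x assume x: "x \<in> (\<Inter>m. A m)"
    have "e (x i) \<le> t i \<and> x i \<in> space X" if "i < n" for i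
    proof -
      have *: "e (x i) \<le> ratq (s i m)" "x i \<in> space X" for m
        using x that by (auto simp: A_def half_line_def)
      then show ?thesis using LIMSEQ_le_const[OF s(3)[of i], of "e (x i)"] by blast
    qed
    then show "x \<in> {x \<in> space L. \<forall>i<n. x i \<in> half_line (t i)}" using x by (auto simp: A_def half_line_def)
  next
    fix x assume x: "x \<in> {x \<in> space L. \<forall>i<n. x i \<in> half_line (t i)}"
    then show "x \<in> (\<Inter>m. A m)"
      using order_trans[OF _ less_imp_le[OF s(1)]] unfolding A_def half_line_def by blast
  qed
  ultimately show ?thesis using LIMSEQ_unique[of "\<lambda>m. measure L (A m)"] by simp
qed

text \<open>The identity is proved for the coded sequences by comparing joint distribution
  functions, then carried back to X by \<open>r\<close>.\<close>

lemma bind_power_directing: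
  "L \<bind> (\<lambda>x. power_space n (directing x)) = distr L (power_space n X) (\<lambda>x. restrict x {..<n})"
proof -
  let ?V = "\<lambda>x. quantile_law (directing_values x)"
  have V: "?V \<in> seq_space X \<rightarrow>\<^sub>M prob_algebra borel" by (rule directing_law_measurable)
  have pV: "(\<lambda>x. power_space n (?V x)) \<in> seq_space X \<rightarrow>\<^sub>M prob_algebra (power_space n borel)"
    using V power_space_kernel by (rule measurable_compose)
  have E: "(\<lambda>x. \<lambda>i\<in>{..<n}. e (x i)) \<in> seq_space X \<rightarrow>\<^sub>M power_space n borel"
    unfolding power_space_def by (intro measurable_restrict measurable_compose[OF measurable_coord e]) simp
  have R: "(\<lambda>y. \<lambda>i\<in>{..<n}. r (y i)) \<in> power_space n borel \<rightarrow>\<^sub>M power_space n X"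
    unfolding power_space_def by (intro measurable_restrict measurable_compose[OF measurable_coord r]) simp
  have "L \<bind> (\<lambda>x. power_space n (?V x)) = distr L (power_space n borel) (\<lambda>x. \<lambda>i\<in>{..<n}. e (x i))"
  proof (rule power_borel_eqI)
    show "L \<bind> (\<lambda>x. power_space n (?V x)) \<in> space (prob_algebra (power_space n borel))"
      by (rule bind_prob_algebra[OF L pV])
    show "distr L (power_space n borel) (\<lambda>x. \<lambda>i\<in>{..<n}. e (x i)) \<in> space (prob_algebra (power_space n borel))"
      by (rule distr_prob_algebra[OF L E])
    fix t :: "nat \<Rightarrow> real"
    let ?A = "PiE {..<n} (\<lambda>i. {..t i})"
    have A: "?A \<in> sets (power_space n borel)" unfolding power_space_def by (intro sets_PiM_I_finite) auto
    have m: "(\<lambda>x. \<Prod>i<n. measure (?V x) {..t i}) \<in> borel_measurable L"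
      unfolding measurable_L
      by (intro borel_measurable_prod measurable_compose[OF V measurable_measure_prob_algebra]) simp
    have Vx: "?V x \<in> space (prob_algebra borel)" if "x \<in> space L" for x
      using that prob_algebraD(3)[OF L] measurable_space[OF V] by simp
    have "emeasure (L \<bind> (\<lambda>x. power_space n (?V x))) ?A = (\<integral>\<^sup>+x. emeasure (power_space n (?V x)) ?A \<partial>L)"
      by (rule emeasure_bind_prob_algebra[OF L pV A])
    also have "\<dots> = (\<integral>\<^sup>+x. ennreal (\<Prod>i<n. measure (?V x) {..t i}) \<partial>L)"
    proof (rule nn_integral_cong)
      fix x assume x: "x \<in> space L"
      interpret V: prob_space "?V x" by (rule prob_algebraD(1)[OF Vx[OF x]])
      show "emeasure (power_space n (?V x)) ?A = ennreal (\<Prod>i<n. measure (?V x) {..t i})"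
        by (subst emeasure_power_space[OF Vx[OF x]]) (simp_all add: V.emeasure_eq_measure prod_ennreal)
    qed
    also have "\<dots> = ennreal (\<integral>x. (\<Prod>i<n. measure (?V x) {..t i}) \<partial>L)"
    proof (rule nn_integral_eq_integral)
      show "integrable L (\<lambda>x. \<Prod>i<n. measure (?V x) {..t i})"
      proof (rule integrable_const_bound[where B = 1, OF _ m], rule AE_I2)
        fix x assume x: "x \<in> space L"
        show "norm (\<Prod>i<n. measure (?V x) {..t i}) \<le> 1"
          using prob_space.prob_le_1[OF prob_algebraD(1)[OF Vx[OF x]]] by (auto simp: abs_prod intro!: prod_le_1)
      qed
    qed (simp add: prod_nonneg)
    also have "\<dots> = ennreal (measure L {x \<in> space L. \<forall>i<n. x i \<in> half_line (t i)})"
      by (simp only: integral_prod_directing_cdf)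
    also have "{x \<in> space L. \<forall>i<n. x i \<in> half_line (t i)} = (\<lambda>x. \<lambda>i\<in>{..<n}. e (x i)) -` ?A \<inter> space L"
      using prob_algebraD(3)[OF L] by (auto simp: half_line_def PiE_iff space_PiM)
    also have "ennreal (measure L \<dots>) = emeasure (distr L (power_space n borel) (\<lambda>x. \<lambda>i\<in>{..<n}. e (x i))) ?A"
      using E A by (simp add: emeasure_distr measurable_L emeasure_eq_measure)
    finally show "emeasure (L \<bind> (\<lambda>x. power_space n (?V x))) ?A =
        emeasure (distr L (power_space n borel) (\<lambda>x. \<lambda>i\<in>{..<n}. e (x i))) ?A" .
  qed
  note * = this
  have "L \<bind> (\<lambda>x. power_space n (directing x)) =
      L \<bind> (\<lambda>x. distr (power_space n (?V x)) (power_space n X) (\<lambda>y. \<lambda>i\<in>{..<n}. r (y i)))"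
    by (rule bind_cong_space[OF L]) (simp add: directing_def decode_def power_space_distr[OF measurable_space[OF V] r])
  also have "\<dots> = distr (L \<bind> (\<lambda>x. power_space n (?V x))) (power_space n X) (\<lambda>y. \<lambda>i\<in>{..<n}. r (y i))"
    by (rule distr_bind_kernel[OF L pV R, symmetric])
  also have "\<dots> = distr L (power_space n X) ((\<lambda>y. \<lambda>i\<in>{..<n}. r (y i)) \<circ> (\<lambda>x. \<lambda>i\<in>{..<n}. e (x i)))"
    unfolding * by (rule distr_distr[OF R]) (simp add: measurable_L E)
  also have "\<dots> = distr L (power_space n X) (\<lambda>x. restrict x {..<n})"
  proof (rule distr_cong[OF refl refl])
    fix x assume "x \<in> space L"
    then have "x i \<in> space X" for i using prob_algebraD(3)[OF L] by (auto simp: space_PiM)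
    then show "((\<lambda>y. \<lambda>i\<in>{..<n}. r (y i)) \<circ> (\<lambda>x. \<lambda>i\<in>{..<n}. e (x i))) x = restrict x {..<n}"
      by (auto simp: fun_eq_iff re)
  qed
  finally show ?thesis .
qed

end

theorem de_finetti:
  assumes X: "standard_borel X"
    and Q: "\<And>n. Q n \<in> Z \<rightarrow>\<^sub>M prob_algebra (power_space n X)"
    and cons: "\<And>n z. z \<in> space Z \<Longrightarrow> distr (Q (Suc n) z) (power_space n X) (\<lambda>x. restrict x {..<n}) = Q n z"
    and sym: "\<And>n z p. z \<in> space Z \<Longrightarrow> p permutes {..<n} \<Longrightarrow> distr (Q n z) (power_space n X) (\<lambda>x. x \<circ> p) = Q n z"
  shows "\<exists>h\<in>Z \<rightarrow>\<^sub>M prob_algebra (prob_algebra X). \<forall>z\<in>space Z. \<forall>n. h z \<bind> power_space n = Q n z"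
proof (cases "space X = {}")
  case True
  \<comment> \<open>Otherwise some \<open>Q 1 z\<close> would be a probability measure on an empty
    space.\<close>
  have "space Z = {}"
  proof (rule ccontr)
    assume "space Z \<noteq> {}"
    then obtain z where "z \<in> space Z" by blast
    then have "Q 1 z \<in> space (prob_algebra (power_space 1 X))" by (rule measurable_space[OF Q])
    then have "space (power_space 1 X) \<noteq> {}" using prob_algebraD(3) prob_space.not_empty[OF prob_algebraD(1)] by metis
    then show False using True by (auto simp: power_space_def space_PiM PiE_iff)
  qed
  then show ?thesis by (intro bexI[of _ "\<lambda>_. undefined"]) (auto simp: measurable_def)
next
  case False
  obtain e r where "unit_coded X e r" using unit_coded_if_standard_borel[OF X False] .
  then interpret unit_coded X e r .
  have Qz: "Q n z \<in> space (prob_algebra (power_space n X))" if "z \<in> space Z" for n z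
    using measurable_space[OF Q that] .
  have "\<forall>z\<in>space Z. \<exists>L. L \<in> space (prob_algebra (seq_space X)) \<and>
      (\<forall>n. distr L (power_space n X) (\<lambda>x. restrict x {..<n}) = Q n z)"
  proof
    fix z assume z: "z \<in> space Z"
    have "\<exists>L\<in>space (prob_algebra (seq_space X)). \<forall>n. distr L (power_space n X) (\<lambda>x. restrict x {..<n}) = Q n z"
      by (rule kolmogorov_sequence[where Q = "\<lambda>n. Q n z", OF Qz[OF z] cons[OF z]])
    then show "\<exists>L. L \<in> space (prob_algebra (seq_space X)) \<and>
      (\<forall>n. distr L (power_space n X) (\<lambda>x. restrict x {..<n}) = Q n z)" by blast
  qed
  from bchoice[OF this] obtain \<Lambda> where
    \<Lambda>: "\<And>z. z \<in> space Z \<Longrightarrow> \<Lambda> z \<in> space (prob_algebra (seq_space X))"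
    and marg: "\<And>z n. z \<in> space Z \<Longrightarrow> distr (\<Lambda> z) (power_space n X) (\<lambda>x. restrict x {..<n}) = Q n z"
    by blast
  have restr: "(\<lambda>x. restrict x {..<n}) \<in> \<Lambda> z \<rightarrow>\<^sub>M power_space n X" if "z \<in> space Z" for n z
    unfolding measurable_cong_sets[OF prob_algebraD(2)[OF \<Lambda>[OF that]] refl] power_space_def
    by (rule restrict_seq_measurable) simp
  \<comment> \<open>The extensions \<open>\<Lambda> z\<close> are chosen point by point, yet on each
    cylinder they take the value of some \<open>Q n z\<close>, with n independent of z; this settles
    measurability.\<close>
  have \<Lambda>_kernel: "\<Lambda> \<in> Z \<rightarrow>\<^sub>M prob_algebra (seq_space X)"
  proof (rule measurable_prob_algebra_generated[OF sets_PiM Int_stable_prod_algebra prod_algebra_sets_into_space])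
    show "prob_space (\<Lambda> z)" "sets (\<Lambda> z) = sets (seq_space X)" if "z \<in> space Z" for z
      using prob_algebraD[OF \<Lambda>[OF that]] by auto
    fix A assume "A \<in> prod_algebra UNIV (\<lambda>_::nat. X)"
    then obtain J F where A: "A = prod_emb UNIV (\<lambda>_. X) J (PiE J F)" and J: "finite J"
      and F: "\<And>i. i \<in> J \<Longrightarrow> F i \<in> sets X"
      by (auto elim!: prod_algebraE)
    obtain n where n: "J \<subseteq> {..<n}" using J finite_nat_iff_bounded by blast
    let ?B = "prod_emb {..<n} (\<lambda>_. X) J (PiE J F)"
    have B: "?B \<in> sets (power_space n X)" unfolding power_space_def using J n F by (intro sets_PiM_I) auto
    have "emeasure (\<Lambda> z) A = emeasure (Q n z) ?B" if z: "z \<in> space Z" for z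
    proof -
      have "(\<lambda>x. restrict x {..<n}) -` ?B \<inter> space (\<Lambda> z) = A"
      proof (rule set_eqI)
        fix x :: "nat \<Rightarrow> 'a"
        have "restrict (restrict x {..<n}) J = restrict x J" using n by (simp add: Int_absorb1)
        then show "x \<in> (\<lambda>x. restrict x {..<n}) -` ?B \<inter> space (\<Lambda> z) \<longleftrightarrow> x \<in> A"
          unfolding A prob_algebraD(3)[OF \<Lambda>[OF z]] vimage_eq Int_iff prod_emb_iff by (auto simp: space_PiM PiE_iff)
      qed
      then show ?thesis unfolding marg[OF z, symmetric] by (simp add: emeasure_distr[OF restr[OF z] B])
    qed
    moreover have "(\<lambda>z. emeasure (Q n z) ?B) \<in> borel_measurable Z"
      using Q emeasure_measurable_prob_algebra[OF B] by (rule measurable_compose)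
    ultimately show "(\<lambda>z. emeasure (\<Lambda> z) A) \<in> borel_measurable Z" by (simp cong: measurable_cong)
  qed
  have exch: "coded_exchangeable X e r (\<Lambda> z)" if z: "z \<in> space Z" for z
  proof (intro coded_exchangeable.intro exchangeable.intro)
    show "unit_coded X e r" by (rule unit_coded_axioms)
    show "\<Lambda> z \<in> space (prob_algebra (seq_space X))" by (rule \<Lambda>[OF z])
    fix n and f :: "nat \<Rightarrow> nat" and A :: "nat \<Rightarrow> 'a set"
    assume f: "inj_on f {..<n}" and A: "\<And>i. i < n \<Longrightarrow> A i \<in> sets X"
    obtain k where k: "f ` {..<n} \<subseteq> {..<k}" using finite_nat_iff_bounded[of "f ` {..<n}"] by auto
    define N where "N = max n k"
    have N: "n \<le> N" "\<And>i. i < n \<Longrightarrow> f i < N" using k by (auto simp: N_def less_max_iff_disj)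
    \<comment> \<open>At a level that contains both the indices below n and their values under
      \<open>f\<close>, the injection is part of a permutation, to which \<open>sym\<close>
      applies.\<close>
    from inj_on_extend_permutes[OF f N(2,1)] obtain p where p: "p permutes {..<N}" "\<And>i. i < n \<Longrightarrow> p i = f i" by auto
    define B where "B g = {y \<in> space (power_space N X). \<forall>i\<in>{..<n}. y (g i) \<in> A i}" for g :: "nat \<Rightarrow> nat"
    have B: "B g \<in> sets (power_space N X)" if g: "\<And>i. i < n \<Longrightarrow> g i < N" for g
      unfolding B_def
    proof (intro sets.sets_Collect_finite_All)
      fix i assume i: "i \<in> {..<n}"
      have "(\<lambda>y. y (g i)) \<in> power_space N X \<rightarrow>\<^sub>M X" unfolding power_space_def
        using g i by (intro measurable_coord) auto
      from measurable_sets[OF this A] i show "{y \<in> space (power_space N X). y (g i) \<in> A i} \<in> sets (power_space N X)"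
        by (simp add: vimage_def Int_def conj_commute)
    qed simp
    have L_B: "measure (\<Lambda> z) {x \<in> space (\<Lambda> z). \<forall>i<n. x (g i) \<in> A i} = measure (Q N z) (B g)"
      if g: "\<And>i. i < n \<Longrightarrow> g i < N" for g
    proof -
      have "measure (Q N z) (B g) = measure (\<Lambda> z) ((\<lambda>x. restrict x {..<N}) -` B g \<inter> space (\<Lambda> z))"
        unfolding marg[OF z, symmetric] by (rule measure_distr[OF restr[OF z] B[OF g]])
      also have "(\<lambda>x. restrict x {..<N}) -` B g \<inter> space (\<Lambda> z) = {x \<in> space (\<Lambda> z). \<forall>i<n. x (g i) \<in> A i}"
        using g measurable_space[OF restr[OF z]] by (auto simp: B_def)
      finally show ?thesis ..
    qed
    have "measure (\<Lambda> z) {x \<in> space (\<Lambda> z). \<forall>i<n. x (f i) \<in> A i} = measure (Q N z) (B f)" by (rule L_B[OF N(2)])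
    also have "B f = (\<lambda>y. y \<circ> p) -` B (\<lambda>i. i) \<inter> space (Q N z)"
      using p(2) measurable_space[OF permute_measurable[OF p(1)]] prob_algebraD(3)[OF Qz[OF z]] by (auto simp: B_def)
    also have "measure (Q N z) \<dots> = measure (distr (Q N z) (power_space N X) (\<lambda>y. y \<circ> p)) (B (\<lambda>i. i))"
    proof (rule measure_distr[symmetric])
      show "(\<lambda>y. y \<circ> p) \<in> Q N z \<rightarrow>\<^sub>M power_space N X"
        using permute_measurable[OF p(1)] by (simp add: measurable_cong_sets[OF prob_algebraD(2)[OF Qz[OF z]] refl])
      show "B (\<lambda>i. i) \<in> sets (power_space N X)" using N(1) by (intro B) simp
    qed
    also have "\<dots> = measure (Q N z) (B (\<lambda>i. i))" by (simp only: sym[OF z p(1)])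
    also have "\<dots> = measure (\<Lambda> z) {x \<in> space (\<Lambda> z). \<forall>i<n. x i \<in> A i}"
      using N(1) by (intro L_B[symmetric]) simp
    finally show "measure (\<Lambda> z) {x \<in> space (\<Lambda> z). \<forall>i<n. x (f i) \<in> A i} =
        measure (\<Lambda> z) {x \<in> space (\<Lambda> z). \<forall>i<n. x i \<in> A i}" .
  qed
  define h where "h z = distr (\<Lambda> z) (prob_algebra X) directing" for z
  have "h \<in> Z \<rightarrow>\<^sub>M prob_algebra (prob_algebra X)"
    unfolding h_def using \<Lambda>_kernel measurable_distr_prob_space[OF directing_measurable] by (rule measurable_compose)
  moreover have "h z \<bind> power_space n = Q n z" if z: "z \<in> space Z" for z n
  proof -
    have "h z \<bind> power_space n = \<Lambda> z \<bind> (\<lambda>x. power_space n (directing x))"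
      unfolding h_def by (rule bind_distr_kernel[OF \<Lambda>[OF z] directing_measurable power_space_kernel])
    also have "\<dots> = Q n z"
      using coded_exchangeable.bind_power_directing[OF exch[OF z], of n] marg[OF z, of n] by (simp only:)
    finally show ?thesis .
  qed
  ultimately show ?thesis by blast
qed

lemma moment_eq_power_space:
  assumes "\<alpha> \<in> space (prob_algebra X)" "set As \<subseteq> sets X"
  shows "moment As \<alpha> = emeasure (power_space (length As) \<alpha>) (PiE {..<length As} ((!) As))"
proof -
  have "As ! i \<in> sets X" if "i < length As" for i using that assms(2) nth_mem by blast
  then show ?thesis
    by (simp add: emeasure_power_space[OF assms(1)] moment_def prod.list_conv_set_nth atLeast0LessThan)
qed

lemma PiE_nth_sets: "set As \<subseteq> sets X \<Longrightarrow> PiE {..<length As} ((!) As) \<in> sets (power_space (length As) X)"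
  unfolding power_space_def using nth_mem by (intro sets_PiM_I_finite) blast+

lemma nn_integral_moment:
  assumes \<mu>: "\<mu> \<in> space (prob_algebra (prob_algebra X))" and As: "set As \<subseteq> sets X"
  shows "(\<integral>\<^sup>+\<alpha>. moment As \<alpha> \<partial>\<mu>) = emeasure (\<mu> \<bind> power_space (length As)) (PiE {..<length As} ((!) As))"
  unfolding emeasure_bind_prob_algebra[OF \<mu> power_space_kernel PiE_nth_sets[OF As]]
  using moment_eq_power_space[OF _ As] prob_algebraD(3)[OF \<mu>] by (intro nn_integral_cong) simp

text \<open>The moment along \<open>As\<close> is the mass of a box in the power of order
  \<open>length As\<close>, so the mixtures of powers fix all moments. Uniqueness of the mediating
  kernels of the chain comes from here.\<close>

lemma bind_power_space_inj:
  fixes X :: "'a measure"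
  assumes \<mu>: "\<mu> \<in> space (prob_algebra (prob_algebra X))" and \<nu>: "\<nu> \<in> space (prob_algebra (prob_algebra X))"
    and eq: "\<And>n. \<mu> \<bind> power_space n = \<nu> \<bind> power_space n"
  shows "\<mu> = \<nu>"
proof (rule random_measure_eqI[where X = X])
  show "finite_measure \<mu>" "finite_measure \<nu>"
    using prob_algebraD(1)[OF \<mu>] prob_algebraD(1)[OF \<nu>] by (auto intro: prob_space.finite_measure)
  show "sets \<mu> = sets (prob_algebra X)" "sets \<nu> = sets (prob_algebra X)"
    by (rule prob_algebraD(2)[OF \<mu>], rule prob_algebraD(2)[OF \<nu>])
  fix As :: "'a set list" assume "set As \<subseteq> sets X"
  from nn_integral_moment[OF \<mu> this] nn_integral_moment[OF \<nu> this]
  show "(\<integral>\<^sup>+\<alpha>. moment As \<alpha> \<partial>\<mu>) = (\<integral>\<^sup>+\<alpha>. moment As \<alpha> \<partial>\<nu>)" by (simp only: eq)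
qed

subsection \<open>Tensoring a kernel with an identity\<close>

text \<open>The tensor of \<open>k\<close> with the identity of Y, with the Dirac factor already
  integrated out (see \<open>stoch_tensor_id\<close>): composites are then computed by push-forwards
  that leave the Y-component fixed.\<close>

definition side :: "'c measure \<Rightarrow> 'y measure \<Rightarrow> ('a \<Rightarrow> 'c measure) \<Rightarrow> 'a \<times> 'y \<Rightarrow> ('c \<times> 'y) measure" where
  "side C Y k p = distr (k (fst p)) (C \<Otimes>\<^sub>M Y) (\<lambda>c. (c, snd p))"

lemma pair_right_measurable: "y \<in> space Y \<Longrightarrow> (\<lambda>c. (c, y)) \<in> C \<rightarrow>\<^sub>M C \<Otimes>\<^sub>M Y"
  by (rule measurable_Pair2')

lemma side_kernel:
  assumes k: "k \<in> A \<rightarrow>\<^sub>M prob_algebra C"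
  shows "side C Y k \<in> A \<Otimes>\<^sub>M Y \<rightarrow>\<^sub>M prob_algebra (C \<Otimes>\<^sub>M Y)"
  unfolding side_def[abs_def]
proof (rule measurable_distr_prob_space2)
  show "(\<lambda>p. k (fst p)) \<in> A \<Otimes>\<^sub>M Y \<rightarrow>\<^sub>M prob_algebra C" by (rule measurable_compose[OF measurable_fst k])
  show "(\<lambda>(p, c). (c, snd p)) \<in> (A \<Otimes>\<^sub>M Y) \<Otimes>\<^sub>M C \<rightarrow>\<^sub>M C \<Otimes>\<^sub>M Y" by measurable
qed

lemma side_bind:
  assumes k: "k \<in> A \<rightarrow>\<^sub>M prob_algebra C" and l: "l \<in> C \<rightarrow>\<^sub>M prob_algebra D" and p: "p \<in> space (A \<Otimes>\<^sub>M Y)"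
  shows "side C Y k p \<bind> side D Y l = side D Y (\<lambda>a. k a \<bind> l) p"
proof -
  have a: "fst p \<in> space A" and y: "snd p \<in> space Y" using p by (auto simp: space_pair_measure)
  note ka = kernel_space[OF k a]
  have "side C Y k p \<bind> side D Y l = k (fst p) \<bind> (\<lambda>c. side D Y l (c, snd p))"
    unfolding side_def[of C Y k] by (rule bind_distr_kernel[OF ka pair_right_measurable[OF y] side_kernel[OF l]])
  also have "\<dots> = side D Y (\<lambda>a. k a \<bind> l) p"
    unfolding side_def fst_conv snd_conv by (rule distr_bind_kernel[OF ka l pair_right_measurable[OF y], symmetric])
  finally show ?thesis .
qed

lemma bind_side_bind:
  assumes \<mu>: "\<mu> \<in> space (prob_algebra (A \<Otimes>\<^sub>M Y))" and k: "k \<in> A \<rightarrow>\<^sub>M prob_algebra C" and l: "l \<in> C \<rightarrow>\<^sub>M prob_algebra D"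
  shows "(\<mu> \<bind> side C Y k) \<bind> side D Y l = \<mu> \<bind> side D Y (\<lambda>a. k a \<bind> l)"
  unfolding bind_assoc_kernel[OF \<mu> side_kernel[OF k] side_kernel[OF l]]
  by (rule bind_cong_space[OF \<mu> side_bind[OF k l]])

lemma side_distr:
  assumes k: "k \<in> A \<rightarrow>\<^sub>M prob_algebra C" and f: "f \<in> C \<rightarrow>\<^sub>M D" and p: "p \<in> space (A \<Otimes>\<^sub>M Y)"
  shows "distr (side C Y k p) (D \<Otimes>\<^sub>M Y) (\<lambda>q. (f (fst q), snd q)) = side D Y (\<lambda>a. distr (k a) D f) p"
proof -
  have a: "fst p \<in> space A" and y: "snd p \<in> space Y" using p by (auto simp: space_pair_measure)
  note ka = kernel_space[OF k a]
  have F: "(\<lambda>q. (f (fst q), snd q)) \<in> C \<Otimes>\<^sub>M Y \<rightarrow>\<^sub>M D \<Otimes>\<^sub>M Y" using f by measurable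
  have "distr (side C Y k p) (D \<Otimes>\<^sub>M Y) (\<lambda>q. (f (fst q), snd q)) =
      distr (k (fst p)) (D \<Otimes>\<^sub>M Y) ((\<lambda>q. (f (fst q), snd q)) \<circ> (\<lambda>c. (c, snd p)))"
    unfolding side_def by (rule distr_distr[OF F]) (simp add: pair_right_measurable y measurable_cong_sets[OF prob_algebraD(2)[OF ka] refl])
  also have "(\<lambda>q. (f (fst q), snd q)) \<circ> (\<lambda>c. (c, snd p)) = (\<lambda>d. (d, snd p)) \<circ> f" by (simp add: fun_eq_iff)
  also have "distr (k (fst p)) (D \<Otimes>\<^sub>M Y) \<dots> = side D Y (\<lambda>a. distr (k a) D f) p"
    unfolding side_def
    by (rule distr_distr[OF pair_right_measurable[OF y], symmetric])
       (simp add: f measurable_cong_sets[OF prob_algebraD(2)[OF ka] refl])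
  finally show ?thesis .
qed

lemma distr_bind_side:
  assumes \<mu>: "\<mu> \<in> space (prob_algebra (A \<Otimes>\<^sub>M Y))" and k: "k \<in> A \<rightarrow>\<^sub>M prob_algebra C" and f: "f \<in> C \<rightarrow>\<^sub>M D"
  shows "distr (\<mu> \<bind> side C Y k) (D \<Otimes>\<^sub>M Y) (\<lambda>q. (f (fst q), snd q)) = \<mu> \<bind> side D Y (\<lambda>a. distr (k a) D f)"
proof -
  have F: "(\<lambda>q. (f (fst q), snd q)) \<in> C \<Otimes>\<^sub>M Y \<rightarrow>\<^sub>M D \<Otimes>\<^sub>M Y" using f by measurable
  show ?thesis
    unfolding distr_bind_kernel[OF \<mu> side_kernel[OF k] F]
    by (rule bind_cong_space[OF \<mu> side_distr[OF k f]])
qed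

lemma bind_side_cong:
  assumes \<mu>: "\<mu> \<in> space (prob_algebra (A \<Otimes>\<^sub>M Y))" and "\<And>a. a \<in> space A \<Longrightarrow> k a = l a"
  shows "\<mu> \<bind> side C Y k = \<mu> \<bind> side C Y l"
  using assms(2) by (intro bind_cong_space[OF \<mu>]) (auto simp: side_def space_pair_measure)

lemma bind_side_return:
  assumes \<mu>: "\<mu> \<in> space (prob_algebra (A \<Otimes>\<^sub>M Y))"
  shows "\<mu> \<bind> side A Y (return A) = \<mu>"
proof -
  have "\<mu> \<bind> side A Y (return A) = \<mu> \<bind> return (A \<Otimes>\<^sub>M Y)"
  proof (rule bind_cong_space[OF \<mu>])
    fix p assume p: "p \<in> space (A \<Otimes>\<^sub>M Y)"
    then have a: "fst p \<in> space A" and y: "snd p \<in> space Y" by (auto simp: space_pair_measure)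
    show "side A Y (return A) p = return (A \<Otimes>\<^sub>M Y) p"
      unfolding side_def using distr_return[OF pair_right_measurable[OF y] a] by simp
  qed
  also have "\<dots> = \<mu>" using prob_algebraD(2)[OF \<mu>] by (rule bind_return'')
  finally show ?thesis .
qed

lemma pair_measure_eq_bind_side:
  assumes \<alpha>: "\<alpha> \<in> space (prob_algebra A)" and \<beta>: "\<beta> \<in> space (prob_algebra B)"
  shows "\<alpha> \<Otimes>\<^sub>M \<beta> = \<beta> \<bind> (\<lambda>y. distr \<alpha> (A \<Otimes>\<^sub>M B) (\<lambda>x. (x, y)))"
proof -
  interpret \<alpha>: prob_space \<alpha> by (rule prob_algebraD[OF \<alpha>])
  interpret \<beta>: prob_space \<beta> by (rule prob_algebraD[OF \<beta>])
  interpret pair_prob_space \<alpha> \<beta> ..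
  have k: "(\<lambda>y. distr \<alpha> (A \<Otimes>\<^sub>M B) (\<lambda>x. (x, y))) \<in> B \<rightarrow>\<^sub>M prob_algebra (A \<Otimes>\<^sub>M B)"
    by (rule measurable_distr_prob_space2[where M = A]) (simp_all add: \<alpha>)
  note P = bind_prob_algebra[OF \<beta> k]
  show ?thesis
  proof (rule measure_eqI_rect)
    show "finite_measure (\<alpha> \<Otimes>\<^sub>M \<beta>)"
      using prob_space_pair[OF prob_algebraD(1)[OF \<alpha>] prob_algebraD(1)[OF \<beta>]] by (rule prob_space.finite_measure)
    show "sets (\<alpha> \<Otimes>\<^sub>M \<beta>) = sets (A \<Otimes>\<^sub>M B)"
      by (intro sets_pair_measure_cong prob_algebraD(2)[OF \<alpha>] prob_algebraD(2)[OF \<beta>])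
    show "sets (\<beta> \<bind> (\<lambda>y. distr \<alpha> (A \<Otimes>\<^sub>M B) (\<lambda>x. (x, y)))) = sets (A \<Otimes>\<^sub>M B)" by (rule prob_algebraD(2)[OF P])
    fix a b assume a: "a \<in> sets A" and b: "b \<in> sets B"
    have "emeasure (\<beta> \<bind> (\<lambda>y. distr \<alpha> (A \<Otimes>\<^sub>M B) (\<lambda>x. (x, y)))) (a \<times> b) =
        (\<integral>\<^sup>+y. emeasure (distr \<alpha> (A \<Otimes>\<^sub>M B) (\<lambda>x. (x, y))) (a \<times> b) \<partial>\<beta>)"
      using a b by (intro emeasure_bind_prob_algebra[OF \<beta> k]) auto
    also have "\<dots> = (\<integral>\<^sup>+y. emeasure \<alpha> a * indicator b y \<partial>\<beta>)"
    proof (rule nn_integral_cong)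
      fix y assume "y \<in> space \<beta>"
      then have y: "(\<lambda>x. (x, y)) \<in> \<alpha> \<rightarrow>\<^sub>M A \<Otimes>\<^sub>M B"
        using prob_algebraD(3)[OF \<beta>] by (simp add: measurable_cong_sets[OF prob_algebraD(2)[OF \<alpha>] refl])
      have "emeasure (distr \<alpha> (A \<Otimes>\<^sub>M B) (\<lambda>x. (x, y))) (a \<times> b) = emeasure \<alpha> ((\<lambda>x. (x, y)) -` (a \<times> b) \<inter> space \<alpha>)"
        using a b by (intro emeasure_distr[OF y]) auto
      also have "(\<lambda>x. (x, y)) -` (a \<times> b) \<inter> space \<alpha> = (if y \<in> b then a else {})"
        using sets.sets_into_space[OF a] prob_algebraD(3)[OF \<alpha>] by auto
      finally show "emeasure (distr \<alpha> (A \<Otimes>\<^sub>M B) (\<lambda>x. (x, y))) (a \<times> b) = emeasure \<alpha> a * indicator b y"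
        by (simp add: indicator_def)
    qed
    also have "\<dots> = emeasure \<alpha> a * emeasure \<beta> b"
      using b prob_algebraD(2)[OF \<beta>] by (simp add: nn_integral_cmult_indicator)
    also have "\<dots> = emeasure (\<alpha> \<Otimes>\<^sub>M \<beta>) (a \<times> b)"
      using a b prob_algebraD(2)[OF \<alpha>] prob_algebraD(2)[OF \<beta>] by (simp add: \<beta>.emeasure_pair_measure_Times)
    finally show "emeasure (\<alpha> \<Otimes>\<^sub>M \<beta>) (a \<times> b) = emeasure (\<beta> \<bind> (\<lambda>y. distr \<alpha> (A \<Otimes>\<^sub>M B) (\<lambda>x. (x, y)))) (a \<times> b)" ..
  qed
qed

lemma stoch_id_hom: "stoch_id Y \<in> stoch_hom Y Y"
  unfolding stoch_id_def by (rule stoch_det_hom) simp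

lemma stoch_tensor_hom:
  assumes k: "k \<in> stoch_hom A C" and l: "l \<in> stoch_hom B D"
  shows "stoch_tensor A B k l \<in> stoch_hom (A \<Otimes>\<^sub>M B) (C \<Otimes>\<^sub>M D)"
  unfolding stoch_tensor_def
  by (intro stoch_hom_restrictI measurable_pair_prob measurable_compose[OF measurable_fst stoch_homD[OF k]]
      measurable_compose[OF measurable_snd stoch_homD[OF l]])

lemma stoch_tensor_id:
  assumes k: "k \<in> A \<rightarrow>\<^sub>M prob_algebra C" and p: "p \<in> space (A \<Otimes>\<^sub>M Y)"
  shows "stoch_tensor A Y k (stoch_id Y) p = side C Y k p"
proof -
  have a: "fst p \<in> space A" and y: "snd p \<in> space Y" using p by (auto simp: space_pair_measure)
  note ka = kernel_space[OF k a]
  have m: "(\<lambda>y. distr (k (fst p)) (C \<Otimes>\<^sub>M Y) (\<lambda>x. (x, y))) \<in> Y \<rightarrow>\<^sub>M prob_algebra (C \<Otimes>\<^sub>M Y)"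
    by (rule measurable_distr_prob_space2[where M = C]) (simp_all add: ka)
  have "stoch_tensor A Y k (stoch_id Y) p = k (fst p) \<Otimes>\<^sub>M return Y (snd p)"
    using p y by (simp add: stoch_tensor_def stoch_id_def stoch_det_def)
  also have "\<dots> = return Y (snd p) \<bind> (\<lambda>y. distr (k (fst p)) (C \<Otimes>\<^sub>M Y) (\<lambda>x. (x, y)))"
    by (rule pair_measure_eq_bind_side[OF ka return_prob_algebra[OF y]])
  also have "\<dots> = side C Y k p"
    unfolding side_def by (rule bind_return[OF measurable_prob_algebraD[OF m] y])
  finally show ?thesis .
qed

lemma bind_stoch_tensor_id:
  assumes \<mu>: "\<mu> \<in> space (prob_algebra (A \<Otimes>\<^sub>M Y))" and k: "k \<in> A \<rightarrow>\<^sub>M prob_algebra C"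
  shows "\<mu> \<bind> stoch_tensor A Y k (stoch_id Y) = \<mu> \<bind> side C Y k"
  by (rule bind_cong_space[OF \<mu> stoch_tensor_id[OF k]])

subsection \<open>The draw-and-delete chain and its cones\<close>

lemma draw_delete_hom: "draw_delete X n \<in> stoch_hom (mset_space (Suc n) X) (mset_space n X)"
  unfolding draw_delete_eq by (rule draw_delete_kernel_hom)

lemma draw_delete_mset_eq:
  "m \<in> space (mset_space (Suc n) X) \<Longrightarrow> draw_delete X n m \<bind> mset_eq n X =
    distr (mset_eq (Suc n) X m) (power_space n X) (\<lambda>x. restrict x {..<n})"
  unfolding draw_delete_eq by (rule draw_delete_kernel_eq)

lemma permute_vimage_PiE:
  assumes p: "p permutes {..<n}" and A: "\<And>i. i < n \<Longrightarrow> A i \<in> sets X"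
  shows "(\<lambda>x. x \<circ> p) -` PiE {..<n} A \<inter> space (power_space n X) = PiE {..<n} (\<lambda>i. A (inv p i))"
proof (intro set_eqI iffI)
  have ip: "inv p permutes {..<n}" using p by (rule permutes_inv)
  fix x assume x: "x \<in> (\<lambda>x. x \<circ> p) -` PiE {..<n} A \<inter> space (power_space n X)"
  then have x': "x \<in> extensional {..<n}" by (auto simp: power_space_def space_PiM PiE_iff)
  have "x i \<in> A (inv p i)" if "i < n" for i
  proof -
    have "inv p i \<in> {..<n}" using permutes_in_image[OF ip] that by simp
    then have "(x \<circ> p) (inv p i) \<in> A (inv p i)" using x by (auto simp: PiE_iff)
    then show ?thesis using permutes_inverses(1)[OF p] by simp
  qed
  then show "x \<in> PiE {..<n} (\<lambda>i. A (inv p i))" using x' by (auto simp: PiE_iff)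
next
  have ip: "inv p permutes {..<n}" using p by (rule permutes_inv)
  fix x assume x: "x \<in> PiE {..<n} (\<lambda>i. A (inv p i))"
  have "x (p i) \<in> A i" if "i < n" for i
  proof -
    have "p i \<in> {..<n}" using permutes_in_image[OF p] that by simp
    then have "x (p i) \<in> A (inv p (p i))" using x by (auto simp: PiE_iff)
    then show ?thesis using permutes_inverses(2)[OF p] by simp
  qed
  moreover have "x i \<in> space X" if "i < n" for i
  proof -
    have "inv p i \<in> {..<n}" using permutes_in_image[OF ip] that by simp
    then show ?thesis using x that sets.sets_into_space[OF A[of "inv p i"]] by (auto simp: PiE_iff)
  qed
  moreover have "(x \<circ> p) i = undefined" if "\<not> i < n" for i
    using x that permutes_not_in[OF p, of i] by (auto simp: PiE_iff extensional_def)
  ultimately show "x \<in> (\<lambda>x. x \<circ> p) -` PiE {..<n} A \<inter> space (power_space n X)"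
    using x by (auto simp: power_space_def space_PiM PiE_iff extensional_def)
qed

lemma power_space_symmetric:
  assumes \<alpha>: "\<alpha> \<in> space (prob_algebra X)" and p: "p permutes {..<n}"
  shows "distr (power_space n \<alpha>) (power_space n X) (\<lambda>x. x \<circ> p) = power_space n \<alpha>"
proof (rule PiM_prob_eqI[of "{..<n}" _ "\<lambda>_. X"])
  note P = power_space_prob_algebra[OF \<alpha>, of n]
  note D = distr_prob_algebra[OF P permute_measurable[OF p]]
  show "prob_space (distr (power_space n \<alpha>) (power_space n X) (\<lambda>x. x \<circ> p))" by (rule prob_algebraD[OF D])
  show "sets (distr (power_space n \<alpha>) (power_space n X) (\<lambda>x. x \<circ> p)) = sets (\<Pi>\<^sub>M i\<in>{..<n}. X)"
    by (simp add: power_space_def)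
  show "sets (power_space n \<alpha>) = sets (\<Pi>\<^sub>M i\<in>{..<n}. X)"
    using prob_algebraD(2)[OF P] by (simp add: power_space_def)
  fix A assume A: "\<And>i. i \<in> {..<n} \<Longrightarrow> A i \<in> sets X"
  have ip: "inv p permutes {..<n}" using p by (rule permutes_inv)
  have m: "(\<lambda>x. x \<circ> p) \<in> power_space n \<alpha> \<rightarrow>\<^sub>M power_space n X"
    using permute_measurable[OF p] by (simp add: measurable_cong_sets[OF prob_algebraD(2)[OF P] refl])
  have "emeasure (distr (power_space n \<alpha>) (power_space n X) (\<lambda>x. x \<circ> p)) (PiE {..<n} A) =
      emeasure (power_space n \<alpha>) ((\<lambda>x. x \<circ> p) -` PiE {..<n} A \<inter> space (power_space n \<alpha>))"
    using A by (intro emeasure_distr[OF m]) (auto simp: power_space_def intro!: sets_PiM_I_finite)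
  also have "(\<lambda>x. x \<circ> p) -` PiE {..<n} A \<inter> space (power_space n \<alpha>) = PiE {..<n} (\<lambda>i. A (inv p i))"
    unfolding prob_algebraD(3)[OF P] using A by (intro permute_vimage_PiE[OF p]) simp
  also have "emeasure (power_space n \<alpha>) \<dots> = (\<Prod>i<n. emeasure \<alpha> (A (inv p i)))"
    using A permutes_in_image[OF ip] by (intro emeasure_power_space[OF \<alpha>]) auto
  also have "\<dots> = (\<Prod>i<n. emeasure \<alpha> (A i))"
    by (rule prod.reindex_bij_betw[OF permutes_imp_bij[OF ip]])
  also have "\<dots> = emeasure (power_space n \<alpha>) (PiE {..<n} A)"
    using A by (intro emeasure_power_space[OF \<alpha>, symmetric]) auto
  finally show "emeasure (distr (power_space n \<alpha>) (power_space n X) (\<lambda>x. x \<circ> p)) (PiE {..<n} A) =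
      emeasure (power_space n \<alpha>) (PiE {..<n} A)" .
qed simp

lemma power_space_restrict:
  assumes \<alpha>: "\<alpha> \<in> space (prob_algebra X)"
  shows "distr (power_space (Suc n) \<alpha>) (power_space n X) (\<lambda>x. restrict x {..<n}) = power_space n \<alpha>"
proof -
  interpret prob_space \<alpha> by (rule prob_algebraD[OF \<alpha>])
  interpret product_prob_space "\<lambda>_. \<alpha>" "{..<Suc n}" ..
  have "distr (power_space (Suc n) \<alpha>) (power_space n X) (\<lambda>x. restrict x {..<n}) =
      distr (PiM {..<Suc n} (\<lambda>_. \<alpha>)) (PiM {..<n} (\<lambda>_. \<alpha>)) (\<lambda>x. restrict x {..<n})"
    using prob_algebraD(2)[OF power_space_prob_algebra[OF \<alpha>, of n]] by (intro distr_cong) (simp_all add: power_space_def)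
  also have "\<dots> = power_space n \<alpha>"
    unfolding power_space_def by (rule distr_PiM_restrict_finite) auto
  finally show ?thesis .
qed

lemma iid_mset_hom: "iid_mset X n \<in> stoch_hom (prob_algebra X) (mset_space n X)"
  unfolding iid_mset_def
  by (intro stoch_hom_restrictI measurable_compose[OF power_space_kernel measurable_distr_prob_space[OF mset_of_tuple_measurable]])

lemma iid_mset_eq:
  assumes \<alpha>: "\<alpha> \<in> space (prob_algebra X)"
  shows "iid_mset X n \<alpha> \<bind> mset_eq n X = power_space n \<alpha>"
  using symmetric_law_mset_eq[OF power_space_prob_algebra[OF \<alpha>] power_space_symmetric[OF \<alpha>]] \<alpha>
  by (simp add: iid_mset_def)

text \<open>Passing through orderings, a random ordering of an iid multiset is an iid tuple, and
  dropping its last entry leaves an iid tuple of length n.\<close>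

lemma iid_mset_draw_delete:
  assumes \<alpha>: "\<alpha> \<in> space (prob_algebra X)"
  shows "iid_mset X (Suc n) \<alpha> \<bind> draw_delete X n = iid_mset X n \<alpha>"
proof -
  note I = kernel_space[OF stoch_homD[OF iid_mset_hom] \<alpha>, of "Suc n"]
  have "iid_mset X (Suc n) \<alpha> \<bind> draw_delete X n = iid_mset X (Suc n) \<alpha> \<bind> (\<lambda>m.
      distr (distr (mset_eq (Suc n) X m) (power_space n X) (\<lambda>x. restrict x {..<n})) (mset_space n X) (mset_of_tuple n))"
    unfolding draw_delete_eq by (rule bind_cong_space[OF I]) (simp add: draw_delete_kernel_def)
  also have "\<dots> = distr (distr (iid_mset X (Suc n) \<alpha> \<bind> mset_eq (Suc n) X) (power_space n X) (\<lambda>x. restrict x {..<n}))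
      (mset_space n X) (mset_of_tuple n)"
    unfolding distr_bind_kernel[OF I mset_eq_kernel restrict_power_measurable]
    by (rule distr_bind_kernel[OF I discard_last_kernel mset_of_tuple_measurable, symmetric])
  also have "\<dots> = iid_mset X n \<alpha>"
    unfolding iid_mset_eq[OF \<alpha>] power_space_restrict[OF \<alpha>] using \<alpha> by (simp add: iid_mset_def)
  finally show ?thesis .
qed

lemma stoch_compD: "stoch_comp Z g f = q \<Longrightarrow> z \<in> space Z \<Longrightarrow> f z \<bind> g = q z"
  by (auto simp: stoch_comp_def)

theorem prob_algebra_chain_limit:
  assumes X: "standard_borel X"
  shows "stoch_chain_limit TYPE('z) (\<lambda>n. mset_space n X) (draw_delete X) (prob_algebra X) (iid_mset X)"
  unfolding stoch_chain_limit_def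
proof (intro conjI allI impI)
  show "stoch_chain (\<lambda>n. mset_space n X) (draw_delete X)"
    by (simp add: stoch_chain_def standard_borel_mset_space[OF X] draw_delete_hom)
  show "stoch_cone (\<lambda>n. mset_space n X) (draw_delete X) (prob_algebra X) (iid_mset X)"
    unfolding stoch_cone_def
  proof (intro conjI allI)
    show "standard_borel (prob_algebra X)" by (rule standard_borel_prob_algebra[OF X])
    fix n
    show "iid_mset X n \<in> stoch_hom (prob_algebra X) (mset_space n X)" by (rule iid_mset_hom)
    show "stoch_comp (prob_algebra X) (draw_delete X n) (iid_mset X (Suc n)) = iid_mset X n"
      by (rule stoch_hom_eqI[OF stoch_comp_hom[OF iid_mset_hom draw_delete_hom] iid_mset_hom])
         (simp add: stoch_comp_def iid_mset_draw_delete)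
  qed
  fix Z :: "'z measure" and q
  assume "stoch_cone (\<lambda>n. mset_space n X) (draw_delete X) Z q"
  then have q: "\<And>n. q n \<in> stoch_hom Z (mset_space n X)" and cone: "\<And>n. stoch_comp Z (draw_delete X n) (q (Suc n)) = q n"
    by (auto simp: stoch_cone_def)
  have qz: "q n z \<in> space (prob_algebra (mset_space n X))" if "z \<in> space Z" for n z
    by (rule kernel_space[OF stoch_homD[OF q] that])
  define Q where "Q n z = q n z \<bind> mset_eq n X" for n z
  have "\<exists>h\<in>Z \<rightarrow>\<^sub>M prob_algebra (prob_algebra X). \<forall>z\<in>space Z. \<forall>n. h z \<bind> power_space n = Q n z"
  proof (rule de_finetti[OF X])
    show "Q n \<in> Z \<rightarrow>\<^sub>M prob_algebra (power_space n X)" for n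
      unfolding Q_def[abs_def] by (rule measurable_bind_prob_space[OF stoch_homD[OF q] mset_eq_kernel])
    fix n z assume z: "z \<in> space Z"
    have "distr (Q (Suc n) z) (power_space n X) (\<lambda>x. restrict x {..<n}) =
        q (Suc n) z \<bind> (\<lambda>m. distr (mset_eq (Suc n) X m) (power_space n X) (\<lambda>x. restrict x {..<n}))"
      unfolding Q_def by (rule distr_bind_kernel[OF qz[OF z] mset_eq_kernel restrict_power_measurable])
    \<comment> \<open>The defining equation of \<open>draw_delete\<close> converts discarding the
      last entry into a step of the chain.\<close>
    also have "\<dots> = q (Suc n) z \<bind> (\<lambda>m. draw_delete X n m \<bind> mset_eq n X)"
      by (rule bind_cong_space[OF qz[OF z]]) (simp add: draw_delete_mset_eq)
    also have "\<dots> = (q (Suc n) z \<bind> draw_delete X n) \<bind> mset_eq n X"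
      by (rule bind_assoc_kernel[OF qz[OF z] stoch_homD[OF draw_delete_hom] mset_eq_kernel, symmetric])
    also have "\<dots> = Q n z" unfolding Q_def stoch_compD[OF cone z] ..
    finally show "distr (Q (Suc n) z) (power_space n X) (\<lambda>x. restrict x {..<n}) = Q n z" .
    fix p assume p: "p permutes {..<n}"
    show "distr (Q n z) (power_space n X) (\<lambda>x. x \<circ> p) = Q n z"
      unfolding Q_def distr_bind_kernel[OF qz[OF z] mset_eq_kernel permute_measurable[OF p]]
      by (rule bind_cong_space[OF qz[OF z]]) (rule mset_eq_symmetric[OF _ p])
  qed
  then obtain h where h: "h \<in> Z \<rightarrow>\<^sub>M prob_algebra (prob_algebra X)"
    and hQ: "\<And>z n. z \<in> space Z \<Longrightarrow> h z \<bind> power_space n = Q n z" by blast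
  show "\<exists>!h. h \<in> stoch_hom Z (prob_algebra X) \<and> (\<forall>n. stoch_comp Z (iid_mset X n) h = q n)"
  proof (rule ex1I[of _ "restrict h (space Z)"])
    show "restrict h (space Z) \<in> stoch_hom Z (prob_algebra X) \<and> (\<forall>n. stoch_comp Z (iid_mset X n) (restrict h (space Z)) = q n)"
    proof (intro conjI allI)
      show hom: "restrict h (space Z) \<in> stoch_hom Z (prob_algebra X)" by (rule stoch_hom_restrictI[OF h])
      fix n
      show "stoch_comp Z (iid_mset X n) (restrict h (space Z)) = q n"
      proof (rule stoch_hom_eqI[OF stoch_comp_hom[OF hom iid_mset_hom] q])
        fix z assume z: "z \<in> space Z"
        note hz = kernel_space[OF h z]
        have "stoch_comp Z (iid_mset X n) (restrict h (space Z)) z = h z \<bind> iid_mset X n"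
          using z by (simp add: stoch_comp_def)
        also have "\<dots> = h z \<bind> (\<lambda>\<alpha>. distr (power_space n \<alpha>) (mset_space n X) (mset_of_tuple n))"
          by (rule bind_cong_space[OF hz]) (simp add: iid_mset_def)
        also have "\<dots> = distr (Q n z) (mset_space n X) (mset_of_tuple n)"
          unfolding hQ[OF z, symmetric] by (rule distr_bind_kernel[OF hz power_space_kernel mset_of_tuple_measurable, symmetric])
        also have "\<dots> = q n z \<bind> (\<lambda>m. distr (mset_eq n X m) (mset_space n X) (mset_of_tuple n))"
          unfolding Q_def by (rule distr_bind_kernel[OF qz[OF z] mset_eq_kernel mset_of_tuple_measurable])
        also have "\<dots> = q n z \<bind> return (mset_space n X)"
          by (rule bind_cong_space[OF qz[OF z]]) (rule distr_mset_eq)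
        also have "\<dots> = q n z" using prob_algebraD(2)[OF qz[OF z]] by (rule bind_return'')
        finally show "stoch_comp Z (iid_mset X n) (restrict h (space Z)) z = q n z" .
      qed
    qed
    fix k assume k: "k \<in> stoch_hom Z (prob_algebra X) \<and> (\<forall>n. stoch_comp Z (iid_mset X n) k = q n)"
    show "k = restrict h (space Z)"
    proof (rule stoch_hom_eqI[OF _ stoch_hom_restrictI[OF h]])
      show "k \<in> stoch_hom Z (prob_algebra X)" using k by blast
      fix z assume z: "z \<in> space Z"
      have kz: "k z \<in> space (prob_algebra (prob_algebra X))" using k z by (blast intro: kernel_space stoch_homD)
      \<comment> \<open>Composing with \<open>mset_eq\<close> turns \<open>iid_mset\<close> into
        \<open>power_space\<close>, so the cone equations fix all moments of
        \<open>k z\<close>.\<close>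
      have "k z = h z"
      proof (rule bind_power_space_inj[OF kz kernel_space[OF h z]])
        fix n
        have "k z \<bind> power_space n = k z \<bind> (\<lambda>\<alpha>. iid_mset X n \<alpha> \<bind> mset_eq n X)"
          by (rule bind_cong_space[OF kz]) (simp add: iid_mset_eq)
        also have "\<dots> = (k z \<bind> iid_mset X n) \<bind> mset_eq n X"
          by (rule bind_assoc_kernel[OF kz stoch_homD[OF iid_mset_hom] mset_eq_kernel, symmetric])
        also have "k z \<bind> iid_mset X n = q n z" using k z by (intro stoch_compD) auto
        finally show "k z \<bind> power_space n = h z \<bind> power_space n" by (simp add: hQ[OF z] Q_def)
      qed
      then show "k z = restrict h (space Z) z" using z by simp
    qed
  qed
qed

section \<open>Splitting the last factor off a power, and the tensored chain\<close>

lemma fun_upd_measurable: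
  "(\<lambda>p. (fst p)(n := snd p)) \<in> power_space n W \<Otimes>\<^sub>M W \<rightarrow>\<^sub>M power_space (Suc n) W"
  unfolding power_space_def lessThan_Suc
  by (rule measurable_fun_upd[where J = "{..<n}", OF _ measurable_fst measurable_snd]) simp

lemma fun_upd_vimage_PiE:
  assumes A: "\<And>i. i < Suc n \<Longrightarrow> A i \<in> sets W"
  shows "(\<lambda>p. (fst p)(n := snd p)) -` PiE {..<Suc n} A \<inter> space (power_space n W) \<times> space W = PiE {..<n} A \<times> A n"
proof (intro set_eqI iffI)
  fix p assume p: "p \<in> (\<lambda>p. (fst p)(n := snd p)) -` PiE {..<Suc n} A \<inter> space (power_space n W) \<times> space W"
  then have "fst p \<in> extensional {..<n}" by (auto simp: power_space_def space_PiM PiE_iff)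
  moreover have *: "((fst p)(n := snd p)) i \<in> A i" if "i < Suc n" for i using p that by (auto simp: PiE_iff)
  have "fst p i \<in> A i" if "i < n" for i using *[of i] that by simp
  moreover have "snd p \<in> A n" using *[of n] by simp
  ultimately show "p \<in> PiE {..<n} A \<times> A n" by (cases p) (auto simp: PiE_iff)
next
  fix p assume p: "p \<in> PiE {..<n} A \<times> A n"
  have sub: "A i \<subseteq> space W" if "i < Suc n" for i using sets.sets_into_space[OF A[OF that]] .
  have x: "fst p \<in> PiE {..<n} A" and w: "snd p \<in> A n" using p by (simp_all only: mem_Times_iff)
  have "PiE {..<n} A \<subseteq> PiE {..<n} (\<lambda>_. space W)" using sub by (intro PiE_mono) simp
  then have "fst p \<in> space (power_space n W)" using x by (auto simp: power_space_def space_PiM)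
  moreover have "snd p \<in> space W" using w sub[of n] by auto
  moreover have "(fst p)(n := snd p) \<in> PiE {..<Suc n} A"
    unfolding lessThan_Suc using w x by (rule PiE_fun_upd)
  ultimately show "p \<in> (\<lambda>p. (fst p)(n := snd p)) -` PiE {..<Suc n} A \<inter> space (power_space n W) \<times> space W"
    by (simp add: mem_Times_iff)
qed

lemma power_space_Suc:
  assumes \<mu>: "\<mu> \<in> space (prob_algebra W)"
  shows "power_space (Suc n) \<mu> = distr (power_space n \<mu> \<Otimes>\<^sub>M \<mu>) (power_space (Suc n) W) (\<lambda>p. (fst p)(n := snd p))"
proof (rule PiM_prob_eqI[of "{..<Suc n}" _ "\<lambda>_. W"])
  note P = power_space_prob_algebra[OF \<mu>]
  interpret \<mu>: prob_space \<mu> by (rule prob_algebraD[OF \<mu>])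
  have st: "sets (power_space n \<mu> \<Otimes>\<^sub>M \<mu>) = sets (power_space n W \<Otimes>\<^sub>M W)"
    by (intro sets_pair_measure_cong prob_algebraD(2)[OF \<mu>] prob_algebraD(2)[OF P])
  have m: "(\<lambda>p. (fst p)(n := snd p)) \<in> power_space n \<mu> \<Otimes>\<^sub>M \<mu> \<rightarrow>\<^sub>M power_space (Suc n) W"
    unfolding measurable_cong_sets[OF st refl] by (rule fun_upd_measurable)
  show "prob_space (power_space (Suc n) \<mu>)" by (rule prob_algebraD[OF P])
  show "sets (power_space (Suc n) \<mu>) = sets (\<Pi>\<^sub>M i\<in>{..<Suc n}. W)"
    using prob_algebraD(2)[OF P] by (simp add: power_space_def)
  show "sets (distr (power_space n \<mu> \<Otimes>\<^sub>M \<mu>) (power_space (Suc n) W) (\<lambda>p. (fst p)(n := snd p))) = sets (\<Pi>\<^sub>M i\<in>{..<Suc n}. W)"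
    by (simp add: power_space_def)
  fix A assume A: "\<And>i. i \<in> {..<Suc n} \<Longrightarrow> A i \<in> sets W"
  have A_n: "PiE {..<n} A \<in> sets (power_space n \<mu>)" 
    by (subst prob_algebraD(2)[OF P]) (auto simp: power_space_def intro!: sets_PiM_I_finite A)
  have "emeasure (distr (power_space n \<mu> \<Otimes>\<^sub>M \<mu>) (power_space (Suc n) W) (\<lambda>p. (fst p)(n := snd p))) (PiE {..<Suc n} A) =
      emeasure (power_space n \<mu> \<Otimes>\<^sub>M \<mu>) ((\<lambda>p. (fst p)(n := snd p)) -` PiE {..<Suc n} A \<inter> space (power_space n \<mu> \<Otimes>\<^sub>M \<mu>))"
    using A by (intro emeasure_distr[OF m]) (auto simp: power_space_def intro!: sets_PiM_I_finite)
  also have "(\<lambda>p. (fst p)(n := snd p)) -` PiE {..<Suc n} A \<inter> space (power_space n \<mu> \<Otimes>\<^sub>M \<mu>) = PiE {..<n} A \<times> A n"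
    using fun_upd_vimage_PiE[of n A W] A by (simp add: space_pair_measure prob_algebraD(3)[OF \<mu>] prob_algebraD(3)[OF P])
  also have "emeasure (power_space n \<mu> \<Otimes>\<^sub>M \<mu>) (PiE {..<n} A \<times> A n) = emeasure (power_space n \<mu>) (PiE {..<n} A) * emeasure \<mu> (A n)"
    using A_n A[of n] prob_algebraD(2)[OF \<mu>] by (intro \<mu>.emeasure_pair_measure_Times) auto
  also have "\<dots> = (\<Prod>i<Suc n. emeasure \<mu> (A i))" using A by (simp add: emeasure_power_space[OF \<mu>])
  also have "\<dots> = emeasure (power_space (Suc n) \<mu>) (PiE {..<Suc n} A)"
    using A by (intro emeasure_power_space[OF \<mu>, symmetric]) auto
  finally show "emeasure (power_space (Suc n) \<mu>) (PiE {..<Suc n} A) =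
      emeasure (distr (power_space n \<mu> \<Otimes>\<^sub>M \<mu>) (power_space (Suc n) W) (\<lambda>p. (fst p)(n := snd p))) (PiE {..<Suc n} A)" ..
qed simp

text \<open>The n + 1 samples are independent, so the X-components of the first n are independent of
  the Y-component of the last, even if the two components of a single sample are dependent.\<close>

lemma power_space_Suc_marginals:
  assumes \<mu>: "\<mu> \<in> space (prob_algebra (X \<Otimes>\<^sub>M Y))"
  shows "distr (power_space (Suc n) \<mu>) (power_space n X \<Otimes>\<^sub>M Y) (\<lambda>w. (\<lambda>i\<in>{..<n}. fst (w i), snd (w n))) =
    power_space n (distr \<mu> X fst) \<Otimes>\<^sub>M distr \<mu> Y snd"
proof -
  note P = power_space_prob_algebra[OF \<mu>]
  have pr: "prob_space \<mu>" "prob_space (power_space n \<mu>)" by (rule prob_algebraD[OF \<mu>], rule prob_algebraD[OF P])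
  have st: "sets (power_space n \<mu> \<Otimes>\<^sub>M \<mu>) = sets (power_space n (X \<Otimes>\<^sub>M Y) \<Otimes>\<^sub>M (X \<Otimes>\<^sub>M Y))"
    by (intro sets_pair_measure_cong prob_algebraD(2)[OF \<mu>] prob_algebraD(2)[OF P])
  have F: "(\<lambda>x. \<lambda>i\<in>{..<n}. fst (x i)) \<in> power_space n (X \<Otimes>\<^sub>M Y) \<rightarrow>\<^sub>M power_space n X"
    unfolding power_space_def by (intro measurable_restrict measurable_compose[OF measurable_coord measurable_fst]) simp
  have \<Phi>: "(\<lambda>w. (\<lambda>i\<in>{..<n}. fst (w i), snd (w n))) \<in> power_space (Suc n) (X \<Otimes>\<^sub>M Y) \<rightarrow>\<^sub>M power_space n X \<Otimes>\<^sub>M Y"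
    unfolding power_space_def
    by (intro measurable_Pair measurable_restrict measurable_compose[OF measurable_coord measurable_fst]
        measurable_compose[OF measurable_coord measurable_snd]) auto
  have U: "(\<lambda>p. (fst p)(n := snd p)) \<in> power_space n \<mu> \<Otimes>\<^sub>M \<mu> \<rightarrow>\<^sub>M power_space (Suc n) (X \<Otimes>\<^sub>M Y)"
    unfolding measurable_cong_sets[OF st refl] by (rule fun_upd_measurable)
  have "distr (power_space (Suc n) \<mu>) (power_space n X \<Otimes>\<^sub>M Y) (\<lambda>w. (\<lambda>i\<in>{..<n}. fst (w i), snd (w n))) =
      distr (power_space n \<mu> \<Otimes>\<^sub>M \<mu>) (power_space n X \<Otimes>\<^sub>M Y)
        ((\<lambda>w. (\<lambda>i\<in>{..<n}. fst (w i), snd (w n))) \<circ> (\<lambda>p. (fst p)(n := snd p)))"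
    unfolding power_space_Suc[OF \<mu>] by (rule distr_distr[OF \<Phi> U])
  also have "(\<lambda>w. (\<lambda>i\<in>{..<n}. fst (w i), snd (w n))) \<circ> (\<lambda>p. (fst p)(n := snd p)) =
      (\<lambda>(x :: nat \<Rightarrow> 'a \<times> 'b, w). (\<lambda>i\<in>{..<n}. fst (x i), snd w))"
    by (auto simp: fun_eq_iff restrict_def)
  also have "distr (power_space n \<mu> \<Otimes>\<^sub>M \<mu>) (power_space n X \<Otimes>\<^sub>M Y) \<dots> =
      distr (power_space n \<mu>) (power_space n X) (\<lambda>x. \<lambda>i\<in>{..<n}. fst (x i)) \<Otimes>\<^sub>M distr \<mu> Y snd"
  proof (rule pair_measure_distr[symmetric])
    show "(\<lambda>x. \<lambda>i\<in>{..<n}. fst (x i)) \<in> power_space n \<mu> \<rightarrow>\<^sub>M power_space n X"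
      using F by (simp add: measurable_cong_sets[OF prob_algebraD(2)[OF P] refl])
    show sn: "snd \<in> \<mu> \<rightarrow>\<^sub>M Y" by (simp add: measurable_cong_sets[OF prob_algebraD(2)[OF \<mu>] refl])
    show "sigma_finite_measure (distr \<mu> Y snd)"
      using prob_space.prob_space_distr[OF pr(1) sn] by (rule prob_space_imp_sigma_finite)
  qed
  also have "distr (power_space n \<mu>) (power_space n X) (\<lambda>x. \<lambda>i\<in>{..<n}. fst (x i)) = power_space n (distr \<mu> X fst)"
    by (rule power_space_distr[OF \<mu> measurable_fst, symmetric])
  finally show ?thesis .
qed

text \<open>Recording the \<open>Y\<close>-component next to every \<open>X\<close>-component makes a cone over the tensored chain exchangeable with values
  in \<open>X \<times> Y\<close>. The directing measure \<open>\<mu>\<close> of the result is sent to the point \<open>\<mu>\<^sub>X\<close> together with the law \<open>\<mu>\<^sub>Y\<close>.\<close>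

theorem prob_algebra_tensor_chain_limit:
  fixes X :: "'a measure" and Y :: "'y measure"
  assumes X: "standard_borel X" and Y: "standard_borel Y"
  shows "stoch_chain_limit TYPE('z) (\<lambda>n. mset_space n X \<Otimes>\<^sub>M Y)
    (\<lambda>n. stoch_tensor (mset_space (Suc n) X) Y (draw_delete X n) (stoch_id Y))
    (prob_algebra X \<Otimes>\<^sub>M Y) (\<lambda>n. stoch_tensor (prob_algebra X) Y (iid_mset X n) (stoch_id Y))"
  unfolding stoch_chain_limit_def
proof (intro conjI allI impI)
  let ?DD = "\<lambda>n. stoch_tensor (mset_space (Suc n) X) Y (draw_delete X n) (stoch_id Y)"
  let ?I = "\<lambda>n. stoch_tensor (prob_algebra X) Y (iid_mset X n) (stoch_id Y)"
  have DD: "?DD n \<in> stoch_hom (mset_space (Suc n) X \<Otimes>\<^sub>M Y) (mset_space n X \<Otimes>\<^sub>M Y)" for n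
    by (rule stoch_tensor_hom[OF draw_delete_hom stoch_id_hom])
  have I: "?I n \<in> stoch_hom (prob_algebra X \<Otimes>\<^sub>M Y) (mset_space n X \<Otimes>\<^sub>M Y)" for n
    by (rule stoch_tensor_hom[OF iid_mset_hom stoch_id_hom])
  note dk = stoch_homD[OF draw_delete_hom] and ik = stoch_homD[OF iid_mset_hom]
  show "stoch_chain (\<lambda>n. mset_space n X \<Otimes>\<^sub>M Y) ?DD"
    unfolding stoch_chain_def by (intro allI conjI standard_borel_pair standard_borel_mset_space X Y DD)
  show "stoch_cone (\<lambda>n. mset_space n X \<Otimes>\<^sub>M Y) ?DD (prob_algebra X \<Otimes>\<^sub>M Y) ?I"
    unfolding stoch_cone_def
  proof (intro conjI allI)
    show "standard_borel (prob_algebra X \<Otimes>\<^sub>M Y)" by (intro standard_borel_pair standard_borel_prob_algebra X Y)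
    fix n
    show "?I n \<in> stoch_hom (prob_algebra X \<Otimes>\<^sub>M Y) (mset_space n X \<Otimes>\<^sub>M Y)" by (rule I)
    show "stoch_comp (prob_algebra X \<Otimes>\<^sub>M Y) (?DD n) (?I (Suc n)) = ?I n"
    proof (rule stoch_hom_eqI[OF stoch_comp_hom[OF I DD] I])
      fix p assume p: "p \<in> space (prob_algebra X \<Otimes>\<^sub>M Y)"
      have "stoch_comp (prob_algebra X \<Otimes>\<^sub>M Y) (?DD n) (?I (Suc n)) p = ?I (Suc n) p \<bind> ?DD n"
        using p by (simp add: stoch_comp_def)
      also have "\<dots> = ?I (Suc n) p \<bind> side (mset_space n X) Y (draw_delete X n)"
        by (rule bind_stoch_tensor_id[OF kernel_space[OF stoch_homD[OF I] p] dk])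
      also have "\<dots> = side (mset_space n X) Y (\<lambda>\<alpha>. iid_mset X (Suc n) \<alpha> \<bind> draw_delete X n) p"
        unfolding stoch_tensor_id[OF ik p] by (rule side_bind[OF ik dk p])
      also have "\<dots> = side (mset_space n X) Y (iid_mset X n) p"
        using p by (auto simp: side_def space_pair_measure iid_mset_draw_delete)
      also have "\<dots> = ?I n p" by (rule stoch_tensor_id[OF ik p, symmetric])
      finally show "stoch_comp (prob_algebra X \<Otimes>\<^sub>M Y) (?DD n) (?I (Suc n)) p = ?I n p" .
    qed
  qed
  fix Z :: "'z measure" and q
  assume "stoch_cone (\<lambda>n. mset_space n X \<Otimes>\<^sub>M Y) ?DD Z q"
  then have q: "\<And>n. q n \<in> stoch_hom Z (mset_space n X \<Otimes>\<^sub>M Y)" and cone: "\<And>n. stoch_comp Z (?DD n) (q (Suc n)) = q n"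
    unfolding stoch_cone_def by blast+
  have qz: "q n z \<in> space (prob_algebra (mset_space n X \<Otimes>\<^sub>M Y))" if "z \<in> space Z" for n z
    by (rule kernel_space[OF stoch_homD[OF q] that])
  \<comment> \<open>The cone with the multiset replaced by a random ordering and the Y-component
    left alone; \<open>E_q\<close> recovers \<open>q n z\<close> from it.\<close>
  define E where "E n z = q n z \<bind> side (power_space n X) Y (mset_eq n X)" for n z
  have E_kernel: "E n \<in> Z \<rightarrow>\<^sub>M prob_algebra (power_space n X \<Otimes>\<^sub>M Y)" for n
    unfolding E_def[abs_def] by (rule measurable_bind_prob_space[OF stoch_homD[OF q] side_kernel[OF mset_eq_kernel]])
  have Ez: "E n z \<in> space (prob_algebra (power_space n X \<Otimes>\<^sub>M Y))" if "z \<in> space Z" for n z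
    by (rule kernel_space[OF E_kernel that])
  have E_Suc: "distr (E (Suc n) z) (power_space n X \<Otimes>\<^sub>M Y) (\<lambda>p. (restrict (fst p) {..<n}, snd p)) = E n z"
    if z: "z \<in> space Z" for n z
  proof -
    have "distr (E (Suc n) z) (power_space n X \<Otimes>\<^sub>M Y) (\<lambda>p. (restrict (fst p) {..<n}, snd p)) =
        q (Suc n) z \<bind> side (power_space n X) Y (\<lambda>m. distr (mset_eq (Suc n) X m) (power_space n X) (\<lambda>x. restrict x {..<n}))"
      unfolding E_def by (rule distr_bind_side[OF qz[OF z] mset_eq_kernel restrict_power_measurable])
    also have "\<dots> = q (Suc n) z \<bind> side (power_space n X) Y (\<lambda>m. draw_delete X n m \<bind> mset_eq n X)"
      by (rule bind_side_cong[OF qz[OF z]]) (simp add: draw_delete_mset_eq)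
    also have "\<dots> = (q (Suc n) z \<bind> side (mset_space n X) Y (draw_delete X n)) \<bind> side (power_space n X) Y (mset_eq n X)"
      by (rule bind_side_bind[OF qz[OF z] dk mset_eq_kernel, symmetric])
    also have "q (Suc n) z \<bind> side (mset_space n X) Y (draw_delete X n) = q n z"
      unfolding bind_stoch_tensor_id[OF qz[OF z] dk, symmetric] by (rule stoch_compD[OF cone z])
    finally show ?thesis by (simp only: E_def)
  qed
  have E_sym: "distr (E n z) (power_space n X \<Otimes>\<^sub>M Y) (\<lambda>s. (fst s \<circ> p, snd s)) = E n z"
    if z: "z \<in> space Z" and p: "p permutes {..<n}" for n z p
    unfolding E_def distr_bind_side[OF qz[OF z] mset_eq_kernel permute_measurable[OF p]]
    by (rule bind_side_cong[OF qz[OF z]]) (rule mset_eq_symmetric[OF _ p])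
  have E_q: "distr (E n z) (mset_space n X \<Otimes>\<^sub>M Y) (\<lambda>s. (mset_of_tuple n (fst s), snd s)) = q n z"
    if z: "z \<in> space Z" for n z
  proof -
    have "distr (E n z) (mset_space n X \<Otimes>\<^sub>M Y) (\<lambda>s. (mset_of_tuple n (fst s), snd s)) =
        q n z \<bind> side (mset_space n X) Y (\<lambda>m. distr (mset_eq n X m) (mset_space n X) (mset_of_tuple n))"
      unfolding E_def by (rule distr_bind_side[OF qz[OF z] mset_eq_kernel mset_of_tuple_measurable])
    also have "\<dots> = q n z \<bind> side (mset_space n X) Y (return (mset_space n X))"
      by (rule bind_side_cong[OF qz[OF z]]) (rule distr_mset_eq)
    also have "\<dots> = q n z" by (rule bind_side_return[OF qz[OF z]])
    finally show ?thesis .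
  qed
  define W where "W = X \<Otimes>\<^sub>M Y"
  define zip where "zip n s = (\<lambda>i\<in>{..<n}. (fst s i, snd s))" for n and s :: "(nat \<Rightarrow> 'a) \<times> 'y"
  have zip: "zip n \<in> power_space n X \<Otimes>\<^sub>M Y \<rightarrow>\<^sub>M power_space n W" for n
    unfolding zip_def[abs_def] W_def power_space_def
    by (intro measurable_restrict measurable_Pair measurable_compose[OF measurable_fst measurable_coord] measurable_snd) simp
  define Q where "Q n z = distr (E n z) (power_space n W) (zip n)" for n z
  have "\<exists>h\<in>Z \<rightarrow>\<^sub>M prob_algebra (prob_algebra W). \<forall>z\<in>space Z. \<forall>n. h z \<bind> power_space n = Q n z"
  proof (rule de_finetti)
    show "standard_borel W" unfolding W_def by (rule standard_borel_pair[OF X Y])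
    show "Q n \<in> Z \<rightarrow>\<^sub>M prob_algebra (power_space n W)" for n
      unfolding Q_def[abs_def] by (rule measurable_compose[OF E_kernel measurable_distr_prob_space[OF zip]])
    fix n z assume z: "z \<in> space Z"
    have R: "(\<lambda>p. (restrict (fst p) {..<n}, snd p)) \<in> power_space (Suc n) X \<Otimes>\<^sub>M Y \<rightarrow>\<^sub>M power_space n X \<Otimes>\<^sub>M Y"
      by (intro measurable_Pair measurable_compose[OF measurable_fst restrict_power_measurable] measurable_snd)
    have "distr (Q (Suc n) z) (power_space n W) (\<lambda>x. restrict x {..<n}) =
        distr (E (Suc n) z) (power_space n W) ((\<lambda>x. restrict x {..<n}) \<circ> zip (Suc n))"
      unfolding Q_def using zip
      by (intro distr_distr[OF restrict_power_measurable]) (simp add: measurable_cong_sets[OF prob_algebraD(2)[OF Ez[OF z]] refl])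
    also have "(\<lambda>x. restrict x {..<n}) \<circ> zip (Suc n) = zip n \<circ> (\<lambda>p. (restrict (fst p) {..<n}, snd p))"
      by (auto simp: fun_eq_iff zip_def restrict_def)
    also have "distr (E (Suc n) z) (power_space n W) \<dots> =
        distr (distr (E (Suc n) z) (power_space n X \<Otimes>\<^sub>M Y) (\<lambda>p. (restrict (fst p) {..<n}, snd p))) (power_space n W) (zip n)"
      using R by (intro distr_distr[OF zip, symmetric]) (simp add: measurable_cong_sets[OF prob_algebraD(2)[OF Ez[OF z]] refl])
    finally show "distr (Q (Suc n) z) (power_space n W) (\<lambda>x. restrict x {..<n}) = Q n z"
      unfolding E_Suc[OF z] Q_def .
    fix p assume p: "p permutes {..<n}"
    have S: "(\<lambda>s. (fst s \<circ> p, snd s)) \<in> power_space n X \<Otimes>\<^sub>M Y \<rightarrow>\<^sub>M power_space n X \<Otimes>\<^sub>M Y"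
      by (intro measurable_Pair measurable_compose[OF measurable_fst permute_measurable[OF p]] measurable_snd)
    have "distr (Q n z) (power_space n W) (\<lambda>x. x \<circ> p) = distr (E n z) (power_space n W) ((\<lambda>x. x \<circ> p) \<circ> zip n)"
      unfolding Q_def using zip
      by (intro distr_distr[OF permute_measurable[OF p]]) (simp add: measurable_cong_sets[OF prob_algebraD(2)[OF Ez[OF z]] refl])
    also have "(\<lambda>x. x \<circ> p) \<circ> zip n = zip n \<circ> (\<lambda>s. (fst s \<circ> p, snd s))"
      using permutes_in_image[OF p] by (auto simp: fun_eq_iff zip_def restrict_def)
    also have "distr (E n z) (power_space n W) \<dots> =
        distr (distr (E n z) (power_space n X \<Otimes>\<^sub>M Y) (\<lambda>s. (fst s \<circ> p, snd s))) (power_space n W) (zip n)"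
      using S by (intro distr_distr[OF zip, symmetric]) (simp add: measurable_cong_sets[OF prob_algebraD(2)[OF Ez[OF z]] refl])
    finally show "distr (Q n z) (power_space n W) (\<lambda>x. x \<circ> p) = Q n z"
      unfolding E_sym[OF z p] Q_def .
  qed
  then obtain h' where h': "h' \<in> Z \<rightarrow>\<^sub>M prob_algebra (prob_algebra W)"
    and hQ: "\<And>z n. z \<in> space Z \<Longrightarrow> h' z \<bind> power_space n = Q n z" by blast
  define \<kappa> where "\<kappa> \<mu> = distr (distr \<mu> Y snd) (prob_algebra X \<Otimes>\<^sub>M Y) (\<lambda>y. (distr \<mu> X fst, y))" for \<mu> :: "('a \<times> 'y) measure"
  have mX: "(\<lambda>\<mu>. distr \<mu> X fst) \<in> prob_algebra W \<rightarrow>\<^sub>M prob_algebra X" and mY: "(\<lambda>\<mu>. distr \<mu> Y snd) \<in> prob_algebra W \<rightarrow>\<^sub>M prob_algebra Y"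
    unfolding W_def by (intro measurable_distr_prob_space measurable_fst measurable_snd)+
  have \<kappa>: "\<kappa> \<in> prob_algebra W \<rightarrow>\<^sub>M prob_algebra (prob_algebra X \<Otimes>\<^sub>M Y)"
    unfolding \<kappa>_def[abs_def]
  proof (rule measurable_distr_prob_space2[OF mY])
    have "(\<lambda>p. (distr (fst p) X fst, snd p)) \<in> prob_algebra W \<Otimes>\<^sub>M Y \<rightarrow>\<^sub>M prob_algebra X \<Otimes>\<^sub>M Y"
      by (intro measurable_Pair measurable_compose[OF measurable_fst mX] measurable_snd)
    then show "(\<lambda>(\<mu>, y). (distr \<mu> X fst, y)) \<in> prob_algebra W \<Otimes>\<^sub>M Y \<rightarrow>\<^sub>M prob_algebra X \<Otimes>\<^sub>M Y" by (simp add: split_def)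
  qed
  \<comment> \<open>The Y-component is read at the extra position n, whose sample is independent of
    the first n. Read at one of those n positions it could depend on the X-components, and for n = 0
    there would be no position to read.\<close>
  define \<Phi> where "\<Phi> n w = (\<lambda>i\<in>{..<n}. fst (w i), snd (w n))" for n and w :: "nat \<Rightarrow> 'a \<times> 'y"
  have \<Phi>: "\<Phi> n \<in> power_space (Suc n) W \<rightarrow>\<^sub>M power_space n X \<Otimes>\<^sub>M Y" for n
    unfolding power_space_def W_def \<Phi>_def[abs_def]
    by (intro measurable_Pair measurable_restrict measurable_compose[OF measurable_coord measurable_fst]
        measurable_compose[OF measurable_coord measurable_snd]) auto
  have \<kappa>_power: "\<kappa> \<mu> \<bind> side (power_space n X) Y (power_space n) = distr (power_space (Suc n) \<mu>) (power_space n X \<Otimes>\<^sub>M Y) (\<Phi> n)"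
    if \<mu>: "\<mu> \<in> space (prob_algebra W)" for \<mu> n
  proof -
    note X\<mu> = measurable_space[OF mX \<mu>] and Y\<mu> = measurable_space[OF mY \<mu>]
    have m: "(\<lambda>y. (distr \<mu> X fst, y)) \<in> Y \<rightarrow>\<^sub>M prob_algebra X \<Otimes>\<^sub>M Y" by (rule measurable_Pair1'[OF X\<mu>])
    have "\<kappa> \<mu> \<bind> side (power_space n X) Y (power_space n) =
        distr \<mu> Y snd \<bind> (\<lambda>y. side (power_space n X) Y (power_space n) (distr \<mu> X fst, y))"
      unfolding \<kappa>_def by (rule bind_distr_kernel[OF Y\<mu> m side_kernel[OF power_space_kernel]])
    also have "\<dots> = power_space n (distr \<mu> X fst) \<Otimes>\<^sub>M distr \<mu> Y snd"
      unfolding side_def fst_conv snd_conv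
      by (rule pair_measure_eq_bind_side[OF power_space_prob_algebra[OF X\<mu>] Y\<mu>, symmetric])
    also have "\<dots> = distr (power_space (Suc n) \<mu>) (power_space n X \<Otimes>\<^sub>M Y) (\<Phi> n)"
      unfolding \<Phi>_def[abs_def] by (rule power_space_Suc_marginals[symmetric]) (use \<mu> in \<open>simp add: W_def\<close>)
    finally show ?thesis .
  qed
  define h where "h z = h' z \<bind> \<kappa>" for z
  have h: "h \<in> Z \<rightarrow>\<^sub>M prob_algebra (prob_algebra X \<Otimes>\<^sub>M Y)"
    unfolding h_def[abs_def] by (rule measurable_bind_prob_space[OF h' \<kappa>])
  have hE: "h z \<bind> side (power_space n X) Y (power_space n) = E n z" if z: "z \<in> space Z" for z n
  proof -
    note h'z = kernel_space[OF h' z]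
    have "h z \<bind> side (power_space n X) Y (power_space n) = h' z \<bind> (\<lambda>\<mu>. \<kappa> \<mu> \<bind> side (power_space n X) Y (power_space n))"
      unfolding h_def by (rule bind_assoc_kernel[OF h'z \<kappa> side_kernel[OF power_space_kernel]])
    also have "\<dots> = h' z \<bind> (\<lambda>\<mu>. distr (power_space (Suc n) \<mu>) (power_space n X \<Otimes>\<^sub>M Y) (\<Phi> n))"
      by (rule bind_cong_space[OF h'z \<kappa>_power])
    also have "\<dots> = distr (Q (Suc n) z) (power_space n X \<Otimes>\<^sub>M Y) (\<Phi> n)"
      unfolding hQ[OF z, symmetric] by (rule distr_bind_kernel[OF h'z power_space_kernel \<Phi>, symmetric])
    also have "\<dots> = distr (E (Suc n) z) (power_space n X \<Otimes>\<^sub>M Y) (\<Phi> n \<circ> zip (Suc n))"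
      unfolding Q_def using zip
      by (intro distr_distr[OF \<Phi>]) (simp add: measurable_cong_sets[OF prob_algebraD(2)[OF Ez[OF z]] refl])
    \<comment> \<open>\<open>zip\<close> repeats the same Y-component at every position, so reading
      it at position n returns the original one.\<close>
    also have "\<Phi> n \<circ> zip (Suc n) = (\<lambda>p. (restrict (fst p) {..<n}, snd p))"
      by (auto simp: fun_eq_iff \<Phi>_def zip_def restrict_def)
    also have "distr (E (Suc n) z) (power_space n X \<Otimes>\<^sub>M Y) \<dots> = E n z" by (rule E_Suc[OF z])
    finally show ?thesis .
  qed
  show "\<exists>!h. h \<in> stoch_hom Z (prob_algebra X \<Otimes>\<^sub>M Y) \<and> (\<forall>n. stoch_comp Z (?I n) h = q n)"
  proof (rule ex1I[of _ "restrict h (space Z)"])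
    show "restrict h (space Z) \<in> stoch_hom Z (prob_algebra X \<Otimes>\<^sub>M Y) \<and> (\<forall>n. stoch_comp Z (?I n) (restrict h (space Z)) = q n)"
    proof (intro conjI allI)
      show hom: "restrict h (space Z) \<in> stoch_hom Z (prob_algebra X \<Otimes>\<^sub>M Y)" by (rule stoch_hom_restrictI[OF h])
      fix n
      show "stoch_comp Z (?I n) (restrict h (space Z)) = q n"
      proof (rule stoch_hom_eqI[OF stoch_comp_hom[OF hom I] q])
        fix z assume z: "z \<in> space Z"
        note hz = kernel_space[OF h z]
        have "stoch_comp Z (?I n) (restrict h (space Z)) z = h z \<bind> ?I n"
          using z by (simp add: stoch_comp_def)
        also have "\<dots> = h z \<bind> side (mset_space n X) Y (iid_mset X n)"
          by (rule bind_stoch_tensor_id[OF hz ik])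
        also have "\<dots> = h z \<bind> side (mset_space n X) Y (\<lambda>\<alpha>. distr (power_space n \<alpha>) (mset_space n X) (mset_of_tuple n))"
          by (rule bind_side_cong[OF hz]) (simp add: iid_mset_def)
        also have "\<dots> = distr (E n z) (mset_space n X \<Otimes>\<^sub>M Y) (\<lambda>s. (mset_of_tuple n (fst s), snd s))"
          unfolding hE[OF z, symmetric] by (rule distr_bind_side[OF hz power_space_kernel mset_of_tuple_measurable, symmetric])
        also have "\<dots> = q n z" by (rule E_q[OF z])
        finally show "stoch_comp Z (?I n) (restrict h (space Z)) z = q n z" .
      qed
    qed
    fix k assume k: "k \<in> stoch_hom Z (prob_algebra X \<Otimes>\<^sub>M Y) \<and> (\<forall>n. stoch_comp Z (?I n) k = q n)"
    show "k = restrict h (space Z)"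
    proof (rule stoch_hom_eqI[OF _ stoch_hom_restrictI[OF h]])
      show "k \<in> stoch_hom Z (prob_algebra X \<Otimes>\<^sub>M Y)" using k by blast
      fix z assume z: "z \<in> space Z"
      have kz: "k z \<in> space (prob_algebra (prob_algebra X \<Otimes>\<^sub>M Y))" using k z by (blast intro: kernel_space stoch_homD)
      note hz = kernel_space[OF h z]
      have kE: "k z \<bind> side (power_space n X) Y (power_space n) = E n z" for n
      proof -
        have "k z \<bind> side (power_space n X) Y (power_space n) = k z \<bind> side (power_space n X) Y (\<lambda>\<alpha>. iid_mset X n \<alpha> \<bind> mset_eq n X)"
          by (rule bind_side_cong[OF kz]) (simp add: iid_mset_eq)
        also have "\<dots> = (k z \<bind> side (mset_space n X) Y (iid_mset X n)) \<bind> side (power_space n X) Y (mset_eq n X)"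
          by (rule bind_side_bind[OF kz ik mset_eq_kernel, symmetric])
        also have "k z \<bind> side (mset_space n X) Y (iid_mset X n) = q n z"
          unfolding bind_stoch_tensor_id[OF kz ik, symmetric] using k z by (intro stoch_compD) auto
        finally show ?thesis by (simp only: E_def)
      qed
      have "k z = h z"
      proof (rule random_measure_pair_eqI[where X = X and W = Y])
        show "finite_measure (k z)" "finite_measure (h z)"
          using prob_algebraD(1)[OF kz] prob_algebraD(1)[OF hz] by (auto intro: prob_space.finite_measure)
        show "sets (k z) = sets (prob_algebra X \<Otimes>\<^sub>M Y)" "sets (h z) = sets (prob_algebra X \<Otimes>\<^sub>M Y)"
          by (rule prob_algebraD(2)[OF kz], rule prob_algebraD(2)[OF hz])
        fix As B assume As: "set As \<subseteq> sets X" and B: "B \<in> sets Y"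
        define n where "n = length As"
        \<comment> \<open>The mixed moments to be compared are the masses of the rectangle
          \<open>A \<times> B\<close> under \<open>E n z\<close>, which \<open>k z\<close> and
          \<open>h z\<close> share.\<close>
        define A where "A = PiE {..<n} ((!) As)"
        have A: "A \<in> sets (power_space n X)" unfolding A_def n_def by (rule PiE_nth_sets[OF As])
        have "(\<integral>\<^sup>+p. indicator B (snd p) * moment As (fst p) \<partial>g) =
            emeasure (g \<bind> side (power_space n X) Y (power_space n)) (A \<times> B)"
          if g: "g \<in> space (prob_algebra (prob_algebra X \<Otimes>\<^sub>M Y))" for g
        proof -
          have "emeasure (g \<bind> side (power_space n X) Y (power_space n)) (A \<times> B) =
              (\<integral>\<^sup>+p. emeasure (side (power_space n X) Y (power_space n) p) (A \<times> B) \<partial>g)"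
            using A B by (intro emeasure_bind_prob_algebra[OF g side_kernel[OF power_space_kernel]]) auto
          also have "\<dots> = (\<integral>\<^sup>+p. indicator B (snd p) * moment As (fst p) \<partial>g)"
          proof (rule nn_integral_cong)
            fix p assume "p \<in> space g"
            then have "p \<in> space (prob_algebra X) \<times> space Y"
              unfolding prob_algebraD(3)[OF g] space_pair_measure .
            then have \<alpha>: "fst p \<in> space (prob_algebra X)" and y: "snd p \<in> space Y" unfolding mem_Times_iff by blast+
            note P = power_space_prob_algebra[OF \<alpha>, of n]
            have m: "(\<lambda>x. (x, snd p)) \<in> power_space n (fst p) \<rightarrow>\<^sub>M power_space n X \<Otimes>\<^sub>M Y"
              using pair_right_measurable[OF y] by (simp add: measurable_cong_sets[OF prob_algebraD(2)[OF P] refl])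
            have "emeasure (side (power_space n X) Y (power_space n) p) (A \<times> B) =
                emeasure (power_space n (fst p)) ((\<lambda>x. (x, snd p)) -` (A \<times> B) \<inter> space (power_space n (fst p)))"
              unfolding side_def using A B by (intro emeasure_distr[OF m]) auto
            also have "(\<lambda>x. (x, snd p)) -` (A \<times> B) \<inter> space (power_space n (fst p)) = (if snd p \<in> B then A else {})"
              using sets.sets_into_space[OF A] prob_algebraD(3)[OF P] by auto
            also have "emeasure (power_space n (fst p)) \<dots> = indicator B (snd p) * moment As (fst p)"
              unfolding moment_eq_power_space[OF \<alpha> As] by (simp add: A_def n_def indicator_def)
            finally show "emeasure (side (power_space n X) Y (power_space n) p) (A \<times> B) = indicator B (snd p) * moment As (fst p)" .
          qed
          finally show ?thesis ..
        qed
        from this[OF kz] this[OF hz]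
        show "(\<integral>\<^sup>+p. indicator B (snd p) * moment As (fst p) \<partial>k z) = (\<integral>\<^sup>+p. indicator B (snd p) * moment As (fst p) \<partial>h z)"
          by (simp only: kE hE[OF z])
      qed
      then show "k z = restrict h (space Z) z" using z by simp
    qed
  qed
qed

subsection \<open>Commutative comonoids\<close>

lemma bind_return_prob_algebra:
  "k \<in> X \<rightarrow>\<^sub>M prob_algebra Y \<Longrightarrow> x \<in> space X \<Longrightarrow> return X x \<bind> k = k x"
  by (rule bind_return[OF measurable_prob_algebraD])

lemma return_pair:
  assumes "a \<in> space A" "b \<in> space B"
  shows "return A a \<Otimes>\<^sub>M return B b = return (A \<Otimes>\<^sub>M B) (a, b)"
proof -
  have m: "(\<lambda>y. distr (return A a) (A \<Otimes>\<^sub>M B) (\<lambda>x. (x, y))) \<in> B \<rightarrow>\<^sub>M prob_algebra (A \<Otimes>\<^sub>M B)"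
    by (rule measurable_distr_prob_space2[where M = A]) (simp_all add: return_prob_algebra assms)
  have "return A a \<Otimes>\<^sub>M return B b = return B b \<bind> (\<lambda>y. distr (return A a) (A \<Otimes>\<^sub>M B) (\<lambda>x. (x, y)))"
    by (rule pair_measure_eq_bind_side[OF return_prob_algebra return_prob_algebra]) fact+
  also have "\<dots> = distr (return A a) (A \<Otimes>\<^sub>M B) (\<lambda>x. (x, b))" by (rule bind_return_prob_algebra[OF m assms(2)])
  also have "\<dots> = return (A \<Otimes>\<^sub>M B) (a, b)" by (rule distr_return[OF pair_right_measurable[OF assms(2)] assms(1)])
  finally show ?thesis .
qed

lemma stoch_det_apply: "x \<in> space X \<Longrightarrow> stoch_det X Y f x = return Y (f x)"
  by (simp add: stoch_det_def)

lemma stoch_tensor_apply: "a \<in> space A \<Longrightarrow> b \<in> space B \<Longrightarrow> stoch_tensor A B k l (a, b) = k a \<Otimes>\<^sub>M l b"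
  by (simp add: stoch_tensor_def space_pair_measure)

lemma unit_kernel_unique:
  assumes "\<mu> \<in> space (prob_algebra stoch_unit)" "\<nu> \<in> space (prob_algebra stoch_unit)" shows "\<mu> = \<nu>"
proof (rule measure_eqI)
  show "sets \<mu> = sets \<nu>" using prob_algebraD(2)[OF assms(1)] prob_algebraD(2)[OF assms(2)] by simp
  fix A :: "unit set"
  have "A = {} \<or> A = UNIV" by auto
  moreover have "emeasure \<mu> UNIV = 1" "emeasure \<nu> UNIV = 1"
    using prob_space.emeasure_space_1[OF prob_algebraD(1)[OF assms(1)]] prob_space.emeasure_space_1[OF prob_algebraD(1)[OF assms(2)]]
    by (simp_all add: prob_algebraD(3)[OF assms(1)] prob_algebraD(3)[OF assms(2)] stoch_unit_def)
  ultimately show "emeasure \<mu> A = emeasure \<nu> A" by auto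
qed

lemma stoch_hom_unit_unique: "f \<in> stoch_hom X stoch_unit \<Longrightarrow> g \<in> stoch_hom X stoch_unit \<Longrightarrow> f = g"
  by (rule stoch_hom_eqI, assumption+) (rule unit_kernel_unique; erule kernel_space[OF stoch_homD])

lemma stoch_comp_apply: "x \<in> space X \<Longrightarrow> stoch_comp X g f x = f x \<bind> g"
  by (simp add: stoch_comp_def)

lemma assoc_measurable:
  "(\<lambda>((x, y), z). (x, y, z)) \<in> (A \<Otimes>\<^sub>M B) \<Otimes>\<^sub>M C \<rightarrow>\<^sub>M A \<Otimes>\<^sub>M B \<Otimes>\<^sub>M C"
  unfolding split_def by measurable

lemma comm_comonoid_copy:
  assumes C: "standard_borel C"
  shows "comm_comonoid C (stoch_det C (C \<Otimes>\<^sub>M C) (\<lambda>c. (c, c))) (stoch_det C stoch_unit (\<lambda>_. ()))"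
proof -
  let ?\<delta> = "stoch_det C (C \<Otimes>\<^sub>M C) (\<lambda>c. (c, c))" and ?\<epsilon> = "stoch_det C stoch_unit (\<lambda>_. ())"
  have \<delta>: "?\<delta> \<in> stoch_hom C (C \<Otimes>\<^sub>M C)" by (rule stoch_det_hom) measurable
  have \<epsilon>: "?\<epsilon> \<in> stoch_hom C stoch_unit" by (rule stoch_det_hom) (simp add: stoch_unit_def)
  have assoc: "stoch_assoc C C C \<in> stoch_hom ((C \<Otimes>\<^sub>M C) \<Otimes>\<^sub>M C) (C \<Otimes>\<^sub>M C \<Otimes>\<^sub>M C)"
    unfolding stoch_assoc_def by (rule stoch_det_hom[OF assoc_measurable])
  have lun: "stoch_lunit C \<in> stoch_hom (stoch_unit \<Otimes>\<^sub>M C) C" unfolding stoch_lunit_def by (rule stoch_det_hom) measurable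
  have run: "stoch_runit C \<in> stoch_hom (C \<Otimes>\<^sub>M stoch_unit) C" unfolding stoch_runit_def by (rule stoch_det_hom) measurable
  have swap: "stoch_swap C C \<in> stoch_hom (C \<Otimes>\<^sub>M C) (C \<Otimes>\<^sub>M C)" unfolding stoch_swap_def by (rule stoch_det_hom) measurable
  note hom = stoch_tensor_hom[OF \<delta> stoch_id_hom[of C]] stoch_tensor_hom[OF stoch_id_hom[of C] \<delta>]
    stoch_tensor_hom[OF \<epsilon> stoch_id_hom[of C]] stoch_tensor_hom[OF stoch_id_hom[of C] \<epsilon>]
  have d: "?\<delta> c = return (C \<Otimes>\<^sub>M C) (c, c)" and e: "?\<epsilon> c = return stoch_unit ()"
    and cc: "(c, c) \<in> space (C \<Otimes>\<^sub>M C)" and i: "stoch_id C c = return C c" if "c \<in> space C" for c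
    using that by (auto simp: stoch_det_apply space_pair_measure stoch_id_def)
  have u: "() \<in> space stoch_unit" by (simp add: stoch_unit_def)
  have t1: "stoch_comp C (stoch_tensor C C ?\<delta> (stoch_id C)) ?\<delta> c = return ((C \<Otimes>\<^sub>M C) \<Otimes>\<^sub>M C) ((c, c), c)" if c: "c \<in> space C" for c
    unfolding stoch_comp_apply[OF c] d[OF c] bind_return_prob_algebra[OF stoch_homD[OF hom(1)] cc[OF c]] stoch_tensor_apply[OF c c] d[OF c] i[OF c] by (rule return_pair[OF cc[OF c] c])
  have t2: "stoch_comp C (stoch_tensor C C (stoch_id C) ?\<delta>) ?\<delta> c = return (C \<Otimes>\<^sub>M C \<Otimes>\<^sub>M C) (c, c, c)" if c: "c \<in> space C" for c
    unfolding stoch_comp_apply[OF c] d[OF c] bind_return_prob_algebra[OF stoch_homD[OF hom(2)] cc[OF c]] stoch_tensor_apply[OF c c] d[OF c] i[OF c] by (rule return_pair[OF c cc[OF c]])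
  have t3: "stoch_comp C (stoch_tensor C C ?\<epsilon> (stoch_id C)) ?\<delta> c = return (stoch_unit \<Otimes>\<^sub>M C) ((), c)" if c: "c \<in> space C" for c
    unfolding stoch_comp_apply[OF c] d[OF c] bind_return_prob_algebra[OF stoch_homD[OF hom(3)] cc[OF c]] stoch_tensor_apply[OF c c] e[OF c] i[OF c] by (rule return_pair[OF u c])
  have t4: "stoch_comp C (stoch_tensor C C (stoch_id C) ?\<epsilon>) ?\<delta> c = return (C \<Otimes>\<^sub>M stoch_unit) (c, ())" if c: "c \<in> space C" for c
    unfolding stoch_comp_apply[OF c] d[OF c] bind_return_prob_algebra[OF stoch_homD[OF hom(4)] cc[OF c]] stoch_tensor_apply[OF c c] e[OF c] i[OF c] by (rule return_pair[OF c u])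
  show ?thesis
    unfolding comm_comonoid_def
  proof (intro conjI C \<delta> \<epsilon>)
    show "stoch_comp C (stoch_assoc C C C) (stoch_comp C (stoch_tensor C C ?\<delta> (stoch_id C)) ?\<delta>) =
       stoch_comp C (stoch_tensor C C (stoch_id C) ?\<delta>) ?\<delta>"
    proof (rule stoch_hom_eqI[OF stoch_comp_hom[OF stoch_comp_hom[OF \<delta> hom(1)] assoc] stoch_comp_hom[OF \<delta> hom(2)]])
      fix c assume c: "c \<in> space C"
      have ccc: "((c, c), c) \<in> space ((C \<Otimes>\<^sub>M C) \<Otimes>\<^sub>M C)" using c by (simp add: space_pair_measure)
      show "stoch_comp C (stoch_assoc C C C) (stoch_comp C (stoch_tensor C C ?\<delta> (stoch_id C)) ?\<delta>) c =
          stoch_comp C (stoch_tensor C C (stoch_id C) ?\<delta>) ?\<delta> c"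
        unfolding stoch_comp_apply[OF c, of "stoch_assoc C C C"] t1[OF c] bind_return_prob_algebra[OF stoch_homD[OF assoc] ccc] t2[OF c] using ccc by (simp add: stoch_assoc_def stoch_det_apply)
    qed
    show "stoch_comp C (stoch_lunit C) (stoch_comp C (stoch_tensor C C ?\<epsilon> (stoch_id C)) ?\<delta>) = stoch_id C"
    proof (rule stoch_hom_eqI[OF stoch_comp_hom[OF stoch_comp_hom[OF \<delta> hom(3)] lun] stoch_id_hom])
      fix c assume c: "c \<in> space C"
      have uc: "((), c) \<in> space (stoch_unit \<Otimes>\<^sub>M C)" using c u by (simp add: space_pair_measure)
      show "stoch_comp C (stoch_lunit C) (stoch_comp C (stoch_tensor C C ?\<epsilon> (stoch_id C)) ?\<delta>) c = stoch_id C c"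
        unfolding stoch_comp_apply[OF c, of "stoch_lunit C"] t3[OF c] bind_return_prob_algebra[OF stoch_homD[OF lun] uc] i[OF c] using uc by (simp add: stoch_lunit_def stoch_det_apply)
    qed
    show "stoch_comp C (stoch_runit C) (stoch_comp C (stoch_tensor C C (stoch_id C) ?\<epsilon>) ?\<delta>) = stoch_id C"
    proof (rule stoch_hom_eqI[OF stoch_comp_hom[OF stoch_comp_hom[OF \<delta> hom(4)] run] stoch_id_hom])
      fix c assume c: "c \<in> space C"
      have cu: "(c, ()) \<in> space (C \<Otimes>\<^sub>M stoch_unit)" using c u by (simp add: space_pair_measure)
      show "stoch_comp C (stoch_runit C) (stoch_comp C (stoch_tensor C C (stoch_id C) ?\<epsilon>) ?\<delta>) c = stoch_id C c"
        unfolding stoch_comp_apply[OF c, of "stoch_runit C"] t4[OF c] bind_return_prob_algebra[OF stoch_homD[OF run] cu] i[OF c] using cu by (simp add: stoch_runit_def stoch_det_apply)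
    qed
    show "stoch_comp C (stoch_swap C C) ?\<delta> = ?\<delta>"
    proof (rule stoch_hom_eqI[OF stoch_comp_hom[OF \<delta> swap] \<delta>])
      fix c assume c: "c \<in> space C"
      show "stoch_comp C (stoch_swap C C) ?\<delta> c = ?\<delta> c"
        unfolding stoch_comp_apply[OF c] d[OF c] bind_return_prob_algebra[OF stoch_homD[OF swap] cc[OF c]] d[OF c] using cc[OF c] by (simp add: stoch_swap_def stoch_det_apply)
    qed
  qed
qed

lemma nn_integral_pair_mult:
  assumes \<alpha>: "\<alpha> \<in> space (prob_algebra A)" and \<beta>: "\<beta> \<in> space (prob_algebra B)"
    and f: "f \<in> borel_measurable A" and g: "g \<in> borel_measurable B"
  shows "(\<integral>\<^sup>+p. f (fst p) * g (snd p) \<partial>(\<alpha> \<Otimes>\<^sub>M \<beta>)) = (\<integral>\<^sup>+x. f x \<partial>\<alpha>) * (\<integral>\<^sup>+y. g y \<partial>\<beta>)"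
proof -
  interpret \<beta>: sigma_finite_measure \<beta> by (rule prob_space_imp_sigma_finite[OF prob_algebraD(1)[OF \<beta>]])
  have f': "f \<in> borel_measurable \<alpha>" and g': "g \<in> borel_measurable \<beta>"
    using f g by (simp_all add: measurable_cong_sets[OF prob_algebraD(2)[OF \<alpha>] refl] measurable_cong_sets[OF prob_algebraD(2)[OF \<beta>] refl])
  have m: "(\<lambda>p. f (fst p) * g (snd p)) \<in> borel_measurable (\<alpha> \<Otimes>\<^sub>M \<beta>)"
    by (intro borel_measurable_times_ennreal measurable_compose[OF measurable_fst f'] measurable_compose[OF measurable_snd g'])
  have "(\<integral>\<^sup>+p. f (fst p) * g (snd p) \<partial>(\<alpha> \<Otimes>\<^sub>M \<beta>)) = (\<integral>\<^sup>+x. (\<integral>\<^sup>+y. f x * g y \<partial>\<beta>) \<partial>\<alpha>)"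
    using \<beta>.nn_integral_fst[OF m] by simp
  also have "\<dots> = (\<integral>\<^sup>+x. f x * (\<integral>\<^sup>+y. g y \<partial>\<beta>) \<partial>\<alpha>)" by (intro nn_integral_cong nn_integral_cmult g')
  also have "\<dots> = (\<integral>\<^sup>+x. f x \<partial>\<alpha>) * (\<integral>\<^sup>+y. g y \<partial>\<beta>)" by (rule nn_integral_multc[OF f'])
  finally show ?thesis .
qed

lemma nn_integral_stoch_tensor:
  assumes p: "p \<in> space (A \<Otimes>\<^sub>M B)" and k: "k \<in> stoch_hom A C" and l: "l \<in> stoch_hom B D"
    and f: "f \<in> borel_measurable C" and g: "g \<in> borel_measurable D"
  shows "(\<integral>\<^sup>+q. f (fst q) * g (snd q) \<partial>stoch_tensor A B k l p) = (\<integral>\<^sup>+x. f x \<partial>k (fst p)) * (\<integral>\<^sup>+y. g y \<partial>l (snd p))"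
proof -
  have a: "fst p \<in> space A" and b: "snd p \<in> space B" using p by (auto simp: space_pair_measure)
  have "stoch_tensor A B k l p = k (fst p) \<Otimes>\<^sub>M l (snd p)" using p by (simp add: stoch_tensor_def)
  then show ?thesis
    using nn_integral_pair_mult[OF kernel_space[OF stoch_homD[OF k] a] kernel_space[OF stoch_homD[OF l] b] f g] by simp
qed

text \<open>The comultiplication turns the measurable functions on a commutative comonoid into a commutative monoid under
  \<open>convolve\<close>, in which the iterated comultiplications followed by \<open>f\<close> are the products of the functions \<open>d \<mapsto> f d A\<close>.\<close>

definition convolve :: "('d \<Rightarrow> ('d \<times> 'd) measure) \<Rightarrow> ('d \<Rightarrow> ennreal) \<Rightarrow> ('d \<Rightarrow> ennreal) \<Rightarrow> 'd \<Rightarrow> ennreal" where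
  "convolve \<delta> u v d = (\<integral>\<^sup>+p. u (fst p) * v (snd p) \<partial>\<delta> d)"

definition convolve_list :: "('d \<Rightarrow> ('d \<times> 'd) measure) \<Rightarrow> ('d \<Rightarrow> 'a measure) \<Rightarrow> 'a set list \<Rightarrow> 'd \<Rightarrow> ennreal" where
  "convolve_list \<delta> f As = foldr (\<lambda>A. convolve \<delta> (\<lambda>d. emeasure (f d) A)) As (\<lambda>_. 1)"

lemma convolve_list_simps:
  "convolve_list \<delta> f [] = (\<lambda>_. 1)"
  "convolve_list \<delta> f (A # As) = convolve \<delta> (\<lambda>d. emeasure (f d) A) (convolve_list \<delta> f As)"
  by (simp_all add: convolve_list_def)

locale comonoid =
  fixes D :: "'d measure" and \<delta> \<epsilon>
  assumes comonoid: "comm_comonoid D \<delta> \<epsilon>"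
begin

lemma \<delta>: "\<delta> \<in> stoch_hom D (D \<Otimes>\<^sub>M D)" and \<epsilon>: "\<epsilon> \<in> stoch_hom D stoch_unit"
  using comonoid by (auto simp: comm_comonoid_def)

lemma \<delta>_space: "d \<in> space D \<Longrightarrow> \<delta> d \<in> space (prob_algebra (D \<Otimes>\<^sub>M D))"
  by (rule kernel_space[OF stoch_homD[OF \<delta>]])

lemma prod_measurable:
  "u \<in> borel_measurable A \<Longrightarrow> v \<in> borel_measurable B \<Longrightarrow> (\<lambda>p. u (fst p) * v (snd p) :: ennreal) \<in> borel_measurable (A \<Otimes>\<^sub>M B)"
  by (intro borel_measurable_times_ennreal measurable_compose[OF measurable_fst] measurable_compose[OF measurable_snd])

lemma convolve_measurable:
  assumes "u \<in> borel_measurable D" "v \<in> borel_measurable D" shows "convolve \<delta> u v \<in> borel_measurable D"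
  unfolding convolve_def
  by (rule measurable_compose[OF measurable_prob_algebraD[OF stoch_homD[OF \<delta>]]
        nn_integral_measurable_subprob_algebra[OF prod_measurable[OF assms]]])

lemma convolve_cong:
  assumes d: "d \<in> space D" and "\<And>x. x \<in> space D \<Longrightarrow> u x = u' x" "\<And>x. x \<in> space D \<Longrightarrow> v x = v' x"
  shows "convolve \<delta> u v d = convolve \<delta> u' v' d"
  unfolding convolve_def using assms(2,3) prob_algebraD(3)[OF \<delta>_space[OF d]]
  by (intro nn_integral_cong) (auto simp: space_pair_measure)

text \<open>Cocommutativity makes the law \<open>\<delta> d\<close> invariant under the exchange of
  its components.\<close>

lemma convolve_commute:
  assumes d: "d \<in> space D" and u: "u \<in> borel_measurable D" and v: "v \<in> borel_measurable D"
  shows "convolve \<delta> u v d = convolve \<delta> v u d"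
proof -
  have sw: "(\<lambda>(x, y). (y, x)) \<in> D \<Otimes>\<^sub>M D \<rightarrow>\<^sub>M D \<Otimes>\<^sub>M D" by measurable
  have "stoch_comp D (stoch_swap D D) \<delta> = \<delta>" using comonoid by (simp add: comm_comonoid_def)
  from stoch_compD[OF this d] have "distr (\<delta> d) (D \<Otimes>\<^sub>M D) (\<lambda>(x, y). (y, x)) = \<delta> d"
    unfolding stoch_swap_def bind_stoch_det[OF \<delta>_space[OF d] sw] .
  then have "convolve \<delta> u v d = (\<integral>\<^sup>+p. u (fst p) * v (snd p) \<partial>distr (\<delta> d) (D \<Otimes>\<^sub>M D) (\<lambda>(x, y). (y, x)))"
    by (simp add: convolve_def)
  also have "\<dots> = (\<integral>\<^sup>+p. u (snd p) * v (fst p) \<partial>\<delta> d)"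
    using sw prod_measurable[OF u v]
    by (subst nn_integral_distr) (simp_all add: measurable_cong_sets[OF prob_algebraD(2)[OF \<delta>_space[OF d]] refl] split_def)
  finally show ?thesis by (simp add: convolve_def mult.commute)
qed

text \<open>Both sides integrate the product of \<open>u\<close>, \<open>v\<close> and
  \<open>w\<close> against the two bracketings of the threefold comultiplication, which
  coassociativity identifies.\<close>

lemma convolve_assoc:
  assumes d: "d \<in> space D" and u: "u \<in> borel_measurable D" and v: "v \<in> borel_measurable D" and w: "w \<in> borel_measurable D"
  shows "convolve \<delta> (convolve \<delta> u v) w d = convolve \<delta> u (convolve \<delta> v w) d"
proof -
  let ?l = "stoch_tensor D D \<delta> (stoch_id D)" and ?r = "stoch_tensor D D (stoch_id D) \<delta>"
  let ?a = "\<lambda>((x, y), z). (x, y, z) :: 'd \<times> 'd \<times> 'd"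
  have l: "?l \<in> stoch_hom (D \<Otimes>\<^sub>M D) ((D \<Otimes>\<^sub>M D) \<Otimes>\<^sub>M D)" by (rule stoch_tensor_hom[OF \<delta> stoch_id_hom])
  have r: "?r \<in> stoch_hom (D \<Otimes>\<^sub>M D) (D \<Otimes>\<^sub>M D \<Otimes>\<^sub>M D)" by (rule stoch_tensor_hom[OF stoch_id_hom \<delta>])
  have a: "?a \<in> (D \<Otimes>\<^sub>M D) \<Otimes>\<^sub>M D \<rightarrow>\<^sub>M D \<Otimes>\<^sub>M D \<Otimes>\<^sub>M D" by (rule assoc_measurable)
  note dl = bind_prob_algebra[OF \<delta>_space[OF d] stoch_homD[OF l]]
  have "stoch_comp D (stoch_assoc D D D) (stoch_comp D ?l \<delta>) = stoch_comp D ?r \<delta>"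
    using comonoid by (simp add: comm_comonoid_def)
  from fun_cong[OF this, of d] d have "(\<delta> d \<bind> ?l) \<bind> stoch_assoc D D D = \<delta> d \<bind> ?r" by (simp add: stoch_comp_def)
  then have eq: "distr (\<delta> d \<bind> ?l) (D \<Otimes>\<^sub>M D \<Otimes>\<^sub>M D) ?a = \<delta> d \<bind> ?r"
    unfolding stoch_assoc_def bind_stoch_det[OF dl a] .
  let ?g = "\<lambda>q :: 'd \<times> 'd \<times> 'd. u (fst q) * (v (fst (snd q)) * w (snd (snd q)))"
  have g: "?g \<in> borel_measurable (D \<Otimes>\<^sub>M D \<Otimes>\<^sub>M D)" by (rule prod_measurable[OF u prod_measurable[OF v w]])
  have g': "(\<lambda>q. (u (fst (fst q)) * v (snd (fst q))) * w (snd q)) \<in> borel_measurable ((D \<Otimes>\<^sub>M D) \<Otimes>\<^sub>M D)"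
    by (rule prod_measurable[OF prod_measurable[OF u v] w])
  have idi: "(\<integral>\<^sup>+x. h x \<partial>stoch_id D c) = h c" if "c \<in> space D" "h \<in> borel_measurable D" for c h
    using that by (simp add: stoch_id_def stoch_det_apply nn_integral_return)
  have sp: "fst p \<in> space D" "snd p \<in> space D" "p \<in> space (D \<Otimes>\<^sub>M D)" if "p \<in> space (\<delta> d)" for p
    using that unfolding prob_algebraD(3)[OF \<delta>_space[OF d]] by (auto simp: space_pair_measure)
  have "convolve \<delta> (convolve \<delta> u v) w d = (\<integral>\<^sup>+p. (\<integral>\<^sup>+q. (u (fst (fst q)) * v (snd (fst q))) * w (snd q) \<partial>?l p) \<partial>\<delta> d)"
    unfolding convolve_def[of _ _ w]
    by (intro nn_integral_cong)
       (simp add: nn_integral_stoch_tensor[OF sp(3) \<delta> stoch_id_hom prod_measurable[OF u v] w] idi sp w convolve_def)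
  also have "\<dots> = (\<integral>\<^sup>+q. (u (fst (fst q)) * v (snd (fst q))) * w (snd q) \<partial>(\<delta> d \<bind> ?l))"
    by (rule nn_integral_bind_prob_algebra[OF \<delta>_space[OF d] stoch_homD[OF l] g', symmetric])
  also have "\<dots> = (\<integral>\<^sup>+q. ?g (?a q) \<partial>(\<delta> d \<bind> ?l))"
    by (intro nn_integral_cong) (simp add: split_def mult.assoc)
  also have "\<dots> = (\<integral>\<^sup>+q. ?g q \<partial>distr (\<delta> d \<bind> ?l) (D \<Otimes>\<^sub>M D \<Otimes>\<^sub>M D) ?a)"
    using a g by (intro nn_integral_distr[symmetric]) (simp_all add: measurable_cong_sets[OF prob_algebraD(2)[OF dl] refl])
  also have "\<dots> = (\<integral>\<^sup>+p. (\<integral>\<^sup>+q. ?g q \<partial>?r p) \<partial>\<delta> d)"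
    unfolding eq by (rule nn_integral_bind_prob_algebra[OF \<delta>_space[OF d] stoch_homD[OF r] g])
  also have "\<dots> = convolve \<delta> u (convolve \<delta> v w) d"
    unfolding convolve_def[of _ u]
    by (intro nn_integral_cong)
       (simp add: nn_integral_stoch_tensor[OF sp(3) stoch_id_hom \<delta> u prod_measurable[OF v w]] idi sp u convolve_def)
  finally show ?thesis .
qed

text \<open>The integral of 1 against the counit is 1, so the left factor can be routed through
  \<epsilon>, where the left counit law applies.\<close>

lemma convolve_one:
  assumes d: "d \<in> space D" and v: "v \<in> borel_measurable D"
  shows "convolve \<delta> (\<lambda>_. 1) v d = v d"
proof -
  let ?l = "stoch_tensor D D \<epsilon> (stoch_id D)"
  have l: "?l \<in> stoch_hom (D \<Otimes>\<^sub>M D) (stoch_unit \<Otimes>\<^sub>M D)" by (rule stoch_tensor_hom[OF \<epsilon> stoch_id_hom])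
  note dl = bind_prob_algebra[OF \<delta>_space[OF d] stoch_homD[OF l]]
  have "stoch_comp D (stoch_lunit D) (stoch_comp D ?l \<delta>) = stoch_id D"
    using comonoid by (simp add: comm_comonoid_def)
  from fun_cong[OF this, of d] d have "(\<delta> d \<bind> ?l) \<bind> stoch_lunit D = return D d"
    by (simp add: stoch_comp_def stoch_id_def stoch_det_apply)
  then have eq: "distr (\<delta> d \<bind> ?l) D snd = return D d"
    unfolding stoch_lunit_def bind_stoch_det[OF dl measurable_snd] .
  have sp: "fst p \<in> space D" "snd p \<in> space D" "p \<in> space (D \<Otimes>\<^sub>M D)" if "p \<in> space (\<delta> d)" for p
    using that unfolding prob_algebraD(3)[OF \<delta>_space[OF d]] by (auto simp: space_pair_measure)
  have one: "(\<integral>\<^sup>+x. 1 \<partial>\<epsilon> c) = 1" if "c \<in> space D" for c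
    using prob_space.emeasure_space_1[OF prob_algebraD(1)[OF kernel_space[OF stoch_homD[OF \<epsilon>] that]]] by simp
  have 1: "(\<lambda>_. 1) \<in> borel_measurable stoch_unit" by simp
  have "convolve \<delta> (\<lambda>_. 1) v d = (\<integral>\<^sup>+p. (\<integral>\<^sup>+q. 1 * v (snd q) \<partial>?l p) \<partial>\<delta> d)"
    unfolding convolve_def using nn_integral_stoch_tensor[OF sp(3) \<epsilon> stoch_id_hom 1 v] one sp v
    by (intro nn_integral_cong) (simp add: stoch_id_def stoch_det_apply nn_integral_return)
  also have "\<dots> = (\<integral>\<^sup>+q. v (snd q) \<partial>(\<delta> d \<bind> ?l))"
    using nn_integral_bind_prob_algebra[OF \<delta>_space[OF d] stoch_homD[OF l] measurable_compose[OF measurable_snd v]] by simp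
  also have "\<dots> = (\<integral>\<^sup>+x. v x \<partial>distr (\<delta> d \<bind> ?l) D snd)"
    using v by (intro nn_integral_distr[symmetric]) (simp_all add: measurable_cong_sets[OF prob_algebraD(2)[OF dl] refl])
  also have "\<dots> = v d" unfolding eq using d v by (simp add: nn_integral_return)
  finally show ?thesis .
qed

lemma convolve_left_commute:
  assumes d: "d \<in> space D" and u: "u \<in> borel_measurable D" and v: "v \<in> borel_measurable D" and w: "w \<in> borel_measurable D"
  shows "convolve \<delta> u (convolve \<delta> v w) d = convolve \<delta> v (convolve \<delta> u w) d"
proof -
  have "convolve \<delta> u (convolve \<delta> v w) d = convolve \<delta> (convolve \<delta> u v) w d" by (rule convolve_assoc[OF d u v w, symmetric])
  also have "\<dots> = convolve \<delta> (convolve \<delta> v u) w d" by (intro convolve_cong[OF d] convolve_commute u v refl)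
  also have "\<dots> = convolve \<delta> v (convolve \<delta> u w) d" by (rule convolve_assoc[OF d v u w])
  finally show ?thesis .
qed

context
  fixes f :: "'d \<Rightarrow> 'a measure" and X :: "'a measure"
  assumes f: "f \<in> stoch_hom D X"
begin

lemma emeasure_f_measurable: "A \<in> sets X \<Longrightarrow> (\<lambda>d. emeasure (f d) A) \<in> borel_measurable D"
  by (rule measurable_compose[OF stoch_homD[OF f] emeasure_measurable_prob_algebra])

lemma convolve_list_measurable: "set As \<subseteq> sets X \<Longrightarrow> convolve_list \<delta> f As \<in> borel_measurable D"
  by (induction As) (auto simp: convolve_list_simps intro!: convolve_measurable emeasure_f_measurable)

text \<open>Associativity and the unit law of \<open>convolve\<close>. For the mediating kernel this
  becomes compatibility with the copying of probability measures.\<close>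

lemma convolve_list_append:
  assumes "set As \<subseteq> sets X" "set Bs \<subseteq> sets X" "d \<in> space D"
  shows "convolve_list \<delta> f (As @ Bs) d = convolve \<delta> (convolve_list \<delta> f As) (convolve_list \<delta> f Bs) d"
  using assms
proof (induction As arbitrary: d)
  case Nil
  then show ?case by (simp add: convolve_list_simps convolve_one convolve_list_measurable)
next
  case (Cons A As)
  have m: "(\<lambda>d. emeasure (f d) A) \<in> borel_measurable D" "convolve_list \<delta> f As \<in> borel_measurable D"
    "convolve_list \<delta> f Bs \<in> borel_measurable D"
    using Cons.prems by (auto intro: emeasure_f_measurable convolve_list_measurable)
  have "convolve_list \<delta> f ((A # As) @ Bs) d =
      convolve \<delta> (\<lambda>d. emeasure (f d) A) (convolve \<delta> (convolve_list \<delta> f As) (convolve_list \<delta> f Bs)) d"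
    unfolding append_Cons convolve_list_simps using Cons by (intro convolve_cong) auto
  also have "\<dots> = convolve \<delta> (convolve_list \<delta> f (A # As)) (convolve_list \<delta> f Bs) d"
    unfolding convolve_list_simps by (rule convolve_assoc[OF Cons.prems(3) m, symmetric])
  finally show ?case .
qed

lemma convolve_list_insert:
  assumes "set As \<subseteq> sets X" "set Bs \<subseteq> sets X" "A \<in> sets X" "d \<in> space D"
  shows "convolve_list \<delta> f (As @ A # Bs) d = convolve_list \<delta> f (A # As @ Bs) d"
  using assms
proof (induction As arbitrary: d)
  case (Cons B As)
  have m: "(\<lambda>d. emeasure (f d) A) \<in> borel_measurable D" "(\<lambda>d. emeasure (f d) B) \<in> borel_measurable D"
    "convolve_list \<delta> f (As @ Bs) \<in> borel_measurable D"
    using Cons.prems by (auto intro!: emeasure_f_measurable convolve_list_measurable)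
  have "convolve_list \<delta> f ((B # As) @ A # Bs) d =
      convolve \<delta> (\<lambda>d. emeasure (f d) B) (convolve \<delta> (\<lambda>d. emeasure (f d) A) (convolve_list \<delta> f (As @ Bs))) d"
    unfolding append_Cons convolve_list_simps(2)[of _ _ B] using Cons
    by (intro convolve_cong) (auto simp: convolve_list_simps)
  also have "\<dots> = convolve_list \<delta> f (A # (B # As) @ Bs) d"
    unfolding append_Cons convolve_list_simps by (rule convolve_left_commute[OF Cons.prems(4) m(2) m(1) m(3)])
  finally show ?case .
qed simp

text \<open>Commutativity of \<open>convolve\<close>, with \<open>convolve_list_insert\<close>
  moving one entry at a time to the front. The symmetry of \<open>iterate\<close> rests on
  it.\<close>

lemma convolve_list_mset_cong:
  assumes "mset As = mset Bs" "set As \<subseteq> sets X" "d \<in> space D"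
  shows "convolve_list \<delta> f As d = convolve_list \<delta> f Bs d"
  using assms
proof (induction As arbitrary: Bs d)
  case (Cons A As)
  have "A \<in> set Bs" using mset_eq_setD[OF Cons.prems(1)] by auto
  then obtain Cs Ds where Bs: "Bs = Cs @ A # Ds" by (auto simp: in_set_conv_decomp)
  have mset: "mset As = mset (Cs @ Ds)" using Cons.prems(1) by (simp add: Bs)
  have sub: "set Cs \<subseteq> sets X" "set Ds \<subseteq> sets X" "A \<in> sets X"
    using Cons.prems(2) mset_eq_setD[OF Cons.prems(1)] by (auto simp: Bs)
  have "convolve_list \<delta> f (A # As) d = convolve_list \<delta> f (A # Cs @ Ds) d"
    unfolding convolve_list_simps using Cons.IH[OF mset] Cons.prems by (intro convolve_cong) auto
  also have "\<dots> = convolve_list \<delta> f Bs d"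
    unfolding Bs by (rule convolve_list_insert[OF sub Cons.prems(3), symmetric])
  finally show ?case .
qed simp

lemma convolve_list_single:
  assumes "A \<in> sets X" "d \<in> space D" shows "convolve_list \<delta> f [A] d = emeasure (f d) A"
proof -
  have "convolve_list \<delta> f [A] d = convolve \<delta> (\<lambda>_. 1) (\<lambda>d. emeasure (f d) A) d"
    unfolding convolve_list_simps by (rule convolve_commute[OF assms(2) emeasure_f_measurable[OF assms(1)]]) simp
  then show ?thesis using assms by (simp add: convolve_one emeasure_f_measurable)
qed

text \<open>The iterated comultiplication bracketed to the left, with each right leg mapped by
  \<open>f\<close> and stored at the new last index; the base is the only point of the power of
  order 0.\<close>

fun iterate :: "nat \<Rightarrow> 'd \<Rightarrow> (nat \<Rightarrow> 'a) measure" where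
  "iterate 0 d = return (power_space 0 X) (\<lambda>_. undefined)"
| "iterate (Suc n) d =
     \<delta> d \<bind> (\<lambda>p. distr (iterate n (fst p) \<Otimes>\<^sub>M f (snd p)) (power_space (Suc n) X) (\<lambda>s. (fst s)(n := snd s)))"

lemma iterate_kernel: "iterate n \<in> D \<rightarrow>\<^sub>M prob_algebra (power_space n X)"
proof (induction n)
  case 0
  have "(\<lambda>_. undefined) \<in> space (power_space 0 X)" by (simp add: power_space_def space_PiM)
  then have "return (power_space 0 X) (\<lambda>_. undefined) \<in> space (prob_algebra (power_space 0 X))" by (rule return_prob_algebra)
  then show ?case unfolding iterate.simps(1)[abs_def] by (rule measurable_const)
next
  case (Suc n)
  show ?case
    unfolding iterate.simps(2)[abs_def]
    by (intro measurable_bind_prob_space[OF stoch_homD[OF \<delta>]] measurable_compose[OF _ measurable_distr_prob_space[OF fun_upd_measurable]]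
        measurable_pair_prob measurable_compose[OF measurable_fst Suc] measurable_compose[OF measurable_snd stoch_homD[OF f]])
qed

lemma emeasure_iterate:
  assumes "\<And>i. i < n \<Longrightarrow> A i \<in> sets X" "d \<in> space D"
  shows "emeasure (iterate n d) (PiE {..<n} A) = convolve_list \<delta> f (map A [0..<n]) d"
  using assms
proof (induction n arbitrary: d)
  case 0
  have "(\<lambda>_. undefined) \<in> space (power_space 0 X)" by (simp add: power_space_def space_PiM)
  moreover have "{\<lambda>_. undefined} = space (power_space 0 X)" by (simp add: power_space_def space_PiM)
  then have "{\<lambda>_. undefined} \<in> sets (power_space 0 X)" by simp
  ultimately show ?case by (simp add: convolve_list_simps)
next
  case (Suc n)
  note d = Suc.prems(2)
  let ?U = "\<lambda>s :: (nat \<Rightarrow> 'a) \<times> 'a. (fst s)(n := snd s)"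
  have k: "(\<lambda>p. distr (iterate n (fst p) \<Otimes>\<^sub>M f (snd p)) (power_space (Suc n) X) ?U) \<in> D \<Otimes>\<^sub>M D \<rightarrow>\<^sub>M prob_algebra (power_space (Suc n) X)"
    by (intro measurable_compose[OF _ measurable_distr_prob_space[OF fun_upd_measurable]]
        measurable_pair_prob measurable_compose[OF measurable_fst iterate_kernel] measurable_compose[OF measurable_snd stoch_homD[OF f]])
  have A: "PiE {..<Suc n} A \<in> sets (power_space (Suc n) X)"
    unfolding power_space_def using Suc.prems by (intro sets_PiM_I_finite) auto
  have A': "PiE {..<n} A \<in> sets (power_space n X)"
    unfolding power_space_def using Suc.prems by (intro sets_PiM_I_finite) auto
  have sub: "set (map A [0..<n]) \<subseteq> sets X" "A n \<in> sets X" using Suc.prems by auto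
  have "emeasure (iterate (Suc n) d) (PiE {..<Suc n} A) =
      (\<integral>\<^sup>+p. emeasure (distr (iterate n (fst p) \<Otimes>\<^sub>M f (snd p)) (power_space (Suc n) X) ?U) (PiE {..<Suc n} A) \<partial>\<delta> d)"
    unfolding iterate.simps(2) by (rule emeasure_bind_prob_algebra[OF \<delta>_space[OF d] k A])
  also have "\<dots> = (\<integral>\<^sup>+p. convolve_list \<delta> f (map A [0..<n]) (fst p) * emeasure (f (snd p)) (A n) \<partial>\<delta> d)"
  proof (rule nn_integral_cong)
    fix p assume "p \<in> space (\<delta> d)"
    then have p: "fst p \<in> space D" "snd p \<in> space D"
      unfolding prob_algebraD(3)[OF \<delta>_space[OF d]] by (auto simp: space_pair_measure)
    note I = kernel_space[OF iterate_kernel p(1), of n] and F = kernel_space[OF stoch_homD[OF f] p(2)]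
    interpret F: prob_space "f (snd p)" by (rule prob_algebraD[OF F])
    have st: "sets (iterate n (fst p) \<Otimes>\<^sub>M f (snd p)) = sets (power_space n X \<Otimes>\<^sub>M X)"
      by (intro sets_pair_measure_cong prob_algebraD(2)[OF I] prob_algebraD(2)[OF F])
    have U: "?U \<in> iterate n (fst p) \<Otimes>\<^sub>M f (snd p) \<rightarrow>\<^sub>M power_space (Suc n) X"
      unfolding measurable_cong_sets[OF st refl] by (rule fun_upd_measurable)
    have "emeasure (distr (iterate n (fst p) \<Otimes>\<^sub>M f (snd p)) (power_space (Suc n) X) ?U) (PiE {..<Suc n} A) =
        emeasure (iterate n (fst p) \<Otimes>\<^sub>M f (snd p)) (?U -` PiE {..<Suc n} A \<inter> space (iterate n (fst p) \<Otimes>\<^sub>M f (snd p)))"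
      by (rule emeasure_distr[OF U A])
    also have "?U -` PiE {..<Suc n} A \<inter> space (iterate n (fst p) \<Otimes>\<^sub>M f (snd p)) = PiE {..<n} A \<times> A n"
      unfolding space_pair_measure prob_algebraD(3)[OF I] prob_algebraD(3)[OF F]
      using Suc.prems(1) by (rule fun_upd_vimage_PiE)
    also have "emeasure (iterate n (fst p) \<Otimes>\<^sub>M f (snd p)) (PiE {..<n} A \<times> A n) =
        emeasure (iterate n (fst p)) (PiE {..<n} A) * emeasure (f (snd p)) (A n)"
      using A' sub(2) prob_algebraD(2)[OF I] prob_algebraD(2)[OF F] by (intro F.emeasure_pair_measure_Times) auto
    also have "emeasure (iterate n (fst p)) (PiE {..<n} A) = convolve_list \<delta> f (map A [0..<n]) (fst p)"
      using Suc.prems(1) p(1) by (intro Suc.IH) auto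
    finally show "emeasure (distr (iterate n (fst p) \<Otimes>\<^sub>M f (snd p)) (power_space (Suc n) X) ?U) (PiE {..<Suc n} A) =
        convolve_list \<delta> f (map A [0..<n]) (fst p) * emeasure (f (snd p)) (A n)" .
  qed
  also have "\<dots> = convolve \<delta> (convolve_list \<delta> f (map A [0..<n])) (\<lambda>d. emeasure (f d) (A n)) d"
    by (simp add: convolve_def)
  \<comment> \<open>\<open>iterate\<close> adds its new factor on the right,
    \<open>convolve_list\<close> on the left; appending a singleton list reconciles them.\<close>
  also have "\<dots> = convolve \<delta> (convolve_list \<delta> f (map A [0..<n])) (convolve_list \<delta> f [A n]) d"
    using sub(2) by (intro convolve_cong[OF d]) (simp_all add: convolve_list_single)
  also have "\<dots> = convolve_list \<delta> f (map A [0..<n] @ [A n]) d"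
    using sub by (intro convolve_list_append[symmetric] d) auto
  finally show ?case by simp
qed

text \<open>Forgetting the last entry puts the whole space in its place, and the mass of the whole
  space is the unit of \<open>convolve\<close>.\<close>

lemma iterate_restrict:
  assumes d: "d \<in> space D"
  shows "distr (iterate (Suc n) d) (power_space n X) (\<lambda>x. restrict x {..<n}) = iterate n d"
proof (rule PiM_prob_eqI[of "{..<n}" _ "\<lambda>_. X"])
  note I = kernel_space[OF iterate_kernel d]
  note R = distr_prob_algebra[OF I restrict_power_measurable]
  show "prob_space (distr (iterate (Suc n) d) (power_space n X) (\<lambda>x. restrict x {..<n}))" by (rule prob_algebraD[OF R])
  show "sets (distr (iterate (Suc n) d) (power_space n X) (\<lambda>x. restrict x {..<n})) = sets (\<Pi>\<^sub>M i\<in>{..<n}. X)"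
    by (simp add: power_space_def)
  show "sets (iterate n d) = sets (\<Pi>\<^sub>M i\<in>{..<n}. X)" using prob_algebraD(2)[OF I] by (simp add: power_space_def)
  fix A assume A: "\<And>i. i \<in> {..<n} \<Longrightarrow> A i \<in> sets X"
  define B where "B = A(n := space X)"
  have B: "B i \<in> sets X" if "i < Suc n" for i using that A by (auto simp: B_def less_Suc_eq)
  have sub: "set (map A [0..<n]) \<subseteq> sets X" using A by auto
  have m: "(\<lambda>x. restrict x {..<n}) \<in> iterate (Suc n) d \<rightarrow>\<^sub>M power_space n X"
    using restrict_power_measurable by (simp add: measurable_cong_sets[OF prob_algebraD(2)[OF I] refl] del: iterate.simps)
  have "emeasure (distr (iterate (Suc n) d) (power_space n X) (\<lambda>x. restrict x {..<n})) (PiE {..<n} A) =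
      emeasure (iterate (Suc n) d) ((\<lambda>x. restrict x {..<n}) -` PiE {..<n} A \<inter> space (iterate (Suc n) d))"
    using A by (intro emeasure_distr[OF m]) (auto simp: power_space_def intro!: sets_PiM_I_finite)
  also have "(\<lambda>x. restrict x {..<n}) -` PiE {..<n} A \<inter> space (iterate (Suc n) d) = PiE {..<Suc n} B"
  proof -
    have sp: "space (iterate (Suc n) d) = PiE {..<Suc n} (\<lambda>_. space X)"
      unfolding prob_algebraD(3)[OF I] by (simp add: power_space_def space_PiM)
    show ?thesis unfolding sp
    proof (intro set_eqI iffI)
      fix x assume "x \<in> (\<lambda>x. restrict x {..<n}) -` PiE {..<n} A \<inter> PiE {..<Suc n} (\<lambda>_. space X)"
      then have r: "restrict x {..<n} \<in> PiE {..<n} A" and x: "x \<in> PiE {..<Suc n} (\<lambda>_. space X)" by simp_all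
      show "x \<in> PiE {..<Suc n} B"
      proof (rule PiE_I)
        fix i assume "i \<in> {..<Suc n}"
        then consider "i < n" | "i = n" by fastforce
        then show "x i \<in> B i"
        proof cases
          case 1
          then show ?thesis using PiE_mem[OF r, of i] by (simp add: B_def)
        next
          case 2
          then show ?thesis using PiE_mem[OF x, of n] by (simp add: B_def)
        qed
      qed (rule PiE_arb[OF x])
    next
      fix x assume x: "x \<in> PiE {..<Suc n} B"
      have "x i \<in> A i" if "i < n" for i using PiE_mem[OF x, of i] that by (simp add: B_def)
      then have "restrict x {..<n} \<in> PiE {..<n} A" by simp
      moreover have "B i \<subseteq> space X" if "i < Suc n" for i using sets.sets_into_space[OF B[OF that]] .
      then have "x \<in> PiE {..<Suc n} (\<lambda>_. space X)" using x PiE_mono[of "{..<Suc n}" B "\<lambda>_. space X"] by blast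
      ultimately show "x \<in> (\<lambda>x. restrict x {..<n}) -` PiE {..<n} A \<inter> PiE {..<Suc n} (\<lambda>_. space X)" by simp
    qed
  qed
  also have "emeasure (iterate (Suc n) d) (PiE {..<Suc n} B) = convolve_list \<delta> f (map B [0..<Suc n]) d"
    by (rule emeasure_iterate[OF B d])
  also have "map B [0..<Suc n] = map A [0..<n] @ [space X]" by (simp add: B_def)
  also have "convolve_list \<delta> f (map A [0..<n] @ [space X]) d =
      convolve \<delta> (convolve_list \<delta> f (map A [0..<n])) (convolve_list \<delta> f [space X]) d"
    using sub by (intro convolve_list_append d) auto
  also have "\<dots> = convolve \<delta> (convolve_list \<delta> f (map A [0..<n])) (\<lambda>_. 1) d"
  proof (rule convolve_cong[OF d refl])
    fix c assume c: "c \<in> space D"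
    note F = kernel_space[OF stoch_homD[OF f] c]
    show "convolve_list \<delta> f [space X] c = 1"
      using prob_space.emeasure_space_1[OF prob_algebraD(1)[OF F]] c
      by (simp add: convolve_list_single prob_algebraD(3)[OF F])
  qed
  also have "\<dots> = convolve_list \<delta> f (map A [0..<n]) d"
    using convolve_commute[OF d convolve_list_measurable[OF sub], of "\<lambda>_. 1"] convolve_one[OF d convolve_list_measurable[OF sub]]
    by simp
  also have "\<dots> = emeasure (iterate n d) (PiE {..<n} A)" using A by (intro emeasure_iterate[symmetric] d) auto
  finally show "emeasure (distr (iterate (Suc n) d) (power_space n X) (\<lambda>x. restrict x {..<n})) (PiE {..<n} A) =
      emeasure (iterate n d) (PiE {..<n} A)" .
qed simp

text \<open>Permuting the entries permutes the list of events, to which \<open>convolve_list\<close>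
  is insensitive.\<close>

lemma iterate_symmetric:
  assumes d: "d \<in> space D" and p: "p permutes {..<n}"
  shows "distr (iterate n d) (power_space n X) (\<lambda>x. x \<circ> p) = iterate n d"
proof (rule PiM_prob_eqI[of "{..<n}" _ "\<lambda>_. X"])
  note I = kernel_space[OF iterate_kernel d, of n]
  note R = distr_prob_algebra[OF I permute_measurable[OF p]]
  show "prob_space (distr (iterate n d) (power_space n X) (\<lambda>x. x \<circ> p))" by (rule prob_algebraD[OF R])
  show "sets (distr (iterate n d) (power_space n X) (\<lambda>x. x \<circ> p)) = sets (\<Pi>\<^sub>M i\<in>{..<n}. X)"
    by (simp add: power_space_def)
  show "sets (iterate n d) = sets (\<Pi>\<^sub>M i\<in>{..<n}. X)" using prob_algebraD(2)[OF I] by (simp add: power_space_def)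
  fix A assume A: "\<And>i. i \<in> {..<n} \<Longrightarrow> A i \<in> sets X"
  have ip: "inv p permutes {..<n}" using p by (rule permutes_inv)
  have Ai: "A (inv p i) \<in> sets X" if "i < n" for i using A permutes_in_image[OF ip] that by auto
  have m: "(\<lambda>x. x \<circ> p) \<in> iterate n d \<rightarrow>\<^sub>M power_space n X"
    using permute_measurable[OF p] by (simp add: measurable_cong_sets[OF prob_algebraD(2)[OF I] refl])
  have "emeasure (distr (iterate n d) (power_space n X) (\<lambda>x. x \<circ> p)) (PiE {..<n} A) =
      emeasure (iterate n d) ((\<lambda>x. x \<circ> p) -` PiE {..<n} A \<inter> space (iterate n d))"
    using A by (intro emeasure_distr[OF m]) (auto simp: power_space_def intro!: sets_PiM_I_finite)
  also have "(\<lambda>x. x \<circ> p) -` PiE {..<n} A \<inter> space (iterate n d) = PiE {..<n} (\<lambda>i. A (inv p i))"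
    unfolding prob_algebraD(3)[OF I] using A by (intro permute_vimage_PiE[OF p]) simp
  also have "emeasure (iterate n d) \<dots> = convolve_list \<delta> f (map (\<lambda>i. A (inv p i)) [0..<n]) d"
    by (rule emeasure_iterate[OF Ai d])
  also have "\<dots> = convolve_list \<delta> f (map A [0..<n]) d"
  proof (rule convolve_list_mset_cong[OF _ _ d])
    show "mset (map (\<lambda>i. A (inv p i)) [0..<n]) = mset (map A [0..<n])"
      using mset_of_tuple_permute[OF ip, of A] unfolding mset_of_tuple_eq comp_def .
    show "set (map (\<lambda>i. A (inv p i)) [0..<n]) \<subseteq> sets X" using Ai by auto
  qed
  also have "\<dots> = emeasure (iterate n d) (PiE {..<n} A)" using A by (intro emeasure_iterate[symmetric] d) auto
  finally show "emeasure (distr (iterate n d) (power_space n X) (\<lambda>x. x \<circ> p)) (PiE {..<n} A) =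
      emeasure (iterate n d) (PiE {..<n} A)" .
qed simp

end

end

section \<open>The comonoid of probability measures and its universal property\<close>

lemma giry_sample_hom: "giry_sample X \<in> stoch_hom (prob_algebra X) X"
  unfolding giry_sample_def by (rule stoch_hom_restrictI) simp

lemma giry_copy_hom: "giry_copy X \<in> stoch_hom (prob_algebra X) (prob_algebra X \<Otimes>\<^sub>M prob_algebra X)"
  unfolding giry_copy_def by (rule stoch_det_hom) measurable

lemma giry_discard_hom: "giry_discard X \<in> stoch_hom (prob_algebra X) stoch_unit"
  unfolding giry_discard_def by (rule stoch_det_hom) (simp add: stoch_unit_def)

lemma emeasure_bind_sample:
  assumes \<mu>: "\<mu> \<in> space (prob_algebra (prob_algebra X))" and A: "A \<in> sets X"
  shows "emeasure (\<mu> \<bind> giry_sample X) A = (\<integral>\<^sup>+\<alpha>. emeasure \<alpha> A \<partial>\<mu>)"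
  unfolding emeasure_bind_prob_algebra[OF \<mu> stoch_homD[OF giry_sample_hom] A]
  by (intro nn_integral_cong) (simp add: prob_algebraD(3)[OF \<mu>] giry_sample_def)

lemma bind_copy:
  "\<mu> \<in> space (prob_algebra (prob_algebra X)) \<Longrightarrow>
    \<mu> \<bind> giry_copy X = distr \<mu> (prob_algebra X \<Otimes>\<^sub>M prob_algebra X) (\<lambda>\<alpha>. (\<alpha>, \<alpha>))"
  unfolding giry_copy_def by (rule bind_stoch_det) measurable

text \<open>On the diagonal a product of two moments is evaluated at one and the same measure, where
  it is the moment of the concatenated list.\<close>

lemma nn_integral_bind_copy:
  assumes \<mu>: "\<mu> \<in> space (prob_algebra (prob_algebra X))" and As: "set As \<subseteq> sets X" and Bs: "set Bs \<subseteq> sets X"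
  shows "(\<integral>\<^sup>+p. moment As (fst p) * moment Bs (snd p) \<partial>(\<mu> \<bind> giry_copy X)) = (\<integral>\<^sup>+\<alpha>. moment (As @ Bs) \<alpha> \<partial>\<mu>)"
proof -
  have m: "(\<lambda>\<alpha>. (\<alpha>, \<alpha>)) \<in> \<mu> \<rightarrow>\<^sub>M prob_algebra X \<Otimes>\<^sub>M prob_algebra X"
    unfolding measurable_cong_sets[OF prob_algebraD(2)[OF \<mu>] refl] by measurable
  have g: "(\<lambda>p. moment As (fst p) * moment Bs (snd p)) \<in> borel_measurable (prob_algebra X \<Otimes>\<^sub>M prob_algebra X)"
    by (intro borel_measurable_times_ennreal measurable_compose[OF measurable_fst moment_measurable[OF As]]
        measurable_compose[OF measurable_snd moment_measurable[OF Bs]])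
  show ?thesis unfolding bind_copy[OF \<mu>] moment_simps by (subst nn_integral_distr[OF m]) (use g in simp_all)
qed

theorem prob_algebra_free_comm_comonoid:
  assumes X: "standard_borel X"
  shows "free_comm_comonoid TYPE('d) X (prob_algebra X) (giry_copy X) (giry_discard X) (giry_sample X)"
  unfolding free_comm_comonoid_def
proof (intro conjI allI impI)
  show "comm_comonoid (prob_algebra X) (giry_copy X) (giry_discard X)"
    unfolding giry_copy_def giry_discard_def by (rule comm_comonoid_copy[OF standard_borel_prob_algebra[OF X]])
  show "giry_sample X \<in> stoch_hom (prob_algebra X) X" by (rule giry_sample_hom)
  fix D :: "'d measure" and \<delta> \<epsilon> f
  assume "comm_comonoid D \<delta> \<epsilon> \<and> f \<in> stoch_hom D X"
  then have "comm_comonoid D \<delta> \<epsilon>" and f: "f \<in> stoch_hom D X" by auto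
  then interpret comonoid D \<delta> \<epsilon> by unfold_locales
  let ?G = "prob_algebra X"
  have "\<exists>h\<in>D \<rightarrow>\<^sub>M prob_algebra ?G. \<forall>d\<in>space D. \<forall>n. h d \<bind> power_space n = iterate f X n d"
    by (rule de_finetti[OF X iterate_kernel[OF f] iterate_restrict[OF f] iterate_symmetric[OF f]])
  then obtain h where h: "h \<in> D \<rightarrow>\<^sub>M prob_algebra ?G"
    and hI: "\<And>d n. d \<in> space D \<Longrightarrow> h d \<bind> power_space n = iterate f X n d" by blast
  note hd = kernel_space[OF h]
  \<comment> \<open>The moments of the mediating kernel are convolution products; compatibility with
    copying and with sampling are both read off this formula.\<close>
  have moment_h: "(\<integral>\<^sup>+\<alpha>. moment As \<alpha> \<partial>h d) = convolve_list \<delta> f As d" if As: "set As \<subseteq> sets X" and d: "d \<in> space D" for As d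
  proof -
    have "As ! i \<in> sets X" if "i < length As" for i using that As nth_mem by blast
    from emeasure_iterate[OF f this d] show ?thesis
      unfolding nn_integral_moment[OF hd[OF d] As] hI[OF d] by (simp only: map_nth)
  qed
  define g where "g = restrict h (space D)"
  have g: "g \<in> stoch_hom D ?G" unfolding g_def by (rule stoch_hom_restrictI[OF h])
  have gh: "g d = h d" if "d \<in> space D" for d using that by (simp add: g_def)
  have tens: "stoch_tensor D D k k \<in> stoch_hom (D \<Otimes>\<^sub>M D) (?G \<Otimes>\<^sub>M ?G)" if "k \<in> stoch_hom D ?G" for k
    by (rule stoch_tensor_hom[OF that that])
  have tens_int: "(\<integral>\<^sup>+p. moment As (fst p) * moment Bs (snd p) \<partial>(\<delta> d \<bind> stoch_tensor D D k k)) =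
      convolve \<delta> (\<lambda>c. \<integral>\<^sup>+\<alpha>. moment As \<alpha> \<partial>k c) (\<lambda>c. \<integral>\<^sup>+\<alpha>. moment Bs \<alpha> \<partial>k c) d"
    if k: "k \<in> stoch_hom D ?G" and As: "set As \<subseteq> sets X" and Bs: "set Bs \<subseteq> sets X" and d: "d \<in> space D" for k As Bs d
  proof -
    have "(\<integral>\<^sup>+p. moment As (fst p) * moment Bs (snd p) \<partial>(\<delta> d \<bind> stoch_tensor D D k k)) =
        (\<integral>\<^sup>+c. (\<integral>\<^sup>+p. moment As (fst p) * moment Bs (snd p) \<partial>stoch_tensor D D k k c) \<partial>\<delta> d)"
      by (rule nn_integral_bind_prob_algebra[OF \<delta>_space[OF d] stoch_homD[OF tens[OF k]]
            prod_measurable[OF moment_measurable[OF As] moment_measurable[OF Bs]]])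
    also have "\<dots> = convolve \<delta> (\<lambda>c. \<integral>\<^sup>+\<alpha>. moment As \<alpha> \<partial>k c) (\<lambda>c. \<integral>\<^sup>+\<alpha>. moment Bs \<alpha> \<partial>k c) d"
      unfolding convolve_def
    proof (rule nn_integral_cong)
      fix c assume "c \<in> space (\<delta> d)"
      then have "c \<in> space (D \<Otimes>\<^sub>M D)" unfolding prob_algebraD(3)[OF \<delta>_space[OF d]] .
      from nn_integral_stoch_tensor[OF this k k moment_measurable[OF As] moment_measurable[OF Bs]]
      show "(\<integral>\<^sup>+p. moment As (fst p) * moment Bs (snd p) \<partial>stoch_tensor D D k k c) =
          (\<integral>\<^sup>+\<alpha>. moment As \<alpha> \<partial>k (fst c)) * (\<integral>\<^sup>+\<alpha>. moment Bs \<alpha> \<partial>k (snd c))" .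
    qed
    finally show ?thesis .
  qed
  show "\<exists>!g. g \<in> comonoid_hom D \<delta> \<epsilon> ?G (giry_copy X) (giry_discard X) \<and> stoch_comp D (giry_sample X) g = f"
  proof (rule ex1I[of _ g])
    have "stoch_comp D (giry_copy X) g = stoch_comp D (stoch_tensor D D g g) \<delta>"
    proof (rule stoch_hom_eqI[OF stoch_comp_hom[OF g giry_copy_hom] stoch_comp_hom[OF \<delta> tens[OF g]]])
      fix d assume d: "d \<in> space D"
      note gd = kernel_space[OF stoch_homD[OF g] d]
      note 1 = bind_prob_algebra[OF gd stoch_homD[OF giry_copy_hom]]
        and 2 = bind_prob_algebra[OF \<delta>_space[OF d] stoch_homD[OF tens[OF g]]]
      have "g d \<bind> giry_copy X = \<delta> d \<bind> stoch_tensor D D g g"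
      proof (rule random_measure_pair2_eqI[where X = X and Y = X])
        show "finite_measure (g d \<bind> giry_copy X)" "finite_measure (\<delta> d \<bind> stoch_tensor D D g g)"
          using prob_algebraD(1)[OF 1] prob_algebraD(1)[OF 2] by (auto intro: prob_space.finite_measure)
        show "sets (g d \<bind> giry_copy X) = sets (?G \<Otimes>\<^sub>M ?G)" "sets (\<delta> d \<bind> stoch_tensor D D g g) = sets (?G \<Otimes>\<^sub>M ?G)"
          by (rule prob_algebraD(2)[OF 1], rule prob_algebraD(2)[OF 2])
        fix As Bs assume As: "set As \<subseteq> sets X" and Bs: "set Bs \<subseteq> sets X"
        have "(\<integral>\<^sup>+p. moment As (fst p) * moment Bs (snd p) \<partial>(g d \<bind> giry_copy X)) = (\<integral>\<^sup>+\<alpha>. moment (As @ Bs) \<alpha> \<partial>g d)"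
          by (rule nn_integral_bind_copy[OF gd As Bs])
        also have "\<dots> = convolve_list \<delta> f (As @ Bs) d"
          unfolding gh[OF d] using As Bs by (intro moment_h d) auto
        also have "\<dots> = convolve \<delta> (convolve_list \<delta> f As) (convolve_list \<delta> f Bs) d"
          by (rule convolve_list_append[OF f As Bs d])
        also have "\<dots> = convolve \<delta> (\<lambda>c. \<integral>\<^sup>+\<alpha>. moment As \<alpha> \<partial>g c) (\<lambda>c. \<integral>\<^sup>+\<alpha>. moment Bs \<alpha> \<partial>g c) d"
          by (intro convolve_cong[OF d]) (simp_all add: gh moment_h As Bs)
        also have "\<dots> = (\<integral>\<^sup>+p. moment As (fst p) * moment Bs (snd p) \<partial>(\<delta> d \<bind> stoch_tensor D D g g))"
          by (rule tens_int[OF g As Bs d, symmetric])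
        finally show "(\<integral>\<^sup>+p. moment As (fst p) * moment Bs (snd p) \<partial>(g d \<bind> giry_copy X)) =
            (\<integral>\<^sup>+p. moment As (fst p) * moment Bs (snd p) \<partial>(\<delta> d \<bind> stoch_tensor D D g g))" .
      qed
      then show "stoch_comp D (giry_copy X) g d = stoch_comp D (stoch_tensor D D g g) \<delta> d"
        using d by (simp add: stoch_comp_def)
    qed
    \<comment> \<open>The unit object is terminal, so every kernel respects counits.\<close>
    moreover have "stoch_comp D (giry_discard X) g = \<epsilon>"
      by (rule stoch_hom_unit_unique[OF stoch_comp_hom[OF g giry_discard_hom] \<epsilon>])
    moreover have "stoch_comp D (giry_sample X) g = f"
    proof (rule stoch_hom_eqI[OF stoch_comp_hom[OF g giry_sample_hom] f])
      fix d assume d: "d \<in> space D"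
      note gd = kernel_space[OF stoch_homD[OF g] d] and fd = kernel_space[OF stoch_homD[OF f] d]
      note S = bind_prob_algebra[OF gd stoch_homD[OF giry_sample_hom]]
      have "g d \<bind> giry_sample X = f d"
      proof (rule measure_eqI)
        show "sets (g d \<bind> giry_sample X) = sets (f d)" unfolding prob_algebraD(2)[OF S] prob_algebraD(2)[OF fd] ..
        fix A assume "A \<in> sets (g d \<bind> giry_sample X)"
        then have A: "A \<in> sets X" unfolding prob_algebraD(2)[OF S] .
        have "emeasure (g d \<bind> giry_sample X) A = (\<integral>\<^sup>+\<alpha>. moment [A] \<alpha> \<partial>h d)"
          unfolding emeasure_bind_sample[OF gd A] moment_simps unfolding gh[OF d] by simp
        also have "\<dots> = emeasure (f d) A" using A d by (simp add: moment_h convolve_list_single[OF f] del: moment_simps)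
        finally show "emeasure (g d \<bind> giry_sample X) A = emeasure (f d) A" .
      qed
      then show "stoch_comp D (giry_sample X) g d = f d" using d by (simp add: stoch_comp_def)
    qed
    ultimately show "g \<in> comonoid_hom D \<delta> \<epsilon> ?G (giry_copy X) (giry_discard X) \<and> stoch_comp D (giry_sample X) g = f"
      using g by (simp add: comonoid_hom_def)
    fix k assume k: "k \<in> comonoid_hom D \<delta> \<epsilon> ?G (giry_copy X) (giry_discard X) \<and> stoch_comp D (giry_sample X) k = f"
    then have kh: "k \<in> stoch_hom D ?G" and copy: "stoch_comp D (giry_copy X) k = stoch_comp D (stoch_tensor D D k k) \<delta>"
      and sample: "stoch_comp D (giry_sample X) k = f" by (auto simp: comonoid_hom_def)
    note kd = kernel_space[OF stoch_homD[OF kh]]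
    \<comment> \<open>Compatibility with copying splits the first event off a moment, and
      \<open>sample\<close> evaluates it; by induction the moments of any competitor are the same
      convolution products.\<close>
    have moment_k: "(\<integral>\<^sup>+\<alpha>. moment As \<alpha> \<partial>k d) = convolve_list \<delta> f As d" if "set As \<subseteq> sets X" "d \<in> space D" for As d
      using that
    proof (induction As arbitrary: d)
      case Nil
      then show ?case
        using prob_space.emeasure_space_1[OF prob_algebraD(1)[OF kd]] by (simp add: convolve_list_simps)
    next
      case (Cons A As)
      then have A: "set [A] \<subseteq> sets X" and As: "set As \<subseteq> sets X" by auto
      note d = Cons.prems(2)
      have "(\<integral>\<^sup>+\<alpha>. moment (A # As) \<alpha> \<partial>k d) = (\<integral>\<^sup>+p. moment [A] (fst p) * moment As (snd p) \<partial>(k d \<bind> giry_copy X))"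
        unfolding nn_integral_bind_copy[OF kd[OF d] A As] by (simp only: append.simps)
      also have "k d \<bind> giry_copy X = \<delta> d \<bind> stoch_tensor D D k k"
        using fun_cong[OF copy, of d] d by (simp add: stoch_comp_def)
      also have "(\<integral>\<^sup>+p. moment [A] (fst p) * moment As (snd p) \<partial>(\<delta> d \<bind> stoch_tensor D D k k)) =
          convolve \<delta> (\<lambda>c. \<integral>\<^sup>+\<alpha>. moment [A] \<alpha> \<partial>k c) (\<lambda>c. \<integral>\<^sup>+\<alpha>. moment As \<alpha> \<partial>k c) d"
        by (rule tens_int[OF kh A As d])
      also have "\<dots> = convolve \<delta> (\<lambda>c. emeasure (f c) A) (convolve_list \<delta> f As) d"
      proof (rule convolve_cong[OF d])
        fix c assume c: "c \<in> space D"
        have "(\<integral>\<^sup>+\<alpha>. moment [A] \<alpha> \<partial>k c) = emeasure (k c \<bind> giry_sample X) A"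
          unfolding moment_simps using A by (subst emeasure_bind_sample[OF kd[OF c]]) simp_all
        then show "(\<integral>\<^sup>+\<alpha>. moment [A] \<alpha> \<partial>k c) = emeasure (f c) A" by (simp only: stoch_compD[OF sample c])
        show "(\<integral>\<^sup>+\<alpha>. moment As \<alpha> \<partial>k c) = convolve_list \<delta> f As c" by (rule Cons.IH[OF As c])
      qed
      finally show ?case by (simp only: convolve_list_simps)
    qed
    show "k = g"
    proof (rule stoch_hom_eqI[OF kh g])
      fix d assume d: "d \<in> space D"
      note gd = kernel_space[OF stoch_homD[OF g] d]
      show "k d = g d"
      proof (rule random_measure_eqI[where X = X])
        show "finite_measure (k d)" "finite_measure (g d)"
          using prob_algebraD(1)[OF kd[OF d]] prob_algebraD(1)[OF gd] by (auto intro: prob_space.finite_measure)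
        show "sets (k d) = sets ?G" "sets (g d) = sets ?G"
          by (rule prob_algebraD(2)[OF kd[OF d]], rule prob_algebraD(2)[OF gd])
        show "(\<integral>\<^sup>+\<alpha>. moment As \<alpha> \<partial>k d) = (\<integral>\<^sup>+\<alpha>. moment As \<alpha> \<partial>g d)" if "set As \<subseteq> sets X" for As
          unfolding moment_k[OF that d] gh[OF d] moment_h[OF that d] ..
      qed
    qed
  qed
qed

theorem theorem2p18:
  fixes X :: "'a measure"
  assumes "standard_borel X"
  shows "stoch_chain_limit TYPE('z) (\<lambda>n. mset_space n X) (draw_delete X)
           (prob_algebra X) (iid_mset X) \<and>
         (\<forall>Y :: 'y measure. standard_borel Y \<longrightarrow>
            stoch_chain_limit TYPE('z) (\<lambda>n. mset_space n X \<Otimes>\<^sub>M Y)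
              (\<lambda>n. stoch_tensor (mset_space (Suc n) X) Y (draw_delete X n) (stoch_id Y))
              (prob_algebra X \<Otimes>\<^sub>M Y)
              (\<lambda>n. stoch_tensor (prob_algebra X) Y (iid_mset X n) (stoch_id Y))) \<and>
         free_comm_comonoid TYPE('d) X (prob_algebra X)
           (giry_copy X) (giry_discard X) (giry_sample X)"
  using prob_algebra_chain_limit[OF assms] prob_algebra_tensor_chain_limit[OF assms]
    prob_algebra_free_comm_comonoid[OF assms] by blast

end
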